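(* For a sufficiently small constant $\epsilon\in(0,1)$, one can deterministically maintain an $(8+\epsilon)$-approximation to the value of the densest subgraph $\rho(G)$ of a directed graph $G = (V, E)$ undergoing edge insertions and deletions (starting from the empty graph). The algorithm requires $\tilde O(m+n)$ space, where $m$ denotes the number of edges and $n$ the number of nodes, has an amortized update time of $\tilde O(1)$ and a query time of $O(1)$.
   Context: $G=(V,E)$ is a directed graph with fixed node set $V$, $|V|=n$, initially with no edges; each update inserts a new directed edge or deletes an existing one. For $X,Y\subseteq V$ (not necessarily disjoint, nonempty), $E(X,Y)=\{(u,v)\in E: u\in X, v\in Y\}$ and the density is $\rho(X,Y)=|E(X,Y)|/\sqrt{|X||Y|}$; the value of the densest subgraph is $\rho(G)=\max_{X,Y\subseteq V}\rho(X,Y)$. An estimate $\eta$ is a $\gamma$-approximation if $\rho(G)/\gamma\le\eta\le\rho(G)$. $\tilde O(\cdot)$ hides $\mathrm{poly}(\log n,1/\epsilon)$ factors. *)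

theory Defs
  imports Complex_Main
begin

section \<open>Directed densest subgraph\<close>

text \<open>A directed graph on a fixed node set is represented by its edge relation.
  Self-loops are permitted: an edge is any ordered pair of nodes.\<close>

type_synonym 'a edges = "('a \<times> 'a) set"

definition edges_between :: "'a edges \<Rightarrow> 'a set \<Rightarrow> 'a set \<Rightarrow> 'a edges" where
  "edges_between E X Y = {(u, v) \<in> E. u \<in> X \<and> v \<in> Y}"

definition density :: "'a edges \<Rightarrow> 'a set \<Rightarrow> 'a set \<Rightarrow> real" where
  "density E X Y = real (card (edges_between E X Y)) / sqrt (real (card X) * real (card Y))"

definition max_density :: "'a set \<Rightarrow> 'a edges \<Rightarrow> real" where
  "max_density V E =
     Max {density E X Y | X Y. X \<subseteq> V \<and> X \<noteq> {} \<and> Y \<subseteq> V \<and> Y \<noteq> {}}"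

definition is_approx :: "real \<Rightarrow> real \<Rightarrow> real \<Rightarrow> bool" where
  "is_approx \<gamma> r \<eta> \<longleftrightarrow> r / \<gamma> \<le> \<eta> \<and> \<eta> \<le> r"


section \<open>Word RAM with structured control flow\<close>

text \<open>Memory consists of cells holding \<open>w\<close>-bit words and addressed by \<open>w\<close>-bit words; there is
  no other storage, so program variables are cells at constant addresses. Arithmetic is modulo
  \<open>2 ^ w\<close>. Every constant, memory access, arithmetic operation and branch costs one time unit.\<close>

type_synonym mem = "nat \<Rightarrow> nat"

datatype binop = Plus | Minus | Times | Divide | Modulo | Less | Equal

fun apply_binop :: "nat \<Rightarrow> binop \<Rightarrow> nat \<Rightarrow> nat \<Rightarrow> nat" where
  "apply_binop w Plus a b = (a + b) mod 2 ^ w"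
| "apply_binop w Minus a b = nat ((int a - int b) mod 2 ^ w)"
| "apply_binop w Times a b = (a * b) mod 2 ^ w"
| "apply_binop w Divide a b = a div b"
| "apply_binop w Modulo a b = a mod b"
| "apply_binop w Less a b = of_bool (a < b) mod 2 ^ w"
| "apply_binop w Equal a b = of_bool (a = b) mod 2 ^ w"

datatype expr = Const nat | Load expr | Bin binop expr expr

fun val :: "nat \<Rightarrow> mem \<Rightarrow> expr \<Rightarrow> nat" where
  "val w M (Const c) = c mod 2 ^ w"
| "val w M (Load e) = M (val w M e)"
| "val w M (Bin f a b) = apply_binop w f (val w M a) (val w M b)"

fun reads :: "nat \<Rightarrow> mem \<Rightarrow> expr \<Rightarrow> nat set" where
  "reads w M (Const c) = {}"
| "reads w M (Load e) = insert (val w M e) (reads w M e)"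
| "reads w M (Bin f a b) = reads w M a \<union> reads w M b"

fun expr_cost :: "expr \<Rightarrow> nat" where
  "expr_cost (Const c) = 1"
| "expr_cost (Load e) = 1 + expr_cost e"
| "expr_cost (Bin f a b) = 1 + expr_cost a + expr_cost b"

datatype com =
    Skip
  | Store expr expr  \<comment> \<open>address, value\<close>
  | Seq com com
  | Cond expr com com
  | While expr com

text \<open>\<open>exec w c M t A M'\<close>: started in memory \<open>M\<close>, program \<open>c\<close> halts after \<open>t\<close> time units in
  memory \<open>M'\<close>, and \<open>A\<close> is the set of all addresses it has read or written.\<close>

inductive exec :: "nat \<Rightarrow> com \<Rightarrow> mem \<Rightarrow> nat \<Rightarrow> nat set \<Rightarrow> mem \<Rightarrow> bool" for w :: nat where
  Skip: "exec w Skip M 1 {} M"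
| Store: "exec w (Store a e) M (1 + expr_cost a + expr_cost e)
            (insert (val w M a) (reads w M a \<union> reads w M e))
            (M(val w M a := val w M e))"
| Seq: "\<lbrakk>exec w c M t A M'; exec w d M' t' A' M''\<rbrakk>
          \<Longrightarrow> exec w (Seq c d) M (t + t') (A \<union> A') M''"
| CondTrue: "\<lbrakk>val w M b \<noteq> 0; exec w c M t A M'\<rbrakk>
          \<Longrightarrow> exec w (Cond b c d) M (1 + expr_cost b + t) (reads w M b \<union> A) M'"
| CondFalse: "\<lbrakk>val w M b = 0; exec w d M t A M'\<rbrakk>
          \<Longrightarrow> exec w (Cond b c d) M (1 + expr_cost b + t) (reads w M b \<union> A) M'"
| WhileFalse: "val w M b = 0
          \<Longrightarrow> exec w (While b c) M (1 + expr_cost b) (reads w M b) M"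
| WhileTrue: "\<lbrakk>val w M b \<noteq> 0; exec w c M t A M'; exec w (While b c) M' t' A' M''\<rbrakk>
          \<Longrightarrow> exec w (While b c) M (1 + expr_cost b + t + t') (reads w M b \<union> A \<union> A') M''"

inductive_cases exec_SkipE: "exec w Skip M t A M'"
inductive_cases exec_StoreE: "exec w (Store a e) M t A M'"
inductive_cases exec_SeqE: "exec w (Seq c d) M t A M'"
inductive_cases exec_CondE: "exec w (Cond b c d) M t A M'"
inductive_cases exec_WhileE: "exec w (While b c) M t A M'"

lemma exec_deterministic:
  "exec w c M t A M' \<Longrightarrow> exec w c M s B N \<Longrightarrow> s = t \<and> B = A \<and> N = M'"
proof (induction arbitrary: s B N rule: exec.induct)
  case (Skip M)
  then show ?case by (rule exec_SkipE) simp
next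
  case (Store a e M)
  then show ?case by (rule exec_StoreE) simp
next
  case (Seq c M t A M' d t' A' M'')
  from Seq.prems show ?case by (rule exec_SeqE) (metis Seq.IH)
next
  case (CondTrue M b c t A M' d)
  from CondTrue.prems show ?case by (rule exec_CondE) (use CondTrue.hyps(1) in \<open>auto dest: CondTrue.IH\<close>)
next
  case (CondFalse M b d t A M' c)
  from CondFalse.prems show ?case by (rule exec_CondE) (use CondFalse.hyps(1) in \<open>auto dest: CondFalse.IH\<close>)
next
  case (WhileFalse M b c)
  from WhileFalse.prems show ?case by (rule exec_WhileE) (use WhileFalse.hyps in auto)
next
  case (WhileTrue M b c t A M' t' A' M'')
  from WhileTrue.prems show ?case
  proof (rule exec_WhileE, goal_cases)
    case 1
    then show ?thesis using WhileTrue.hyps(1) by simp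
  next
    case (2 t1 A1 M1 t2 A2)
    have "t1 = t \<and> A1 = A \<and> M1 = M'" using 2 WhileTrue.IH(1) by blast
    moreover from this have "t2 = t' \<and> A2 = A' \<and> N = M''" using 2 WhileTrue.IH(2) by blast
    ultimately show ?thesis using 2 by simp
  qed
qed


section \<open>Dynamic graph data structures\<close>

text \<open>The nodes are \<open>0, \<dots>, n - 1\<close>. Queries are part of the operation sequence because a query
  program, too, may change the memory.\<close>

datatype opn = Insert nat nat | Delete nat nat | Query

fun legal_opn :: "nat \<Rightarrow> nat edges \<Rightarrow> opn \<Rightarrow> bool" where
  "legal_opn n E (Insert u v) \<longleftrightarrow> u < n \<and> v < n \<and> (u, v) \<notin> E"
| "legal_opn n E (Delete u v) \<longleftrightarrow> (u, v) \<in> E"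
| "legal_opn n E Query \<longleftrightarrow> True"

fun apply_opn :: "opn \<Rightarrow> nat edges \<Rightarrow> nat edges" where
  "apply_opn (Insert u v) E = insert (u, v) E"
| "apply_opn (Delete u v) E = E - {(u, v)}"
| "apply_opn Query E = E"

definition graph_after :: "opn list \<Rightarrow> nat \<Rightarrow> nat edges" where
  "graph_after ops i = fold apply_opn (take i ops) {}"

definition legal_seq :: "nat \<Rightarrow> opn list \<Rightarrow> bool" where
  "legal_seq n ops \<longleftrightarrow> (\<forall>i < length ops. legal_opn n (graph_after ops i) (ops ! i))"

definition peak_edges :: "opn list \<Rightarrow> nat" where
  "peak_edges ops = Max ((\<lambda>i. card (graph_after ops i)) ` {..length ops})"

definition updates :: "opn list \<Rightarrow> nat set" where
  "updates ops = {i. i < length ops \<and> ops ! i \<noteq> Query}"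

definition queries :: "opn list \<Rightarrow> nat set" where
  "queries ops = {i. i < length ops \<and> ops ! i = Query}"

text \<open>Arguments are passed in, and results returned from, cells 0 and 1. The rest of the memory
  persists between operations.\<close>

record dyn_alg =
  init_com :: com
  insert_com :: com
  delete_com :: com
  query_com :: com

fun com_of :: "dyn_alg \<Rightarrow> opn \<Rightarrow> com" where
  "com_of D (Insert u v) = insert_com D"
| "com_of D (Delete u v) = delete_com D"
| "com_of D Query = query_com D"

fun pass_args :: "opn \<Rightarrow> mem \<Rightarrow> mem" where
  "pass_args (Insert u v) M = M(0 := u, 1 := v)"
| "pass_args (Delete u v) M = M(0 := u, 1 := v)"
| "pass_args Query M = M"

definition start_mem :: "nat \<Rightarrow> mem" where
  "start_mem n = (\<lambda>_. 0)(0 := n)"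

record stage =
  time :: nat
  touched :: "nat set"
  memory :: mem

inductive run :: "nat \<Rightarrow> dyn_alg \<Rightarrow> mem \<Rightarrow> opn list \<Rightarrow> stage list \<Rightarrow> bool" for w D where
  Nil: "run w D M [] []"
| Cons: "\<lbrakk>exec w (com_of D p) (pass_args p M) t A M'; run w D M' ops tr\<rbrakk>
          \<Longrightarrow> run w D M (p # ops) (\<lparr>time = t, touched = A, memory = M'\<rparr> # tr)"

text \<open>A query answers with a fraction, numerator in cell 0 and denominator in cell 1.\<close>

definition answers :: "mem \<Rightarrow> real \<Rightarrow> bool" where
  "answers M \<eta> \<longleftrightarrow> M 1 \<noteq> 0 \<and> \<eta> = real (M 0) / real (M 1)"

text \<open>\<open>log\<^sub>2 (n + 1)\<close> rather than \<open>log\<^sub>2 n\<close>, so that the bound is meaningful for \<open>n = 1\<close>. Both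
  \<open>log\<^sub>2 (n + 1)\<close> and \<open>1 / \<epsilon>\<close> are at least 1 for \<open>n \<ge> 1\<close> and \<open>\<epsilon> \<le> 1\<close>, so every polynomial in
  the two is bounded by \<open>polyfactor C k n \<epsilon>\<close> for suitable constants \<open>C\<close> and \<open>k\<close>.\<close>

definition polyfactor :: "real \<Rightarrow> nat \<Rightarrow> nat \<Rightarrow> real \<Rightarrow> real" where
  "polyfactor C k n \<epsilon> = C * (log 2 (real n + 1) / \<epsilon>) ^ k"

text \<open>\<open>space_within A s\<close>: only the first \<open>s\<close> cells are used. Space is thus measured by the extent
  of the memory and not by the number of distinct cells touched.\<close>

definition space_within :: "nat set \<Rightarrow> real \<Rightarrow> bool" where
  "space_within A s \<longleftrightarrow> (\<forall>a \<in> A. real (Suc a) \<le> s)"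

end

theory Submission
  imports Defs
begin

text \<open>Fix \<open>J\<close> with \<open>n \<le> 4 ^ J\<close>. For every guess \<open>e \<in> {0, \<dots>, 2 J}\<close> of the ratio \<open>|X| / |Y| \<approx> 4 ^ (e - J)\<close>
  split each node into a left and a right copy, with weights \<open>2 ^ e\<close> and \<open>2 ^ (2 J - e)\<close>, and
  replace each edge by \<open>K\<close> parallel units, each of which is owned by one of its two endpoints. The
  value of a node is its weight times the number of units it owns. By linear programming duality
  a fractional orientation that minimises the maximal value for the right guess reveals the density
  of the subgraph.

  Optimality is relaxed to a local condition: no unit is owned by a node whose value exceeds that of
  the other endpoint by more than a factor of about \<open>1 + 4 / P\<close> with \<open>P \<approx> 128 log n\<close>. Under this
  condition the sets of nodes whose value is at least \<open>l\<^sub>0 > l\<^sub>1 > \<dots>\<close>, with thresholds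
  decreasing slowly, are nested such that the units owned in one of them have both
  endpoints in the next. If no such pair of sets were dense, their weighted size would double in each step,
  which is impossible for more than \<open>O(log n)\<close> steps.

  Nodes publish their loads lazily, when these have changed by a factor of \<open>1 + 1 / P\<close>, so that a
  unit moves or a neighbour is informed only after sufficient change. The number of moves is paid
  for by the potential \<open>\<Sum>\<^sub>x \<Sum>\<^sub>i ln (i m\<^sub>x)\<close>, where \<open>i\<close> ranges over \<open>1, \<dots>, load of x\<close> and \<open>m\<^sub>x\<close> is
  the weight of \<open>x\<close>: an insertion raises it by \<open>O(log n)\<close>, and each move lowers it by at least
  \<open>1 / (2 P)\<close>. All data apart from the loads live in a single ordered set of integers, a binary
  trie whose nodes are recycled through a free list, so that the memory stays linear in the peak
  size.\<close>

section \<open>Programs over registers and arrays\<close>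

text \<open>The weights of the two copies multiply to \<open>4 ^ J\<close>. Hence
  \<open>sqrt (|X| |Y|)\<close> is at most \<open>2 ^ J / 2\<close> times the weighted size
  \<open>|X| / 2 ^ e + |Y| / 2 ^ (2 J - e)\<close>, by the inequality of arithmetic and geometric
  means, and nearly equal to it for the right guess. So each guess turns the quotient by a square
  root into an ordinary weighted density. With \<open>M\<close> the density, the largest value that
  counts lies between \<open>2 ^ J K M / 4\<close> and \<open>2 * 2 ^ J K M\<close>. The quotient of
  these bounds is the 8; both have slack that absorbs the rounding of the ratio and of the published
  loads. Units are indivisible, so an endpoint is judged by the value it would have after gaining
  one more unit. This additive error of one weight per level forces many parallel units per edge and
  a cut-off below which values do not count. The peak number of edges is unknown to the program. The
  capacities \<open>NB\<close>, \<open>B\<close> and \<open>ub\<close> are parameters of the proof,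
  chosen anew for each operation sequence, while the program and its initial run stay the
  same.\<close>

datatype reg =
    Arg0 | Arg1 | SizeJ | Guesses | Copies | Prec | Radix | Pow4 | KeyTop | KeyHalf
  | AnsNum | AnsDen | Key | Res | NodeX | NodeY | Copy | Index | ValOld | ValNew | Cursor | Flag | Unit
  | TrieNode | TrieWeight | TrieSlot | TrieKid | TrieKey | TrieCand | TrieCode | TrieFree | TrieFresh

datatype arr = Kid | Par | Stack | Load | Pub | Pow

datatype loc = V reg | H arr nat

text \<open>\<open>Arg0\<close> and \<open>Arg1\<close> are the cells of the calling convention. All
  registers lie below address 64, where the arrays begin.\<close>

fun reg_index :: "reg \<Rightarrow> nat" where
  "reg_index Arg0 = 0" | "reg_index Arg1 = 1" | "reg_index SizeJ = 3"
| "reg_index Guesses = 4" | "reg_index Copies = 5" | "reg_index Prec = 6" | "reg_index Radix = 7"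
| "reg_index Pow4 = 8" | "reg_index KeyTop = 9" | "reg_index KeyHalf = 10" | "reg_index AnsNum = 11"
| "reg_index AnsDen = 12" | "reg_index Key = 13" | "reg_index Res = 14" | "reg_index NodeX = 15"
| "reg_index NodeY = 16" | "reg_index Copy = 17" | "reg_index Index = 18" | "reg_index ValOld = 19"
| "reg_index ValNew = 20" | "reg_index Cursor = 21" | "reg_index Flag = 22" | "reg_index Unit = 23"
| "reg_index TrieNode = 24" | "reg_index TrieWeight = 25" | "reg_index TrieSlot = 26"
| "reg_index TrieKid = 27" | "reg_index TrieKey = 28" | "reg_index TrieCand = 29"
| "reg_index TrieCode = 30" | "reg_index TrieFree = 31" | "reg_index TrieFresh = 32"

fun arr_index :: "arr \<Rightarrow> nat" where
  "arr_index Kid = 0" | "arr_index Par = 1" | "arr_index Stack = 2" | "arr_index Load = 3"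
| "arr_index Pub = 4" | "arr_index Pow = 5"

text \<open>The arrays are interleaved with stride 8, so that each of them can grow without bound.\<close>

fun addr :: "loc \<Rightarrow> nat" where
  "addr (V r) = reg_index r"
| "addr (H a i) = 64 + arr_index a + 8 * i"

lemma reg_index_less: "reg_index r < 64"
  by (cases r) auto

lemma arr_index_less: "arr_index a < 8"
  by (cases a) auto

lemma inj_reg_index: "inj reg_index"
proof (rule injI)
  fix r r' assume "reg_index r = reg_index r'"
  then show "r = r'" by (cases r; cases r') simp_all
qed

lemma inj_arr_index: "inj arr_index"
proof (rule injI)
  fix r r' assume "arr_index r = arr_index r'"
  then show "r = r'" by (cases r; cases r') simp_all
qed

lemma inj_addr: "inj addr"
proof (rule injI)
  fix l l' assume eq: "addr l = addr l'"
  show "l = l'"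
  proof (cases l)
    case (V r)
    then show ?thesis using eq reg_index_less[of r] inj_reg_index by (cases l') (auto dest: injD)
  next
    case (H a i)
    show ?thesis
    proof (cases l')
      case (V r)
      then show ?thesis using eq H reg_index_less[of r] by auto
    next
      case H': (H a' i')
      have e: "arr_index a + 8 * i = arr_index a' + 8 * i'" using eq H H' by simp
      have "arr_index a = (arr_index a + 8 * i) mod 8" "arr_index a' = (arr_index a' + 8 * i') mod 8"
        using arr_index_less[of a] arr_index_less[of a'] by auto
      then have "arr_index a = arr_index a'" using e by simp
      then show ?thesis using e H H' inj_arr_index by (auto dest: injD)
    qed
  qed
qed

lemma upd_addr: "(M(addr l := x)) \<circ> addr = (M \<circ> addr)(l := x)"
  using inj_addr by (auto simp: fun_eq_iff dest: injD)

section \<open>Arithmetic expressions and their translation\<close>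

datatype ex = Num nat | Reg reg | Elem arr ex | Op binop ex ex

abbreviation ex_plus (infixl "\<oplus>" 65) where "a \<oplus> b \<equiv> Op Plus a b"
abbreviation ex_minus (infixl "\<ominus>" 65) where "a \<ominus> b \<equiv> Op Minus a b"
abbreviation ex_times (infixl "\<otimes>" 70) where "a \<otimes> b \<equiv> Op Times a b"
abbreviation ex_div (infixl "\<oslash>" 70) where "a \<oslash> b \<equiv> Op Divide a b"
abbreviation ex_mod (infixl "\<odot>" 70) where "a \<odot> b \<equiv> Op Modulo a b"
abbreviation ex_less (infix "\<lhd>" 50) where "a \<lhd> b \<equiv> Op Less a b"
abbreviation ex_eq (infix "\<doteq>" 50) where "a \<doteq> b \<equiv> Op Equal a b"

fun ev :: "(loc \<Rightarrow> nat) \<Rightarrow> ex \<Rightarrow> nat" where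
  "ev s (Num c) = c"
| "ev s (Reg r) = s (V r)"
| "ev s (Elem a e) = s (H a (ev s e))"
| "ev s (Op f a b) = (case f of
      Plus \<Rightarrow> ev s a + ev s b
    | Minus \<Rightarrow> ev s a - ev s b
    | Times \<Rightarrow> ev s a * ev s b
    | Divide \<Rightarrow> ev s a div ev s b
    | Modulo \<Rightarrow> ev s a mod ev s b
    | Less \<Rightarrow> of_bool (ev s a < ev s b)
    | Equal \<Rightarrow> of_bool (ev s a = ev s b))"

text \<open>The side conditions under which machine arithmetic agrees with arithmetic on natural numbers
  (no overflow, no underflow) and all array indices stay below \<open>B\<close>.\<close>

fun ok :: "nat \<Rightarrow> nat \<Rightarrow> (loc \<Rightarrow> nat) \<Rightarrow> ex \<Rightarrow> bool" where
  "ok w B s (Num c) \<longleftrightarrow> c < 2 ^ w"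
| "ok w B s (Reg r) \<longleftrightarrow> True"
| "ok w B s (Elem a e) \<longleftrightarrow> ok w B s e \<and> ev s e < B"
| "ok w B s (Op f a b) \<longleftrightarrow> ok w B s a \<and> ok w B s b \<and> (case f of
      Plus \<Rightarrow> ev s a + ev s b < 2 ^ w
    | Minus \<Rightarrow> ev s b \<le> ev s a \<and> ev s a < 2 ^ w
    | Times \<Rightarrow> ev s a * ev s b < 2 ^ w
    | Divide \<Rightarrow> True
    | Modulo \<Rightarrow> True
    | Less \<Rightarrow> True
    | Equal \<Rightarrow> True)"

fun code :: "ex \<Rightarrow> expr" where
  "code (Num c) = Const c"
| "code (Reg r) = expr.Load (Const (reg_index r))"
| "code (Elem a e) =
     expr.Load (Bin Plus (Const (64 + arr_index a)) (Bin Times (Const 8) (code e)))"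
| "code (Op f a b) = Bin f (code a) (code b)"

definition assign :: "reg \<Rightarrow> ex \<Rightarrow> com" (infix "::=" 61) where
  "r ::= e = Store (Const (reg_index r)) (code e)"

definition put :: "arr \<Rightarrow> ex \<Rightarrow> ex \<Rightarrow> com" where
  "put a i e =
     Store (Bin Plus (Const (64 + arr_index a)) (Bin Times (Const 8) (code i))) (code e)"

abbreviation seq (infixr ";;" 60) where "c ;; d \<equiv> Seq c d"
abbreviation cond ("(IF _/ THEN _/ ELSE _)" [0, 0, 61] 61) where
  "IF b THEN c ELSE d \<equiv> Cond (code b) c d"
abbreviation while ("(WHILE _/ DO _)" [0, 61] 61) where
  "WHILE b DO c \<equiv> While (code b) c"


text \<open>Total correctness with time and space. \<open>\<alpha>\<close> ties the memory to an
  abstract state, so that one calculus serves both the raw memory and, later, the view in which the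
  trie is a set of keys. \<open>Q\<close> receives an upper bound of the time, which lets costs be
  rounded up at will. \<open>64 + 8 * B\<close> is where the arrays end if all indices stay below
  \<open>B\<close>.\<close>

definition wp ::
  "nat \<Rightarrow> nat \<Rightarrow> (mem \<Rightarrow> 'x \<Rightarrow> bool) \<Rightarrow> com \<Rightarrow> (real \<Rightarrow> 'x \<Rightarrow> bool) \<Rightarrow> 'x \<Rightarrow> bool" where
  "wp w B \<alpha> c Q x \<longleftrightarrow> (\<forall>M. \<alpha> M x \<longrightarrow> (\<exists>t A M' u x'.
     exec w c M t A M' \<and> A \<subseteq> {..<64 + 8 * B} \<and> real t \<le> u \<and> \<alpha> M' x' \<and> Q u x'))"

text \<open>A test must be determined by the abstract state; only then can a branch be chosen
  without inspecting the memory.\<close>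

definition guard :: "nat \<Rightarrow> nat \<Rightarrow> (mem \<Rightarrow> 'x \<Rightarrow> bool) \<Rightarrow> expr \<Rightarrow> 'x \<Rightarrow> nat \<Rightarrow> bool" where
  "guard w B \<alpha> e x v \<longleftrightarrow>
     (\<forall>M. \<alpha> M x \<longrightarrow> val w M e = v \<and> reads w M e \<subseteq> {..<64 + 8 * B})"

lemma wp_conseq:
  assumes "wp w B \<alpha> c Q x" and "\<And>u y. Q u y \<Longrightarrow> \<exists>u'\<ge>u. Q' u' y"
  shows "wp w B \<alpha> c Q' x"
  unfolding wp_def
proof (intro allI impI)
  fix M assume "\<alpha> M x"
  then obtain t A M' u y where r: "exec w c M t A M'" "A \<subseteq> {..<64 + 8 * B}" "real t \<le> u"
      "\<alpha> M' y" "Q u y"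
    using assms(1) unfolding wp_def by blast
  from assms(2)[OF r(5)] obtain u' where "u' \<ge> u" "Q' u' y" by blast
  then show "\<exists>t A M' u x'. exec w c M t A M' \<and> A \<subseteq> {..<64 + 8 * B} \<and> real t \<le> u
      \<and> \<alpha> M' x' \<and> Q' u x'"
    using r by (intro exI[of _ t] exI[of _ A] exI[of _ M'] exI[of _ u'] exI[of _ y]) auto
qed

lemma wp_Skip: "Q 1 x \<Longrightarrow> wp w B \<alpha> Skip Q x"
  unfolding wp_def by (metis empty_subsetI exec.Skip of_nat_1 order_refl)

lemma wp_Seq:
  assumes "wp w B \<alpha> c (\<lambda>u. wp w B \<alpha> d (\<lambda>u'. Q (u + u'))) x"
  shows "wp w B \<alpha> (c ;; d) Q x"
  unfolding wp_def
proof (intro allI impI)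
  fix M assume "\<alpha> M x"
  then obtain t A M' u y where 1: "exec w c M t A M'" "A \<subseteq> {..<64 + 8 * B}" "real t \<le> u"
      "\<alpha> M' y" "wp w B \<alpha> d (\<lambda>u'. Q (u + u')) y"
    using assms unfolding wp_def[of w B \<alpha> c] by blast
  then obtain t' A' M'' u' z where 2: "exec w d M' t' A' M''" "A' \<subseteq> {..<64 + 8 * B}"
      "real t' \<le> u'" "\<alpha> M'' z" "Q (u + u') z"
    unfolding wp_def by blast
  have "exec w (c ;; d) M (t + t') (A \<union> A') M''" using 1 2 by (auto intro: exec.Seq)
  moreover have "real (t + t') \<le> u + u'" using 1 2 by simp
  ultimately show "\<exists>t A M' u x'. exec w (c ;; d) M t A M' \<and> A \<subseteq> {..<64 + 8 * B}
      \<and> real t \<le> u \<and> \<alpha> M' x' \<and> Q u x'"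
    using 1 2 by (meson Un_least)
qed

lemma wp_Cond:
  assumes g: "guard w B \<alpha> b x v"
    and 1: "v \<noteq> 0 \<Longrightarrow> wp w B \<alpha> c (\<lambda>u. Q (real (1 + expr_cost b) + u)) x"
    and 2: "v = 0 \<Longrightarrow> wp w B \<alpha> d (\<lambda>u. Q (real (1 + expr_cost b) + u)) x"
  shows "wp w B \<alpha> (Cond b c d) Q x"
  unfolding wp_def
proof (intro allI impI)
  fix M assume M: "\<alpha> M x"
  define e where "e = (if v \<noteq> 0 then c else d)"
  have "wp w B \<alpha> e (\<lambda>u. Q (real (1 + expr_cost b) + u)) x"
    using 1 2 by (auto simp: e_def)
  then obtain t A M' u y where r: "exec w e M t A M'" "A \<subseteq> {..<64 + 8 * B}" "real t \<le> u"
      "\<alpha> M' y" "Q (real (1 + expr_cost b) + u) y"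
    using M unfolding wp_def by blast
  have v: "val w M b = v" "reads w M b \<subseteq> {..<64 + 8 * B}" using g M by (auto simp: guard_def)
  have "exec w (Cond b c d) M (1 + expr_cost b + t) (reads w M b \<union> A) M'"
    using exec.CondTrue[of w M b c t A M' d] exec.CondFalse[of w M b d t A M' c] r(1) v(1)
    by (cases "v = 0") (simp_all add: e_def)
  moreover have "real (1 + expr_cost b + t) \<le> real (1 + expr_cost b) + u" using r by simp
  ultimately show "\<exists>t A M' u x'. exec w (Cond b c d) M t A M' \<and> A \<subseteq> {..<64 + 8 * B}
      \<and> real t \<le> u \<and> \<alpha> M' x' \<and> Q u x'"
    using r v by (meson Un_least)
qed

text \<open>The function \<open>pot\<close> bounds the remaining running time of the loop; since a step costs at least
  one unit, this also yields termination.\<close>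

lemma wp_While:
  fixes I :: "'g \<Rightarrow> 'x \<Rightarrow> bool" and pot :: "'g \<Rightarrow> 'x \<Rightarrow> real"
  assumes I: "I g x"
    and gd: "\<And>g x. I g x \<Longrightarrow> guard w B \<alpha> b x (v x)"
    and pos: "\<And>g x. I g x \<Longrightarrow> 0 \<le> pot g x"
    and step: "\<And>g x. I g x \<Longrightarrow> v x \<noteq> 0 \<Longrightarrow>
      wp w B \<alpha> c (\<lambda>u y. \<exists>h. I h y \<and> real (1 + expr_cost b) + u + pot h y \<le> pot g x) x"
    and fin: "\<And>h y. I h y \<Longrightarrow> v y = 0 \<Longrightarrow> Q (real (1 + expr_cost b) + pot g x - pot h y) y"
  shows "wp w B \<alpha> (While b c) Q x"
proof -
  \<comment> \<open>Every pass pays for its own test out of \<open>pot\<close>; the extra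
    \<open>1 + expr_cost b\<close> on the right is the last, failing test.\<close>
  have main: "\<exists>t A M' h y. exec w (While b c) M t A M' \<and> A \<subseteq> {..<64 + 8 * B}
      \<and> real t + pot h y \<le> real (1 + expr_cost b) + pot g x \<and> \<alpha> M' y \<and> I h y \<and> v y = 0"
    if "I g x" "pot g x < real N" "\<alpha> M x" for N g x M
    using that
  proof (induction N arbitrary: g x M)
    case 0
    then show ?case using pos[of g x] by simp
  next
    case (Suc N)
    have v: "val w M b = v x" "reads w M b \<subseteq> {..<64 + 8 * B}"
      using gd[OF Suc.prems(1)] Suc.prems by (auto simp: guard_def)
    show ?case
    proof (cases "v x = 0")
      case True
      then have "exec w (While b c) M (1 + expr_cost b) (reads w M b) M"
        using v by (intro exec.WhileFalse) simp
      then show ?thesis using v Suc.prems True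
        by (intro exI[of _ "1 + expr_cost b"] exI[of _ "reads w M b"] exI[of _ M] exI[of _ g]
            exI[of _ x]) auto
    next
      case False
      then obtain t A M' u h y where r: "exec w c M t A M'" "A \<subseteq> {..<64 + 8 * B}" "real t \<le> u"
          "\<alpha> M' y" "I h y" "real (1 + expr_cost b) + u + pot h y \<le> pot g x"
        using step[OF Suc.prems(1)] Suc.prems(3) unfolding wp_def by blast
      have "pot h y < real N" using r Suc.prems(2) by simp
      from Suc.IH[OF r(5) this r(4)] obtain t' A' M'' h' z where
        r': "exec w (While b c) M' t' A' M''" "A' \<subseteq> {..<64 + 8 * B}"
          "real t' + pot h' z \<le> real (1 + expr_cost b) + pot h y" "\<alpha> M'' z" "I h' z" "v z = 0"
        by blast
      have "exec w (While b c) M (1 + expr_cost b + t + t') (reads w M b \<union> A \<union> A') M''"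
        using False v r r' by (intro exec.WhileTrue) auto
      moreover have "real (1 + expr_cost b + t + t') + pot h' z \<le> real (1 + expr_cost b) + pot g x"
        using r r' by simp
      ultimately show ?thesis using r r' v by (meson Un_least)
    qed
  qed
  show ?thesis unfolding wp_def
  proof (intro allI impI)
    fix M assume M: "\<alpha> M x"
    obtain N :: nat where "pot g x < real N" using reals_Archimedean2 by blast
    from main[OF I this M] obtain t A M' h y where r: "exec w (While b c) M t A M'"
        "A \<subseteq> {..<64 + 8 * B}" "real t + pot h y \<le> real (1 + expr_cost b) + pot g x"
        "\<alpha> M' y" "I h y" "v y = 0" by blast
    then show "\<exists>t A M' u x'. exec w (While b c) M t A M' \<and> A \<subseteq> {..<64 + 8 * B}
        \<and> real t \<le> u \<and> \<alpha> M' x' \<and> Q u x'"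
      using fin[OF r(5,6)]
      by (intro exI[of _ t] exI[of _ A] exI[of _ M'] exI[of _ y] conjI
          exI[of _ "real (1 + expr_cost b) + pot g x - pot h y"]) auto
  qed
qed


text \<open>\<open>64 + 8 * B \<le> 2 ^ w\<close> keeps every computed address below the modulus, so
  address arithmetic does not wrap around; \<open>ok\<close> excludes wrapping elsewhere.\<close>

lemma code_correct:
  assumes "64 + 8 * B \<le> 2 ^ w" "ok w B s e" "s = M \<circ> addr"
  shows "val w M (code e) = ev s e \<and> reads w M (code e) \<subseteq> {..<64 + 8 * B}"
  using assms(2)
proof (induction e)
  case (Reg r)
  have "reg_index r < 2 ^ w" using reg_index_less[of r] assms(1) by simp
  then show ?case using assms(3) reg_index_less[of r] by simp
next
  case (Elem a e)
  then have IH: "val w M (code e) = ev s e" "reads w M (code e) \<subseteq> {..<64 + 8 * B}" by auto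
  have s: "s (H a i) = M (64 + arr_index a + 8 * i)" for i using assms(3) by simp
  have "64 + arr_index a + 8 * ev s e < 64 + 8 * B" using Elem.prems arr_index_less[of a] by auto
  moreover from this have "64 + arr_index a + 8 * ev s e < 2 ^ w" using assms(1) by simp
  moreover from this have "8 * ev s e < 2 ^ w" "64 + arr_index a < 2 ^ w" "8 < (2::nat) ^ w"
    using assms(1) by linarith+
  ultimately show ?case using IH by (simp add: s)
next
  case (Op f a b)
  have 1: "1 < (2::nat) ^ w" using assms(1) by linarith
  have "nat ((int x - int y) mod 2 ^ w) = x - y" if "y \<le> x" "x < 2 ^ w" for x y
  proof -
    have "int x < 2 ^ w" using that(2) by simp
    then have "(int x - int y) mod 2 ^ w = int x - int y"
      using that(1) by (intro mod_pos_pos_trivial) linarith+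
    then show ?thesis by simp
  qed
  then show ?case using Op 1 by (cases f) auto
qed (use assms in auto)

abbreviation raw :: "mem \<Rightarrow> (loc \<Rightarrow> nat) \<Rightarrow> bool" where
  "raw M s \<equiv> s = M \<circ> addr"

lemma raw_guard:
  "64 + 8 * B \<le> 2 ^ w \<Longrightarrow> ok w B s e \<Longrightarrow> guard w B raw (code e) s (ev s e)"
  unfolding guard_def using code_correct by blast

lemma exec_assign:
  assumes "64 + 8 * B \<le> 2 ^ w" "ok w B s e" "s = M \<circ> addr"
  shows "\<exists>A. exec w (r ::= e) M (2 + expr_cost (code e)) A (M(addr (V r) := ev s e)) \<and>
    A \<subseteq> {..<64 + 8 * B}"
proof -
  let ?a = "Const (reg_index r)"
  have r: "reg_index r < 64" by (rule reg_index_less)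
  then have a: "val w M ?a = reg_index r" using assms(1) by simp
  have "exec w (r ::= e) M (1 + expr_cost ?a + expr_cost (code e))
      (insert (val w M ?a) (reads w M ?a \<union> reads w M (code e)))
      (M(val w M ?a := val w M (code e)))"
    unfolding assign_def by (rule exec.Store)
  then show ?thesis using code_correct[OF assms] a r by (intro exI) (auto simp: numeral_2_eq_2)
qed

lemma exec_put:
  assumes "64 + 8 * B \<le> 2 ^ w" "ok w B s i" "ev s i < B" "ok w B s e" "s = M \<circ> addr"
  shows "\<exists>A. exec w (put a i e) M (5 + expr_cost (code i) + expr_cost (code e)) A
      (M(addr (H a (ev s i)) := ev s e)) \<and> A \<subseteq> {..<64 + 8 * B}"
proof -
  let ?a = "Bin Plus (Const (64 + arr_index a)) (Bin Times (Const 8) (code i))"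
  have ok: "ok w B s (Elem a i)" using assms by simp
  have ci: "val w M (code i) = ev s i" using code_correct[OF assms(1,2,5)] by simp
  have "64 + arr_index a + 8 * ev s i < 64 + 8 * B" using assms(3) arr_index_less[of a] by auto
  moreover from this have "64 + arr_index a + 8 * ev s i < 2 ^ w" using assms(1) by simp
  moreover from this have "8 * ev s i < 2 ^ w" "64 + arr_index a < 2 ^ w" "8 < (2::nat) ^ w"
    using assms(1) by linarith+
  ultimately have a: "val w M ?a = addr (H a (ev s i))" "val w M ?a < 64 + 8 * B"
    using ci by auto
  have "exec w (put a i e) M (1 + expr_cost ?a + expr_cost (code e))
      (insert (val w M ?a) (reads w M ?a \<union> reads w M (code e)))
      (M(val w M ?a := val w M (code e)))"
    unfolding put_def by (rule exec.Store)
  moreover have "1 + expr_cost ?a + expr_cost (code e) = 5 + expr_cost (code i) + expr_cost (code e)"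
    by simp
  ultimately have "exec w (put a i e) M (5 + expr_cost (code i) + expr_cost (code e))
      (insert (val w M ?a) (reads w M ?a \<union> reads w M (code e)))
      (M(addr (H a (ev s i)) := ev s e))"
    using a(1) code_correct[OF assms(1,4,5)] by metis
  moreover have "reads w M ?a \<subseteq> {..<64 + 8 * B}" using code_correct[OF assms(1,2,5)] by simp
  ultimately show ?thesis using code_correct[OF assms(1,4,5)] a(2)
    by (metis insert_subset lessThan_iff Un_least)
qed

section \<open>Program rules for the raw memory\<close>

lemma raw_assign:
  assumes "64 + 8 * B \<le> 2 ^ w" "ok w B s e"
    and "Q (real (2 + expr_cost (code e))) (s(V r := ev s e))"
  shows "wp w B raw (r ::= e) Q s"
  unfolding wp_def
proof (intro allI impI)
  fix M assume "s = M \<circ> addr"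
  from exec_assign[OF assms(1,2) this, of r] this assms(3)
  show "\<exists>t A M' u x'. exec w (r ::= e) M t A M' \<and> A \<subseteq> {..<64 + 8 * B}
      \<and> real t \<le> u \<and> x' = M' \<circ> addr \<and> Q u x'"
    by (metis order_refl upd_addr)
qed

lemma raw_put:
  assumes "64 + 8 * B \<le> 2 ^ w" "ok w B s i" "ev s i < B" "ok w B s e"
    and "Q (real (5 + expr_cost (code i) + expr_cost (code e))) (s(H a (ev s i) := ev s e))"
  shows "wp w B raw (put a i e) Q s"
  unfolding wp_def
proof (intro allI impI)
  fix M assume "s = M \<circ> addr"
  from exec_put[OF assms(1-4) this, of a] this assms(5)
  show "\<exists>t A M' u x'. exec w (put a i e) M t A M' \<and> A \<subseteq> {..<64 + 8 * B}
      \<and> real t \<le> u \<and> x' = M' \<circ> addr \<and> Q u x'"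
    by (metis order_refl upd_addr)
qed

lemma raw_Cond:
  assumes "64 + 8 * B \<le> 2 ^ w" "ok w B s b"
    and "ev s b \<noteq> 0 \<Longrightarrow> wp w B raw c (\<lambda>u. Q (real (1 + expr_cost (code b)) + u)) s"
    and "ev s b = 0 \<Longrightarrow> wp w B raw d (\<lambda>u. Q (real (1 + expr_cost (code b)) + u)) s"
  shows "wp w B raw (IF b THEN c ELSE d) Q s"
  by (rule wp_Cond[OF raw_guard[OF assms(1,2)]]) (use assms in auto)

lemma raw_While:
  fixes I :: "'g \<Rightarrow> (loc \<Rightarrow> nat) \<Rightarrow> bool" and pot :: "'g \<Rightarrow> (loc \<Rightarrow> nat) \<Rightarrow> real"
  assumes "64 + 8 * B \<le> 2 ^ w" "I g s"
    and "\<And>g s. I g s \<Longrightarrow> ok w B s b"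
    and "\<And>g s. I g s \<Longrightarrow> 0 \<le> pot g s"
    and "\<And>g s. I g s \<Longrightarrow> ev s b \<noteq> 0 \<Longrightarrow> wp w B raw c
      (\<lambda>u s'. \<exists>h. I h s' \<and> real (1 + expr_cost (code b)) + u + pot h s' \<le> pot g s) s"
    and "\<And>h s'. I h s' \<Longrightarrow> ev s' b = 0 \<Longrightarrow>
      Q (real (1 + expr_cost (code b)) + pot g s - pot h s') s'"
  shows "wp w B raw (WHILE b DO c) Q s"
  by (rule wp_While[where I = I and pot = pot and v = "\<lambda>s. ev s b", OF assms(2)])
    (use assms raw_guard in blast)+

section \<open>An ordered set as a binary trie\<close>

text \<open>The complement is the private memory of the trie. Among the client locations,
  \<open>Key\<close>, \<open>KeyTop\<close> and \<open>KeyHalf\<close> are inputs of the trie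
  programs, and only \<open>Res\<close> is written by one of them.\<close>

fun client :: "loc \<Rightarrow> bool" where
  "client (V r) \<longleftrightarrow> r \<notin> {TrieNode, TrieWeight, TrieSlot, TrieKid, TrieKey, TrieCand, TrieCode,
     TrieFree, TrieFresh}"
| "client (H a i) \<longleftrightarrow> a \<notin> {Kid, Par, Stack}"

definition same :: "(loc \<Rightarrow> nat) \<Rightarrow> (loc \<Rightarrow> nat) \<Rightarrow> bool" where
  "same s s' \<longleftrightarrow> (\<forall>l. client l \<longrightarrow> s' l = s l)"

lemma same_refl: "same s s"
  by (simp add: same_def)

lemma same_upd: "\<not> client l \<Longrightarrow> same s (s'(l := x)) \<longleftrightarrow> same s s'"
  by (auto simp: same_def)

text \<open>Adding \<open>KeyTop\<close>, that is \<open>2 ^ b\<close>, puts a leading 1 before the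
  \<open>b\<close> bits of the key, so that its quotients by powers of two are the names of its
  prefixes. \<open>TrieWeight\<close> is the weight of the next bit; halving it past 1 gives 0 and
  ends the loops.\<close>

definition t_begin :: com where
  "t_begin = (TrieKey ::= Reg Key \<oplus> Reg KeyTop ;; TrieNode ::= Num 0 ;;
     TrieWeight ::= Reg KeyHalf)"

definition t_slot :: com where
  "t_slot = (TrieSlot ::= Num 2 \<otimes> Reg TrieNode \<oplus> (Reg TrieKey \<oslash> Reg TrieWeight) \<odot> Num 2 ;;
     TrieKid ::= Elem Kid (Reg TrieSlot))"

definition t_next :: com where
  "t_next = (TrieNode ::= Reg TrieKid ;; TrieWeight ::= Reg TrieWeight \<oslash> Num 2)"

text \<open>Both child cells are cleared here, so that the invariants need not describe the contents
  of slots that are not in use.\<close>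

definition t_alloc :: com where
  "t_alloc =
     ((IF Reg TrieFree
       THEN (TrieFree ::= Reg TrieFree \<ominus> Num 1 ;; TrieKid ::= Elem Stack (Reg TrieFree))
       ELSE (TrieKid ::= Reg TrieFresh ;; TrieFresh ::= Reg TrieFresh \<oplus> Num 1)) ;;
      put Kid (Num 2 \<otimes> Reg TrieKid) (Num 0) ;;
      put Kid (Num 2 \<otimes> Reg TrieKid \<oplus> Num 1) (Num 0) ;;
      put Par (Reg TrieKid) (Reg TrieSlot) ;;
      put Kid (Reg TrieSlot) (Reg TrieKid))"

definition t_insert :: com where
  "t_insert = (t_begin ;; (WHILE Reg TrieWeight DO
     (t_slot ;; (IF Reg TrieKid THEN Skip ELSE t_alloc) ;; t_next)))"

text \<open>Missing children are stored as 0, so a zero sum of both child cells means a childless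
  node. \<open>Par\<close> holds the index of the parent's child cell that points to the node: it is
  used to cut the link and, halved, to reach the parent.\<close>

definition t_delete :: com where
  "t_delete = (t_begin ;; (WHILE Reg TrieWeight DO (t_slot ;; t_next)) ;;
     (WHILE (Elem Kid (Num 2 \<otimes> Reg TrieNode) \<oplus> Elem Kid (Num 2 \<otimes> Reg TrieNode \<oplus> Num 1)
         \<doteq> Num 0) \<otimes> (Num 0 \<lhd> Reg TrieNode) DO
       (TrieSlot ::= Elem Par (Reg TrieNode) ;;
        put Kid (Reg TrieSlot) (Num 0) ;;
        put Stack (Reg TrieFree) (Reg TrieNode) ;;
        TrieFree ::= Reg TrieFree \<oplus> Num 1 ;;
        TrieNode ::= Reg TrieSlot \<oslash> Num 2)))"

text \<open>Whenever the path turns right past an existing left sibling, all keys under this sibling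
  are smaller than the sought one and larger than those under earlier candidates. So the last such
  sibling is kept, with its name in \<open>TrieCode\<close>; its rightmost leaf is the predecessor.
  A leaf is recognised by its name reaching \<open>KeyTop\<close>.\<close>

definition t_pred :: com where
  "t_pred = (t_begin ;; TrieCode ::= Num 0 ;;
     (WHILE Reg TrieWeight DO
       (t_slot ;;
        (IF Reg TrieSlot \<odot> Num 2
         THEN (IF Elem Kid (Num 2 \<otimes> Reg TrieNode)
               THEN (TrieCand ::= Elem Kid (Num 2 \<otimes> Reg TrieNode) ;;
                     TrieCode ::= Reg TrieKey \<oslash> Reg TrieWeight \<ominus> Num 1)
               ELSE Skip)
         ELSE Skip) ;;
        (IF Reg TrieKid THEN t_next ELSE (TrieWeight ::= Num 0)))) ;;
     (IF Reg TrieCode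
      THEN (WHILE Reg TrieCode \<lhd> Reg KeyTop DO
        (IF Elem Kid (Num 2 \<otimes> Reg TrieCand \<oplus> Num 1)
         THEN (TrieCand ::= Elem Kid (Num 2 \<otimes> Reg TrieCand \<oplus> Num 1) ;;
               TrieCode ::= Num 2 \<otimes> Reg TrieCode \<oplus> Num 1)
         ELSE (TrieCand ::= Elem Kid (Num 2 \<otimes> Reg TrieCand) ;;
               TrieCode ::= Num 2 \<otimes> Reg TrieCode)))
      ELSE Skip) ;;
     Res ::= Reg TrieCode)"

text \<open>\<open>b\<close> is the length of the keys, \<open>NB\<close> a cap on the number of
  trie nodes, each of which owns two child cells, and \<open>B\<close> a cap on array indices. No
  program reads these caps. The three spare bits leave room for sums of \<open>KeyTop\<close> and a
  key.\<close>

locale machine =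
  fixes w B b NB :: nat
  assumes b_pos: "1 \<le> b" and b_word: "b + 3 \<le> w" and NB: "2 * NB \<le> B" "1 \<le> NB"
    and space: "64 + 8 * B \<le> 2 ^ w"
begin

text \<open>A trie node is named by the binary code of its path, preceded by a leading 1: the root is 1, the
  children of \<open>\<nu>\<close> are \<open>2 \<nu>\<close> and \<open>2 \<nu> + 1\<close>, and the key \<open>k\<close> is the leaf \<open>2 ^ b + k\<close>. The function
  \<open>\<phi>\<close> below maps these names to array slots. Slot 0 is the root, hence 0 can encode a missing child.\<close>

definition pref :: "nat set \<Rightarrow> nat set" where
  "pref S = insert 1 {(2 ^ b + k) div 2 ^ j | k j. k \<in> S \<and> j \<le> b}"

definition links :: "(loc \<Rightarrow> nat) \<Rightarrow> nat set \<Rightarrow> (nat \<Rightarrow> nat) \<Rightarrow> bool" where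
  "links s P \<phi> \<longleftrightarrow> 1 \<in> P \<and> P \<subseteq> {1..<2 ^ (b + 1)} \<and> (\<forall>\<nu>\<in>P. \<nu> \<noteq> 1 \<longrightarrow> \<nu> div 2 \<in> P)
     \<and> inj_on \<phi> P \<and> \<phi> 1 = 0
     \<and> (\<forall>\<nu>\<in>P. \<forall>c<2. s (H Kid (2 * \<phi> \<nu> + c)) = (if 2 * \<nu> + c \<in> P then \<phi> (2 * \<nu> + c) else 0))
     \<and> (\<forall>\<nu>\<in>P. \<nu> \<noteq> 1 \<longrightarrow> s (H Par (\<phi> \<nu>)) = 2 * \<phi> (\<nu> div 2) + \<nu> mod 2)"

text \<open>\<open>I\<close> is the set of slots in use; the other slots handed out so far lie on
  the free stack, each exactly once. A fresh slot is taken only when that stack is empty, so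
  \<open>TrieFresh\<close> never exceeds the largest number of nodes alive at one time.\<close>

definition pool :: "(loc \<Rightarrow> nat) \<Rightarrow> nat set \<Rightarrow> bool" where
  "pool s I \<longleftrightarrow> I \<subseteq> {..<s (V TrieFresh)} \<and> s (V TrieFresh) \<le> NB
     \<and> bij_betw (\<lambda>i. s (H Stack i)) {..<s (V TrieFree)} ({..<s (V TrieFresh)} - I)"

definition params :: "(loc \<Rightarrow> nat) \<Rightarrow> bool" where
  "params s \<longleftrightarrow> s (V KeyTop) = 2 ^ b \<and> s (V KeyHalf) = 2 ^ (b - 1)"

lemma links_upd:
  "links (s(V r := x)) P \<phi> \<longleftrightarrow> links s P \<phi>"
  "a \<noteq> Kid \<Longrightarrow> a \<noteq> Par \<Longrightarrow> links (s(H a i := x)) P \<phi> \<longleftrightarrow> links s P \<phi>"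
  by (auto simp: links_def)

lemma pool_upd:
  "r \<noteq> TrieFree \<Longrightarrow> r \<noteq> TrieFresh \<Longrightarrow> pool (s(V r := x)) I \<longleftrightarrow> pool s I"
  "a \<noteq> Stack \<Longrightarrow> pool (s(H a i := x)) I \<longleftrightarrow> pool s I"
  by (auto simp: pool_def)

lemma pool_card: "pool s I \<Longrightarrow> s (V TrieFree) + card I = s (V TrieFresh)"
proof -
  assume p: "pool s I"
  then have "card ({..<s (V TrieFresh)} - I) = s (V TrieFree)"
    by (metis pool_def bij_betw_same_card card_lessThan)
  moreover have "finite I" using p finite_subset by (auto simp: pool_def)
  ultimately show ?thesis using p card_mono[of "{..<s (V TrieFresh)}" I]
    by (auto simp: pool_def card_Diff_subset)
qed

lemma links_finite: "links s P \<phi> \<Longrightarrow> finite P"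
  unfolding links_def using finite_subset by blast

lemma small: "(c::nat) < 64 \<Longrightarrow> c < 2 ^ w"
  using space by linarith

lemma pow_word: "2 ^ b * 8 \<le> (2::nat) ^ w"
proof -
  have "(2::nat) ^ (b + 3) \<le> 2 ^ w" using b_word by (intro power_increasing) auto
  then show ?thesis by (simp add: power_add)
qed

lemma kid_nonzero:
  assumes "links s P \<phi>" "\<nu> \<in> P"
  shows "\<phi> \<nu> = 0 \<longleftrightarrow> \<nu> = 1"
  using assms inj_on_eq_iff[of \<phi> P \<nu> 1] by (auto simp: links_def)

lemma double_eq: "c < 2 \<Longrightarrow> d < 2 \<Longrightarrow> 2 * x + c = 2 * y + d \<longleftrightarrow> x = y \<and> c = (d::nat)"
  by presburger

lemma insert_links:
  assumes l: "links s P \<phi>" and \<nu>: "\<nu> \<in> P" "c < 2" "2 * \<nu> + c \<notin> P" "2 * \<nu> + c < 2 ^ (b + 1)"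
    and i: "i \<notin> \<phi> ` P"
  shows "links (s(H Kid (2 * i) := 0, H Kid (2 * i + 1) := 0, H Par i := 2 * \<phi> \<nu> + c,
      H Kid (2 * \<phi> \<nu> + c) := i)) (insert (2 * \<nu> + c) P) (\<phi>(2 * \<nu> + c := i))"
    (is "links ?s ?P ?\<phi>")
proof -
  define \<mu> where "\<mu> = 2 * \<nu> + c"
  have P: "1 \<in> P" "P \<subseteq> {1..<2 ^ (b + 1)}" "\<And>\<kappa>. \<kappa> \<in> P \<Longrightarrow> \<kappa> \<noteq> 1 \<Longrightarrow> \<kappa> div 2 \<in> P" "inj_on \<phi> P" "\<phi> 1 = 0"
    "\<And>\<kappa> d. \<kappa> \<in> P \<Longrightarrow> d < 2 \<Longrightarrow> s (H Kid (2 * \<phi> \<kappa> + d)) = (if 2 * \<kappa> + d \<in> P then \<phi> (2 * \<kappa> + d) else 0)"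
    "\<And>\<kappa>. \<kappa> \<in> P \<Longrightarrow> \<kappa> \<noteq> 1 \<Longrightarrow> s (H Par (\<phi> \<kappa>)) = 2 * \<phi> (\<kappa> div 2) + \<kappa> mod 2"
    using l by (auto simp: links_def)
  have "1 \<le> \<nu>" using \<nu>(1) P(2) by auto
  then have \<mu>: "\<mu> div 2 = \<nu>" "\<mu> mod 2 = c" "\<mu> \<notin> P" "\<mu> < 2 ^ (b + 1)" "2 \<le> \<mu>"
    using \<nu> by (auto simp: \<mu>_def)
  \<comment> \<open>\<open>P\<close> is closed under parents, so a child of the new node in
    \<open>P\<close> would put the new node itself into \<open>P\<close>.\<close>
  have ne: "2 * \<mu> + d \<notin> insert \<mu> P" if "d < 2" for d
    using P(3)[of "2 * \<mu> + d"] that \<mu> by auto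
  have i': "\<phi> \<kappa> \<noteq> i" if "\<kappa> \<in> P" for \<kappa> using that i by auto
  have kid: "?s (H Kid (2 * ?\<phi> \<kappa> + d)) = (if 2 * \<kappa> + d \<in> ?P then ?\<phi> (2 * \<kappa> + d) else 0)"
    if "\<kappa> \<in> ?P" "d < 2" for \<kappa> d
  proof (cases "\<kappa> = \<mu>")
    case True
    have "2 * i + d \<noteq> 2 * \<phi> \<nu> + c" using double_eq[of d c i "\<phi> \<nu>"] that \<nu>(2) i'[OF \<nu>(1)] by auto
    moreover have "d = 0 \<or> d = 1" using that by auto
    ultimately show ?thesis using ne[OF that(2)] True by (auto simp flip: \<mu>_def)
  next
    case False
    then have \<kappa>: "\<kappa> \<in> P" using that by (auto simp: \<mu>_def)
    have 1: "2 * \<phi> \<kappa> + d \<noteq> 2 * i + d'" if "d' < 2" for d'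
      using double_eq[OF \<open>d < 2\<close> that] i'[OF \<kappa>] by auto
    have 2: "2 * \<phi> \<kappa> + d = 2 * \<phi> \<nu> + c \<longleftrightarrow> \<kappa> = \<nu> \<and> d = c"
      using double_eq[OF \<open>d < 2\<close> \<nu>(2)] P(4) \<kappa> \<nu>(1) by (auto dest: inj_onD)
    have 3: "2 * \<kappa> + d = \<mu> \<longleftrightarrow> \<kappa> = \<nu> \<and> d = c"
      using double_eq[OF \<open>d < 2\<close> \<nu>(2)] by (auto simp: \<mu>_def)
    show ?thesis using 1[of 0] 1[of 1] 2 3 P(6)[OF \<kappa> \<open>d < 2\<close>] False by (auto simp flip: \<mu>_def)
  qed
  have par: "?s (H Par (?\<phi> \<kappa>)) = 2 * ?\<phi> (\<kappa> div 2) + \<kappa> mod 2" if "\<kappa> \<in> ?P" "\<kappa> \<noteq> 1" for \<kappa>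
  proof (cases "\<kappa> = \<mu>")
    case True
    then show ?thesis using \<mu> \<nu>(1) by (auto simp flip: \<mu>_def)
  next
    case False
    then have "\<kappa> \<in> P" using that by (auto simp: \<mu>_def)
    then have "\<kappa> div 2 \<noteq> \<mu>" using P(3) that \<mu>(3) by auto
    then show ?thesis using False \<open>\<kappa> \<in> P\<close> i' that P(7) by (auto simp flip: \<mu>_def)
  qed
  have 1: "inj_on ?\<phi> ?P" using P(4) i \<mu>(3) by (auto simp: inj_on_def simp flip: \<mu>_def)
  have 2: "\<forall>\<kappa>\<in>?P. \<kappa> \<noteq> 1 \<longrightarrow> \<kappa> div 2 \<in> ?P" using P(3) \<mu>(1) \<nu>(1) by (auto simp flip: \<mu>_def)
  have 3: "1 \<in> ?P" "?P \<subseteq> {1..<2 ^ (b + 1)}" "?\<phi> 1 = 0" using P \<mu>(4,5) by (auto simp flip: \<mu>_def)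
  show ?thesis unfolding links_def using 1 2 3 kid par by blast
qed

lemma delete_links:
  assumes l: "links s P \<phi>" and \<mu>: "\<mu> \<in> P" "\<mu> \<noteq> 1" "2 * \<mu> \<notin> P" "2 * \<mu> + 1 \<notin> P"
  shows "links (s(H Kid (2 * \<phi> (\<mu> div 2) + \<mu> mod 2) := 0)) (P - {\<mu>}) \<phi>" (is "links ?s ?P \<phi>")
proof -
  have P: "1 \<in> P" "P \<subseteq> {1..<2 ^ (b + 1)}" "\<And>\<kappa>. \<kappa> \<in> P \<Longrightarrow> \<kappa> \<noteq> 1 \<Longrightarrow> \<kappa> div 2 \<in> P" "inj_on \<phi> P" "\<phi> 1 = 0"
    "\<And>\<kappa> d. \<kappa> \<in> P \<Longrightarrow> d < 2 \<Longrightarrow> s (H Kid (2 * \<phi> \<kappa> + d)) = (if 2 * \<kappa> + d \<in> P then \<phi> (2 * \<kappa> + d) else 0)"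
    "\<And>\<kappa>. \<kappa> \<in> P \<Longrightarrow> \<kappa> \<noteq> 1 \<Longrightarrow> s (H Par (\<phi> \<kappa>)) = 2 * \<phi> (\<kappa> div 2) + \<kappa> mod 2"
    using l by (auto simp: links_def)
  have "\<kappa> div 2 \<noteq> \<mu>" if "\<kappa> \<in> P" for \<kappa>
  proof
    assume "\<kappa> div 2 = \<mu>"
    then have "\<kappa> = 2 * \<mu> \<or> \<kappa> = 2 * \<mu> + 1" by linarith
    then show False using that \<mu> by auto
  qed
  then have closed: "\<forall>\<kappa>\<in>?P. \<kappa> \<noteq> 1 \<longrightarrow> \<kappa> div 2 \<in> ?P" using P(3) by auto
  have kid: "?s (H Kid (2 * \<phi> \<kappa> + d)) = (if 2 * \<kappa> + d \<in> ?P then \<phi> (2 * \<kappa> + d) else 0)"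
    if "\<kappa> \<in> ?P" "d < 2" for \<kappa> d
  proof -
    have "2 * \<phi> \<kappa> + d = 2 * \<phi> (\<mu> div 2) + \<mu> mod 2 \<longleftrightarrow> \<kappa> = \<mu> div 2 \<and> d = \<mu> mod 2"
      using double_eq[of d "\<mu> mod 2"] P(3)[OF \<mu>(1,2)] P(4) that by (auto dest: inj_onD)
    moreover have "2 * \<kappa> + d = \<mu> \<longleftrightarrow> \<kappa> = \<mu> div 2 \<and> d = \<mu> mod 2" using that by auto
    ultimately show ?thesis using P(6)[of \<kappa> d] that by auto
  qed
  have 1: "inj_on \<phi> ?P" "1 \<in> ?P" "?P \<subseteq> {1..<2 ^ (b + 1)}"
    using P \<mu>(2) by (auto simp: inj_on_def)
  have 2: "\<forall>\<kappa>\<in>?P. \<kappa> \<noteq> 1 \<longrightarrow> ?s (H Par (\<phi> \<kappa>)) = 2 * \<phi> (\<kappa> div 2) + \<kappa> mod 2"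
    using P(7) by auto
  show ?thesis unfolding links_def using 1 2 kid closed P(5) by blast
qed

lemma pool_push:
  assumes "pool s I" "i \<in> I" "f = s (V TrieFree)"
  shows "pool (s(H Stack f := i, V TrieFree := f + 1)) (I - {i})"
proof -
  define t where "t = (\<lambda>j. s (H Stack j))"
  have I: "I \<subseteq> {..<s (V TrieFresh)}" "s (V TrieFresh) \<le> NB" "bij_betw t {..<f} ({..<s (V TrieFresh)} - I)"
    using assms by (auto simp: pool_def t_def)
  have "bij_betw (t(f := i)) {..<f} ({..<s (V TrieFresh)} - I)"
    using I(3) by (subst bij_betw_cong[of _ _ t]) auto
  then have "bij_betw (t(f := i)) ({..<f} \<union> {f}) (({..<s (V TrieFresh)} - I) \<union> {(t(f := i)) f})"
    using assms(2) by (intro notIn_Un_bij_betw) auto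
  moreover have "({..<s (V TrieFresh)} - I) \<union> {(t(f := i)) f} = {..<s (V TrieFresh)} - (I - {i})"
    using I(1) assms(2) by auto
  moreover have "{..<f} \<union> {f} = {..<f + 1}" by auto
  moreover have "(\<lambda>j. (s(H Stack f := i, V TrieFree := f + 1)) (H Stack j)) = t(f := i)"
    by (auto simp: t_def)
  ultimately show ?thesis using I by (auto simp: pool_def)
qed

lemma pool_pop:
  assumes "pool s I" "s (V TrieFree) = Suc f" "i = s (H Stack f)"
  shows "pool (s(V TrieFree := f)) (insert i I)" "i \<notin> I"
proof -
  define t where "t = (\<lambda>j. s (H Stack j))"
  have I: "I \<subseteq> {..<s (V TrieFresh)}" "s (V TrieFresh) \<le> NB"
      "bij_betw t {..<Suc f} ({..<s (V TrieFresh)} - I)"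
    using assms by (auto simp: pool_def t_def)
  have i: "i = t f" using assms by (simp add: t_def)
  have "t f \<in> {..<s (V TrieFresh)} - I" using I(3) by (auto simp: bij_betw_def)
  moreover have "bij_betw t {..<f} ({..<s (V TrieFresh)} - I - {t f})"
    using I(3) by (auto simp: bij_betw_def lessThan_Suc inj_on_insert) (metis imageI lessThan_iff)
  moreover have "{..<s (V TrieFresh)} - I - {t f} = {..<s (V TrieFresh)} - insert i I"
    using i by auto
  ultimately show "pool (s(V TrieFree := f)) (insert i I)" "i \<notin> I"
    using I i by (auto simp: pool_def t_def)
qed

lemma pool_fresh:
  assumes "pool s I" "s (V TrieFree) = 0" "card I < NB"
  shows "pool (s(V TrieFresh := s (V TrieFresh) + 1)) (insert (s (V TrieFresh)) I)"
    "s (V TrieFresh) \<notin> I" "s (V TrieFresh) < NB"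
proof -
  have c: "s (V TrieFresh) < NB" using pool_card[OF assms(1)] assms by simp
  have "{..<s (V TrieFresh)} - I = {}" using assms by (auto simp: pool_def bij_betw_def)
  then show "pool (s(V TrieFresh := s (V TrieFresh) + 1)) (insert (s (V TrieFresh)) I)"
    "s (V TrieFresh) \<notin> I" "s (V TrieFresh) < NB"
    using assms c by (auto simp: pool_def bij_betw_def)
qed

lemma wp_SeqI:
  assumes "wp w B \<alpha> c Q1 x" "\<And>u y. Q1 u y \<Longrightarrow> wp w B \<alpha> d (\<lambda>u'. Q (u + u')) y"
  shows "wp w B \<alpha> (c ;; d) Q x"
  by (rule wp_Seq, rule wp_conseq[OF assms(1)]) (use assms(2) in blast)

lemmas raw_intros = wp_Skip wp_Seq raw_assign[OF space] raw_put[OF space] raw_Cond[OF space]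

text \<open>Besides the client memory, allocation must preserve the registers that the surrounding
  insertion loop still uses.\<close>

definition keep :: "(loc \<Rightarrow> nat) \<Rightarrow> (loc \<Rightarrow> nat) \<Rightarrow> bool" where
  "keep s s' \<longleftrightarrow> same s s' \<and>
     (\<forall>r\<in>{TrieNode, TrieWeight, TrieSlot, TrieKey}. s' (V r) = s (V r))"

lemma wp_alloc:
  assumes l: "links s P \<phi>" and p: "pool s (\<phi> ` P)"
    and \<nu>: "\<nu> \<in> P" "c < 2" "\<mu> = 2 * \<nu> + c" "\<mu> \<notin> P" "\<mu> < 2 ^ (b + 1)"
    and slot: "s (V TrieSlot) = 2 * \<phi> \<nu> + c" and card: "card P < NB"
  shows "wp w B raw t_alloc (\<lambda>u s'. u \<le> 100 \<and> keep s s' \<and> (\<exists>\<psi>. links s' (insert \<mu> P) \<psi>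
    \<and> pool s' (\<psi> ` insert \<mu> P) \<and> s' (V TrieKid) = \<psi> \<mu>)) s"
proof -
  have inj: "inj_on \<phi> P" using l by (simp add: links_def)
  have card': "card (\<phi> ` P) < NB" using card card_image[OF inj] by simp
  have sl: "2 * \<phi> \<nu> + c < B"
  proof -
    have "\<phi> \<nu> < NB" using p \<nu>(1) by (auto simp: pool_def)
    then show ?thesis using NB \<nu>(2) by linarith
  qed
  have fr: "s (V TrieFree) \<le> NB" using pool_card[OF p] p by (simp add: pool_def)
  have BW: "B + 64 \<le> 2 ^ w" using space by linarith
  have 1: "wp w B raw
      (IF Reg TrieFree
       THEN (TrieFree ::= Reg TrieFree \<ominus> Num 1 ;; TrieKid ::= Elem Stack (Reg TrieFree))
       ELSE (TrieKid ::= Reg TrieFresh ;; TrieFresh ::= Reg TrieFresh \<oplus> Num 1))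
     (\<lambda>u t. u \<le> 50 \<and> keep s t \<and> links t P \<phi> \<and> pool t (insert (t (V TrieKid)) (\<phi> ` P))
       \<and> t (V TrieKid) \<notin> \<phi> ` P) s"
  proof (rule raw_Cond[OF space], goal_cases)
    case 1 then show ?case by simp
  next
    case 2
    then obtain f where f: "s (V TrieFree) = Suc f" by (cases "s (V TrieFree)") auto
    have "pool (s(V TrieFree := f)) (insert (s (H Stack f)) (\<phi> ` P))" "s (H Stack f) \<notin> \<phi> ` P"
      using pool_pop[OF p f] by auto
    then show ?case
      using l f fr NB BW small[of 1]
      by (intro raw_intros) (auto simp: keep_def same_upd same_refl links_upd pool_upd)
  next
    case 3
    have "s (V TrieFree) = 0" using 3 by simp
    note pf = pool_fresh[OF p this card']
    then show ?case
      using l NB BW small[of 1]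
      by (intro raw_intros) (auto simp: keep_def same_upd same_refl links_upd pool_upd
         fun_upd_twist[of "V TrieKid" "V TrieFresh"])
  qed
  show ?thesis unfolding t_alloc_def
  proof (rule wp_SeqI[OF 1])
    fix u :: real and t
    assume t: "u \<le> 50 \<and> keep s t \<and> links t P \<phi> \<and> pool t (insert (t (V TrieKid)) (\<phi> ` P))
       \<and> t (V TrieKid) \<notin> \<phi> ` P"
    define i where "i = t (V TrieKid)"
    have i: "2 * i + 1 < B" "i < B" using t NB by (auto simp: pool_def i_def)
    have st: "t (V TrieSlot) = 2 * \<phi> \<nu> + c" using t slot by (auto simp: keep_def)
    let ?t = "t(H Kid (2 * i) := 0, H Kid (2 * i + 1) := 0, H Par i := 2 * \<phi> \<nu> + c,
      H Kid (2 * \<phi> \<nu> + c) := i)"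
    have li: "links ?t (insert \<mu> P) (\<phi>(\<mu> := i))"
      using insert_links[of t P \<phi> \<nu> c i] t \<nu> by (simp add: i_def)
    have im: "\<phi>(\<mu> := i) ` insert \<mu> P = insert i (\<phi> ` P)" using \<nu>(4) by auto
    have po: "pool ?t (insert i (\<phi> ` P))" using t by (simp add: pool_upd i_def)
    have fin: "keep s ?t \<and> (\<exists>\<psi>. links ?t (insert \<mu> P) \<psi>
      \<and> pool ?t (\<psi> ` insert \<mu> P) \<and> ?t (V TrieKid) = \<psi> \<mu>)"
      using t li po im by (intro conjI exI[of _ "\<phi>(\<mu> := i)"]) (auto simp: keep_def same_upd i_def)
    show "wp w B raw
      (put Kid (Num 2 \<otimes> Reg TrieKid) (Num 0) ;;
       put Kid (Num 2 \<otimes> Reg TrieKid \<oplus> Num 1) (Num 0) ;;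
       put Par (Reg TrieKid) (Reg TrieSlot) ;; put Kid (Reg TrieSlot) (Reg TrieKid))
      (\<lambda>u' s'. u + u' \<le> 100 \<and> keep s s' \<and> (\<exists>\<psi>. links s' (insert \<mu> P) \<psi>
        \<and> pool s' (\<psi> ` insert \<mu> P) \<and> s' (V TrieKid) = \<psi> \<mu>)) t"
      using fin i sl st BW small[of 2] small[of 1] small[of 0] t
      by (intro raw_intros) (simp_all add: i_def)
  qed
qed



definition tset :: "(loc \<Rightarrow> nat) \<Rightarrow> nat set \<Rightarrow> bool" where
  "tset s S \<longleftrightarrow> S \<subseteq> {..<2 ^ b} \<and> (\<exists>\<phi>. links s (pref S) \<phi> \<and> pool s (\<phi> ` pref S))"

section \<open>Arithmetic of prefixes\<close>

lemma pref_insert: "pref (insert k S) = pref S \<union> {(2 ^ b + k) div 2 ^ j | j. j \<le> b}"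
  by (auto simp: pref_def)

lemma pref_mono: "S \<subseteq> T \<Longrightarrow> pref S \<subseteq> pref T"
  by (auto simp: pref_def)

lemma prefI: "k \<in> S \<Longrightarrow> j \<le> b \<Longrightarrow> (2 ^ b + k) div 2 ^ j \<in> pref S"
  by (auto simp: pref_def)

lemma root_div: "k < 2 ^ b \<Longrightarrow> (2 ^ b + k) div 2 ^ b = (1::nat)"
  by simp

lemma div_Suc: "(x::nat) div 2 ^ Suc j = x div 2 ^ j div 2"
  by (metis div_mult2_eq mult.commute power_Suc)

lemma top_le_div: "j \<le> b \<Longrightarrow> 2 ^ (b - j) \<le> (2 ^ b + k) div (2::nat) ^ j"
  by (metis div_le_mono le_add1 power_diff zero_neq_numeral)

lemma half_cases: "(y::nat) div 2 = z \<Longrightarrow> y = 2 * z \<or> y = 2 * z + 1"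
  by presburger

text \<open>A name below \<open>2 ^ b\<close> is a proper prefix of some key, and the next longer
  prefix of that key is one of its two children. The root is in \<open>pref {}\<close> as well,
  hence the condition on \<open>S\<close>.\<close>

lemma pref_child:
  assumes "\<nu> \<in> pref S" "\<nu> < 2 ^ b" "\<nu> \<noteq> 1 \<or> S \<noteq> {}" "S \<subseteq> {..<2 ^ b}"
  shows "2 * \<nu> \<in> pref S \<or> 2 * \<nu> + 1 \<in> pref S"
proof -
  obtain k j where k: "\<nu> = (2 ^ b + k) div 2 ^ j" "k \<in> S" "j \<le> b"
  proof (cases "\<nu> = 1")
    case True
    then obtain k where "k \<in> S" using assms by auto
    then show ?thesis using that[of k b] True root_div[of k] assms(4) by auto
  next
    case False
    then show ?thesis using that assms(1) by (auto simp: pref_def)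
  qed
  have "j \<noteq> 0" using k assms(2) by (cases j) auto
  then obtain i where i: "j = Suc i" by (cases j) auto
  have "(2 ^ b + k) div 2 ^ i \<in> pref S" using k i by (intro prefI) auto
  moreover have "(2 ^ b + k) div 2 ^ i = 2 * \<nu> \<or> (2 ^ b + k) div 2 ^ i = 2 * \<nu> + 1"
  proof -
    have "(2 ^ b + k) div 2 ^ i div 2 = \<nu>" using k(1) div_Suc[of "2 ^ b + k" i] i by simp
    then show ?thesis by (rule half_cases)
  qed
  ultimately show ?thesis by auto
qed

lemma pref_leaf:
  assumes "\<nu> \<in> pref S" "2 ^ b \<le> \<nu>" "S \<subseteq> {..<2 ^ b}"
  shows "\<exists>k\<in>S. \<nu> = 2 ^ b + k"
proof -
  have "2 ^ 1 \<le> (2::nat) ^ b" using b_pos by (intro power_increasing) auto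
  then have "\<nu> \<noteq> 1" using assms(2) by auto
  then obtain k j where k: "\<nu> = (2 ^ b + k) div 2 ^ j" "k \<in> S" "j \<le> b"
    using assms(1) by (auto simp: pref_def)
  have "j = 0"
  proof (rule ccontr)
    assume "j \<noteq> 0"
    then have "2 ^ 1 \<le> (2::nat) ^ j" by (intro power_increasing) auto
    then have "\<nu> \<le> (2 ^ b + k) div 2 ^ 1" using k(1) by (simp add: div_le_mono2)
    moreover have "k < 2 ^ b" using assms(3) k(2) by auto
    ultimately show False using assms(2) by simp
  qed
  then show ?thesis using k by auto
qed

text \<open>The prefix for \<open>j = b\<close> is the root for every key, so a key contributes at
  most \<open>b\<close> further names.\<close>

lemma card_pref:
  assumes "finite S" "S \<subseteq> {..<2 ^ b}"
  shows "finite (pref S)" "card (pref S) \<le> 1 + b * card S"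
proof -
  let ?T = "(\<lambda>(k, j). (2 ^ b + k) div 2 ^ j) ` (S \<times> {..<b})"
  have "pref S \<subseteq> insert 1 ?T"
  proof
    fix \<nu> assume "\<nu> \<in> pref S"
    then consider "\<nu> = 1" | k j where "\<nu> = (2 ^ b + k) div 2 ^ j" "k \<in> S" "j \<le> b"
      by (auto simp: pref_def)
    then show "\<nu> \<in> insert 1 ?T"
    proof cases
      case 2
      then show ?thesis using root_div[of k] assms(2) by (cases "j = b") (auto intro!: rev_image_eqI[of "(k, j)"])
    qed auto
  qed
  moreover have "card (insert 1 ?T) \<le> 1 + b * card S"
  proof -
    have "card ?T \<le> b * card S"
      using card_image_le[of "S \<times> {..<b}" "\<lambda>(k, j). (2 ^ b + k) div 2 ^ j"] assms(1)
      by (simp add: mult.commute)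
    then show ?thesis using card_insert_le_m1 assms(1) by (simp add: card_insert_if)
  qed
  moreover have "finite (insert 1 ?T)" using assms(1) by simp
  ultimately show "finite (pref S)" "card (pref S) \<le> 1 + b * card S"
    by (meson finite_subset, meson card_mono le_trans)
qed

lemma pref_below: "S \<subseteq> {..<2 ^ b} \<Longrightarrow> pref S \<subseteq> {1..<2 ^ (b + 1)}"
proof
  fix \<nu> assume S: "S \<subseteq> {..<2 ^ b}" and "\<nu> \<in> pref S"
  then consider "\<nu> = 1" | k j where "\<nu> = (2 ^ b + k) div 2 ^ j" "k \<in> S" "j \<le> b"
    by (auto simp: pref_def)
  then show "\<nu> \<in> {1..<2 ^ (b + 1)}"
  proof cases
    case 2
    have "1 \<le> (2::nat) ^ (b - j)" by simp
    then have "1 \<le> \<nu>" using top_le_div[of j k] 2 by linarith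
    moreover have "\<nu> \<le> 2 ^ b + k" using 2 by simp
    moreover have "k < 2 ^ b" using S 2 by auto
    ultimately show ?thesis by auto
  next
    case 1
    moreover have "(1::nat) < 2 ^ (b + 1)" by (rule one_less_power) auto
    ultimately show ?thesis by simp
  qed
qed

lemma wp_slot:
  assumes l: "links s P \<phi>" and p: "pool s (\<phi> ` P)"
    and \<nu>: "x div 2 ^ Suc j \<in> P" "s (V TrieNode) = \<phi> (x div 2 ^ Suc j)"
    and s: "s (V TrieWeight) = 2 ^ j" "s (V TrieKey) = x"
    and \<mu>: "\<mu> = x div 2 ^ j"
    and Q: "Q 23 (s(V TrieSlot := 2 * \<phi> (\<mu> div 2) + \<mu> mod 2, V TrieKid := if \<mu> \<in> P then \<phi> \<mu> else 0))"
  shows "wp w B raw t_slot Q s"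
proof -
  have \<nu>': "x div 2 ^ Suc j = \<mu> div 2" using \<mu> div_Suc[of x j] by simp
  have lt: "\<phi> (\<mu> div 2) < NB" using p \<nu>(1) \<nu>' by (auto simp: pool_def)
  then have i: "2 * \<phi> (\<mu> div 2) + \<mu> mod 2 < B" "2 * \<phi> (\<mu> div 2) + \<mu> mod 2 < 2 ^ w"
      "2 * \<phi> (\<mu> div 2) < 2 ^ w"
    using NB space by linarith+
  have "s (H Kid (2 * \<phi> (\<mu> div 2) + \<mu> mod 2)) = (if \<mu> \<in> P then \<phi> \<mu> else 0)"
    using l \<nu>(1) \<nu>' by (auto simp: links_def)
  then show ?thesis unfolding t_slot_def
    using i \<nu>(2) \<nu>' s Q \<mu> small[of 2] by (intro raw_intros) simp_all
qed

lemma wp_begin: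
  assumes "params s" "s (V Key) = k" "k < 2 ^ b"
    and "Q 14 (s(V TrieKey := 2 ^ b + k, V TrieNode := 0, V TrieWeight := 2 ^ b div 2))"
  shows "wp w B raw t_begin Q s"
proof -
  have "(2::nat) ^ (b - 1) = 2 ^ b div 2" using b_pos by (cases b) auto
  then show ?thesis unfolding t_begin_def
    using assms small[of 0] pow_word by (intro raw_intros) (simp_all add: params_def add.commute)
qed

lemma wp_insert:
  assumes ts: "tset s S" "finite S" and par: "params s" and k: "s (V Key) = k" "k < 2 ^ b"
    and cap: "1 + b * card (insert k S) \<le> NB"
  shows "wp w B raw t_insert (\<lambda>u s'. u \<le> 200 * (real b + 1) \<and> same s s' \<and> tset s' (insert k S)) s"
proof -
  define x where "x = 2 ^ b + k"
  have S: "S \<subseteq> {..<2 ^ b}" "insert k S \<subseteq> {..<2 ^ b}" using ts k by (auto simp: tset_def)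
  obtain \<phi>0 where \<phi>0: "links s (pref S) \<phi>0" "pool s (\<phi>0 ` pref S)" using ts by (auto simp: tset_def)
  \<comment> \<open>\<open>j\<close> levels remain below the current node. \<open>P\<close> grows
    from \<open>pref S\<close> to \<open>pref (insert k S)\<close>, and \<open>2 ^ j div 2\<close>
    is the weight of the next bit, which is 0 exactly for \<open>j = 0\<close>.\<close>
  define I where "I = (\<lambda>(P, \<phi>, j) t. same s t \<and> links t P \<phi> \<and> pool t (\<phi> ` P) \<and> pref S \<subseteq> P
    \<and> P \<subseteq> pref (insert k S) \<and> j \<le> b \<and> (\<forall>i. j \<le> i \<and> i \<le> b \<longrightarrow> x div 2 ^ i \<in> P)
    \<and> t (V TrieNode) = \<phi> (x div 2 ^ j) \<and> t (V TrieWeight) = 2 ^ j div 2 \<and> t (V TrieKey) = x)"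
  have cP: "card P \<le> NB" "finite P" if "P \<subseteq> pref (insert k S)" for P
  proof -
    have "finite (insert k S)" using ts(2) by simp
    note c = card_pref[OF this S(2)]
    show "card P \<le> NB" using card_mono[OF c(1) that] c(2) cap by linarith
    show "finite P" using c(1) that finite_subset by auto
  qed
  have loop: "wp w B raw (WHILE Reg TrieWeight DO
      (t_slot ;; (IF Reg TrieKid THEN Skip ELSE t_alloc) ;; t_next))
     (\<lambda>u t. u \<le> 2 + 2 + 180 * real b \<and> same s t \<and> tset t (insert k S)) t0"
    if "I (pref S, \<phi>0, b) t0" for t0
  proof (rule raw_While[where I = I and pot = "\<lambda>(P, \<phi>, j) t. 180 * real j", OF space that],
      goal_cases)
    case (1 g t) then show ?case by simp
  next
    case (2 g t) then show ?case by (auto split: prod.splits)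
  next
    case (3 g t)
    obtain P \<phi> j' where g: "g = (P, \<phi>, j')" by (cases g)
    from 3 g obtain j where j: "j' = Suc j" by (cases j') (auto simp: I_def)
    define \<mu> where "\<mu> = x div 2 ^ j"
    have t: "same s t" "links t P \<phi>" "pool t (\<phi> ` P)" "pref S \<subseteq> P" "P \<subseteq> pref (insert k S)"
        "Suc j \<le> b" "\<And>i. Suc j \<le> i \<Longrightarrow> i \<le> b \<Longrightarrow> x div 2 ^ i \<in> P"
        "t (V TrieNode) = \<phi> (x div 2 ^ Suc j)" "t (V TrieWeight) = 2 ^ j" "t (V TrieKey) = x"
      using 3 by (auto simp: g j I_def)
    have \<nu>: "x div 2 ^ Suc j = \<mu> div 2" "\<mu> div 2 \<in> P"
      using t(7)[of "Suc j"] t(6) div_Suc[of x j] by (auto simp: \<mu>_def)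
    have \<mu>k: "\<mu> \<in> pref (insert k S)" using t(6) by (auto simp: \<mu>_def x_def intro: prefI)
    then have \<mu>b: "\<mu> < 2 ^ (b + 1)" using pref_below[OF S(2)] by auto
    let ?t = "t(V TrieSlot := 2 * \<phi> (\<mu> div 2) + \<mu> mod 2, V TrieKid := if \<mu> \<in> P then \<phi> \<mu> else 0)"
    have mid: "wp w B raw (IF Reg TrieKid THEN Skip ELSE t_alloc)
      (\<lambda>u t'. u \<le> 103 \<and> keep ?t t' \<and> (\<exists>\<psi>. links t' (insert \<mu> P) \<psi> \<and> pool t' (\<psi> ` insert \<mu> P)
        \<and> t' (V TrieKid) = \<psi> \<mu>)) ?t"
    proof (rule raw_Cond[OF space], goal_cases)
      case 1 then show ?case by simp
    next
      case 2
      then have "\<mu> \<in> P" by (simp split: if_splits)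
      then show ?case using t(2,3)
        by (intro wp_Skip) (auto simp: keep_def same_refl links_upd pool_upd insert_absorb intro!: exI[of _ \<phi>])
    next
      case 3
      \<comment> \<open>Slot 0 belongs to the root alone and the next node is not the root, so an
        empty child cell means that it is absent.\<close>
      have "(2::nat) ^ 1 \<le> 2 ^ (b - j)" using t(6) by (intro power_increasing) auto
      then have "\<mu> \<noteq> 1" using \<mu>_def top_le_div[of j k] t(6) x_def by auto
      then have \<mu>P: "\<mu> \<notin> P" using 3 kid_nonzero[OF t(2), of \<mu>] by auto
      then have "insert \<mu> P \<subseteq> pref (insert k S)" using t(5) \<mu>k by auto
      from cP(1)[OF this] have "card P < NB" using \<mu>P cP(2)[OF t(5)] by simp
      then show ?case using t(2,3) \<nu>(2) \<mu>P \<mu>b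
        by (intro wp_conseq[OF wp_alloc[of ?t P \<phi> "\<mu> div 2" "\<mu> mod 2" \<mu>]])
          (auto simp: links_upd pool_upd)
    qed
    have "wp w B raw (t_slot ;; (IF Reg TrieKid THEN Skip ELSE t_alloc) ;; t_next)
       (\<lambda>u t'. u \<le> 170 \<and> (\<exists>h. I h t' \<and> (\<exists>P \<phi>. h = (P, \<phi>, j)))) t"
    proof (intro wp_Seq wp_slot[OF t(2,3) t(7)[OF order_refl t(6)] t(8-10) \<mu>_def] wp_conseq[OF mid])
      fix u :: real and t' assume a: "u \<le> 103 \<and> keep ?t t' \<and> (\<exists>\<psi>. links t' (insert \<mu> P) \<psi>
        \<and> pool t' (\<psi> ` insert \<mu> P) \<and> t' (V TrieKid) = \<psi> \<mu>)"
      then obtain \<psi> where \<psi>: "links t' (insert \<mu> P) \<psi>" "pool t' (\<psi> ` insert \<mu> P)" "t' (V TrieKid) = \<psi> \<mu>"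
        by blast
      have a': "same t t'" "t' (V TrieWeight) = 2 ^ j" "t' (V TrieKey) = x"
        using a t by (auto simp: keep_def same_def)
      let ?t' = "t'(V TrieNode := \<psi> \<mu>, V TrieWeight := 2 ^ j div 2)"
      have "x div 2 ^ i \<in> insert \<mu> P" if "j \<le> i" "i \<le> b" for i
        using that t(7)[of i] by (cases "i = j") (auto simp: \<mu>_def)
      then have "I (insert \<mu> P, \<psi>, j) ?t'"
        using \<psi> a' t(1,4-7) \<mu>k by (auto simp: I_def links_upd pool_upd same_def \<mu>_def)
      then have "wp w B raw t_next
        (\<lambda>u'. \<lambda>y. 23 + (u + u') \<le> 170 \<and> (\<exists>h. I h y \<and> (\<exists>P \<phi>. h = (P, \<phi>, j)))) t'"
        unfolding t_next_def using a a' \<psi>(3) small[of 2] by (intro raw_intros) auto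
      then show "\<exists>u'\<ge>u. wp w B raw t_next
        (\<lambda>u''. \<lambda>y. 23 + (u' + u'') \<le> 170 \<and> (\<exists>h. I h y \<and> (\<exists>P \<phi>. h = (P, \<phi>, j)))) t'" by blast
    qed
    then show ?case
    proof (rule wp_conseq, goal_cases)
      case (1 u y)
      then obtain P' \<phi>' where "I (P', \<phi>', j) y" "u \<le> 170" by blast
      then show ?case by (intro exI[of _ u] conjI order_refl exI[of _ "(P', \<phi>', j)"]) (auto simp: g j)
    qed
  next
    case (4 h t)
    obtain P \<phi> j where h: "h = (P, \<phi>, j)" by (cases h)
    have "2 ^ j div 2 = (0::nat)" using 4 by (simp add: I_def h)
    then have j: "j = 0" by (cases j) auto
    have "{(2 ^ b + k) div 2 ^ j | j. j \<le> b} \<subseteq> P" using 4 by (auto simp: I_def h j x_def)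
    then have "P = pref (insert k S)" using 4 by (auto simp: I_def h pref_insert)
    then show ?case using 4 S by (auto simp: I_def h tset_def)
  qed
  show ?thesis unfolding t_insert_def
  proof (intro wp_Seq wp_begin[OF par k] wp_conseq[OF loop])
    show "I (pref S, \<phi>0, b) (s(V TrieKey := 2 ^ b + k, V TrieNode := 0, V TrieWeight := 2 ^ b div 2))"
      using \<phi>0 root_div[OF k(2)] pref_mono[of S "insert k S"]
      by (auto simp: I_def same_upd same_refl links_upd pool_upd x_def links_def)
  qed auto
qed


lemma pref_div: "\<nu> \<in> pref S \<Longrightarrow> S \<subseteq> {..<2 ^ b} \<Longrightarrow> \<nu> div 2 ^ m \<noteq> 0 \<Longrightarrow> \<nu> div 2 ^ m \<in> pref S"
proof -
  assume S: "S \<subseteq> {..<2 ^ b}" and nz: "\<nu> div 2 ^ m \<noteq> 0" and "\<nu> \<in> pref S"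
  then consider "\<nu> = 1" | k j where "\<nu> = (2 ^ b + k) div 2 ^ j" "k \<in> S" "j \<le> b"
    by (auto simp: pref_def)
  then show ?thesis
  proof cases
    case 1
    have "1 div 2 ^ m \<noteq> (0::nat)" using nz 1 by simp
    then have "(2::nat) ^ m \<le> 1" by (metis div_eq_0_iff not_le)
    moreover have "(2::nat) ^ 1 \<le> 2 ^ m" if "m \<noteq> 0" using that by (intro power_increasing) auto
    ultimately have "m = 0" by auto
    then show ?thesis using 1 by (auto simp: pref_def)
  next
    case 2
    have e: "\<nu> div 2 ^ m = (2 ^ b + k) div 2 ^ (j + m)" using 2 by (simp add: div_mult2_eq power_add)
    show ?thesis
    proof (cases "j + m \<le> b")
      case True
      then show ?thesis using e 2 prefI[of k S "j + m"] by simp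
    next
      case False
      have "k < 2 ^ b" using S 2 by auto
      then have "2 ^ b + k < 2 ^ (b + 1)" by simp
      also have "(2::nat) ^ (b + 1) \<le> 2 ^ (j + m)" using False by (intro power_increasing) auto
      finally show ?thesis using e nz by simp
    qed
  qed
qed

lemma kids:
  assumes "links s P \<phi>" "\<nu> \<in> P"
  shows "s (H Kid (2 * \<phi> \<nu>)) = (if 2 * \<nu> \<in> P then \<phi> (2 * \<nu>) else 0)"
    "s (H Kid (Suc (2 * \<phi> \<nu>))) = (if 2 * \<nu> + 1 \<in> P then \<phi> (2 * \<nu> + 1) else 0)"
    "s (H Kid (2 * \<phi> \<nu>)) = 0 \<longleftrightarrow> 2 * \<nu> \<notin> P"
    "s (H Kid (Suc (2 * \<phi> \<nu>))) = 0 \<longleftrightarrow> 2 * \<nu> + 1 \<notin> P"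
proof -
  have "\<forall>c<2. s (H Kid (2 * \<phi> \<nu> + c)) = (if 2 * \<nu> + c \<in> P then \<phi> (2 * \<nu> + c) else 0)"
    using assms by (auto simp: links_def)
  from this[rule_format, of 0] this[rule_format, of 1]
  show 1: "s (H Kid (2 * \<phi> \<nu>)) = (if 2 * \<nu> \<in> P then \<phi> (2 * \<nu>) else 0)"
    "s (H Kid (Suc (2 * \<phi> \<nu>))) = (if 2 * \<nu> + 1 \<in> P then \<phi> (2 * \<nu> + 1) else 0)" by auto
  have "1 \<le> \<nu>" using assms by (auto simp: links_def)
  then show "s (H Kid (2 * \<phi> \<nu>)) = 0 \<longleftrightarrow> 2 * \<nu> \<notin> P"
    "s (H Kid (Suc (2 * \<phi> \<nu>))) = 0 \<longleftrightarrow> 2 * \<nu> + 1 \<notin> P"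
    using 1 kid_nonzero[OF assms(1)] by auto
qed

lemma node_bound:
  assumes "pool s (\<phi> ` P)" "\<nu> \<in> P"
  shows "\<phi> \<nu> < NB" "2 * \<phi> \<nu> + 1 < B" "2 * \<phi> \<nu> + 1 < 2 ^ w"
proof -
  show "\<phi> \<nu> < NB" using assms by (auto simp: pool_def)
  then show "2 * \<phi> \<nu> + 1 < B" "2 * \<phi> \<nu> + 1 < 2 ^ w" using NB space by linarith+
qed

lemma wp_descend:
  assumes ts: "links s (pref S) \<phi>" "pool s (\<phi> ` pref S)" and k: "k \<in> S" "k < 2 ^ b"
    and s: "s (V TrieNode) = 0" "s (V TrieWeight) = 2 ^ b div 2" "s (V TrieKey) = 2 ^ b + k"
  shows "wp w B raw (WHILE Reg TrieWeight DO (t_slot ;; t_next))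
    (\<lambda>u t. u \<le> 3 + 100 * real b \<and> same s t \<and> links t (pref S) \<phi> \<and> pool t (\<phi> ` pref S)
      \<and> t (V TrieNode) = \<phi> (2 ^ b + k)) s"
proof -
  define x where "x = 2 ^ b + k"
  define I where "I = (\<lambda>j t. same s t \<and> links t (pref S) \<phi> \<and> pool t (\<phi> ` pref S) \<and> j \<le> b
    \<and> t (V TrieNode) = \<phi> (x div 2 ^ j) \<and> t (V TrieWeight) = 2 ^ j div 2 \<and> t (V TrieKey) = x)"
  have "\<phi> 1 = 0" using ts(1) by (simp add: links_def)
  then have I: "I b s" using ts s root_div[OF k(2)] by (auto simp: I_def same_refl x_def)
  show ?thesis
  proof (rule raw_While[where I = I and pot = "\<lambda>j t. 100 * real j", OF space I], goal_cases)
    case (1 g t) then show ?case by simp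
  next
    case (2 g t) then show ?case by simp
  next
    case (3 j' t)
    then obtain j where j: "j' = Suc j" by (cases j') (auto simp: I_def)
    have t: "same s t" "links t (pref S) \<phi>" "pool t (\<phi> ` pref S)" "Suc j \<le> b"
        "t (V TrieNode) = \<phi> (x div 2 ^ Suc j)" "t (V TrieWeight) = 2 ^ j" "t (V TrieKey) = x"
      using 3 by (auto simp: j I_def)
    have m: "x div 2 ^ Suc j \<in> pref S" "x div 2 ^ j \<in> pref S"
      using t(4) k(1) by (auto simp: x_def intro!: prefI simp del: power_Suc)
    let ?t = "t(V TrieSlot := 2 * \<phi> (x div 2 ^ j div 2) + x div 2 ^ j mod 2, V TrieKid := \<phi> (x div 2 ^ j),
      V TrieNode := \<phi> (x div 2 ^ j), V TrieWeight := 2 ^ j div 2)"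
    have "I j ?t" using t by (auto simp: I_def links_upd pool_upd same_upd)
    then show ?case unfolding t_next_def using m t(6) small[of 2]
      by (intro wp_Seq wp_slot[OF t(2,3) m(1) t(5-7) refl] raw_intros) (auto simp: j intro!: exI[of _ j])
  next
    case (4 j t)
    have "2 ^ j div 2 = (0::nat)" using 4 by (simp add: I_def)
    then have "j = 0" by (cases j) auto
    then show ?case using 4 by (auto simp: I_def x_def)
  qed
qed

lemma wp_unlink:
  assumes ts: "links s P \<phi>" "pool s (\<phi> ` P)" and \<mu>: "\<mu> \<in> P" "\<mu> \<noteq> 1" "2 * \<mu> \<notin> P" "2 * \<mu> + 1 \<notin> P"
    and s: "s (V TrieNode) = \<phi> \<mu>"
  shows "wp w B raw (TrieSlot ::= Elem Par (Reg TrieNode) ;;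
        put Kid (Reg TrieSlot) (Num 0) ;;
        put Stack (Reg TrieFree) (Reg TrieNode) ;;
        TrieFree ::= Reg TrieFree \<oplus> Num 1 ;;
        TrieNode ::= Reg TrieSlot \<oslash> Num 2)
      (\<lambda>u t. u \<le> 60 \<and> same s t \<and> links t (P - {\<mu>}) \<phi> \<and> pool t (\<phi> ` (P - {\<mu>}))
        \<and> t (V TrieNode) = \<phi> (\<mu> div 2)) s"
proof -
  define f where "f = s (V TrieFree)"
  define z where "z = 2 * \<phi> (\<mu> div 2) + \<mu> mod 2"
  have par: "s (H Par (\<phi> \<mu>)) = z" "\<mu> div 2 \<in> P" using ts(1) \<mu> by (auto simp: links_def z_def)
  have z: "z < B" "z div 2 = \<phi> (\<mu> div 2)" using node_bound[OF ts(2) par(2)] by (auto simp: z_def)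
  have \<mu>B: "\<phi> \<mu> < NB" using node_bound[OF ts(2) \<mu>(1)] by simp
  have fr: "f < NB"
  proof -
    have "card (\<phi> ` P) \<noteq> 0" using links_finite[OF ts(1)] \<mu>(1) by auto
    then show ?thesis using pool_card[OF ts(2)] ts(2) by (simp add: pool_def f_def)
  qed
  let ?t = "s(V TrieSlot := z, H Kid z := 0, H Stack f := \<phi> \<mu>, V TrieFree := f + 1, V TrieNode := \<phi> (\<mu> div 2))"
  have "links ?t (P - {\<mu>}) \<phi>"
    using delete_links[of "s(V TrieSlot := z)" P \<phi> \<mu>] ts(1) \<mu> by (simp add: links_upd z_def)
  moreover have "pool ?t (\<phi> ` P - {\<phi> \<mu>})"
    using pool_push[of "s(V TrieSlot := z, H Kid z := 0)" "\<phi> ` P" "\<phi> \<mu>" f] ts(2) \<mu>(1)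
    by (simp add: pool_upd f_def)
  moreover have "\<phi> ` P - {\<phi> \<mu>} = \<phi> ` (P - {\<mu>})"
    using ts(1) \<mu>(1) by (subst inj_on_image_set_diff[of \<phi> P]) (auto simp: links_def)
  moreover have "same s ?t" by (simp add: same_upd same_refl)
  ultimately show ?thesis
    using z \<mu>B fr NB space par(1) s small[of 0] small[of 1] small[of 2]
    by (intro raw_intros) (simp_all flip: f_def)
qed

lemma wp_delete:
  assumes ts: "tset s S" and par: "params s" and k: "s (V Key) = k" "k \<in> S"
  shows "wp w B raw t_delete (\<lambda>u s'. u \<le> 250 * (real b + 1) \<and> same s s' \<and> tset s' (S - {k})) s"
proof -
  define x where "x = 2 ^ b + k"
  have S: "S \<subseteq> {..<2 ^ b}" "S - {k} \<subseteq> {..<2 ^ b}" "k < 2 ^ b" using ts k by (auto simp: tset_def)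
  obtain \<phi> where \<phi>: "links s (pref S) \<phi>" "pool s (\<phi> ` pref S)" using ts by (auto simp: tset_def)
  define I where "I = (\<lambda>(P, j) t. same s t \<and> links t P \<phi> \<and> pool t (\<phi> ` P) \<and> pref (S - {k}) \<subseteq> P
    \<and> P \<subseteq> pref (S - {k}) \<union> {x div 2 ^ i | i. j \<le> i \<and> i \<le> b} \<and> j \<le> b \<and> x div 2 ^ j \<in> P
    \<and> t (V TrieNode) = \<phi> (x div 2 ^ j))"
  have loop: "wp w B raw (WHILE (Elem Kid (Num 2 \<otimes> Reg TrieNode) \<oplus> Elem Kid (Num 2 \<otimes> Reg TrieNode \<oplus> Num 1)
         \<doteq> Num 0) \<otimes> (Num 0 \<lhd> Reg TrieNode) DO
       (TrieSlot ::= Elem Par (Reg TrieNode) ;;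
        put Kid (Reg TrieSlot) (Num 0) ;;
        put Stack (Reg TrieFree) (Reg TrieNode) ;;
        TrieFree ::= Reg TrieFree \<oplus> Num 1 ;;
        TrieNode ::= Reg TrieSlot \<oslash> Num 2))
     (\<lambda>u t. u \<le> 50 + 100 * real b \<and> same s t \<and> tset t (S - {k})) t0"
    if "I (pref S, 0) t0" for t0
  proof (rule raw_While[where I = I and pot = "\<lambda>(P, j) t. 100 * real (b - j)", OF space that],
      goal_cases)
    case (1 g t)
    obtain P j where g: "g = (P, j)" by (cases g)
    from 1 have t: "links t P \<phi>" "pool t (\<phi> ` P)" "x div 2 ^ j \<in> P" "t (V TrieNode) = \<phi> (x div 2 ^ j)"
      by (auto simp: I_def g)
    have "t (H Kid (2 * \<phi> (x div 2 ^ j))) < NB" "t (H Kid (Suc (2 * \<phi> (x div 2 ^ j)))) < NB"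
      using kids(1,2)[OF t(1,3)] node_bound(1)[OF t(2)] NB by auto
    then show ?case using node_bound[OF t(2,3)] t(4) NB space small[of 0] small[of 1] small[of 2] by simp
  next
    case (2 g t) then show ?case by (auto split: prod.splits)
  next
    case (3 g t)
    obtain P j where g: "g = (P, j)" by (cases g)
    define \<mu> where "\<mu> = x div 2 ^ j"
    from 3 have t: "same s t" "links t P \<phi>" "pool t (\<phi> ` P)" "pref (S - {k}) \<subseteq> P"
        "P \<subseteq> pref (S - {k}) \<union> {x div 2 ^ i | i. j \<le> i \<and> i \<le> b}" "j \<le> b" "\<mu> \<in> P"
        "t (V TrieNode) = \<phi> \<mu>"
      by (auto simp: I_def g \<mu>_def)
    have nk: "2 * \<mu> \<notin> P" "2 * \<mu> + 1 \<notin> P" "\<mu> \<noteq> 1"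
      using 3(2) kids(3,4)[OF t(2,7)] kid_nonzero[OF t(2,7)] t(8) by (auto split: if_splits)
    have jb: "j < b"
    proof -
      have "j \<noteq> b" using nk(3) root_div[OF S(3)] by (auto simp: \<mu>_def x_def)
      then show ?thesis using t(6) by simp
    qed
    \<comment> \<open>A childless node still in use would be the leaf of another key; but the only
      name of leaf length on the path is \<open>x\<close> itself.\<close>
    have "\<mu> \<notin> pref (S - {k})"
    proof
      assume a: "\<mu> \<in> pref (S - {k})"
      then have "2 ^ b \<le> \<mu>" using pref_child[OF a _ _ S(2)] nk t(4) by (cases "\<mu> < 2 ^ b") auto
      from pref_leaf[OF a this S(2)] obtain k' where k': "k' \<in> S - {k}" "\<mu> = 2 ^ b + k'" by auto
      have "x = \<mu>"
      proof (cases "j = 0")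
        case False
        then have "2 ^ 1 \<le> (2::nat) ^ j" by (intro power_increasing) auto
        then have "\<mu> \<le> x div 2 ^ 1" by (simp add: \<mu>_def div_le_mono2)
        then show ?thesis using \<open>2 ^ b \<le> \<mu>\<close> S(3) by (simp add: x_def)
      qed (simp add: \<mu>_def)
      then show False using k' by (simp add: x_def)
    qed
    then have 1: "pref (S - {k}) \<subseteq> P - {\<mu>}" using t(4) by auto
    have 2: "P - {\<mu>} \<subseteq> pref (S - {k}) \<union> {x div 2 ^ i | i. Suc j \<le> i \<and> i \<le> b}"
    proof
      fix \<nu> assume \<nu>: "\<nu> \<in> P - {\<mu>}"
      show "\<nu> \<in> pref (S - {k}) \<union> {x div 2 ^ i | i. Suc j \<le> i \<and> i \<le> b}"
      proof (cases "\<nu> \<in> pref (S - {k})")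
        case False
        then obtain i where "\<nu> = x div 2 ^ i" "j \<le> i" "i \<le> b" using \<nu> t(5) by auto
        moreover from this have "i \<noteq> j" using \<nu> by (auto simp: \<mu>_def)
        ultimately have "\<nu> = x div 2 ^ i \<and> Suc j \<le> i \<and> i \<le> b" by auto
        then show ?thesis by blast
      qed simp
    qed
    have 3: "x div 2 ^ Suc j = \<mu> div 2" using div_Suc by (simp add: \<mu>_def)
    have "1 \<le> \<mu>" using t(2,7) by (auto simp: links_def)
    then have "\<mu> div 2 \<noteq> \<mu>" by simp
    then have 4: "\<mu> div 2 \<in> P - {\<mu>}" using t(2,7) nk(3) by (auto simp: links_def)
    show ?case
    proof (rule wp_conseq[OF wp_unlink[OF t(2,3,7) nk(3,1,2) t(8)]], goal_cases)
      case (1 u y)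
      have "I (P - {\<mu>}, Suc j) y"
        unfolding I_def using 1 t(1) \<open>pref (S - {k}) \<subseteq> P - {\<mu>}\<close> 2 3 4 jb by (auto simp: same_def simp del: power_Suc)
      then show ?case using 1 jb
        by (intro exI[of _ u]) (auto simp: g intro!: exI[of _ "P - {\<mu>}"] exI[of _ "Suc j"])
    qed
  next
    case (4 h t)
    obtain P j where h: "h = (P, j)" by (cases h)
    define \<mu> where "\<mu> = x div 2 ^ j"
    from 4 have t: "same s t" "links t P \<phi>" "pool t (\<phi> ` P)" "pref (S - {k}) \<subseteq> P"
        "P \<subseteq> pref (S - {k}) \<union> {x div 2 ^ i | i. j \<le> i \<and> i \<le> b}" "j \<le> b" "\<mu> \<in> P"
        "t (V TrieNode) = \<phi> \<mu>"
      by (auto simp: I_def h \<mu>_def)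
    have "\<mu> = 1 \<or> (\<exists>c<2. 2 * \<mu> + c \<in> P)"
    proof (rule ccontr)
      assume a: "\<not> (\<mu> = 1 \<or> (\<exists>c<2. 2 * \<mu> + c \<in> P))"
      have "2 * \<mu> + 0 \<notin> P" "2 * \<mu> + 1 \<notin> P" "\<mu> \<noteq> 1"
        using a by (metis pos2, metis one_less_numeral_iff semiring_norm(76), metis)
      then show False using 4(2) kids(3,4)[OF t(2,7)] kid_nonzero[OF t(2,7)] t(8) by simp
    qed
    \<comment> \<open>A remaining child has a larger name than every path node from level
      \<open>j\<close> upwards, so it belongs to another key, and so do all its ancestors.\<close>
    then have "\<mu> \<in> pref (S - {k})"
    proof
      assume "\<exists>c<2. 2 * \<mu> + c \<in> P"
      then obtain c where c: "c < 2" "2 * \<mu> + c \<in> P" by blast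
      have m1: "1 \<le> \<mu>" using t(2,7) by (auto simp: links_def)
      have "2 * \<mu> + c \<noteq> x div 2 ^ i" if "j \<le> i" for i
      proof -
        have "(2::nat) ^ j \<le> 2 ^ i" using that by (intro power_increasing) auto
        then have "x div 2 ^ i \<le> \<mu>" by (simp add: \<mu>_def div_le_mono2)
        then show ?thesis using m1 by linarith
      qed
      then have "2 * \<mu> + c \<in> pref (S - {k})" using t(5) c(2) by auto
      from pref_div[OF this S(2), of 1] show ?thesis using c(1) m1 by simp
    qed (simp add: pref_def)
    have "x div 2 ^ i \<in> pref (S - {k})" if "j \<le> i" "i \<le> b" for i
    proof -
      have e: "x div 2 ^ i = \<mu> div 2 ^ (i - j)"
        using that(1) by (simp add: \<mu>_def flip: div_mult2_eq power_add)
      have "(1::nat) \<le> 2 ^ (b - i)" by simp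
      then have "x div 2 ^ i \<noteq> 0" using top_le_div[OF that(2), of k] unfolding x_def by linarith
      then show ?thesis using e pref_div[OF \<open>\<mu> \<in> pref (S - {k})\<close> S(2)] by simp
    qed
    then have "P = pref (S - {k})" using t(4,5) by auto
    then show ?case using t S(2) by (auto simp: tset_def h)
  qed
  have x0: "x \<in> pref S" using prefI[OF k(2), of 0] by (simp add: x_def)
  let ?s = "s(V TrieKey := 2 ^ b + k, V TrieNode := 0, V TrieWeight := 2 ^ b div 2)"
  have d: "wp w B raw (WHILE Reg TrieWeight DO (t_slot ;; t_next))
    (\<lambda>u t. u \<le> 3 + 100 * real b \<and> same ?s t \<and> links t (pref S) \<phi> \<and> pool t (\<phi> ` pref S)
      \<and> t (V TrieNode) = \<phi> (2 ^ b + k)) ?s"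
    by (rule wp_descend[OF _ _ k(2) S(3)]) (use \<phi> in \<open>auto simp: links_upd pool_upd\<close>)
  show ?thesis unfolding t_delete_def
  proof (intro wp_Seq wp_begin[OF par k(1) S(3)] wp_conseq[OF d])
    fix u :: real and t
    assume a: "u \<le> 3 + 100 * real b \<and> same ?s t \<and> links t (pref S) \<phi> \<and> pool t (\<phi> ` pref S)
      \<and> t (V TrieNode) = \<phi> (2 ^ b + k)"
    have "pref S \<subseteq> pref (S - {k}) \<union> {x div 2 ^ i |i. 0 \<le> i \<and> i \<le> b}"
      using pref_insert[of k "S - {k}"] k(2) by (auto simp: insert_absorb x_def)
    then have "I (pref S, 0) t"
      using a x0 pref_mono[of "S - {k}" S] by (auto simp: I_def same_def x_def)
    note loop' = loop[OF this]
    show "\<exists>u'\<ge>u. wp w B raw (WHILE (Elem Kid (Num 2 \<otimes> Reg TrieNode) \<oplus> Elem Kid (Num 2 \<otimes> Reg TrieNode \<oplus> Num 1)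
         \<doteq> Num 0) \<otimes> (Num 0 \<lhd> Reg TrieNode) DO
       (TrieSlot ::= Elem Par (Reg TrieNode) ;;
        put Kid (Reg TrieSlot) (Num 0) ;;
        put Stack (Reg TrieFree) (Reg TrieNode) ;;
        TrieFree ::= Reg TrieFree \<oplus> Num 1 ;;
        TrieNode ::= Reg TrieSlot \<oslash> Num 2))
        (\<lambda>u'' s'. 14 + (u' + u'') \<le> 250 * (real b + 1) \<and> same s s' \<and> tset s' (S - {k})) t"
    proof (intro exI[of _ u] conjI order_refl, rule wp_conseq[OF loop'], goal_cases)
      case (1 u' y)
      then show ?case using a by (intro exI[of _ u']) auto
    qed
  qed
qed

text \<open>The leading 1 stays in the result, which leaves 0 free to say that there is no smaller
  key.\<close>

definition below :: "nat set \<Rightarrow> nat \<Rightarrow> nat" where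
  "below S k = (if \<exists>x\<in>S. x < k then 2 ^ b + Max {x \<in> S. x < k} else 0)"

lemma wp_pred1:
  assumes ts: "links s (pref S) \<phi>" "pool s (\<phi> ` pref S)" and S: "S \<subseteq> {..<2 ^ b}" and k: "k < 2 ^ b"
    and s: "s (V TrieNode) = 0" "s (V TrieWeight) = 2 ^ b div 2" "s (V TrieKey) = 2 ^ b + k" "s (V TrieCode) = 0"
  shows "wp w B raw
    (WHILE Reg TrieWeight DO
       (t_slot ;;
        (IF Reg TrieSlot \<odot> Num 2
         THEN (IF Elem Kid (Num 2 \<otimes> Reg TrieNode)
               THEN (TrieCand ::= Elem Kid (Num 2 \<otimes> Reg TrieNode) ;;
                     TrieCode ::= Reg TrieKey \<oslash> Reg TrieWeight \<ominus> Num 1)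
               ELSE Skip)
         ELSE Skip) ;;
        (IF Reg TrieKid THEN t_next ELSE (TrieWeight ::= Num 0))))
    (\<lambda>u t. u \<le> 3 + 150 * real b \<and> same s t \<and> links t (pref S) \<phi> \<and> pool t (\<phi> ` pref S)
      \<and> (\<exists>\<kappa> h. t (V TrieCode) = \<kappa> \<and> (\<kappa> \<noteq> 0 \<longrightarrow> \<kappa> \<in> pref S \<and> t (V TrieCand) = \<phi> \<kappa> \<and> h \<le> b
        \<and> (\<kappa> + 1) * 2 ^ h \<le> 2 ^ b + k \<and> 2 ^ b \<le> \<kappa> * 2 ^ h)
        \<and> (\<forall>y\<in>S. y < k \<longrightarrow> \<kappa> \<noteq> 0 \<and> (2 ^ b + y) div 2 ^ h \<le> \<kappa>))) s"
proof -
  define x where "x = 2 ^ b + k"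
  \<comment> \<open>\<open>h\<close> is the height of the candidate. Its leaves run from
    \<open>\<kappa> * 2 ^ h\<close> to just below \<open>(\<kappa> + 1) * 2 ^ h\<close>; they are
    proper leaf names and all smaller than \<open>x\<close>.\<close>
  define J where "J = (\<lambda>\<kappa> h t. t (V TrieCode) = \<kappa> \<and> (\<kappa> \<noteq> 0 \<longrightarrow> \<kappa> \<in> pref S \<and> t (V TrieCand) = \<phi> \<kappa> \<and> h \<le> b
        \<and> (\<kappa> + 1) * 2 ^ h \<le> x \<and> 2 ^ b \<le> \<kappa> * 2 ^ h))"
  \<comment> \<open>A smaller key either still shares the current prefix with \<open>x\<close> or
    does not lie beyond the candidate. \<open>alive\<close> says that the path has not left the
    trie.\<close>
  define L where "L = (\<lambda>alive j \<kappa> h. \<forall>y\<in>S. y < k \<longrightarrow> (alive \<and> (2 ^ b + y) div 2 ^ j = x div 2 ^ j)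
        \<or> (\<kappa> \<noteq> 0 \<and> (2 ^ b + y) div 2 ^ h \<le> \<kappa>))"
  define I where "I = (\<lambda>(alive, j, \<kappa>, h) t. same s t \<and> links t (pref S) \<phi> \<and> pool t (\<phi> ` pref S) \<and> j \<le> b
    \<and> (if alive then x div 2 ^ j \<in> pref S \<and> t (V TrieNode) = \<phi> (x div 2 ^ j) else j = 0)
    \<and> t (V TrieWeight) = 2 ^ j div 2 \<and> t (V TrieKey) = x \<and> J \<kappa> h t \<and> L alive j \<kappa> h)"
  have r: "\<phi> 1 = 0" "1 \<in> pref S" using ts(1) by (auto simp: links_def)
  have "x div 2 ^ b = 1" using root_div[OF k] by (simp add: x_def)
  moreover have "(2 ^ b + y) div 2 ^ b = 1" if "y \<in> S" for y using S that by (intro root_div) auto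
  ultimately have I: "I (True, b, 0, 0) s"
    using ts s r by (auto simp: I_def J_def L_def same_refl x_def)
  show ?thesis
  proof (rule raw_While[where I = I and pot = "\<lambda>(alive, j, \<kappa>, h) t. 150 * real j", OF space I], goal_cases)
    case (1 g t) then show ?case by simp
  next
    case (2 g t) then show ?case by (auto split: prod.splits)
  next
    case (3 g t)
    obtain alive j' \<kappa> h where g: "g = (alive, j', \<kappa>, h)" by (cases g)
    from 3 obtain j where j: "j' = Suc j" by (cases j') (auto simp: I_def g)
    define \<mu> where "\<mu> = x div 2 ^ j"
    define \<nu> where "\<nu> = \<mu> div 2"
    define c where "c = \<mu> mod 2"
    have t: "same s t" "links t (pref S) \<phi>" "pool t (\<phi> ` pref S)" "Suc j \<le> b" alive
        "x div 2 ^ Suc j \<in> pref S" "t (V TrieNode) = \<phi> (x div 2 ^ Suc j)" "t (V TrieWeight) = 2 ^ j"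
        "t (V TrieKey) = x" "J \<kappa> h t" "L True (Suc j) \<kappa> h"
      using 3 by (auto simp: j I_def g split: if_splits)
    have \<nu>: "x div 2 ^ Suc j = \<nu>" "\<mu> = 2 * \<nu> + c" "c < 2" using div_Suc[of x j] by (auto simp: \<mu>_def \<nu>_def c_def)
    have nb: "\<phi> \<nu> < NB" "2 * \<phi> \<nu> + 1 < B" "2 * \<phi> \<nu> + 1 < 2 ^ w" "\<nu> \<in> pref S"
      using node_bound[OF t(3)] t(6) \<nu>(1) by auto
    have kd: "t (H Kid (2 * \<phi> \<nu>)) = (if 2 * \<nu> \<in> pref S then \<phi> (2 * \<nu>) else 0)"
        "t (H Kid (2 * \<phi> \<nu>)) = 0 \<longleftrightarrow> 2 * \<nu> \<notin> pref S"
      using kids(1,3)[OF t(2) nb(4)] by auto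
    have \<mu>1: "\<mu> \<noteq> 1" "\<nu> \<noteq> 0"
    proof -
      have "(2::nat) ^ 1 \<le> 2 ^ (b - j)" using t(4) by (intro power_increasing) auto
      then show "\<mu> \<noteq> 1" using top_le_div[of j k] t(4) by (auto simp: \<mu>_def x_def)
      then show "\<nu> \<noteq> 0" using nb(4) pref_below[OF S] by auto
    qed
    define new where "new \<longleftrightarrow> c = 1 \<and> 2 * \<nu> \<in> pref S"
    define \<kappa>' where "\<kappa>' = (if new then 2 * \<nu> else \<kappa>)"
    define h' where "h' = (if new then j else h)"
    let ?t = "t(V TrieSlot := 2 * \<phi> \<nu> + c, V TrieKid := if \<mu> \<in> pref S then \<phi> \<mu> else 0)"
    define t' where "t' = (if new then ?t(V TrieCand := \<phi> (2 * \<nu>), V TrieCode := 2 * \<nu>) else ?t)"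
    have mid: "wp w B raw (IF Reg TrieSlot \<odot> Num 2
         THEN (IF Elem Kid (Num 2 \<otimes> Reg TrieNode)
               THEN (TrieCand ::= Elem Kid (Num 2 \<otimes> Reg TrieNode) ;;
                     TrieCode ::= Reg TrieKey \<oslash> Reg TrieWeight \<ominus> Num 1)
               ELSE Skip)
         ELSE Skip) (\<lambda>u y. u \<le> 60 \<and> y = t') ?t"
    proof -
      have m: "x div 2 ^ j < 2 ^ w"
      proof -
        have "x div 2 ^ j \<le> x" by simp
        then show ?thesis using pow_word k unfolding x_def by linarith
      qed
      have c01: "c = 0 \<or> c = 1" using \<nu>(3) by auto
      have e: "\<mu> - 1 = 2 * \<nu>" if "c = 1" using \<nu>(2) that by simp
      have cm: "(2 * \<phi> \<nu> + c) mod 2 = c" using \<nu>(3) by simp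
      show ?thesis
        using c01 e kd nb cm m t(7-9) \<nu>(1) \<mu>1 \<nu>(2) space small[of 1] small[of 2]
        by (intro raw_intros) (auto simp: t'_def new_def \<mu>_def[symmetric])
    qed
    have J': "J \<kappa>' h' t'"
    proof (cases new)
      case True
      have "(2 * \<nu> + 1) * 2 ^ j \<le> x" using True \<nu>(2) by (simp add: \<mu>_def new_def flip: \<nu>(2)) (metis div_times_less_eq_dividend mult_Suc)
      moreover have "2 ^ b \<le> 2 * \<nu> * 2 ^ j"
      proof -
        have "(2::nat) ^ b = 2 ^ (b - Suc j) * 2 ^ Suc j"
          using t(4) by (simp flip: power_add del: power_Suc)
        also have "\<dots> \<le> \<nu> * 2 ^ Suc j"
          using top_le_div[OF t(4), of k] \<nu>(1) by (intro mult_right_mono) (auto simp: x_def)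
        finally show ?thesis by (simp add: mult_ac)
      qed
      ultimately show ?thesis using True t(4) by (auto simp: J_def \<kappa>'_def h'_def t'_def new_def)
    next
      case False
      then show ?thesis using t(10) by (auto simp: J_def \<kappa>'_def h'_def t'_def)
    qed
    have L': "L (\<mu> \<in> pref S) j \<kappa>' h'"
      unfolding L_def
    proof (intro ballI impI)
      fix y assume y: "y \<in> S" "y < k"
      define z where "z = (2 ^ b + y) div 2 ^ j"
      have zp: "z \<in> pref S" using y t(4) by (auto simp: z_def intro: prefI)
      have zle: "z \<le> \<mu>" "z div 2 \<le> \<nu>" using y by (auto simp: z_def \<mu>_def x_def \<nu>_def div_le_mono)
      have zS: "(2 ^ b + y) div 2 ^ Suc j = z div 2" unfolding z_def by (rule div_Suc)
      show "(\<mu> \<in> pref S \<and> (2 ^ b + y) div 2 ^ j = x div 2 ^ j) \<or> (\<kappa>' \<noteq> 0 \<and> (2 ^ b + y) div 2 ^ h' \<le> \<kappa>')"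
      proof (cases "z = \<mu>")
        case True
        then show ?thesis using zp by (simp add: z_def \<mu>_def)
      next
        \<comment> \<open>\<open>y\<close> leaves the path at this level, and then lies under the
          left sibling, or it has left before.\<close>
        case ne: False
        show ?thesis
        proof (cases new)
          case True
          then have "z \<le> 2 * \<nu>" using zle(1) ne \<nu>(2) by (simp add: new_def)
          then show ?thesis using True \<mu>1 by (simp add: \<kappa>'_def h'_def z_def)
        next
          case False
          have "z div 2 \<noteq> \<nu>"
          proof
            assume "z div 2 = \<nu>"
            then have "z = 2 * \<nu> \<or> z = 2 * \<nu> + 1" by (rule half_cases)
            then show False using ne zle(1) \<nu>(2,3) zp False by (auto simp: new_def)
          qed
          then show ?thesis using t(11) y False zS \<nu>(1) by (auto simp: L_def \<kappa>'_def h'_def)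
        qed
      qed
    qed
    have same': "same s t'" "links t' (pref S) \<phi>" "pool t' (\<phi> ` pref S)" "t' (V TrieWeight) = 2 ^ j"
        "t' (V TrieKey) = x" "t' (V TrieKid) = (if \<mu> \<in> pref S then \<phi> \<mu> else 0)"
      using t by (auto simp: t'_def same_upd links_upd pool_upd)
    have tail: "wp w B raw (IF Reg TrieKid THEN t_next ELSE (TrieWeight ::= Num 0))
       (\<lambda>u y. u \<le> 60 \<and> I (\<mu> \<in> pref S, if \<mu> \<in> pref S then j else 0, \<kappa>', h') y) t'"
    proof (rule raw_Cond[OF space], goal_cases)
      case 1 show ?case by simp
    next
      case 2
      then have \<mu>: "\<mu> \<in> pref S" using same'(6) by (auto split: if_splits)
      let ?y = "t'(V TrieNode := \<phi> \<mu>, V TrieWeight := 2 ^ j div 2)"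
      have "J \<kappa>' h' ?y" using J' by (simp add: J_def)
      then have "I (True, j, \<kappa>', h') ?y"
        using \<mu> same' L' t(4) by (simp add: I_def same_upd links_upd pool_upd \<mu>_def)
      then show ?case unfolding t_next_def using \<mu> same' small[of 2] by (intro raw_intros) simp_all
    next
      case 3
      then have \<mu>: "\<mu> \<notin> pref S"
        using same'(6) kid_nonzero[OF t(2), of \<mu>] \<mu>1 by (auto split: if_splits)
      let ?y = "t'(V TrieWeight := 0)"
      have "J \<kappa>' h' ?y" using J' by (simp add: J_def)
      moreover have "L False 0 \<kappa>' h'" using L' \<mu> by (simp add: L_def)
      ultimately have "I (False, 0, \<kappa>', h') ?y"
        using \<mu> same' t(4) by (simp add: I_def same_upd links_upd pool_upd)
      then show ?case using \<mu> same' small[of 0] by (intro raw_intros) simp_all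
    qed
    have \<nu>\<mu>: "\<mu> div 2 = \<nu>" "\<mu> mod 2 = c" by (auto simp: \<nu>_def c_def)
    show ?case
    proof (intro wp_Seq wp_slot[OF t(2,3) t(6-9) \<mu>_def], unfold \<nu>\<mu>, rule wp_conseq[OF mid], goal_cases)
      case (1 u y)
      have y: "y = t'" and u: "u \<le> 60" using 1 by auto
      show ?case unfolding y
      proof (rule exI[of _ u], rule conjI[OF order_refl], rule wp_conseq[OF tail], goal_cases)
        case (1 u' y')
        have "(if \<mu> \<in> pref S then j else 0) \<le> j" by simp
        then show ?case using 1 u
          by (intro exI[of _ u'] conjI order_refl exI[of _ "(\<mu> \<in> pref S, if \<mu> \<in> pref S then j else 0, \<kappa>', h')"])
            (auto simp: g j)
      qed
    qed
  next
    case (4 h' t)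
    obtain alive j \<kappa> h where h: "h' = (alive, j, \<kappa>, h)" by (cases h')
    have "2 ^ j div 2 = (0::nat)" using 4 by (simp add: I_def h)
    then have j: "j = 0" by (cases j) auto
    then have "\<forall>y\<in>S. y < k \<longrightarrow> \<kappa> \<noteq> 0 \<and> (2 ^ b + y) div 2 ^ h \<le> \<kappa>"
      using 4 by (auto simp: I_def h L_def x_def)
    then show ?case using 4 j by (auto simp: I_def h J_def x_def)
  qed
qed

text \<open>The subtree of the candidate lies below \<open>k\<close> and no smaller key lies beyond
  it, so preferring right children leads to the maximum. The height \<open>h\<close> exists only in
  the proof, as the loop counter.\<close>

lemma wp_pred2:
  assumes ts: "links s (pref S) \<phi>" "pool s (\<phi> ` pref S)" and S: "S \<subseteq> {..<2 ^ b}" and k: "k < 2 ^ b"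
    and par: "s (V KeyTop) = 2 ^ b"
    and \<kappa>: "s (V TrieCode) = \<kappa>" "\<kappa> \<in> pref S" "s (V TrieCand) = \<phi> \<kappa>" "h \<le> b"
      "(\<kappa> + 1) * 2 ^ h \<le> 2 ^ b + k" "2 ^ b \<le> \<kappa> * 2 ^ h" "\<forall>y\<in>S. y < k \<longrightarrow> (2 ^ b + y) div 2 ^ h \<le> \<kappa>"
  shows "wp w B raw
    (WHILE Reg TrieCode \<lhd> Reg KeyTop DO
        (IF Elem Kid (Num 2 \<otimes> Reg TrieCand \<oplus> Num 1)
         THEN (TrieCand ::= Elem Kid (Num 2 \<otimes> Reg TrieCand \<oplus> Num 1) ;;
               TrieCode ::= Num 2 \<otimes> Reg TrieCode \<oplus> Num 1)
         ELSE (TrieCand ::= Elem Kid (Num 2 \<otimes> Reg TrieCand) ;;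
               TrieCode ::= Num 2 \<otimes> Reg TrieCode)))
    (\<lambda>u t. u \<le> 6 + 100 * real b \<and> same s t \<and> links t (pref S) \<phi> \<and> pool t (\<phi> ` pref S)
      \<and> t (V TrieCode) = below S k) s"
proof -
  define I where "I = (\<lambda>(\<kappa>, h) t. same s t \<and> links t (pref S) \<phi> \<and> pool t (\<phi> ` pref S)
    \<and> t (V TrieCode) = \<kappa> \<and> \<kappa> \<in> pref S \<and> t (V TrieCand) = \<phi> \<kappa> \<and> h \<le> b \<and> (\<kappa> + 1) * 2 ^ h \<le> 2 ^ b + k
    \<and> 2 ^ b \<le> \<kappa> * 2 ^ h \<and> (\<forall>y\<in>S. y < k \<longrightarrow> (2 ^ b + y) div 2 ^ h \<le> \<kappa>))"
  have I: "I (\<kappa>, h) s" using ts \<kappa> by (auto simp: I_def same_refl)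
  show ?thesis
  proof (rule raw_While[where I = I and pot = "\<lambda>(\<kappa>, h) t. 100 * real h", OF space I], goal_cases)
    case (1 g t) then show ?case by simp
  next
    case (2 g t) then show ?case by (auto split: prod.splits)
  next
    case (3 g t)
    obtain \<kappa> h where g: "g = (\<kappa>, h)" by (cases g)
    have t: "same s t" "links t (pref S) \<phi>" "pool t (\<phi> ` pref S)" "t (V TrieCode) = \<kappa>" "\<kappa> \<in> pref S"
        "t (V TrieCand) = \<phi> \<kappa>" "h \<le> b" "(\<kappa> + 1) * 2 ^ h \<le> 2 ^ b + k" "2 ^ b \<le> \<kappa> * 2 ^ h"
        "\<And>y. y \<in> S \<Longrightarrow> y < k \<Longrightarrow> (2 ^ b + y) div 2 ^ h \<le> \<kappa>"
      using 3(1) by (auto simp: I_def g)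
    have "t (V KeyTop) = 2 ^ b" using t(1) par by (simp add: same_def)
    then have lt: "\<kappa> < 2 ^ b" using 3(2) t(4) by (auto split: if_splits)
    then obtain i where i: "h = Suc i" using t(9) by (cases h) auto
    \<comment> \<open>The root is never a candidate: its range of leaves would extend beyond
      \<open>k\<close>.\<close>
    have Sne: "S \<noteq> {} \<or> \<kappa> \<noteq> 1" using t(5) 3(2)
    proof -
      show ?thesis
      proof (rule ccontr)
        assume a: "\<not> ?thesis"
        then have "2 ^ b \<le> (2::nat) ^ h" using t(9) by simp
        then have "b \<le> h" by simp
        then have "h = b" using t(7) by simp
        then show False using t(8) k a by simp
      qed
    qed
    note nb = node_bound[OF t(3,5)] and kd = kids[OF t(2,5)]
    define \<kappa>' where "\<kappa>' = (if 2 * \<kappa> + 1 \<in> pref S then 2 * \<kappa> + 1 else 2 * \<kappa>)"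
    have k': "\<kappa>' \<in> pref S" using pref_child[OF t(5) lt _ S] Sne by (auto simp: \<kappa>'_def)
    let ?t = "t(V TrieCand := \<phi> \<kappa>', V TrieCode := \<kappa>')"
    have "(2 ^ b + y) div 2 ^ i \<le> \<kappa>'" if y: "y \<in> S" "y < k" for y
    proof -
      define z where "z = (2 ^ b + y) div 2 ^ i"
      have zp: "z \<in> pref S" using y t(7) i by (auto simp: z_def intro: prefI)
      have "z div 2 \<le> \<kappa>" using t(10)[OF y] div_Suc[of "2 ^ b + y" i] by (simp add: z_def i)
      then have "z \<le> 2 * \<kappa> + 1" by linarith
      then have "z \<le> \<kappa>'" using zp by (auto simp: \<kappa>'_def le_Suc_eq)
      then show ?thesis by (simp add: z_def)
    qed
    moreover have "(\<kappa>' + 1) * 2 ^ i \<le> 2 ^ b + k"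
    proof -
      have "(\<kappa>' + 1) * 2 ^ i \<le> (2 * \<kappa> + 2) * 2 ^ i" by (intro mult_right_mono) (auto simp: \<kappa>'_def)
      also have "\<dots> = (\<kappa> + 1) * 2 ^ h" by (simp add: i)
      finally show ?thesis using t(8) by linarith
    qed
    moreover have "2 ^ b \<le> \<kappa>' * 2 ^ i"
    proof -
      have "2 ^ b \<le> 2 * \<kappa> * 2 ^ i" using t(9) by (simp add: i mult_ac)
      also have "\<dots> \<le> \<kappa>' * 2 ^ i" by (intro mult_right_mono) (auto simp: \<kappa>'_def)
      finally show ?thesis .
    qed
    ultimately have "I (\<kappa>', i) ?t"
      using t(1-7) i k' by (auto simp: I_def same_upd links_upd pool_upd)
    moreover have "(\<kappa>' = 2 * \<kappa> + 1 \<and> 2 * \<kappa> + 1 \<in> pref S) \<or> (\<kappa>' = 2 * \<kappa> \<and> 2 * \<kappa> + 1 \<notin> pref S \<and> 2 * \<kappa> \<in> pref S)"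
      using k' by (auto simp: \<kappa>'_def)
    moreover have "2 * \<kappa> + 1 < 2 ^ w" using lt pow_word by linarith
    ultimately have "wp w B raw (IF Elem Kid (Num 2 \<otimes> Reg TrieCand \<oplus> Num 1)
         THEN (TrieCand ::= Elem Kid (Num 2 \<otimes> Reg TrieCand \<oplus> Num 1) ;;
               TrieCode ::= Num 2 \<otimes> Reg TrieCode \<oplus> Num 1)
         ELSE (TrieCand ::= Elem Kid (Num 2 \<otimes> Reg TrieCand) ;;
               TrieCode ::= Num 2 \<otimes> Reg TrieCode)) (\<lambda>u y. u \<le> 90 \<and> I (\<kappa>', i) y) t"
      using nb kd t(4,6) small[of 1] small[of 2] space by (intro raw_intros) auto
    then show ?case
    proof (rule wp_conseq, goal_cases)
      case (1 u y)
      then show ?case by (intro exI[of _ u] conjI order_refl exI[of _ "(\<kappa>', i)"]) (auto simp: g i)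
    qed
  next
    case (4 g t)
    obtain \<kappa> h where g: "g = (\<kappa>, h)" by (cases g)
    have t: "same s t" "links t (pref S) \<phi>" "pool t (\<phi> ` pref S)" "t (V TrieCode) = \<kappa>" "\<kappa> \<in> pref S"
        "(\<kappa> + 1) * 2 ^ h \<le> 2 ^ b + k" "\<And>y. y \<in> S \<Longrightarrow> y < k \<Longrightarrow> (2 ^ b + y) div 2 ^ h \<le> \<kappa>"
      using 4(1) by (auto simp: I_def g)
    have "t (V KeyTop) = 2 ^ b" using t(1) par by (simp add: same_def)
    then have ge: "2 ^ b \<le> \<kappa>" using 4(2) t(4) by (auto split: if_splits)
    have h0: "h = 0"
    proof (rule ccontr)
      assume "h \<noteq> 0"
      then have "2 ^ 1 \<le> (2::nat) ^ h" by (intro power_increasing) auto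
      then have "(\<kappa> + 1) * 2 \<le> (\<kappa> + 1) * 2 ^ h" by (intro mult_left_mono) auto
      then have "(\<kappa> + 1) * 2 \<le> 2 ^ b + k" using t(6) by (rule le_trans)
      then show False using ge k by simp
    qed
    from pref_leaf[OF t(5) ge S] obtain y where y: "y \<in> S" "\<kappa> = 2 ^ b + y" by auto
    have yk: "y < k" using t(6) y h0 by simp
    have "finite {x \<in> S. x < k}" by simp
    then have "Max {x \<in> S. x < k} = y" using t(7) y yk h0 by (intro Max_eqI) auto
    then have "t (V TrieCode) = below S k" using t(4) y yk by (auto simp: below_def)
    then show ?case using t \<kappa>(4) by (simp add: g)
  qed
qed

lemma wp_pred:
  assumes ts: "tset s S" and par: "params s" and k: "s (V Key) = k" "k < 2 ^ b"
  shows "wp w B raw t_pred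
    (\<lambda>u s'. u \<le> 300 * (real b + 1) \<and> same (s(V Res := below S k)) s' \<and> tset s' S) s"
proof -
  have S: "S \<subseteq> {..<2 ^ b}" using ts by (auto simp: tset_def)
  obtain \<phi> where \<phi>: "links s (pref S) \<phi>" "pool s (\<phi> ` pref S)" using ts by (auto simp: tset_def)
  let ?s = "s(V TrieKey := 2 ^ b + k, V TrieNode := 0, V TrieWeight := 2 ^ b div 2, V TrieCode := 0)"
  have s0: "same s ?s" by (simp add: same_upd same_refl)
  show ?thesis unfolding t_pred_def
  proof (rule wp_Seq, rule wp_begin[OF par k], intro wp_Seq raw_assign[OF space],
      simp add: small, unfold ev.simps, rule wp_conseq[OF wp_pred1[of ?s S \<phi> k]], goal_cases)
    case (9 u t)
    then obtain \<kappa> h where t: "u \<le> 3 + 150 * real b" "same s t" "links t (pref S) \<phi>" "pool t (\<phi> ` pref S)"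
      "t (V TrieCode) = \<kappa>" "\<kappa> \<noteq> 0 \<Longrightarrow> \<kappa> \<in> pref S \<and> t (V TrieCand) = \<phi> \<kappa> \<and> h \<le> b
        \<and> (\<kappa> + 1) * 2 ^ h \<le> 2 ^ b + k \<and> 2 ^ b \<le> \<kappa> * 2 ^ h"
      "\<And>y. y \<in> S \<Longrightarrow> y < k \<Longrightarrow> \<kappa> \<noteq> 0 \<and> (2 ^ b + y) div 2 ^ h \<le> \<kappa>"
      using s0 by (auto simp: same_def)
    have "wp w B raw (IF Reg TrieCode
      THEN (WHILE Reg TrieCode \<lhd> Reg KeyTop DO
        (IF Elem Kid (Num 2 \<otimes> Reg TrieCand \<oplus> Num 1)
         THEN (TrieCand ::= Elem Kid (Num 2 \<otimes> Reg TrieCand \<oplus> Num 1) ;;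
               TrieCode ::= Num 2 \<otimes> Reg TrieCode \<oplus> Num 1)
         ELSE (TrieCand ::= Elem Kid (Num 2 \<otimes> Reg TrieCand) ;;
               TrieCode ::= Num 2 \<otimes> Reg TrieCode)))
      ELSE Skip) (\<lambda>u t'. u \<le> 10 + 100 * real b \<and> same s t' \<and> links t' (pref S) \<phi> \<and> pool t' (\<phi> ` pref S)
      \<and> t' (V TrieCode) = below S k) t"
    proof (rule raw_Cond[OF space], goal_cases)
      case 1 show ?case by simp
    next
      case 2
      then have "\<kappa> \<noteq> 0" using t(5) by simp
      then show ?case
        using t par wp_conseq[OF wp_pred2[OF t(3,4) S k(2) _ t(5), of h]]
        by (intro wp_conseq[OF wp_pred2[OF t(3,4) S k(2) _ t(5), of h]]) (auto simp: same_def params_def)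
    next
      case 3
      then have "\<kappa> = 0" using t(5) by simp
      then have "\<not> (\<exists>y\<in>S. y < k)" using t(7) by auto
      then have "below S k = 0" by (simp add: below_def)
      then show ?case using t \<open>\<kappa> = 0\<close> by (intro wp_Skip) auto
    qed
    then show ?case
    proof (intro exI[of _ u] conjI order_refl wp_Seq, elim wp_conseq, goal_cases)
      case (1 u' t')
      have "same (s(V Res := below S k)) (t'(V Res := below S k))"
        using 1 by (auto simp: same_def)
      moreover have "tset (t'(V Res := below S k)) S"
        using 1 S by (auto simp: tset_def links_upd pool_upd)
      ultimately show ?case using 1 t(1)
        by (intro exI[of _ u'] conjI order_refl raw_assign[OF space]) auto
    qed
  qed (use \<phi> S k in \<open>auto simp: links_upd pool_upd\<close>)
qed

end

section \<open>Programs that use the ordered set\<close>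

fun client_ex :: "ex \<Rightarrow> bool" where
  "client_ex (Num c) \<longleftrightarrow> True"
| "client_ex (Reg r) \<longleftrightarrow> client (V r)"
| "client_ex (Elem a e) \<longleftrightarrow> client (H a 0) \<and> client_ex e"
| "client_ex (Op f d e) \<longleftrightarrow> client_ex d \<and> client_ex e"

lemma client_ex:
  assumes "same \<sigma> s" "client_ex e"
  shows "ev s e = ev \<sigma> e" "ok w B s e = ok w B \<sigma> e"
proof -
  have "ev s e = ev \<sigma> e \<and> ok w B s e = ok w B \<sigma> e"
    using assms(2)
  proof (induction e)
    case (Op f d e)
    then show ?case by (cases f) auto
  qed (use assms(1) in \<open>auto simp: same_def\<close>)
  then show "ev s e = ev \<sigma> e" "ok w B s e = ok w B \<sigma> e" by auto
qed

context machine
begin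

text \<open>From here on a state is a pair of client memory and key set. \<open>\<sigma>\<close> is
  tied to the memory on client locations only, so rearrangements inside the trie leave it
  unchanged.\<close>

definition cli :: "mem \<Rightarrow> (loc \<Rightarrow> nat) \<times> nat set \<Rightarrow> bool" where
  "cli M = (\<lambda>(\<sigma>, S). finite S \<and> tset (M \<circ> addr) S \<and> params (M \<circ> addr) \<and> same \<sigma> (M \<circ> addr))"

lemma cli_lift:
  assumes "\<And>s. finite S \<Longrightarrow> tset s S \<Longrightarrow> params s \<Longrightarrow> same \<sigma> s \<Longrightarrow>
      wp w B raw c (\<lambda>u s'. u \<le> T \<and> tset s' S' \<and> params s' \<and> same \<sigma>' s') s"
    and "finite S \<Longrightarrow> finite S'" and "Q T (\<sigma>', S')"
  shows "wp w B cli c Q (\<sigma>, S)"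
  unfolding wp_def
proof (intro allI impI)
  fix M assume M: "cli M (\<sigma>, S)"
  then have "wp w B raw c (\<lambda>u s'. u \<le> T \<and> tset s' S' \<and> params s' \<and> same \<sigma>' s') (M \<circ> addr)"
    using assms(1) by (auto simp: cli_def)
  then obtain t A M' u where r: "exec w c M t A M'" "A \<subseteq> {..<64 + 8 * B}" "real t \<le> u"
      "u \<le> T \<and> tset (M' \<circ> addr) S' \<and> params (M' \<circ> addr) \<and> same \<sigma>' (M' \<circ> addr)"
    unfolding wp_def by blast
  have "cli M' (\<sigma>', S')" using r(4) M assms(2) by (auto simp: cli_def)
  moreover have "real t \<le> T" using r by linarith
  ultimately show "\<exists>t A M' u x'. exec w c M t A M' \<and> A \<subseteq> {..<64 + 8 * B} \<and> real t \<le> u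
      \<and> cli M' x' \<and> Q u x'"
    using r(1,2) assms(3)
    by (intro exI[of _ t] exI[of _ A] exI[of _ M'] exI[of _ T] exI[of _ "(\<sigma>', S')"]) simp
qed

lemma tset_upd:
  "r \<noteq> TrieFree \<Longrightarrow> r \<noteq> TrieFresh \<Longrightarrow> tset (s(V r := x)) S \<longleftrightarrow> tset s S"
  "a \<noteq> Kid \<Longrightarrow> a \<noteq> Par \<Longrightarrow> a \<noteq> Stack \<Longrightarrow> tset (s(H a i := x)) S \<longleftrightarrow> tset s S"
  by (auto simp: tset_def links_upd pool_upd)

lemma same_upd2: "same \<sigma> s \<Longrightarrow> same (\<sigma>(l := x)) (s(l := x))"
  by (auto simp: same_def)

lemma c_assign:
  assumes "client (V r)" "r \<noteq> KeyTop" "r \<noteq> KeyHalf" "client_ex e" "ok w B \<sigma> e"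
    and "Q (real (2 + expr_cost (code e))) (\<sigma>(V r := ev \<sigma> e), S)"
  shows "wp w B cli (r ::= e) Q (\<sigma>, S)"
proof (rule cli_lift[where T = "real (2 + expr_cost (code e))" and Q = Q, OF _ _ assms(6)], goal_cases)
  case (1 s)
  then show ?case
    using assms client_ex[OF 1(4) assms(4)]
    by (intro raw_assign[OF space]) (auto simp: tset_upd params_def intro!: same_upd2)
qed

lemma c_put:
  assumes "client (H a 0)" "client_ex i" "client_ex e" "ok w B \<sigma> i" "ev \<sigma> i < B" "ok w B \<sigma> e"
    and "Q (real (5 + expr_cost (code i) + expr_cost (code e))) (\<sigma>(H a (ev \<sigma> i) := ev \<sigma> e), S)"
  shows "wp w B cli (put a i e) Q (\<sigma>, S)"
proof (rule cli_lift[where T = "real (5 + expr_cost (code i) + expr_cost (code e))" and Q = Q, OF _ _ assms(7)], goal_cases)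
  case (1 s)
  then show ?case
    using assms client_ex[OF 1(4) assms(2)] client_ex[OF 1(4) assms(3)]
    by (intro raw_put[OF space]) (auto simp: tset_upd params_def intro!: same_upd2)
qed

lemma cli_guard:
  assumes "client_ex e" "ok w B \<sigma> e"
  shows "guard w B cli (code e) (\<sigma>, S) (ev \<sigma> e)"
  unfolding guard_def
proof (intro allI impI)
  fix M assume "cli M (\<sigma>, S)"
  then have s: "same \<sigma> (M \<circ> addr)" by (simp add: cli_def)
  then have "ok w B (M \<circ> addr) e" using client_ex[OF s assms(1)] assms(2) by simp
  from code_correct[OF space this refl]
  show "val w M (code e) = ev \<sigma> e \<and> reads w M (code e) \<subseteq> {..<64 + 8 * B}"
    using client_ex[OF s assms(1)] by simp
qed

lemma c_Cond:
  assumes "client_ex e" "ok w B \<sigma> e"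
    and "ev \<sigma> e \<noteq> 0 \<Longrightarrow> wp w B cli c (\<lambda>u. Q (real (1 + expr_cost (code e)) + u)) (\<sigma>, S)"
    and "ev \<sigma> e = 0 \<Longrightarrow> wp w B cli d (\<lambda>u. Q (real (1 + expr_cost (code e)) + u)) (\<sigma>, S)"
  shows "wp w B cli (IF e THEN c ELSE d) Q (\<sigma>, S)"
  by (rule wp_Cond[OF cli_guard[OF assms(1,2)]]) (use assms in auto)

lemma c_While:
  fixes I :: "'g \<Rightarrow> (loc \<Rightarrow> nat) \<Rightarrow> nat set \<Rightarrow> bool" and pot :: "'g \<Rightarrow> real"
  assumes "client_ex e" "I g \<sigma> S"
    and "\<And>g \<sigma> S. I g \<sigma> S \<Longrightarrow> ok w B \<sigma> e"
    and "\<And>g \<sigma> S. I g \<sigma> S \<Longrightarrow> 0 \<le> pot g"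
    and "\<And>g \<sigma> S. I g \<sigma> S \<Longrightarrow> ev \<sigma> e \<noteq> 0 \<Longrightarrow> wp w B cli c
      (\<lambda>u (\<sigma>', S'). \<exists>h. I h \<sigma>' S' \<and> real (1 + expr_cost (code e)) + u + pot h \<le> pot g) (\<sigma>, S)"
    and "\<And>h \<sigma>' S'. I h \<sigma>' S' \<Longrightarrow> ev \<sigma>' e = 0 \<Longrightarrow>
      Q (real (1 + expr_cost (code e)) + pot g - pot h) (\<sigma>', S')"
  shows "wp w B cli (WHILE e DO c) Q (\<sigma>, S)"
proof (rule wp_While[where g = g and I = "\<lambda>g (\<sigma>, S). I g \<sigma> S" and pot = "\<lambda>g x. pot g" and v = "\<lambda>(\<sigma>, S). ev \<sigma> e"], goal_cases)
  case 1 then show ?case using assms(2) by simp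
next
  case (2 g x) then show ?case using assms(3) cli_guard[OF assms(1)] by (auto split: prod.splits)
next
  case (3 g x) then show ?case using assms(4) by (auto split: prod.splits)
next
  case (4 g x)
  obtain \<sigma>' S' where "x = (\<sigma>', S')" by (cases x)
  have I: "I g \<sigma>' S'" "ev \<sigma>' e \<noteq> 0" using 4 \<open>x = _\<close> by auto
  show ?case unfolding \<open>x = _\<close>
  proof (rule wp_conseq[OF assms(5)[OF I]], goal_cases)
    case (1 u y)
    then show ?case by (intro exI[of _ u]) (cases y, auto)
  qed
next
  case (5 h y) then show ?case using assms(6) by (auto split: prod.splits)
qed

definition lg :: real where "lg = real b + 1"

lemma c_insert:
  assumes "\<sigma> (V Key) < 2 ^ b" "1 + b * card (insert (\<sigma> (V Key)) S) \<le> NB"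
    and "Q (200 * lg) (\<sigma>, insert (\<sigma> (V Key)) S)"
  shows "wp w B cli t_insert Q (\<sigma>, S)"
proof (rule cli_lift[where T = "200 * lg" and Q = Q, OF _ _ assms(3)], goal_cases)
  case (1 s)
  then have "s (V Key) = \<sigma> (V Key)" by (simp add: same_def)
  show ?case
  proof (rule wp_conseq[OF wp_insert[OF 1(2,1,3) \<open>s (V Key) = _\<close> assms(1,2)]], goal_cases)
    case (1 u s')
    then have "same \<sigma> s'" "params s'" using \<open>same \<sigma> s\<close> \<open>params s\<close> by (auto simp: same_def params_def)
    then show ?case using 1 by (auto simp: lg_def)
  qed
qed simp

lemma c_delete:
  assumes "\<sigma> (V Key) \<in> S"
    and "Q (250 * lg) (\<sigma>, S - {\<sigma> (V Key)})"
  shows "wp w B cli t_delete Q (\<sigma>, S)"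
proof (rule cli_lift[where T = "250 * lg" and Q = Q, OF _ _ assms(2)], goal_cases)
  case (1 s)
  then have "s (V Key) = \<sigma> (V Key)" by (simp add: same_def)
  show ?case
  proof (rule wp_conseq[OF wp_delete[OF 1(2,3) \<open>s (V Key) = _\<close> assms(1)]], goal_cases)
    case (1 u s')
    then have "same \<sigma> s'" "params s'" using \<open>same \<sigma> s\<close> \<open>params s\<close> by (auto simp: same_def params_def)
    then show ?case using 1 by (auto simp: lg_def)
  qed
qed simp

lemma c_pred:
  assumes "\<sigma> (V Key) < 2 ^ b"
    and "Q (300 * lg) (\<sigma>(V Res := below S (\<sigma> (V Key))), S)"
  shows "wp w B cli t_pred Q (\<sigma>, S)"
proof (rule cli_lift[where T = "300 * lg" and Q = Q, OF _ _ assms(2)], goal_cases)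
  case (1 s)
  then have k: "s (V Key) = \<sigma> (V Key)" by (simp add: same_def)
  show ?case
  proof (rule wp_conseq[OF wp_pred[OF 1(2,3) k assms(1)]], goal_cases)
    case (1 u s')
    then have "same (\<sigma>(V Res := below S (\<sigma> (V Key)))) s'" "params s'"
      using \<open>same \<sigma> s\<close> \<open>params s\<close> by (auto simp: same_def params_def)
    then show ?case using 1 by (auto simp: lg_def)
  qed
qed simp

lemmas c_intros = wp_Skip wp_Seq c_assign c_put c_Cond c_insert c_delete c_pred

text \<open>The dichotomy behind all range scans: a search from \<open>hi\<close> either yields the
  largest key from \<open>lo\<close> on or shows that there is none. Comparing its result with
  \<open>2 ^ b + lo\<close> decides, since the result 0 falls on the same side as keys that are too
  small.\<close>

lemma below_cases:
  assumes "finite S" "lo \<le> hi"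
  obtains "below S hi < 2 ^ b + lo" "\<And>k. k \<in> S \<Longrightarrow> k < hi \<Longrightarrow> k < lo"
  | k where "k \<in> S" "lo \<le> k" "k < hi" "below S hi = 2 ^ b + k" "\<And>k'. k' \<in> S \<Longrightarrow> k' < hi \<Longrightarrow> k' \<le> k"
proof (cases "\<exists>x\<in>S. x < hi")
  case True
  define k where "k = Max {x \<in> S. x < hi}"
  have f: "finite {x \<in> S. x < hi}" "{x \<in> S. x < hi} \<noteq> {}" using assms(1) True by auto
  have k: "k \<in> S" "k < hi" using Max_in[OF f] by (auto simp: k_def)
  have m: "k' \<le> k" if "k' \<in> S" "k' < hi" for k' using that f by (auto simp: k_def)
  have e: "below S hi = 2 ^ b + k" using True by (simp add: below_def k_def)
  show ?thesis
  proof (cases "lo \<le> k")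
    case True
    then show ?thesis using that(2) k m e by blast
  next
    case False
    then have "below S hi < 2 ^ b + lo" using e by simp
    moreover have "k' < lo" if "k' \<in> S" "k' < hi" for k' using m[OF that] False by simp
    ultimately show ?thesis using that(1) by blast
  qed
next
  case False
  then have "below S hi = 0" by (simp add: below_def)
  then show ?thesis using that(1) False by auto
qed

end

text \<open>Digits in base \<open>R\<close>, the kind first: numerical order is lexicographic, and
  the keys of one kind, or of one kind and one leading node, fill an interval.\<close>

definition enc :: "nat \<Rightarrow> nat \<Rightarrow> nat \<Rightarrow> nat \<Rightarrow> nat \<Rightarrow> nat \<Rightarrow> nat" where
  "enc R t a b c d = (((t * R + a) * R + b) * R + c) * R + d"

lemma digit_less: "v < R \<Longrightarrow> v' < R \<Longrightarrow> u * R + v < u' * R + v' \<longleftrightarrow> u < u' \<or> u = u' \<and> v < (v'::nat)"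
proof -
  assume v: "v < R" "v' < R"
  have *: "a * R + v1 < c * R + v2" if "a < c" "v1 < R" for a c v1 v2 :: nat
  proof -
    have "Suc a * R \<le> c * R" using that by (intro mult_right_mono) auto
    then show ?thesis using that by simp
  qed
  show ?thesis using *[of u u' v v'] *[of u' u v' v] v by (cases u u' rule: linorder_cases) auto
qed

lemma digit_eq: "v < R \<Longrightarrow> v' < R \<Longrightarrow> u * R + v = u' * R + v' \<longleftrightarrow> u = u' \<and> v = (v'::nat)"
  using digit_less[of v R v' u u'] digit_less[of v' R v u' u] by (metis less_irrefl nat_neq_iff)

lemma enc_eq:
  assumes "a < R" "b < R" "c < R" "d < R" "a' < R" "b' < R" "c' < R" "d' < R"
  shows "enc R t a b c d = enc R t' a' b' c' d' \<longleftrightarrow> t = t' \<and> a = a' \<and> b = b' \<and> c = c' \<and> d = d'"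
  using assms by (auto simp: enc_def digit_eq)

lemma enc_less:
  assumes "a < R" "b < R" "c < R" "d < R" "a' < R" "b' < R" "c' < R" "d' < R"
  shows "enc R t a b c d < enc R t' a' b' c' d' \<longleftrightarrow> t < t' \<or> t = t' \<and> (a < a' \<or> a = a' \<and>
    (b < b' \<or> b = b' \<and> (c < c' \<or> c = c' \<and> d < d')))"
  using assms by (auto simp: enc_def digit_less digit_eq)

lemma enc_le:
  assumes "a < R" "b < R" "c < R" "d < R" "a' < R" "b' < R" "c' < R" "d' < R"
  shows "enc R t a b c d \<le> enc R t' a' b' c' d' \<longleftrightarrow> t < t' \<or> t = t' \<and> (a < a' \<or> a = a' \<and>
    (b < b' \<or> b = b' \<and> (c < c' \<or> c = c' \<and> d \<le> d')))"
  using enc_less[OF assms(5-8,1-4), of t' t] by (auto simp: not_less[symmetric])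

lemma enc_bound:
  assumes "t < R" "a < R" "b < R" "c < R" "d < R"
  shows "enc R t a b c d < R ^ 5" "((t * R + a) * R + b) * R + c < R ^ 5" "(t * R + a) * R + b < R ^ 5"
    "t * R + a < R ^ 5" "(((t * R + a) * R + b) * R + c) * R < R ^ 5" "((t * R + a) * R + b) * R < R ^ 5"
    "(t * R + a) * R < R ^ 5" "t * R < R ^ 5"
proof -
  have s: "u * R + v < R ^ Suc i" if "u < R ^ i" "v < R" for u v i
  proof -
    have "Suc u * R \<le> R ^ i * R" using that by (intro mult_right_mono) auto
    then show ?thesis using that by (simp add: mult.commute)
  qed
  have 1: "t * R + a < R ^ 2" using s[of t 1 a] assms by (simp add: eval_nat_numeral)
  have 2: "(t * R + a) * R + b < R ^ 3" using s[OF 1, of b] assms by (simp add: eval_nat_numeral)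
  have 3: "((t * R + a) * R + b) * R + c < R ^ 4" using s[OF 2, of c] assms by (simp add: eval_nat_numeral)
  have 4: "(((t * R + a) * R + b) * R + c) * R + d < R ^ 5" using s[OF 3, of d] assms by (simp add: eval_nat_numeral)
  show "enc R t a b c d < R ^ 5" using 4 by (simp add: enc_def)
  have R: "1 \<le> R" using assms by simp
  have le: "x \<le> x * R + y" for x y
  proof -
    have "x * 1 \<le> x * R" using R by (intro mult_left_mono) auto
    then show ?thesis unfolding mult_1_right by (rule trans_le_add1)
  qed
  show "((t * R + a) * R + b) * R + c < R ^ 5" "(((t * R + a) * R + b) * R + c) * R < R ^ 5"
    using 4 le[of "((t * R + a) * R + b) * R + c" d] by linarith+
  then show "(t * R + a) * R + b < R ^ 5" "((t * R + a) * R + b) * R < R ^ 5"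
    using le[of "(t * R + a) * R + b" c] by linarith+
  then show "t * R + a < R ^ 5" "(t * R + a) * R < R ^ 5" using le[of "t * R + a" b] by linarith+
  then show "t * R < R ^ 5" by linarith
qed

lemma enc_decode:
  assumes "a < R" "b < R" "c < R" "d < R"
  shows "enc R t a b c d div (R * R) mod R = b" "enc R t a b c d div R mod R = c"
    "enc R t a b c d mod R = d" "enc R t a b c d div (R * R * R) mod R = a"
proof -
  have R: "R \<noteq> 0" using assms by auto
  have 1: "enc R t a b c d div R = ((t * R + a) * R + b) * R + c" using assms(4) R by (simp add: enc_def)
  then show "enc R t a b c d div R mod R = c" using assms R by simp
  have 2: "enc R t a b c d div (R * R) = (t * R + a) * R + b" using assms R by (simp add: div_mult2_eq 1)
  then show "enc R t a b c d div (R * R) mod R = b" using assms R by simp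
  show "enc R t a b c d mod R = d" using assms by (simp add: enc_def)
  show "enc R t a b c d div (R * R * R) mod R = a" using assms R by (simp add: div_mult2_eq[of _ "R * R"] 2)
qed

definition encx :: "ex \<Rightarrow> ex \<Rightarrow> ex \<Rightarrow> ex \<Rightarrow> ex \<Rightarrow> ex" where
  "encx t a b c d = (((t \<otimes> Reg Radix \<oplus> a) \<otimes> Reg Radix \<oplus> b) \<otimes> Reg Radix \<oplus> c) \<otimes> Reg Radix \<oplus> d"

lemma encx_cost: "expr_cost (code (encx t a b c d)) = 16 + expr_cost (code t) + expr_cost (code a)
    + expr_cost (code b) + expr_cost (code c) + expr_cost (code d)"
  by (simp add: encx_def)

lemma encx_client: "client_ex (encx t a b c d) \<longleftrightarrow>
    client_ex t \<and> client_ex a \<and> client_ex b \<and> client_ex c \<and> client_ex d"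
  by (auto simp: encx_def)

lemma encx_ev: "ev \<sigma> (encx t a b c d) = enc (\<sigma> (V Radix)) (ev \<sigma> t) (ev \<sigma> a) (ev \<sigma> b) (ev \<sigma> c) (ev \<sigma> d)"
  by (simp add: encx_def enc_def)

section \<open>Programs that publish a load\<close>

abbreviation mult_at :: "reg \<Rightarrow> ex" where
  "mult_at r \<equiv> Elem Pow (Reg r \<odot> Reg Guesses)"

definition do_insert :: "ex \<Rightarrow> com" where "do_insert e = (Key ::= e ;; t_insert)"
definition do_delete :: "ex \<Rightarrow> com" where "do_delete e = (Key ::= e ;; t_delete)"
definition do_pred :: "ex \<Rightarrow> com" where "do_pred e = (Key ::= e ;; t_pred)"

text \<open>The last assignments leave the cut-off \<open>F x\<close> in \<open>Flag\<close>:
  \<open>Prec \<oslash> Num 4\<close> is \<open>32 * (J + 1)\<close>, and \<open>Cursor\<close>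
  briefly holds the complementary weight.\<close>

definition publish_values :: com where
  "publish_values =
     (ValOld ::= Elem Pub (Reg NodeX) \<otimes> mult_at NodeX ;;
      ValNew ::= Elem Load (Reg NodeX) \<otimes> mult_at NodeX ;;
      put Pub (Reg NodeX) (Elem Load (Reg NodeX)) ;;
      Flag ::= mult_at NodeX ;;
      Cursor ::= Reg Pow4 \<oslash> Reg Flag ;;
      (IF Reg Flag \<lhd> Reg Cursor THEN (Flag ::= Reg Cursor) ELSE Skip) ;;
      Flag ::= Reg Prec \<oslash> Num 4 \<otimes> Reg Flag)"

text \<open>Values below the cut-off have no key of kind 3, so the two tests mirror
  \<open>thr\<close>. The node itself is marked for inspection, since a smaller value may make units
  owned by its neighbours violate the local condition.\<close>

definition publish_node :: com where
  "publish_node =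
     ((IF Reg ValOld \<lhd> Reg Flag THEN Skip
       ELSE (do_delete (encx (Num 3) (Reg ValOld) (Reg NodeX) (Num 0) (Num 0)))) ;;
      (IF Reg ValNew \<lhd> Reg Flag THEN Skip
       ELSE (do_insert (encx (Num 3) (Reg ValNew) (Reg NodeX) (Num 0) (Num 0)))) ;;
      do_insert (encx (Num 2) (Reg NodeX) (Num 0) (Num 0) (Num 0)))"

text \<open>The keys of kind 0 stay in place, so searching below the current one continues the scan
  while keys of kinds 1 and 2 change. The other endpoint is marked because the value of the owner
  may have grown.\<close>

definition publish_unit :: com where
  "publish_unit =
     (Cursor ::= Reg Res \<ominus> Reg KeyTop ;;
      Unit ::= Reg Cursor \<oslash> (Reg Radix \<otimes> Reg Radix) \<odot> Reg Radix ;;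
      Copy ::= Reg Cursor \<oslash> Reg Radix \<odot> Reg Radix ;;
      do_delete (encx (Num 1) (Reg Unit) (Reg ValOld) (Reg NodeX) (Reg Copy)) ;;
      do_insert (encx (Num 1) (Reg Unit) (Reg ValNew) (Reg NodeX) (Reg Copy)) ;;
      do_insert (encx (Num 2) (Reg Unit) (Num 0) (Num 0) (Num 0)) ;;
      do_pred (Reg Cursor))"

definition publish_units :: com where
  "publish_units =
     (do_pred (encx (Num 0) (Reg NodeX \<oplus> Num 1) (Num 0) (Num 0) (Num 0)) ;;
      (WHILE (Reg Res \<lhd> Reg KeyTop \<oplus> encx (Num 0) (Reg NodeX) (Num 0) (Num 0) (Num 0)) \<doteq> Num 0
       DO publish_unit))"

definition publish :: com where
  "publish = (publish_values ;; publish_node ;; publish_units)"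

text \<open>The second test is the negation of \<open>near\<close>, free of fractions.\<close>

definition adjust :: com where
  "adjust =
     ((IF Elem Load (Reg NodeX) \<lhd> Elem Pub (Reg NodeX)
       THEN (Flag ::= Elem Pub (Reg NodeX) \<ominus> Elem Load (Reg NodeX))
       ELSE (Flag ::= Elem Load (Reg NodeX) \<ominus> Elem Pub (Reg NodeX))) ;;
      (IF Elem Pub (Reg NodeX) \<lhd> Reg Prec \<otimes> Reg Flag THEN publish ELSE Skip))"

fun kept :: "loc \<Rightarrow> bool" where
  "kept (V r) \<longleftrightarrow> r \<notin> {Key, Res, Copy, ValOld, ValNew, Cursor, Flag, Unit}"
| "kept (H a i) \<longleftrightarrow> True"

definition frame :: "(loc \<Rightarrow> nat) \<Rightarrow> (loc \<Rightarrow> nat) \<Rightarrow> bool" where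
  "frame \<sigma> \<sigma>' \<longleftrightarrow> (\<forall>l. kept l \<longrightarrow> \<sigma>' l = \<sigma> l)"

lemma frame_refl: "frame \<sigma> \<sigma>"
  by (simp add: frame_def)

lemma frame_trans: "frame \<sigma> \<sigma>' \<Longrightarrow> frame \<sigma>' \<sigma>'' \<Longrightarrow> frame \<sigma> \<sigma>''"
  by (simp add: frame_def)

lemma frame_upd: "\<not> kept l \<Longrightarrow> frame \<sigma> (\<sigma>'(l := x)) \<longleftrightarrow> frame \<sigma> \<sigma>'"
  by (auto simp: frame_def)

type_synonym edge_copy = "nat \<times> nat \<times> nat"

definition deg :: "edge_copy set \<Rightarrow> nat \<Rightarrow> nat" where
  "deg A x = card {t \<in> A. fst t = x}"

text \<open>The key length \<open>40 * J + 80\<close> is five digits of \<open>8 * J + 16\<close>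
  bits. \<open>ub\<close> bounds the number of units. A unit has two keys, and each of the
  \<open>2 * n * (2 * J + 1)\<close> nodes has at most one of kind 2 and one of kind 3;
  \<open>card_pref\<close> converts this number of keys into trie nodes.\<close>

locale graph_machine = machine w B "40 * J + 80" NB for w B J NB :: nat +
  fixes n ub :: nat
  assumes n: "1 \<le> n" "n \<le> 4 ^ J"
    and NB_cap: "1 + (40 * J + 80) * (2 * ub + 4 * n * (2 * J + 1)) \<le> NB"
begin

text \<open>Node \<open>x\<close> belongs to guess \<open>x mod G\<close> and has weight \<open>m x\<close>. Only values above \<open>F x\<close> compete for the
  answer, since smaller loads are too coarse to be approximated by the level sets of the
  upper bound; \<open>thr\<close> replaces the others by 0.\<close>

definition R :: nat where "R = 2 ^ (8 * J + 16)"
definition G :: nat where "G = 2 * J + 1"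
definition N :: nat where "N = 2 * n * G"
text \<open>Large enough that the right guess lifts some value above the cut-off:
  \<open>approx_lower\<close> needs \<open>64 * (J + 1)\<close> to be at most
  \<open>5 / 13 * K\<close>.\<close>

definition K :: nat where "K = 256 * (J + 1)"
text \<open>Over the \<open>4 * (J + 1)\<close> level sets of \<open>approx_upper\<close>, a
  relative loss of \<open>4 / P\<close> each adds up to one eighth.\<close>

definition P :: nat where "P = 128 * (J + 1)"
definition m :: "nat \<Rightarrow> nat" where "m x = 2 ^ (x mod G)"
text \<open>\<open>m x\<close> and \<open>4 ^ J div m x\<close> are the two weights of the guess.
  Above \<open>F x\<close>, the additive loss of one weight in each of \<open>4 * (J + 1)\<close>
  levels costs at most another eighth.\<close>

definition F :: "nat \<Rightarrow> nat" where "F x = 32 * (J + 1) * max (m x) (4 ^ J div m x)"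
definition thr :: "nat \<Rightarrow> nat \<Rightarrow> nat" where "thr x v = (if F x \<le> v * m x then v * m x else 0)"
definition U :: "edge_copy set" where "U = {..<N} \<times> {..<N} \<times> {..<K}"

text \<open>A triple \<open>(x, y, j)\<close> is the \<open>j\<close>-th unit between \<open>x\<close> and \<open>y\<close>, owned by \<open>x\<close>. Keys of kind 0 list the units
  by owner; kind 1 lists them by the other endpoint and then by the published value of the owner, so that a
  predecessor search finds the largest; kind 2 collects the nodes awaiting inspection; kind 3
  sorts the nodes by value.\<close>

definition k0 :: "edge_copy \<Rightarrow> nat" where "k0 = (\<lambda>(x, y, j). enc R 0 x y j 0)"
definition k1 :: "nat \<Rightarrow> edge_copy \<Rightarrow> nat" where "k1 v = (\<lambda>(x, y, j). enc R 1 y v x j)"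
definition k2 :: "nat \<Rightarrow> nat" where "k2 x = enc R 2 x 0 0 0"
definition k3 :: "nat \<Rightarrow> nat \<Rightarrow> nat" where "k3 v x = enc R 3 v x 0 0"

text \<open>The value \<open>g\<close> is attached to units and not to owners, because publishing
  rewrites the keys one by one and passes through states in which units of one owner carry different
  values.\<close>

definition ks :: "edge_copy set \<Rightarrow> (edge_copy \<Rightarrow> nat) \<Rightarrow> nat set \<Rightarrow> (nat \<Rightarrow> nat) \<Rightarrow> nat set" where
  "ks A g D f = k0 ` A \<union> (\<lambda>t. k1 (g t) t) ` A \<union> k2 ` D \<union> {k3 (f x) x | x. x < N \<and> f x \<noteq> 0}"

definition fixed :: "(loc \<Rightarrow> nat) \<Rightarrow> bool" where
  "fixed \<sigma> \<longleftrightarrow> \<sigma> (V SizeJ) = J \<and> \<sigma> (V Guesses) = G \<and> \<sigma> (V Copies) = K \<and> \<sigma> (V Prec) = P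
     \<and> \<sigma> (V Radix) = R \<and> \<sigma> (V Pow4) = 4 ^ J \<and> \<sigma> (V KeyTop) = R ^ 5 \<and> \<sigma> (V AnsDen) = 2 * 2 ^ J * K
     \<and> (\<forall>e < G. \<sigma> (H Pow e) = 2 ^ e)"

section \<open>Sizes of the constants\<close>

lemma top: "2 ^ (40 * J + 80) = R ^ 5"
  by (simp add: R_def power_add power_mult flip: power_mult)

lemma J_less_pow: "J + 1 \<le> 2 ^ J" "2 * J + 1 \<le> 4 ^ J"
proof -
  show 1: "J + 1 \<le> 2 ^ J" by (induction J) auto
  show "2 * J + 1 \<le> 4 ^ J" by (induction J) auto
qed

lemma m_bounds: "1 \<le> m x" "m x \<le> 4 ^ J"
proof -
  have "m x \<le> 2 ^ (2 * J)" unfolding m_def G_def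
    by (intro power_increasing) (auto simp: less_Suc_eq_le[symmetric])
  then show "m x \<le> 4 ^ J" by (simp add: power_mult)
qed (simp add: m_def)

text \<open>\<open>4 ^ J\<close> bounds \<open>n\<close>, \<open>G\<close> and the weights, and
  \<open>2 ^ J\<close> bounds \<open>J + 1\<close>. Hence \<open>N * K * 4 ^ J\<close>, which bounds
  all values, is at most \<open>2 ^ (7 * J + 9)\<close>.\<close>

lemma R_large: "N * K * 4 ^ J < R" "N < R" "K < R" "P + 4 < R" "4 ^ J < R" "G < R" "100 < R"
  "1 \<le> N" "1 \<le> K" "N * K < R" "1 \<le> R"
proof -
  have "N * K * 4 ^ J \<le> (2 * 4 ^ J * 4 ^ J) * (256 * 2 ^ J) * 4 ^ J"
    unfolding N_def K_def G_def using n(2) J_less_pow by (intro mult_mono) auto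
  also have "\<dots> = 2 ^ (7 * J + 9)"
  proof -
    have "(4::nat) ^ J = 2 ^ (2 * J)" by (simp add: power_mult)
    moreover have "(2::nat) ^ (7 * J + 9) = 2 ^ (2 * J) * 2 ^ (2 * J) * 2 ^ J * 2 ^ (2 * J) * 2 ^ 9"
      by (simp only: power_add[symmetric]) (rule arg_cong[of _ _ "\<lambda>i. 2 ^ i"], simp)
    ultimately show ?thesis by simp
  qed
  also have "\<dots> < R" unfolding R_def by (intro power_strict_increasing) auto
  finally show 1: "N * K * 4 ^ J < R" .
  show 2: "1 \<le> N" "1 \<le> K" using n by (auto simp: N_def K_def G_def)
  have 3: "N * K * 1 \<le> N * K * 4 ^ J" by (intro mult_left_mono) auto
  then show 4: "N * K < R" using 1 by linarith
  have "N * 1 \<le> N * K" "1 * K \<le> N * K" using 2 by (auto intro: mult_mono)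
  then show "N < R" "K < R" using 4 by linarith+
  then show "P + 4 < R" "100 < R" by (auto simp: P_def K_def)
  have "1 * 4 ^ J \<le> N * K * 4 ^ J" using 2 by (intro mult_right_mono) auto
  then show "4 ^ J < R" using 1 by linarith
  then show "G < R" using J_less_pow unfolding G_def by linarith
  show "1 \<le> R" by (simp add: R_def)
qed

lemma word: "8 * R ^ 5 \<le> 2 ^ w"
  using pow_word unfolding top by simp

lemma R_pow: "R \<le> R ^ 5" "R * R \<le> R ^ 5" "R * R * R \<le> R ^ 5"
proof -
  have "R ^ i \<le> R ^ 5" if "i \<le> 5" for i using R_large(11) that by (intro power_increasing)
  from this[of 1] this[of 2] this[of 3]
  show "R \<le> R ^ 5" "R * R \<le> R ^ 5" "R * R * R \<le> R ^ 5"
    by (simp_all add: power2_eq_square power3_eq_cube)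
qed

lemma encx_ok:
  assumes "\<sigma> (V Radix) = R" "ok w B \<sigma> t" "ok w B \<sigma> a" "ok w B \<sigma> b" "ok w B \<sigma> c" "ok w B \<sigma> d"
    and "ev \<sigma> t < R" "ev \<sigma> a < R" "ev \<sigma> b < R" "ev \<sigma> c < R" "ev \<sigma> d < R"
  shows "ok w B \<sigma> (encx t a b c d)"
proof -
  have "R ^ 5 \<le> 2 ^ w" using word by linarith
  then have *: "x < 2 ^ w" if "x < R ^ 5" for x using that by (rule less_le_trans[rotated])
  note e = enc_bound[OF assms(7-11), THEN *]
  show ?thesis using assms e by (simp add: encx_def enc_def)
qed

section \<open>The key set and its changes\<close>

lemma k_eq:
  "t \<in> U \<Longrightarrow> t' \<in> U \<Longrightarrow> k0 t = k0 t' \<longleftrightarrow> t = t'"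
  "t \<in> U \<Longrightarrow> t' \<in> U \<Longrightarrow> v < R \<Longrightarrow> v' < R \<Longrightarrow> k1 v t = k1 v' t' \<longleftrightarrow> v = v' \<and> t = t'"
  "x < N \<Longrightarrow> x' < N \<Longrightarrow> k2 x = k2 x' \<longleftrightarrow> x = x'"
  "x < N \<Longrightarrow> x' < N \<Longrightarrow> v < R \<Longrightarrow> v' < R \<Longrightarrow> k3 v x = k3 v' x' \<longleftrightarrow> v = v' \<and> x = x'"
  "t \<in> U \<Longrightarrow> t' \<in> U \<Longrightarrow> v < R \<Longrightarrow> k0 t \<noteq> k1 v t'" "t \<in> U \<Longrightarrow> t' \<in> U \<Longrightarrow> v < R \<Longrightarrow> k1 v t' \<noteq> k0 t"
  "t \<in> U \<Longrightarrow> x < N \<Longrightarrow> k0 t \<noteq> k2 x" "t \<in> U \<Longrightarrow> x < N \<Longrightarrow> k2 x \<noteq> k0 t"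
  "t \<in> U \<Longrightarrow> x < N \<Longrightarrow> v < R \<Longrightarrow> k0 t \<noteq> k3 v x" "t \<in> U \<Longrightarrow> x < N \<Longrightarrow> v < R \<Longrightarrow> k3 v x \<noteq> k0 t"
  "t \<in> U \<Longrightarrow> v < R \<Longrightarrow> x < N \<Longrightarrow> k1 v t \<noteq> k2 x" "t \<in> U \<Longrightarrow> v < R \<Longrightarrow> x < N \<Longrightarrow> k2 x \<noteq> k1 v t"
  "t \<in> U \<Longrightarrow> v < R \<Longrightarrow> x < N \<Longrightarrow> v' < R \<Longrightarrow> k1 v t \<noteq> k3 v' x"
  "t \<in> U \<Longrightarrow> v < R \<Longrightarrow> x < N \<Longrightarrow> v' < R \<Longrightarrow> k3 v' x \<noteq> k1 v t"
  "x < N \<Longrightarrow> x' < N \<Longrightarrow> v < R \<Longrightarrow> k2 x' \<noteq> k3 v x" "x < N \<Longrightarrow> x' < N \<Longrightarrow> v < R \<Longrightarrow> k3 v x \<noteq> k2 x'"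
  using R_large(2,3,11) by (auto simp: k0_def k1_def k2_def k3_def U_def enc_eq)

text \<open>Removing the old key must not remove anything else; here the injectivity of the encoding
  and the disjointness of the kinds enter.\<close>

lemma ks_rekey:
  assumes "A \<subseteq> U" "\<And>t. t \<in> A \<Longrightarrow> g t < R" "D \<subseteq> {..<N}" "\<And>x. x < N \<Longrightarrow> f x < R" "t \<in> A" "v < R"
  shows "insert (k1 v t) (ks A g D f - {k1 (g t) t}) = ks A (g(t := v)) D f"
proof -
  have U: "\<And>t. t \<in> A \<Longrightarrow> t \<in> U" "\<And>x. x \<in> D \<Longrightarrow> x < N" using assms by auto
  have gt: "g t < R" "t \<in> U" using U assms by auto
  have i: "s = t" if "s \<in> A" "k1 (g s) s = k1 (g t) t" for s
    using k_eq(2)[OF U(1)[OF that(1)] gt(2) assms(2)[OF that(1)] gt(1)] that(2) by simp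
  define X where "X = k0 ` A \<union> k2 ` D \<union> {k3 (f x) x | x. x < N \<and> f x \<noteq> 0}"
  have ks: "ks A h D f = X \<union> (\<lambda>t. k1 (h t) t) ` A" for h by (simp add: ks_def X_def Un_ac)
  have 1: "(\<lambda>t. k1 (g t) t) ` A - {k1 (g t) t} = (\<lambda>t. k1 (g t) t) ` (A - {t})"
    using i by auto
  have "(\<lambda>s. k1 ((g(t := v)) s) s) ` insert t (A - {t}) = insert (k1 v t) ((\<lambda>t. k1 (g t) t) ` (A - {t}))"
    by (auto intro!: image_cong simp del: insert_Diff_single)
  then have 2: "(\<lambda>s. k1 ((g(t := v)) s) s) ` A = insert (k1 v t) ((\<lambda>t. k1 (g t) t) ` (A - {t}))"
    using assms(5) by (simp only: insert_Diff)
  have 3: "k1 (g t) t \<notin> X"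
    using k_eq(6)[OF U(1) gt(2,1)] k_eq(11)[OF gt(2,1) U(2)] k_eq(13)[OF gt(2,1) _ assms(4)]
    unfolding X_def by blast
  have "insert (k1 v t) (X \<union> (\<lambda>t. k1 (g t) t) ` A - {k1 (g t) t})
      = X \<union> insert (k1 v t) ((\<lambda>t. k1 (g t) t) ` A - {k1 (g t) t})" using 3 by blast
  then show ?thesis unfolding ks 1 2 .
qed

lemma ks_remove:
  assumes "A \<subseteq> U" "\<And>t. t \<in> A \<Longrightarrow> g t < R" "D \<subseteq> {..<N}" "\<And>x. x < N \<Longrightarrow> f x < R" "t \<in> A"
  shows "ks A g D f - {k0 t} - {k1 (g t) t} = ks (A - {t}) g D f" "k1 (g t) t \<noteq> k0 t"
proof -
  have U: "\<And>t. t \<in> A \<Longrightarrow> t \<in> U" "\<And>x. x \<in> D \<Longrightarrow> x < N" using assms by auto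
  have gt: "g t < R" "t \<in> U" using U assms by auto
  have i: "s = t" if "s \<in> A" "k1 (g s) s = k1 (g t) t" for s
    using k_eq(2)[OF U(1)[OF that(1)] gt(2) assms(2)[OF that(1)] gt(1)] that(2) by simp
  have i': "s = t" if "s \<in> A" "k0 s = k0 t" for s
    using k_eq(1)[OF U(1)[OF that(1)] gt(2)] that(2) by simp
  have "(\<lambda>t. k1 (g t) t) ` A - {k1 (g t) t} = (\<lambda>t. k1 (g t) t) ` (A - {t})" "k0 ` A - {k0 t} = k0 ` (A - {t})"
    using i i' by auto
  moreover have "k1 (g t) t \<notin> k0 ` A \<union> k2 ` D \<union> {k3 (f x) x | x. x < N \<and> f x \<noteq> 0}"
    "k0 t \<notin> (\<lambda>t. k1 (g t) t) ` A \<union> k2 ` D \<union> {k3 (f x) x | x. x < N \<and> f x \<noteq> 0}"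
    using k_eq(6)[OF U(1) gt(2,1)] k_eq(11)[OF gt(2,1) U(2)] k_eq(13)[OF gt(2,1) _ assms(4)]
      k_eq(5)[OF gt(2) U(1) assms(2)] k_eq(7)[OF gt(2) U(2)] k_eq(9)[OF gt(2) _ assms(4)] by blast+
  ultimately show "ks A g D f - {k0 t} - {k1 (g t) t} = ks (A - {t}) g D f" unfolding ks_def by blast
  show "k1 (g t) t \<noteq> k0 t" using k_eq(6)[OF gt(2) gt(2,1)] .
qed

lemma ks_clean:
  assumes "A \<subseteq> U" "\<And>t. t \<in> A \<Longrightarrow> g t < R" "D \<subseteq> {..<N}" "\<And>x. x < N \<Longrightarrow> f x < R" "x \<in> D"
  shows "ks A g D f - {k2 x} = ks A g (D - {x}) f"
proof -
  have U: "\<And>t. t \<in> A \<Longrightarrow> t \<in> U" "\<And>x. x \<in> D \<Longrightarrow> x < N" using assms by auto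
  have "k2 ` D - {k2 x} = k2 ` (D - {x})" using U assms by (auto simp: k_eq)
  moreover have "k2 x \<notin> k0 ` A \<union> (\<lambda>t. k1 (g t) t) ` A \<union> {k3 (f x) x | x. x < N \<and> f x \<noteq> 0}"
    using U assms by (auto simp: k_eq)
  ultimately show ?thesis unfolding ks_def by blast
qed

lemma ks_value:
  assumes "A \<subseteq> U" "\<And>t. t \<in> A \<Longrightarrow> g t < R" "D \<subseteq> {..<N}" "\<And>x. x < N \<Longrightarrow> f x < R" "x < N"
  shows "f x \<noteq> 0 \<Longrightarrow> ks A g D f - {k3 (f x) x} = ks A g D (f(x := 0))"
    "f x = 0 \<Longrightarrow> v \<noteq> 0 \<Longrightarrow> insert (k3 v x) (ks A g D f) = ks A g D (f(x := v))"
proof -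
  have U: "\<And>t. t \<in> A \<Longrightarrow> t \<in> U" "\<And>x. x \<in> D \<Longrightarrow> x < N" using assms by auto
  show "ks A g D f - {k3 (f x) x} = ks A g D (f(x := 0))" if "f x \<noteq> 0"
  proof -
    have i: "z = x" if "z < N" "k3 (f z) z = k3 (f x) x" for z
      using that k_eq(4)[of z x] assms by auto
    have "{k3 (f x) x | x. x < N \<and> f x \<noteq> 0} - {k3 (f x) x}
        = (\<lambda>z. k3 (f z) z) ` ({z. z < N \<and> f z \<noteq> 0} - {x})"
      using i by auto
    also have "\<dots> = (\<lambda>z. k3 ((f(x := 0)) z) z) ` {z. z < N \<and> (f(x := 0)) z \<noteq> 0}"
      by (intro image_cong) auto
    also have "\<dots> = {k3 ((f(x := 0)) z) z | z. z < N \<and> (f(x := 0)) z \<noteq> 0}" by blast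
    finally have "{k3 (f x) x | x. x < N \<and> f x \<noteq> 0} - {k3 (f x) x} = {k3 ((f(x := 0)) z) z | z. z < N \<and> (f(x := 0)) z \<noteq> 0}" .
    moreover have "k3 (f x) x \<notin> k0 ` A \<union> (\<lambda>t. k1 (g t) t) ` A \<union> k2 ` D"
      using U assms by (auto simp: k_eq)
    ultimately show ?thesis unfolding ks_def by blast
  qed
  show "insert (k3 v x) (ks A g D f) = ks A g D (f(x := v))" if "f x = 0" "v \<noteq> 0"
  proof -
    have "{k3 ((f(x := v)) z) z | z. z < N \<and> (f(x := v)) z \<noteq> 0}
        = (\<lambda>z. k3 ((f(x := v)) z) z) ` insert x {z. z < N \<and> f z \<noteq> 0}"
      using assms(5) that by auto
    also have "\<dots> = insert (k3 v x) ((\<lambda>z. k3 ((f(x := v)) z) z) ` {z. z < N \<and> f z \<noteq> 0})" by simp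
    also have "(\<lambda>z. k3 ((f(x := v)) z) z) ` {z. z < N \<and> f z \<noteq> 0} = (\<lambda>z. k3 (f z) z) ` {z. z < N \<and> f z \<noteq> 0}"
      using that by (intro image_cong) auto
    also have "(\<lambda>z. k3 (f z) z) ` {z. z < N \<and> f z \<noteq> 0} = {k3 (f x) x | x. x < N \<and> f x \<noteq> 0}" by blast
    finally have "{k3 ((f(x := v)) z) z | z. z < N \<and> (f(x := v)) z \<noteq> 0} = insert (k3 v x) {k3 (f x) x | x. x < N \<and> f x \<noteq> 0}" .
    then show ?thesis unfolding ks_def by blast
  qed
qed

lemma ks_card:
  assumes "finite A" "D \<subseteq> {..<N}"
  shows "finite (ks A g D f)" "card (ks A g D f) \<le> 2 * card A + 2 * N"
proof -
  have e: "{k3 (f x) x | x. x < N \<and> f x \<noteq> 0} = (\<lambda>x. k3 (f x) x) ` {x. x < N \<and> f x \<noteq> 0}" by auto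
  have fD: "finite D" using assms(2) finite_subset by blast
  then show "finite (ks A g D f)" using assms by (simp add: ks_def e)
  have "card (k0 ` A) \<le> card A" "card ((\<lambda>t. k1 (g t) t) ` A) \<le> card A" "card (k2 ` D) \<le> card D"
    using assms fD by (auto intro: card_image_le)
  moreover have "card D \<le> N" using card_mono[OF _ assms(2)] by simp
  moreover have "card ((\<lambda>x. k3 (f x) x) ` {x. x < N \<and> f x \<noteq> 0}) \<le> card {x. x < N \<and> f x \<noteq> 0}"
    by (intro card_image_le) auto
  moreover have "card {x. x < N \<and> f x \<noteq> 0} \<le> card {..<N}" by (intro card_mono) auto
  moreover have "card (ks A g D f) \<le> card (k0 ` A) + card ((\<lambda>t. k1 (g t) t) ` A) + card (k2 ` D)
      + card ((\<lambda>x. k3 (f x) x) ` {x. x < N \<and> f x \<noteq> 0})"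
    unfolding ks_def e using card_Un_le by (meson add_le_mono1 le_trans)
  ultimately show "card (ks A g D f) \<le> 2 * card A + 2 * N" by simp
qed

lemma cap:
  assumes "finite A" "D \<subseteq> {..<N}" "card A \<le> ub" "S \<subseteq> ks A g D f"
  shows "1 + (40 * J + 80) * card S \<le> NB"
proof -
  have "card S \<le> 2 * ub + 2 * N" using card_mono[OF ks_card(1)[OF assms(1,2)] assms(4)] ks_card(2)[OF assms(1,2), of g f] assms(3)
    by linarith
  moreover have "2 * N = 4 * n * (2 * J + 1)" by (simp add: N_def G_def)
  ultimately have "card S \<le> 2 * ub + 4 * n * (2 * J + 1)" by linarith
  then have "(40 * J + 80) * card S \<le> (40 * J + 80) * (2 * ub + 4 * n * (2 * J + 1))"
    by (rule mult_left_mono) simp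
  then show ?thesis using NB_cap by linarith
qed

lemma ks_E:
  assumes "A \<subseteq> U" "\<And>t. t \<in> A \<Longrightarrow> g t < R" "D \<subseteq> {..<N}" "\<And>x. x < N \<Longrightarrow> f x < R" "k \<in> ks A g D f"
  obtains x y j where "(x, y, j) \<in> A" "k = enc R 0 x y j 0" "x < R" "y < R" "j < R"
  | x y j where "(x, y, j) \<in> A" "k = enc R 1 y (g (x, y, j)) x j" "x < R" "y < R" "j < R" "g (x, y, j) < R"
  | x where "x \<in> D" "k = enc R 2 x 0 0 0" "x < R"
  | x where "x < N" "f x \<noteq> 0" "k = enc R 3 (f x) x 0 0" "x < R" "f x < R"
proof -
  have U: "x < R \<and> y < R \<and> j < R" if "(x, y, j) \<in> A" for x y j
    using that assms(1) R_large(2,3) by (auto simp: U_def)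
  have D: "x < R" if "x \<in> D" for x using that assms(3) R_large(2) by auto
  have N: "x < R" if "x < N" for x using that R_large(2) by simp
  from assms(5) consider x y j where "(x, y, j) \<in> A" "k = k0 (x, y, j)"
    | x y j where "(x, y, j) \<in> A" "k = k1 (g (x, y, j)) (x, y, j)" | x where "x \<in> D" "k = k2 x"
    | x where "x < N" "f x \<noteq> 0" "k = k3 (f x) x"
    unfolding ks_def by auto
  then show ?thesis
  proof cases
    case 1 then show ?thesis using U that(1) by (simp add: k0_def)
  next
    case 2 then show ?thesis using U assms(2) that(2) by (simp add: k1_def)
  next
    case 3 then show ?thesis using D that(3) by (simp add: k2_def)
  next
    case 4 then show ?thesis using N assms(4) that(4) by (simp add: k3_def)
  qed
qed

text \<open>Like the three lemmas that follow, this turns a key found by a predecessor search in an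
  interval of one kind back into the unit or node that it encodes.\<close>

lemma ks_range0:
  assumes "A \<subseteq> U" "\<And>t. t \<in> A \<Longrightarrow> g t < R" "D \<subseteq> {..<N}" "\<And>x. x < N \<Longrightarrow> f x < R"
    and k: "k \<in> ks A g D f" "enc R 0 x 0 0 0 \<le> k" "k < enc R 0 (x + 1) 0 0 0" "x < N"
  shows "\<exists>t\<in>A. fst t = x \<and> k = k0 t"
proof -
  have b: "0 < R" using R_large(11) by simp
  have c: "x + 1 < R" using k(4) R_large(2) by simp
  from ks_E[OF assms(1-4) k(1)] show ?thesis
    using k(2-) b c by cases (force simp: k0_def k1_def k2_def k3_def enc_less enc_le)+
qed

lemma ks_range1:
  assumes "A \<subseteq> U" "\<And>t. t \<in> A \<Longrightarrow> g t < R" "D \<subseteq> {..<N}" "\<And>x. x < N \<Longrightarrow> f x < R"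
    and k: "k \<in> ks A g D f" "enc R 1 y 0 0 0 \<le> k" "k < enc R 1 (y + 1) 0 0 0" "y < N"
  shows "\<exists>t\<in>A. fst (snd t) = y \<and> k = k1 (g t) t"
proof -
  have b: "0 < R" using R_large(11) by simp
  have c: "y + 1 < R" using k(4) R_large(2) by simp
  from ks_E[OF assms(1-4) k(1)] show ?thesis
    using k(2-) b c by cases (force simp: k0_def k1_def k2_def k3_def enc_less enc_le)+
qed

lemma ks_range2:
  assumes "A \<subseteq> U" "\<And>t. t \<in> A \<Longrightarrow> g t < R" "D \<subseteq> {..<N}" "\<And>x. x < N \<Longrightarrow> f x < R"
    and k: "k \<in> ks A g D f" "enc R 2 0 0 0 0 \<le> k" "k < enc R 3 0 0 0 0"
  shows "\<exists>x\<in>D. k = k2 x"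
proof -
  have b: "0 < R" using R_large(11) by simp
  have c: "0 < R" using R_large(11) by simp
  from ks_E[OF assms(1-4) k(1)] show ?thesis
    using k(2-) b c by cases (force simp: k0_def k1_def k2_def k3_def enc_less enc_le)+
qed

lemma ks_range3:
  assumes "A \<subseteq> U" "\<And>t. t \<in> A \<Longrightarrow> g t < R" "D \<subseteq> {..<N}" "\<And>x. x < N \<Longrightarrow> f x < R"
    and k: "k \<in> ks A g D f" "enc R 3 0 0 0 0 \<le> k"
  shows "\<exists>x<N. f x \<noteq> 0 \<and> k = k3 (f x) x"
proof -
  have b: "0 < R" using R_large(11) by simp
  have c: "0 < R" using R_large(11) by simp
  from ks_E[OF assms(1-4) k(1)] show ?thesis
    using k(2-) b c by cases (force simp: k0_def k1_def k2_def k3_def enc_less enc_le)+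
qed

end

section \<open>Published loads\<close>

context graph_machine
begin

lemma index: "x < N \<Longrightarrow> x < B" "e < G \<Longrightarrow> e < B"
proof -
  define z where "z = 2 * ub + 4 * n * (2 * J + 1)"
  have "2 * N \<le> z" by (simp add: N_def G_def z_def)
  moreover have "1 * z \<le> (40 * J + 80) * z" by (intro mult_right_mono) auto
  ultimately have "2 * N \<le> NB" using NB_cap[folded z_def] by linarith
  moreover have "G \<le> N" using n(1) by (simp add: N_def)
  ultimately show "x < N \<Longrightarrow> x < B" "e < G \<Longrightarrow> e < B" using NB by linarith+
qed

lemma G_pos: "0 < G"
  by (simp add: G_def)

lemma lg1: "1 \<le> lg"
  by (simp add: lg_def)

lemma c_do_insert:
  assumes "client_ex e" "ok w B \<sigma> e" "ev \<sigma> e = k" "k < R ^ 5" "1 + (40 * J + 80) * card (insert k S) \<le> NB"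
    and "Q (2 + real (expr_cost (code e)) + 200 * lg) (\<sigma>(V Key := k), insert k S)"
  shows "wp w B cli (do_insert e) Q (\<sigma>, S)"
  unfolding do_insert_def using assms by (intro c_intros) (auto simp: top)

lemma c_do_delete:
  assumes "client_ex e" "ok w B \<sigma> e" "ev \<sigma> e = k" "k \<in> S"
    and "Q (2 + real (expr_cost (code e)) + 250 * lg) (\<sigma>(V Key := k), S - {k})"
  shows "wp w B cli (do_delete e) Q (\<sigma>, S)"
  unfolding do_delete_def using assms by (intro c_intros) (auto simp: top)

lemma c_do_pred:
  assumes "client_ex e" "ok w B \<sigma> e" "ev \<sigma> e = k" "k < R ^ 5"
    and "Q (2 + real (expr_cost (code e)) + 300 * lg) (\<sigma>(V Key := k, V Res := below S k), S)"
  shows "wp w B cli (do_pred e) Q (\<sigma>, S)"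
  unfolding do_pred_def using assms by (intro c_intros) (auto simp: top)

lemma fixed_frame: "frame \<sigma> \<sigma>' \<Longrightarrow> fixed \<sigma>' \<longleftrightarrow> fixed \<sigma>"
  by (auto simp: frame_def fixed_def)

lemma fixed_upd: "fixed (\<sigma>(H Pub x := v)) \<longleftrightarrow> fixed \<sigma>" "fixed (\<sigma>(H Load x := v)) \<longleftrightarrow> fixed \<sigma>"
  "\<not> kept (V r) \<Longrightarrow> fixed (\<sigma>(V r := v)) \<longleftrightarrow> fixed \<sigma>" "fixed (\<sigma>(V NodeX := v)) \<longleftrightarrow> fixed \<sigma>"
  "fixed (\<sigma>(V NodeY := v)) \<longleftrightarrow> fixed \<sigma>" "fixed (\<sigma>(V Index := v)) \<longleftrightarrow> fixed \<sigma>"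
  "fixed (\<sigma>(V AnsNum := v)) \<longleftrightarrow> fixed \<sigma>" "fixed (\<sigma>(V Arg0 := v)) \<longleftrightarrow> fixed \<sigma>" "fixed (\<sigma>(V Arg1 := v)) \<longleftrightarrow> fixed \<sigma>"
  by (auto simp: fixed_def)

lemma mult_at:
  assumes "fixed \<sigma>" "client (V r)"
  shows "ok w B \<sigma> (mult_at r)" "ev \<sigma> (mult_at r) = m (\<sigma> (V r))" "client_ex (mult_at r)"
proof -
  have "\<sigma> (V r) mod G < G" using G_pos by simp
  then show "ok w B \<sigma> (mult_at r)" "ev \<sigma> (mult_at r) = m (\<sigma> (V r))"
    using assms(1) index(2) by (auto simp: fixed_def m_def)
qed (use assms in auto)

lemma value_bound: "l \<le> N * K \<Longrightarrow> l * m x < R"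
proof -
  assume "l \<le> N * K"
  then have "l * m x \<le> N * K * 4 ^ J" using m_bounds by (intro mult_mono) auto
  then show ?thesis using R_large(1) by linarith
qed

lemma F_bounds: "1 \<le> F x" "F x < R" "max (m x) (4 ^ J div m x) < R"
proof -
  have M: "max (m x) (4 ^ J div m x) \<le> 4 ^ J" using m_bounds[of x] by simp
  have "F x \<le> K * 4 ^ J" unfolding F_def K_def using M by (intro mult_mono) auto
  moreover have "1 * (K * 4 ^ J) \<le> N * (K * 4 ^ J)" using R_large(8) by (intro mult_right_mono) auto
  ultimately have "F x \<le> N * K * 4 ^ J" unfolding mult_1_left mult.assoc by (rule le_trans)
  then show "F x < R" using R_large(1) by linarith
  show "max (m x) (4 ^ J div m x) < R" using M R_large(5) by linarith
  have "1 \<le> max (m x) (4 ^ J div m x)" using m_bounds(1)[of x] by simp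
  then have "1 * 1 \<le> 32 * (J + 1) * max (m x) (4 ^ J div m x)" by (intro mult_mono) auto
  then show "1 \<le> F x" by (simp add: F_def)
qed

lemma R_less_word: "v < R \<Longrightarrow> v < 2 ^ w" "v < R ^ 5 \<Longrightarrow> v < 2 ^ w"
  using R_pow(1) word by linarith+

definition wf :: "edge_copy set \<Rightarrow> (edge_copy \<Rightarrow> nat) \<Rightarrow> nat set \<Rightarrow> (nat \<Rightarrow> nat) \<Rightarrow> bool" where
  "wf A g D f \<longleftrightarrow> A \<subseteq> U \<and> (\<forall>t\<in>A. g t < R) \<and> D \<subseteq> {..<N} \<and> (\<forall>x<N. f x < R) \<and> card A \<le> ub"

lemma wf_finite: "wf A g D f \<Longrightarrow> finite A"
  unfolding wf_def U_def by (meson finite_SigmaI finite_lessThan finite_subset)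

lemma wf_cap: "wf A g D f \<Longrightarrow> S \<subseteq> ks A g D f \<Longrightarrow> 1 + (40 * J + 80) * card S \<le> NB"
  using cap[OF wf_finite] by (auto simp: wf_def)

lemma enc_bounds: "t < 100 \<Longrightarrow> a < R \<Longrightarrow> b < R \<Longrightarrow> c < R \<Longrightarrow> d < R \<Longrightarrow> enc R t a b c d < R ^ 5"
  using enc_bound(1) R_large(7) by simp

lemma wp_publish_values:
  assumes fx: "fixed \<sigma>" and x: "\<sigma> (V NodeX) = x" "x < N"
    and l: "\<sigma> (H Load x) = l" "l \<le> N * K" and q: "\<sigma> (H Pub x) = q" "q \<le> N * K"
  shows "wp w B cli publish_values (\<lambda>u (\<sigma>', S'). u \<le> 200 \<and> frame (\<sigma>(H Pub x := l)) \<sigma>' \<and> S' = S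
    \<and> \<sigma>' (V ValOld) = q * m x \<and> \<sigma>' (V ValNew) = l * m x \<and> \<sigma>' (V Flag) = F x) (\<sigma>, S)"
proof -
  let ?\<sigma> = "\<sigma>(V ValOld := q * m x, V ValNew := l * m x, H Pub x := l, V Flag := m x, V Cursor := 4 ^ J div m x)"
  have f1: "\<sigma> (V Guesses) = G" "\<sigma> (V Pow4) = 4 ^ J" "\<sigma> (V Prec) = P"
      "\<sigma> (H Pow (x mod G)) = m x" "x mod G < B"
    using fx index(2)[of "x mod G"] G_pos by (auto simp: fixed_def m_def)
  have v: "q * m x < 2 ^ w" "l * m x < 2 ^ w" using value_bound[OF q(2)] value_bound[OF l(2)] R_less_word by auto
  have P4: "P div 4 = 32 * (J + 1)" by (simp add: P_def)
  have Fw: "32 * (J + 1) * max (m x) (4 ^ J div m x) < 2 ^ w" using F_bounds(2)[of x] R_less_word by (simp add: F_def)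
  have xB: "x < B" using index(1) x by simp
  have c1: "32 * (J + 1) * (4 ^ J div m x) < 2 ^ w" "32 * (J + 1) * (4 ^ J div m x) = F x"
    if "m x < 4 ^ J div m x" using Fw that by (auto simp: F_def max_def)
  have c2: "32 * (J + 1) * m x < 2 ^ w" "32 * (J + 1) * m x = F x"
    if "\<not> m x < 4 ^ J div m x" using Fw that by (auto simp: F_def max_def)
  show ?thesis unfolding publish_values_def
    using c1 c2 v xB small[of 4] f1 l q
    by (intro c_intros) (auto simp: x P4 frame_def simp del: mult_Suc add_Suc_right)
qed

definition keepv :: "(loc \<Rightarrow> nat) \<Rightarrow> (loc \<Rightarrow> nat) \<Rightarrow> bool" where
  "keepv \<sigma> \<sigma>' \<longleftrightarrow> frame \<sigma> \<sigma>' \<and> \<sigma>' (V ValOld) = \<sigma> (V ValOld) \<and> \<sigma>' (V ValNew) = \<sigma> (V ValNew)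
     \<and> \<sigma>' (V Flag) = \<sigma> (V Flag)"

lemma keepv_refl: "keepv \<sigma> \<sigma>"
  by (simp add: keepv_def frame_refl)

lemma keepv_upd: "r \<in> {Key, Res, Copy, Cursor, Unit} \<Longrightarrow> keepv \<sigma> (\<sigma>'(V r := v)) \<longleftrightarrow> keepv \<sigma> \<sigma>'"
  by (auto simp: keepv_def frame_upd)

lemma keepvD:
  assumes "keepv \<sigma> \<sigma>'"
  shows "frame \<sigma> \<sigma>'" "\<sigma>' (V ValOld) = \<sigma> (V ValOld)" "\<sigma>' (V ValNew) = \<sigma> (V ValNew)"
    "\<sigma>' (V Flag) = \<sigma> (V Flag)" "\<sigma>' (V NodeX) = \<sigma> (V NodeX)" "\<sigma>' (V Radix) = \<sigma> (V Radix)"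
    "\<sigma>' (V KeyTop) = \<sigma> (V KeyTop)"
  using assms by (auto simp: keepv_def frame_def)

lemma wp_publish_node:
  assumes fx: "fixed \<sigma>" and x: "\<sigma> (V NodeX) = x" "x < N" and S: "S = ks A g D f" and wf: "wf A g D f"
    and v: "\<sigma> (V ValOld) = vo" "\<sigma> (V ValNew) = vn" "\<sigma> (V Flag) = F x" "vo < R" "vn < R"
    and f: "f x = (if F x \<le> vo then vo else 0)"
  shows "wp w B cli publish_node (\<lambda>u (\<sigma>', S'). u \<le> 900 * lg \<and> frame \<sigma> \<sigma>'
    \<and> \<sigma>' (V ValOld) = vo \<and> \<sigma>' (V ValNew) = vn
    \<and> S' = ks A g (insert x D) (f(x := if F x \<le> vn then vn else 0))) (\<sigma>, S)"
proof -
  note w' = wf[unfolded wf_def]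
  define f0 where "f0 = f(x := 0)"
  define f1 where "f1 = f(x := if F x \<le> vn then vn else 0)"
  have wf0: "wf A g D f0" using w' R_large(11) by (auto simp: wf_def f0_def)
  have wf1: "wf A g D f1" "wf A g (insert x D) f1" using w' R_large(11) v(5) x(2) by (auto simp: wf_def f1_def)
  have R: "\<sigma> (V Radix) = R" using fx by (simp add: fixed_def)
  have xR: "x < R" using x(2) R_large(2) by simp
  have R0: "0 < R" using R_large(11) by simp
  have R3: "3 < R" "2 < R" using R_large(7) by auto
  have F: "F x \<noteq> 0" using F_bounds(1)[of x] by simp
  have 1: "wp w B cli (IF Reg ValOld \<lhd> Reg Flag THEN Skip
       ELSE do_delete (encx (Num 3) (Reg ValOld) (Reg NodeX) (Num 0) (Num 0)))
     (\<lambda>u (\<sigma>', S'). u \<le> 40 + 250 * lg \<and> S' = ks A g D f0 \<and> keepv \<sigma> \<sigma>') (\<sigma>, S)"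
  proof (rule c_Cond, goal_cases)
    case 3
    then have "f x = 0" using f v by (auto split: if_splits)
    then have "f0 = f" by (auto simp: f0_def)
    then show ?case using S lg1 by (intro wp_Skip) (simp add: keepv_refl)
  next
    case 4
    then have fx': "f x = vo" "vo \<noteq> 0" using f v F by (auto split: if_splits)
    then have "k3 vo x \<in> S" using x(2) unfolding S ks_def by blast
    moreover have "S - {k3 vo x} = ks A g D f0"
      using ks_value(1)[of A g D f x] w' x(2) fx' by (simp add: S f0_def)
    ultimately show ?case
      using v x xR R R0 R3 small[of 3] small[of 0]
      by (intro c_do_delete[where k = "k3 vo x"])
        (simp_all add: encx_client encx_ev encx_cost encx_ok keepv_refl keepv_upd k3_def)
  qed auto
  have 2: "wp w B cli (IF Reg ValNew \<lhd> Reg Flag THEN Skip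
       ELSE do_insert (encx (Num 3) (Reg ValNew) (Reg NodeX) (Num 0) (Num 0)))
     (\<lambda>u (\<sigma>', S'). u \<le> 40 + 250 * lg \<and> S' = ks A g D f1 \<and> keepv \<sigma> \<sigma>') (\<tau>, ks A g D f0)" if "keepv \<sigma> \<tau>" for \<tau>
  proof (rule c_Cond, goal_cases)
    case 3
    then have "f1 = f0" using v keepvD[OF that] by (auto simp: f0_def f1_def split: if_splits)
    then show ?case using lg1 that by (intro wp_Skip) simp
  next
    case 4
    then have fn: "F x \<le> vn" "vn \<noteq> 0" using v F keepvD[OF that] by (auto split: if_splits)
    have e: "insert (k3 vn x) (ks A g D f0) = ks A g D f1"
      using ks_value(2)[of A g D f0 x vn] wf0[unfolded wf_def] x(2) fn by (simp add: f0_def f1_def)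
    show ?case
      using v x xR R R0 R3 small[of 3] small[of 0] that keepvD[OF that] e wf_cap[OF wf1(1), of "ks A g D f1"] lg1
      by (intro c_do_insert[where k = "k3 vn x"])
        (simp_all add: encx_client encx_ev encx_cost encx_ok keepv_refl keepv_upd k3_def enc_bounds)
  qed auto
  have 3: "wp w B cli (do_insert (encx (Num 2) (Reg NodeX) (Num 0) (Num 0) (Num 0)))
     (\<lambda>u (\<sigma>', S'). u \<le> 40 + 250 * lg \<and> S' = ks A g (insert x D) f1 \<and> keepv \<sigma> \<sigma>') (\<tau>, ks A g D f1)" if "keepv \<sigma> \<tau>" for \<tau>
  proof -
    have "insert (k2 x) (ks A g D f1) = ks A g (insert x D) f1" by (auto simp: ks_def)
    then show ?thesis
      using v x xR R R0 R3 that keepvD[OF that] small[of 2] small[of 0] wf_cap[OF wf1(2), of "ks A g (insert x D) f1"] lg1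
      by (intro c_do_insert[where k = "k2 x"])
        (simp_all add: encx_client encx_ev encx_cost encx_ok keepv_refl keepv_upd k2_def enc_bounds)
  qed
  show ?thesis unfolding publish_node_def
  proof (rule wp_SeqI[OF 1], clarify, rule wp_SeqI[OF 2], assumption, clarify, rule wp_conseq[OF 3], assumption, goal_cases)
    case (1 u \<tau> S1 u' \<tau>' S2 u'' y)
    obtain \<sigma>' S' where "y = (\<sigma>', S')" by (cases y)
    then show ?case using 1 lg1 v keepvD by (intro exI[of _ u'']) (auto simp: f1_def)
  qed
qed

lemma k0_range:
  assumes "t \<in> U" "fst t = x" "x < N"
  shows "enc R 0 x 0 0 0 \<le> k0 t" "k0 t < enc R 0 (x + 1) 0 0 0" "k0 t < R ^ 5"
proof -
  obtain y j where t: "t = (x, y, j)" using assms(2) by (cases t) auto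
  have b: "y < R" "j < R" "x < R" "x + 1 < R" "0 < R" using assms t R_large(2,3) by (auto simp: U_def)
  show "enc R 0 x 0 0 0 \<le> k0 t" "k0 t < enc R 0 (x + 1) 0 0 0" "k0 t < R ^ 5"
    using b by (auto simp: t k0_def enc_le enc_less enc_bounds)
qed

lemma wp_publish_units:
  assumes fx: "fixed \<sigma>" and x: "\<sigma> (V NodeX) = x" "x < N" and S: "S = ks A g D f" and wf: "wf A g D f"
    and v: "\<sigma> (V ValOld) = vo" "\<sigma> (V ValNew) = vn" "vo < R" "vn < R"
    and g: "\<And>t. t \<in> A \<Longrightarrow> fst t = x \<Longrightarrow> g t = vo"
  shows "wp w B cli publish_units (\<lambda>u (\<sigma>', S'). u \<le> 1500 * lg * (1 + real (deg A x)) \<and> frame \<sigma> \<sigma>'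
    \<and> S' = ks A (\<lambda>t. if fst t = x then vn else g t) (D \<union> (fst \<circ> snd) ` {t \<in> A. fst t = x}) f) (\<sigma>, S)"
proof -
  note w' = wf[unfolded wf_def]
  define lo where "lo = enc R 0 x 0 0 0"
  define hi where "hi = enc R 0 (x + 1) 0 0 0"
  \<comment> \<open>\<open>c\<close> is the position of the downward scan. \<open>Pr c\<close> are
    the units already treated; \<open>gc c\<close> and \<open>Dc c\<close> describe the key set at
    this intermediate moment.\<close>
  define Pr where "Pr = (\<lambda>c. {t \<in> A. fst t = x \<and> c \<le> k0 t})"
  define gc where "gc = (\<lambda>c t. if t \<in> Pr c then vn else g t)"
  define Dc where "Dc = (\<lambda>c. D \<union> (fst \<circ> snd) ` Pr c)"
  have AU: "t \<in> U" if "t \<in> A" for t using that w' by auto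
  have wfc: "wf A (gc c) (Dc c) f" for c
    using w' v(4) by (auto simp: wf_def gc_def Dc_def Pr_def U_def)
  have Rs: "x < R" "x + 1 < R" "0 < R" "1 < R" "2 < R" "1 \<le> R" using x(2) R_large(2,7,11) by auto
  have lohi: "lo \<le> hi" "hi < R ^ 5" "lo < R ^ 5" using Rs by (simp_all add: lo_def hi_def enc_le enc_bounds)
  have rg: "lo \<le> k0 t" "k0 t < hi" "k0 t < R ^ 5" if "t \<in> A" "fst t = x" for t
    using k0_range[OF AU[OF that(1)] that(2) x(2)] by (auto simp: lo_def hi_def)
  define I where "I = (\<lambda>c \<tau> T. keepv \<sigma> \<tau> \<and> lo \<le> c \<and> c \<le> hi \<and> T = ks A (gc c) (Dc c) f \<and> \<tau> (V Res) = below T c)"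
  define rem where "rem = (\<lambda>c. {t \<in> A. fst t = x \<and> k0 t < c})"
  have fA: "finite A" using wf wf_finite by blast
  have kf: "\<tau> (V NodeX) = x" "\<tau> (V Radix) = R" "\<tau> (V KeyTop) = R ^ 5" "\<tau> (V ValOld) = vo" "\<tau> (V ValNew) = vn"
    if "keepv \<sigma> \<tau>" for \<tau>
    using keepvD[OF that] fx x(1) v(1,2) by (auto simp: fixed_def)
  have zw: "0 < (2::nat) ^ w" "1 < (2::nat) ^ w" "2 < (2::nat) ^ w" using small by auto
  have sumw: "R ^ 5 + lo < 2 ^ w" using word lohi(3) by linarith
  have finS: "finite (ks A (gc c) (Dc c) f)" for c using ks_card(1)[OF fA, of "Dc c"] wfc[of c] by (auto simp: wf_def)
  have loop: "wp w B cli (WHILE (Reg Res \<lhd> Reg KeyTop \<oplus> encx (Num 0) (Reg NodeX) (Num 0) (Num 0) (Num 0)) \<doteq> Num 0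
       DO publish_unit)
     (\<lambda>u (\<sigma>', S'). u \<le> 100 + 1350 * lg * real (deg A x) \<and> frame \<sigma> \<sigma>'
    \<and> S' = ks A (\<lambda>t. if fst t = x then vn else g t) (D \<union> (fst \<circ> snd) ` {t \<in> A. fst t = x}) f) (\<tau>, T)"
    if "I hi \<tau> T" for \<tau> T
  proof (rule c_While[where I = I and pot = "\<lambda>c. 1350 * lg * real (card (rem c))", OF _ that], goal_cases)
    case 1 show ?case by (simp add: encx_client)
  next
    case (2 c \<tau> T)
    then have "keepv \<sigma> \<tau>" by (simp add: I_def)
    then show ?case using kf Rs zw sumw by (simp add: encx_ok encx_ev lo_def)
  next
    case (3 c \<tau> T) then show ?case using lg1 by simp
  next
    case (4 c \<tau> T)
    then have i: "keepv \<sigma> \<tau>" "lo \<le> c" "c \<le> hi" "T = ks A (gc c) (Dc c) f" "\<tau> (V Res) = below T c"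
      by (auto simp: I_def)
    note kt = kf[OF i(1)]
    have ge: "\<not> below T c < R ^ 5 + lo" using 4(2) kt i(5) by (simp add: encx_ev lo_def split: if_splits)
    have "finite T" using i(4) finS by simp
    from below_cases[OF this i(2)] obtain k where k: "k \<in> T" "lo \<le> k" "k < c" "below T c = R ^ 5 + k"
        "\<And>k'. k' \<in> T \<Longrightarrow> k' < c \<Longrightarrow> k' \<le> k"
      using ge unfolding top by (metis (no_types, lifting))
    have "k < hi" using k(3) i(3) by simp
    then obtain t where t: "t \<in> A" "fst t = x" "k = k0 t"
      using ks_range0[of A "gc c" "Dc c" f k x] wfc[of c] k(1,2) i(4) x(2) by (auto simp: wf_def lo_def hi_def)
    obtain y j where tt: "t = (x, y, j)" using t(2) by (cases t) auto
    have yj: "y < N" "y < R" "j < R" using AU[OF t(1)] tt R_large(2,3) by (auto simp: U_def)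
    have kb: "k < R ^ 5" using rg(3)[OF t(1,2)] t(3) by simp
    have tP: "t \<notin> Pr c" using k(3) t by (simp add: Pr_def)
    have Pr': "Pr k = insert t (Pr c)"
    proof -
      have "s = t \<or> s \<in> Pr c" if "s \<in> A" "fst s = x" "k \<le> k0 s" for s
      proof (cases "c \<le> k0 s")
        case False
        have "k0 s \<in> T" using that(1) by (simp add: i(4) ks_def)
        then have "k0 s = k0 t" using k(5)[of "k0 s"] False that(3) t(3) by simp
        then show ?thesis using k_eq(1)[OF AU[OF that(1)] AU[OF t(1)]] by simp
      qed (use that in \<open>simp add: Pr_def\<close>)
      then show ?thesis using t k(3) by (auto simp: Pr_def)
    qed
    have g': "gc c t = vo" "(gc c)(t := vn) = gc k" using tP g[OF t(1,2)] Pr' by (auto simp: gc_def)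
    have D': "insert y (Dc c) = Dc k" using Pr' tt by (auto simp: Dc_def)
    have del: "k1 vo t \<in> T" using t(1) g'(1) unfolding i(4) ks_def by force
    have S1: "insert (k1 vn t) (T - {k1 vo t}) = ks A (gc k) (Dc c) f"
      using ks_rekey[of A "gc c" "Dc c" f t vn] wfc[of c] t(1) v(4) g' by (simp add: wf_def i(4))
    have S2: "insert (k2 y) (ks A (gc k) (Dc c) f) = ks A (gc k) (Dc k) f" using D' by (auto simp: ks_def)
    have sub: "ks A (gc k) (Dc c) f \<subseteq> ks A (gc k) (Dc k) f" using S2 by blast
    have cap1: "1 + (40 * J + 80) * card (insert (k1 vn t) (T - {k1 vo t})) \<le> NB"
        "1 + (40 * J + 80) * card (insert (k2 y) (ks A (gc k) (Dc c) f)) \<le> NB"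
      using wf_cap[OF wfc[of k]] sub unfolding S1 S2 by auto
    have dec: "k div (R * R) mod R = y" "k div R mod R = j"
      using enc_decode(1,2)[of y R j 0 x 0] yj Rs(1,3) by (auto simp: t(3) tt k0_def enc_decode)
    have rem': "card (rem c) = Suc (card (rem k))"
    proof -
      have "rem c = insert t (rem k)"
      proof -
        have "s = t \<or> k0 s < k" if "s \<in> A" "fst s = x" "k0 s < c" for s
        proof -
          have "k0 s \<in> T" using that(1) by (simp add: i(4) ks_def)
          then have "k0 s \<le> k" using k(5) that by simp
          then show ?thesis using k_eq(1)[OF AU[OF that(1)] AU[OF t(1)]] t(3) by auto
        qed
        then show ?thesis using t k(3) by (auto simp: rem_def)
      qed
      moreover have "t \<notin> rem k" "finite (rem k)" using t(3) fA by (auto simp: rem_def)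
      ultimately show ?thesis by simp
    qed
    define k1o where "k1o = k1 vo t"
    define k1n where "k1n = k1 vn t"
    have k1e: "enc R 1 y vo x j = k1o" "enc R 1 y vn x j = k1n" "enc R 2 y 0 0 0 = k2 y"
      by (auto simp: k1o_def k1n_def tt k1_def k2_def)
    have k1b: "k1n < R ^ 5" "k2 y < R ^ 5" using yj v Rs by (auto simp flip: k1e simp: enc_bounds)
    have RR: "R * R < 2 ^ w" "R ^ 5 + k < 2 ^ w" using R_pow(2) word R_large(7) kb by linarith+
    have fin: "wp w B cli publish_unit (\<lambda>u (\<sigma>', S'). u \<le> 1250 * lg \<and> I k \<sigma>' S') (\<tau>, T)"
      unfolding publish_unit_def
      apply (intro wp_Seq c_assign)
      apply (simp_all add: kt i(5) k(4) RR dec del: One_nat_def)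
      apply (rule c_do_delete[where k = k1o])
      apply (simp_all add: encx_client encx_ev encx_cost kt k1e yj v Rs encx_ok zw del[folded k1o_def] del: One_nat_def)
      apply (rule wp_Seq, rule c_do_insert[where k = k1n])
      apply (simp_all add: encx_client encx_ev encx_cost kt k1e yj v Rs encx_ok zw k1b cap1[folded k1o_def k1n_def] del: One_nat_def)
      apply (rule wp_Seq, rule c_do_insert[where k = "k2 y"])
      apply (simp_all add: encx_client encx_ev encx_cost kt k1e yj v Rs encx_ok zw k1b S1[folded k1o_def k1n_def] cap1 del: One_nat_def)
      apply (rule c_do_pred[where k = k])
      apply (simp_all add: kb S2)
      using i k(2,3) lg1 by (simp add: I_def keepv_upd)
    show ?case
    proof (rule wp_conseq[OF fin], goal_cases)
      case (1 u y)
      obtain \<sigma>' S' where y: "y = (\<sigma>', S')" by (cases y)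
      have "1350 * lg * real (card (rem c)) = 1350 * lg * real (card (rem k)) + 1350 * lg"
        using rem' by (simp add: algebra_simps)
      then show ?case using 1 lg1 unfolding y
        by (intro exI[of _ u] conjI order_refl) (auto intro!: exI[of _ k] simp: encx_cost)
    qed
  next
    case (5 c \<tau> T)
    then have i: "keepv \<sigma> \<tau>" "lo \<le> c" "c \<le> hi" "T = ks A (gc c) (Dc c) f" "\<tau> (V Res) = below T c"
      by (auto simp: I_def)
    note kt = kf[OF i(1)]
    have "below T c < R ^ 5 + lo" using 5(2) kt i(5) by (simp add: encx_ev lo_def split: if_splits)
    moreover have "finite T" using i(4) finS by simp
    ultimately have n: "k < lo" if "k \<in> T" "k < c" for k
      using below_cases[OF \<open>finite T\<close> i(2)] that unfolding top by (metis add_less_cancel_left not_le)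
    have all: "Pr c = {t \<in> A. fst t = x}"
    proof -
      have "c \<le> k0 t" if "t \<in> A" "fst t = x" for t
      proof (rule ccontr)
        assume "\<not> c \<le> k0 t"
        moreover have "k0 t \<in> T" using that(1) by (simp add: i(4) ks_def)
        ultimately show False using n[of "k0 t"] rg(1)[OF that] by simp
      qed
      then show ?thesis by (auto simp: Pr_def)
    qed
    have "ks A (gc c) (Dc c) f = ks A (\<lambda>t. if fst t = x then vn else g t) (D \<union> (fst \<circ> snd) ` {t \<in> A. fst t = x}) f"
      unfolding ks_def Dc_def all gc_def by (auto intro!: image_eqI)
    moreover have "rem hi = {t \<in> A. fst t = x}" using rg by (auto simp: rem_def)
    moreover have "0 \<le> 1350 * lg * real (card (rem c))" using lg1 by simp
    then have "- (1350 * lg * real (card (rem c))) \<le> 69" by linarith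
    ultimately show ?case using i(1,4) keepvD(1) lg1 by (simp add: encx_cost deg_def)
  qed
  have "\<not> hi \<le> k0 t" if "t \<in> A" "fst t = x" for t using rg(2)[OF that] by simp
  then have init: "Pr hi = {}" unfolding Pr_def by blast
  then have S0: "S = ks A (gc hi) (Dc hi) f" by (simp add: S gc_def Dc_def)
  note k = kf[OF keepv_refl]
  have 1: "wp w B cli (do_pred (encx (Num 0) (Reg NodeX \<oplus> Num 1) (Num 0) (Num 0) (Num 0)))
     (\<lambda>u (\<sigma>', S'). u \<le> 400 * lg \<and> I hi \<sigma>' S') (\<sigma>, S)"
    using S0 lohi lg1 k Rs zw x R_less_word(1)[OF Rs(2)]
    by (intro c_do_pred[where k = hi])
      (simp_all add: encx_client encx_ev encx_cost encx_ok hi_def[symmetric] I_def keepv_refl keepv_upd del: One_nat_def)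
  show ?thesis unfolding publish_units_def
  proof (rule wp_SeqI[OF 1], goal_cases)
    case (1 u y)
    obtain \<tau> T where y: "y = (\<tau>, T)" by (cases y)
    from 1 have u: "u \<le> 400 * lg" and I: "I hi \<tau> T" unfolding y prod.case by blast+
    show ?case unfolding y
    proof (rule wp_conseq[OF loop[OF I]], goal_cases)
      case (1 v z)
      have "0 \<le> lg * real (deg A x)" using lg1 by simp
      then have "400 * lg + (100 + 1350 * lg * real (deg A x)) \<le> 1500 * lg * (1 + real (deg A x))"
        using lg1 by (simp only: distrib_left mult_1_right)
      then show ?case using 1 u by (intro exI[of _ v]) (cases z, auto)
    qed
  qed
qed


section \<open>The orientation and its representation in memory\<close>

definition keys :: "edge_copy set \<Rightarrow> (nat \<Rightarrow> nat) \<Rightarrow> nat set \<Rightarrow> nat set" where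
  "keys A p D = ks A (\<lambda>t. p (fst t) * m (fst t)) D (\<lambda>x. thr x (p x))"

text \<open>The asymmetry of \<open>A\<close> says that no unit has two owners. The published loads
  \<open>p\<close> and the set \<open>D\<close> are arbitrary here; they acquire their meaning
  through \<open>near\<close> and \<open>good\<close>.\<close>

definition rep :: "(loc \<Rightarrow> nat) \<Rightarrow> nat set \<Rightarrow> edge_copy set \<Rightarrow> (nat \<Rightarrow> nat) \<Rightarrow> nat set \<Rightarrow> bool" where
  "rep \<sigma> S A p D \<longleftrightarrow> fixed \<sigma> \<and> A \<subseteq> U \<and> (\<forall>(x, y, j)\<in>A. (y, x, j) \<notin> A) \<and> card A \<le> ub \<and> D \<subseteq> {..<N}
     \<and> (\<forall>x<N. p x \<le> N * K) \<and> (\<forall>x<N. \<sigma> (H Load x) = deg A x \<and> \<sigma> (H Pub x) = p x) \<and> S = keys A p D"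

definition nbrs :: "edge_copy set \<Rightarrow> nat \<Rightarrow> nat set" where
  "nbrs A x = (fst \<circ> snd) ` {t \<in> A. fst t = x}"

definition same_regs :: "(loc \<Rightarrow> nat) \<Rightarrow> (loc \<Rightarrow> nat) \<Rightarrow> bool" where
  "same_regs \<sigma> \<sigma>' \<longleftrightarrow> (\<forall>r. kept (V r) \<longrightarrow> \<sigma>' (V r) = \<sigma> (V r))"

lemma finite_U: "finite U"
  by (simp add: U_def)

lemma deg_le: "A \<subseteq> U \<Longrightarrow> deg A x \<le> N * K"
proof -
  assume A: "A \<subseteq> U"
  have "{t \<in> A. fst t = x} \<subseteq> {x} \<times> {..<N} \<times> {..<K}" using A by (auto simp: U_def)
  then have "deg A x \<le> card ({x} \<times> {..<N} \<times> {..<K})" unfolding deg_def by (intro card_mono) auto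
  then show ?thesis by (simp add: card_cartesian_product)
qed

lemma rep_wf:
  assumes "rep \<sigma> S A p D"
  shows "wf A (\<lambda>t. p (fst t) * m (fst t)) D (\<lambda>x. thr x (p x))"
  using assms value_bound R_large(11) by (auto simp: wf_def rep_def thr_def U_def)

lemma wp_publish:
  assumes rep: "rep \<sigma> S A p D" and x: "\<sigma> (V NodeX) = x" "x < N"
  shows "wp w B cli publish (\<lambda>u (\<sigma>', S'). u \<le> 3000 * lg * (1 + real (deg A x)) \<and> same_regs \<sigma> \<sigma>'
    \<and> rep \<sigma>' S' A (p(x := deg A x)) (insert x D \<union> nbrs A x)) (\<sigma>, S)"
proof -
  let ?g = "\<lambda>t :: edge_copy. p (fst t) * m (fst t)"
  let ?f = "\<lambda>x. thr x (p x)"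
  define l where "l = deg A x"
  have r: "fixed \<sigma>" "A \<subseteq> U" "p x \<le> N * K" "\<sigma> (H Load x) = l" "\<sigma> (H Pub x) = p x" "S = ks A ?g D ?f"
    using rep x(2) by (auto simp: rep_def l_def keys_def)
  have l: "l \<le> N * K" using deg_le[OF r(2)] by (simp add: l_def)
  have vb: "p x * m x < R" "l * m x < R" using value_bound r(3) l by auto
  note wf = rep_wf[OF rep]
  have thr: "?f(x := if F x \<le> l * m x then l * m x else 0) = (\<lambda>z. thr z ((p(x := l)) z))"
    by (auto simp: thr_def fun_eq_iff)
  define f' where "f' = (\<lambda>z. thr z ((p(x := l)) z))"
  have wf': "wf A ?g (insert x D) f'"
    using wf x(2) vb(2) R_large(11) by (auto simp: wf_def f'_def thr_def)
  have nb: "nbrs A x \<subseteq> {..<N}" using r(2) by (auto simp: nbrs_def U_def)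
  show ?thesis unfolding publish_def
  proof (rule wp_SeqI[OF wp_publish_values[OF r(1) x r(4) l r(5,3)]], clarify, goal_cases)
    case (1 u1 \<sigma>1 S1)
    have f1: "fixed \<sigma>1" "\<sigma>1 (V NodeX) = x"
      using 1(2) fixed_frame[OF 1(2)] r(1) x(1) by (auto simp: fixed_upd frame_def)
    show ?case
    proof (rule wp_SeqI[OF wp_publish_node[OF f1 x(2) r(6) wf 1(3-5) vb]], goal_cases)
      case 1 show ?case by (simp add: thr_def)
    next
      case (2 u2 y)
      then obtain \<sigma>2 S2 where y: "y = (\<sigma>2, S2)" and 2: "u2 \<le> 900 * lg" "frame \<sigma>1 \<sigma>2" "\<sigma>2 (V ValOld) = p x * m x"
          "\<sigma>2 (V ValNew) = l * m x" "S2 = ks A ?g (insert x D) f'"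
        unfolding thr f'_def[symmetric] by (cases y) auto
      have f2: "fixed \<sigma>2" "\<sigma>2 (V NodeX) = x"
        using fixed_frame[OF 2(2)] f1 2(2) by (auto simp: frame_def)
      show ?case unfolding y
      proof (rule wp_conseq[OF wp_publish_units[OF f2 x(2) 2(5) wf' 2(3,4) vb]], goal_cases)
        case (1 t) then show ?case by simp
      next
        case (2 u3 z)
        then obtain \<sigma>3 S3 where z: "z = (\<sigma>3, S3)" and 3: "u3 \<le> 1500 * lg * (1 + real l)" "frame \<sigma>2 \<sigma>3"
            "S3 = ks A (\<lambda>t. if fst t = x then l * m x else ?g t) (insert x D \<union> nbrs A x) f'"
          by (cases z) (auto simp: nbrs_def l_def)
        have fr: "frame (\<sigma>(H Pub x := l)) \<sigma>3"
          using \<open>frame (\<sigma>(H Pub x := l)) \<sigma>1\<close> \<open>frame \<sigma>1 \<sigma>2\<close> 3(2) frame_trans by blast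
        have "(\<lambda>t :: edge_copy. if fst t = x then l * m x else ?g t) = (\<lambda>t. (p(x := l)) (fst t) * m (fst t))"
          by (auto simp: fun_eq_iff)
        then have "S3 = keys A (p(x := l)) (insert x D \<union> nbrs A x)" using 3(3) by (simp add: keys_def f'_def)
        moreover have "fixed \<sigma>3" using fixed_frame[OF fr] r(1) by (simp add: fixed_upd)
        ultimately have "rep \<sigma>3 S3 A (p(x := l)) (insert x D \<union> nbrs A x)"
          using rep fr l nb x(2) by (auto simp: rep_def frame_def)
        moreover have "same_regs \<sigma> \<sigma>3" using fr by (auto simp: same_regs_def frame_def)
        moreover have "u1 + (u2 + u3) \<le> 3000 * lg * (1 + real l)"
        proof -
          have "lg * 1 \<le> lg * (1 + real l)" using lg1 by (intro mult_left_mono) auto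
          then show ?thesis using \<open>u1 \<le> 200\<close> \<open>u2 \<le> 900 * lg\<close> 3(1) lg1 by linarith
        qed
        ultimately show ?case unfolding z by (intro exI[of _ u3]) (auto simp: l_def)
      qed
    qed
  qed
qed

text \<open>In \<open>good\<close>, the summand 1 in \<open>p y + 1\<close> is the unit that \<open>y\<close> would gain, and \<open>D\<close> is the set of
  nodes that have not yet been inspected.\<close>

definition near :: "edge_copy set \<Rightarrow> (nat \<Rightarrow> nat) \<Rightarrow> nat \<Rightarrow> bool" where
  "near A p x \<longleftrightarrow> real P * \<bar>real (deg A x) - real (p x)\<bar> \<le> real (p x)"

definition good :: "edge_copy set \<Rightarrow> (nat \<Rightarrow> nat) \<Rightarrow> nat set \<Rightarrow> bool" where
  "good A p D \<longleftrightarrow> (\<forall>(x, y, j)\<in>A. y \<in> D \<or> P * (p x * m x) \<le> (P + 4) * (p y + 1) * m y)"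

text \<open>The price of a node in \<open>D\<close>, and below it the price of one unit of drift
  between load and published load. Publishing a load \<open>l\<close> costs
  \<open>3000 * lg * (1 + l)\<close>, adds at most \<open>1 + l\<close> nodes at
  \<open>1500 * lg\<close> each and should leave \<open>100 * lg\<close>; this explains 4600, and
  \<open>1 + l \<le> (P + 2) * d\<close> for the drift \<open>d\<close> explains the factor
  \<open>P + 2\<close>.\<close>

definition cD :: real where "cD = 1500 * lg"
definition cL :: real where "cL = 4600 * lg * (real P + 2)"

definition pot0 :: "edge_copy set \<Rightarrow> (nat \<Rightarrow> nat) \<Rightarrow> nat set \<Rightarrow> real" where
  "pot0 A p D = cL * (\<Sum>x<N. \<bar>real (deg A x) - real (p x)\<bar>) + cD * real (card D)"

text \<open>If \<open>near\<close> fails, the drift \<open>d\<close> is a positive integer with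
  \<open>p x < P * d\<close>. The load is then less than \<open>(P + 1) * d\<close>, so the drift,
  which publishing resets to 0, pays for a pass over all owned units.\<close>

lemma publish_pot:
  assumes "x < N" "finite A" "finite D" "\<not> near A p x"
  shows "3000 * lg * (1 + real (deg A x)) + pot0 A (p(x := deg A x)) (insert x D \<union> nbrs A x) + 100 * lg \<le> pot0 A p D"
proof -
  define d where "d = \<bar>real (deg A x) - real (p x)\<bar>"
  define l where "l = real (deg A x)"
  have n: "real (p x) < real P * d" using assms(4) by (simp add: near_def d_def not_le)
  have d1: "1 \<le> d"
  proof -
    have "d \<noteq> 0" using n by auto
    then have "1 \<le> \<bar>int (deg A x) - int (p x)\<bar>" by (auto simp: d_def)
    then have "real_of_int 1 \<le> real_of_int \<bar>int (deg A x) - int (p x)\<bar>" by (simp only: of_int_le_iff)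
    then show ?thesis by (simp add: d_def)
  qed
  have "l \<le> real (p x) + d" by (simp add: l_def d_def)
  then have ld: "1 + l \<le> (real P + 2) * d" using n d1 by (simp add: algebra_simps)
  have s1: "(\<Sum>z<N. \<bar>real (deg A z) - real (p z)\<bar>) = d + (\<Sum>z\<in>{..<N} - {x}. \<bar>real (deg A z) - real (p z)\<bar>)"
    using assms(1) by (simp add: sum.remove[of "{..<N}" x] d_def)
  have s2: "(\<Sum>z<N. \<bar>real (deg A z) - real ((p(x := deg A x)) z)\<bar>)
      = (\<Sum>z\<in>{..<N} - {x}. \<bar>real (deg A z) - real (p z)\<bar>)"
    using assms(1) by (simp add: sum.remove[of "{..<N}" x])
  have "card (nbrs A x) \<le> deg A x" unfolding nbrs_def deg_def using assms(2) by (intro card_image_le) auto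
  moreover have "card (insert x D \<union> nbrs A x) \<le> Suc (card D) + card (nbrs A x)"
    using card_Un_le[of "insert x D" "nbrs A x"] card_insert_le_m1[of "Suc (card D)" D x] assms(3)
    by (simp add: card_insert_if split: if_splits)
  ultimately have cd: "real (card (insert x D \<union> nbrs A x)) \<le> real (card D) + (1 + l)" by (simp add: l_def)
  have "cD * real (card (insert x D \<union> nbrs A x)) \<le> cD * (real (card D) + (1 + l))"
    using cd lg1 by (intro mult_left_mono) (auto simp: cD_def)
  moreover have "4600 * lg * (1 + l) \<le> 4600 * lg * ((real P + 2) * d)"
    using ld lg1 by (intro mult_left_mono) auto
  moreover have "lg * 1 \<le> lg * (1 + l)" using lg1 by (intro mult_left_mono) (auto simp: l_def)
  ultimately show ?thesis
    unfolding pot0_def s1 s2 by (simp add: cD_def cL_def algebra_simps flip: l_def)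
qed

text \<open>A unit is endangered only if the value of its owner or of its other endpoint changes. If
  \<open>x\<close> is the owner, the other endpoint is in \<open>nbrs A x\<close>; if
  \<open>x\<close> is the other endpoint, \<open>x\<close> itself has been added.\<close>

lemma good_publish:
  assumes "good A p D"
  shows "good A (p(x := v)) (insert x D \<union> nbrs A x)"
  unfolding good_def
proof (rule ballI)
  fix t assume t: "t \<in> A"
  obtain x' y' j where e: "t = (x', y', j)" by (cases t)
  have "P * ((p(x := v)) x' * m x') \<le> (P + 4) * ((p(x := v)) y' + 1) * m y'" if "y' \<notin> insert x D \<union> nbrs A x"
  proof -
    have "x' \<noteq> x" "y' \<noteq> x" "y' \<notin> D" using that t e by (force simp: nbrs_def)+
    then show ?thesis using t e assms by (auto simp: good_def)
  qed
  then show "case t of (x', y', j) \<Rightarrow> y' \<in> insert x D \<union> nbrs A x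
      \<or> P * ((p(x := v)) x' * m x') \<le> (P + 4) * ((p(x := v)) y' + 1) * m y'"
    unfolding e prod.case by blast
qed

lemma wp_adjust:
  assumes rep: "rep \<sigma> S A p D" and x: "\<sigma> (V NodeX) = x" "x < N" and good: "good A p D"
  shows "wp w B cli adjust (\<lambda>u (\<sigma>', S'). \<exists>p' D'. rep \<sigma>' S' A p' D' \<and> same_regs \<sigma> \<sigma>' \<and> good A p' D'
    \<and> near A p' x \<and> (\<forall>y. y \<noteq> x \<longrightarrow> p' y = p y) \<and> u + pot0 A p' D' \<le> pot0 A p D + 100 * lg) (\<sigma>, S)"
proof -
  define l where "l = deg A x"
  define d where "d = (if l < p x then p x - l else l - p x)"
  have r: "fixed \<sigma>" "A \<subseteq> U" "p x \<le> N * K" "\<sigma> (H Load x) = l" "\<sigma> (H Pub x) = p x" "D \<subseteq> {..<N}"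
    using rep x(2) by (auto simp: rep_def l_def keys_def)
  have l: "l \<le> N * K" using deg_le[OF r(2)] by (simp add: l_def)
  have dR: "d < R" "p x < R" "l < R" using r(3) l R_large(10) by (auto simp: d_def)
  have rd: "real d = \<bar>real l - real (p x)\<bar>" by (auto simp: d_def)
  have "P * d \<le> R * R" using dR R_large(4) by (intro mult_mono) auto
  moreover have "0 < R ^ 5" using R_large(11) by simp
  ultimately have Pd: "P * d < 2 ^ w" using R_pow(2) word by linarith
  have near: "near A p x \<longleftrightarrow> \<not> p x < P * d"
    unfolding near_def l_def[symmetric] rd[symmetric] not_less of_nat_mult[symmetric] of_nat_le_iff ..
  let ?\<sigma> = "\<sigma>(V Flag := d)"
  have rep': "rep ?\<sigma> S A p D" using rep by (auto simp: rep_def fixed_upd)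
  have fin: "finite A" "finite D" using r(2,6) finite_U finite_subset by auto
  have sr: "same_regs \<sigma> ?\<sigma>" by (simp add: same_regs_def)
  have 1: "wp w B cli (IF Elem Load (Reg NodeX) \<lhd> Elem Pub (Reg NodeX)
       THEN (Flag ::= Elem Pub (Reg NodeX) \<ominus> Elem Load (Reg NodeX))
       ELSE (Flag ::= Elem Load (Reg NodeX) \<ominus> Elem Pub (Reg NodeX)))
     (\<lambda>u (\<sigma>', S'). u \<le> 50 \<and> \<sigma>' = ?\<sigma> \<and> S' = S) (\<sigma>, S)"
    using r x index(1)[OF x(2)] R_less_word(1)[OF dR(2)] R_less_word(1)[OF dR(3)]
    by (intro c_intros) (auto simp: d_def)
  show ?thesis unfolding adjust_def
  proof (rule wp_SeqI[OF 1], clarify, rule c_Cond, goal_cases)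
    case (3 u a b)
    then have "p x < P * d" using r x by (simp add: fixed_def split: if_splits)
    then have nn: "\<not> near A p x" using near by simp
    have x': "?\<sigma> (V NodeX) = x" using x by simp
    show ?case
    proof (rule wp_conseq[OF wp_publish[OF rep' x' x(2)]], goal_cases)
      case (1 v y)
      obtain \<sigma>' S' where y: "y = (\<sigma>', S')" by (cases y)
      from 1 have 1: "v \<le> 3000 * lg * (1 + real (deg A x))" "same_regs ?\<sigma> \<sigma>'"
          "rep \<sigma>' S' A (p(x := deg A x)) (insert x D \<union> nbrs A x)"
        unfolding y prod.case by blast+
      have "near A (p(x := deg A x)) x" by (simp add: near_def)
      moreover have "same_regs \<sigma> \<sigma>'" using 1(2) by (simp add: same_regs_def)
      ultimately show ?case unfolding y prod.case
        using 1 publish_pot[OF x(2) fin nn] \<open>u \<le> 50\<close> lg1 good_publish[OF good]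
        by (intro exI[of _ v] conjI order_refl exI[of _ "p(x := deg A x)"] exI[of _ "insert x D \<union> nbrs A x"]) auto
    qed
  next
    case (4 u a b)
    then have "\<not> p x < P * d" using r x by (simp add: fixed_def split: if_splits)
    then show ?case using near rep' sr good lg1 \<open>u \<le> 50\<close>
      by (intro wp_Skip) (auto intro!: exI[of _ p] exI[of _ D])
  qed (use r x index(1)[OF x(2)] Pd in \<open>auto simp: fixed_def\<close>)
qed

end

section \<open>Restoring local optimality\<close>

definition add_unit :: "reg \<Rightarrow> reg \<Rightarrow> reg \<Rightarrow> com" where
  "add_unit x y v =
     (do_insert (encx (Num 0) (Reg x) (Reg y) (Reg Copy) (Num 0)) ;;
      do_insert (encx (Num 1) (Reg y) (Reg v) (Reg x) (Reg Copy)) ;;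
      put Load (Reg x) (Elem Load (Reg x) \<oplus> Num 1))"

definition del_unit :: "reg \<Rightarrow> reg \<Rightarrow> reg \<Rightarrow> com" where
  "del_unit x y v =
     (do_delete (encx (Num 0) (Reg x) (Reg y) (Reg Copy) (Num 0)) ;;
      do_delete (encx (Num 1) (Reg y) (Reg v) (Reg x) (Reg Copy)) ;;
      put Load (Reg x) (Elem Load (Reg x) \<ominus> Num 1))"

text \<open>\<open>adjust\<close> acts on \<open>NodeX\<close>, hence the second call after copying
  \<open>NodeY\<close>. \<open>ValOld\<close> and \<open>ValNew\<close> hold the published values of
  the two endpoints, which occur in the keys of kind 1.\<close>

definition flip :: com where
  "flip = (del_unit NodeX NodeY ValOld ;; add_unit NodeY NodeX ValNew ;; adjust ;;
     NodeX ::= Reg NodeY ;; adjust)"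

definition fetch_dirty :: com where
  "fetch_dirty =
     (NodeY ::= (Reg Res \<ominus> Reg KeyTop) \<oslash> (Reg Radix \<otimes> Reg Radix \<otimes> Reg Radix) \<odot> Reg Radix ;;
      do_pred (encx (Num 1) (Reg NodeY \<oplus> Num 1) (Num 0) (Num 0) (Num 0)))"

text \<open>The preceding search yields, among the units whose other endpoint is
  \<open>NodeY\<close>, one with the largest published value of its owner. The test is monotone in
  this value, so one comparison settles the node.\<close>

definition compare_best :: com where
  "compare_best =
      (IF Reg Res \<lhd> Reg KeyTop \<oplus> encx (Num 1) (Reg NodeY) (Num 0) (Num 0) (Num 0) THEN (Flag ::= Num 0)
       ELSE
        (Cursor ::= Reg Res \<ominus> Reg KeyTop ;;
         ValOld ::= Reg Cursor \<oslash> (Reg Radix \<otimes> Reg Radix) \<odot> Reg Radix ;;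
         NodeX ::= Reg Cursor \<oslash> Reg Radix \<odot> Reg Radix ;;
         Copy ::= Reg Cursor \<odot> Reg Radix ;;
         ValNew ::= Elem Pub (Reg NodeY) \<otimes> mult_at NodeY ;;
         Flag ::= ((Reg Prec \<oplus> Num 4) \<otimes> ((Elem Pub (Reg NodeY) \<oplus> Num 1) \<otimes> mult_at NodeY)
           \<lhd> Reg Prec \<otimes> Reg ValOld)))"

definition inspect :: com where
  "inspect = (fetch_dirty ;; compare_best)"

text \<open>A node with a violation stays marked after the flip and is examined again; it is
  unmarked only when no unit violates the condition at it.\<close>

definition settle :: com where
  "settle =
     (do_pred (encx (Num 3) (Num 0) (Num 0) (Num 0) (Num 0)) ;;
      (WHILE (Reg Res \<lhd> Reg KeyTop \<oplus> encx (Num 2) (Num 0) (Num 0) (Num 0) (Num 0)) \<doteq> Num 0 DO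
        (inspect ;;
         (IF Reg Flag THEN flip ELSE do_delete (encx (Num 2) (Reg NodeY) (Num 0) (Num 0) (Num 0))) ;;
         do_pred (encx (Num 3) (Num 0) (Num 0) (Num 0) (Num 0)))))"

context graph_machine
begin

definition but_key :: "(loc \<Rightarrow> nat) \<Rightarrow> (loc \<Rightarrow> nat) \<Rightarrow> bool" where
  "but_key \<sigma> \<sigma>' \<longleftrightarrow> (\<forall>r. r \<noteq> Key \<longrightarrow> \<sigma>' (V r) = \<sigma> (V r))"

lemma deg_insert: "finite A \<Longrightarrow> (x, y, j) \<notin> A \<Longrightarrow> deg (insert (x, y, j) A) z = deg A z + (if z = x then 1 else 0)"
proof -
  assume a: "finite A" "(x, y, j) \<notin> A"
  have "{t \<in> insert (x, y, j) A. fst t = z} = (if z = x then insert (x, y, j) {t \<in> A. fst t = z} else {t \<in> A. fst t = z})"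
    by auto
  then show ?thesis using a by (simp add: deg_def)
qed

lemma deg_remove: "finite A \<Longrightarrow> (x, y, j) \<in> A \<Longrightarrow> deg A z = deg (A - {(x, y, j)}) z + (if z = x then 1 else 0)"
  using deg_insert[of "A - {(x, y, j)}" x y j z] by (simp add: insert_absorb)

lemma enc_fields:
  assumes "x < N" "y < N" "j < K"
  shows "x < R" "y < R" "j < R" "(0::nat) < R"
  using assms R_large(2,3,11) by auto

lemma wp_add_unit:
  assumes rep: "rep \<sigma> S A p D" and r: "\<sigma> (V rx) = x" "\<sigma> (V ry) = y" "\<sigma> (V Copy) = j" "\<sigma> (V rv) = p x * m x"
    and b: "x < N" "y < N" "j < K" "(x, y, j) \<notin> A" "(y, x, j) \<notin> A" "x \<noteq> y" "card A < ub"
    and c: "client (V rx)" "client (V ry)" "client (V rv)" "rx \<noteq> Key" "ry \<noteq> Key" "rv \<noteq> Key"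
  shows "wp w B cli (add_unit rx ry rv) (\<lambda>u (\<sigma>', S'). u \<le> 550 * lg \<and> but_key \<sigma> \<sigma>'
    \<and> rep \<sigma>' S' (insert (x, y, j) A) p D) (\<sigma>, S)"
proof -
  define A' where "A' = insert (x, y, j) A"
  have q: "fixed \<sigma>" "A \<subseteq> U" "p x \<le> N * K" "\<sigma> (H Load x) = deg A x" "S = keys A p D" "\<sigma> (V Radix) = R"
    using rep b by (auto simp: rep_def fixed_def)
  have fin: "finite A" using q(2) finite_U finite_subset by blast
  have A': "A' \<subseteq> U" "card A' \<le> ub" using q(2) b fin by (auto simp: A'_def U_def)
  have wf: "wf A' (\<lambda>t. p (fst t) * m (fst t)) D (\<lambda>x. thr x (p x))"
    using rep_wf[OF rep] A' value_bound[OF q(3)] by (auto simp: wf_def A'_def)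
  define kx where "kx = k0 (x, y, j)"
  define ky where "ky = k1 (p x * m x) (x, y, j)"
  have S': "insert ky (insert kx S) = keys A' p D"
    by (auto simp: q(5) keys_def ks_def A'_def kx_def ky_def)
  have cap: "1 + (40 * J + 80) * card (insert kx S) \<le> NB" "1 + (40 * J + 80) * card (insert ky (insert kx S)) \<le> NB"
    using wf_cap[OF wf, folded keys_def] S' by blast+
  note f = enc_fields[OF b(1-3)]
  have v: "p x * m x < R" using value_bound[OF q(3)] .
  have e: "enc R 0 x y j 0 = kx" "enc R 1 y (p x * m x) x j = ky" by (auto simp: kx_def ky_def k0_def k1_def)
  have kb: "kx < R ^ 5" "ky < R ^ 5" using f v R_large(7) by (auto simp flip: e simp: enc_bounds)
  have zw: "0 < (2::nat) ^ w" "1 < (2::nat) ^ w" "1 < R" using small R_large(7) by auto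
  have d: "deg A x < 2 ^ w" "deg A x + 1 < 2 ^ w"
    using deg_le[OF q(2), of x] R_large(10) R_less_word word R_pow(1) by linarith+
  let ?\<sigma> = "\<sigma>(V Key := ky, H Load x := deg A x + 1)"
  have "rep ?\<sigma> (keys A' p D) A' p D"
    using rep A' b by (auto simp: rep_def fixed_upd A'_def deg_insert[OF fin b(4)])
  then have fin': "rep ?\<sigma> (insert ky (insert kx S)) (insert (x, y, j) A) p D" unfolding S' A'_def .
  have bk: "but_key \<sigma> ?\<sigma>" by (simp add: but_key_def)
  have upd: "\<sigma>(V Key := kx, V Key := ky, H Load x := deg A x + 1) = ?\<sigma>" by simp
  note c' = c[simplified]
  show ?thesis unfolding add_unit_def
    apply (rule wp_Seq, rule c_do_insert[where k = kx])
    apply (simp_all add: encx_client encx_ev encx_cost encx_ok c' r q(6) f e v zw kb cap del: One_nat_def)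
    apply (rule wp_Seq, rule c_do_insert[where k = ky])
    apply (simp_all add: encx_client encx_ev encx_cost encx_ok c' r q(6) f e v zw kb cap del: One_nat_def)
    apply (rule c_put)
    using fin' bk lg1 d index(1)[OF b(1)] zw c' r q(4) by simp_all
qed

lemma wp_del_unit:
  assumes rep: "rep \<sigma> S A p D" and r: "\<sigma> (V rx) = x" "\<sigma> (V ry) = y" "\<sigma> (V Copy) = j" "\<sigma> (V rv) = p x * m x"
    and b: "(x, y, j) \<in> A"
    and c: "client (V rx)" "client (V ry)" "client (V rv)" "rx \<noteq> Key" "ry \<noteq> Key" "rv \<noteq> Key"
  shows "wp w B cli (del_unit rx ry rv) (\<lambda>u (\<sigma>', S'). u \<le> 650 * lg \<and> but_key \<sigma> \<sigma>'
    \<and> rep \<sigma>' S' (A - {(x, y, j)}) p D) (\<sigma>, S)"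
proof -
  define A' where "A' = A - {(x, y, j)}"
  have q0: "A \<subseteq> U" using rep by (auto simp: rep_def)
  then have b': "x < N" "y < N" "j < K" using b by (auto simp: U_def)
  have q: "fixed \<sigma>" "A \<subseteq> U" "p x \<le> N * K" "\<sigma> (H Load x) = deg A x" "S = keys A p D" "\<sigma> (V Radix) = R"
    using rep b' by (auto simp: rep_def fixed_def)
  have fin: "finite A" using q(2) finite_U finite_subset by blast
  have A': "A' \<subseteq> U" "card A' \<le> ub" using q(2) rep fin card_Diff1_le[of A "(x, y, j)"] by (auto simp: A'_def rep_def)
  note wf = rep_wf[OF rep, unfolded wf_def]
  define kx where "kx = k0 (x, y, j)"
  define ky where "ky = k1 (p x * m x) (x, y, j)"
  have S': "S - {kx} - {ky} = keys A' p D" "ky \<noteq> kx"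
    using ks_remove[of A "\<lambda>t. p (fst t) * m (fst t)" D "\<lambda>x. thr x (p x)" "(x, y, j)"] wf b
    by (simp_all add: q(5) keys_def A'_def kx_def ky_def)
  have mem: "kx \<in> S" "ky \<in> S - {kx}"
  proof -
    show "kx \<in> S" using b by (simp add: q(5) keys_def ks_def kx_def)
    have "ky \<in> (\<lambda>t. k1 (p (fst t) * m (fst t)) t) ` A" using b by (force simp: ky_def)
    then show "ky \<in> S - {kx}" using S'(2) by (simp add: q(5) keys_def ks_def)
  qed
  note f = enc_fields[OF b']
  have v: "p x * m x < R" using value_bound[OF q(3)] .
  have e: "enc R 0 x y j 0 = kx" "enc R 1 y (p x * m x) x j = ky" by (auto simp: kx_def ky_def k0_def k1_def)
  have zw: "0 < (2::nat) ^ w" "1 < (2::nat) ^ w" "1 < R" using small R_large(7) by auto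
  have dA: "deg A z = deg A' z + (if z = x then 1 else 0)" for z
    unfolding A'_def by (rule deg_remove[OF fin b])
  have d: "deg A x < 2 ^ w" "1 \<le> deg A x" "deg A x - 1 = deg A' x"
    using deg_le[OF q(2), of x] R_large(10) R_less_word dA[of x] by auto
  let ?\<sigma> = "\<sigma>(V Key := ky, H Load x := deg A x - 1)"
  have "rep ?\<sigma> (keys A' p D) A' p D"
    using rep A' b d by (auto simp: rep_def fixed_upd A'_def[symmetric] dA) (auto simp: A'_def)
  then have fin': "rep ?\<sigma> (S - {kx} - {ky}) (A - {(x, y, j)}) p D" unfolding S' A'_def .
  have bk: "but_key \<sigma> ?\<sigma>" by (simp add: but_key_def)
  note c' = c[simplified]
  show ?thesis unfolding del_unit_def
    apply (rule wp_Seq, rule c_do_delete[where k = kx])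
    apply (simp_all add: encx_client encx_ev encx_cost encx_ok c' r q(6) f e v zw mem del: One_nat_def)
    apply (rule wp_Seq, rule c_do_delete[where k = ky])
    apply (simp_all add: encx_client encx_ev encx_cost encx_ok c' r q(6) f e v zw mem[simplified] del: One_nat_def)
    apply (rule c_put)
    using fin' bk lg1 d index(1)[OF b'(1)] zw c' r q(4) by simp_all
qed

definition violates :: "(nat \<Rightarrow> nat) \<Rightarrow> nat \<Rightarrow> nat \<Rightarrow> bool" where
  "violates p x y \<longleftrightarrow> (P + 4) * (p y + 1) * m y < P * (p x * m x)"

lemma wp_inspect:
  assumes rep: "rep \<sigma> S A p D" and y: "y \<in> D" and res: "\<sigma> (V Res) = R ^ 5 + k2 y"
  shows "wp w B cli inspect (\<lambda>u (\<sigma>', S'). u \<le> 600 * lg \<and> rep \<sigma>' S A p D \<and> S' = S \<and> \<sigma>' (V NodeY) = y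
    \<and> (if \<sigma>' (V Flag) = 0 then \<forall>(x, z, j)\<in>A. z = y \<longrightarrow> \<not> violates p x y
       else \<exists>x j. (x, y, j) \<in> A \<and> violates p x y \<and> \<sigma>' (V NodeX) = x \<and> \<sigma>' (V Copy) = j
         \<and> \<sigma>' (V ValOld) = p x * m x \<and> \<sigma>' (V ValNew) = p y * m y)) (\<sigma>, S)"
proof -
  have q: "fixed \<sigma>" "A \<subseteq> U" "D \<subseteq> {..<N}" "S = keys A p D" "\<sigma> (V Radix) = R" "\<sigma> (V KeyTop) = R ^ 5" "\<sigma> (V Prec) = P"
    "\<sigma> (V Guesses) = G"
    using rep by (auto simp: rep_def fixed_def)
  have yN: "y < N" using y q(3) by auto
  then have qy: "p y \<le> N * K" "\<sigma> (H Pub y) = p y" using rep by (auto simp: rep_def)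
  have fA: "finite A" using q(2) finite_U finite_subset by blast
  note wf = rep_wf[OF rep, unfolded wf_def]
  have finS: "finite S" unfolding q(4) keys_def by (rule ks_card(1)[OF fA q(3)])
  have f: "y < R" "y + 1 < R" "0 < R" "1 < R" "2 < R" using yN R_large(2,7) by auto
  have k2b: "k2 y < R ^ 5" using f by (simp add: k2_def enc_bounds)
  have dec: "k2 y div (R * R * R) mod R = y" using f by (simp add: k2_def enc_decode)
  define lo where "lo = enc R 1 y 0 0 0"
  define hi where "hi = enc R 1 (y + 1) 0 0 0"
  have lohi: "lo \<le> hi" "hi < R ^ 5" "lo < R ^ 5" using f by (simp_all add: lo_def hi_def enc_le enc_bounds)
  have zw: "0 < (2::nat) ^ w" "1 < (2::nat) ^ w" "4 < (2::nat) ^ w" using small by auto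
  have W: "R * R < 2 ^ w" "R * R * R < 2 ^ w" "R ^ 5 + k2 y < 2 ^ w" "R ^ 5 + lo < 2 ^ w"
    using word R_pow k2b lohi(3) by linarith+
  have my: "\<sigma> (H Pow (y mod G)) = m y" "y mod G < B" "y < B"
    using q(1) G_pos index(2)[of "y mod G"] index(1)[OF yN] by (auto simp: fixed_def m_def)
  have rep': "rep (\<sigma>') S A p D" if "\<forall>a i. \<sigma>' (H a i) = \<sigma> (H a i)" "fixed \<sigma>'" for \<sigma>'
    using rep that by (auto simp: rep_def)
  let ?\<sigma>1 = "\<sigma>(V NodeY := y, V Key := hi, V Res := below S hi)"
  have 1: "wp w B cli fetch_dirty
     (\<lambda>u (\<sigma>', S'). u \<le> 400 * lg \<and> \<sigma>' = ?\<sigma>1 \<and> S' = S) (\<sigma>, S)"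
    unfolding fetch_dirty_def
    apply (rule wp_Seq, rule c_assign)
    apply (simp_all add: q res dec W del: One_nat_def)
    apply (rule c_do_pred[where k = hi])
    using f lohi R_less_word(1)[OF f(2)] zw lg1
    by (simp_all add: encx_client encx_ev encx_cost encx_ok q hi_def[symmetric] del: One_nat_def)
  have 2: "wp w B cli compare_best
    (\<lambda>u (\<sigma>', S'). u \<le> 200 \<and> rep \<sigma>' S A p D \<and> S' = S \<and> \<sigma>' (V NodeY) = y
    \<and> (if \<sigma>' (V Flag) = 0 then \<forall>(x, z, j)\<in>A. z = y \<longrightarrow> \<not> violates p x y
       else \<exists>x j. (x, y, j) \<in> A \<and> violates p x y \<and> \<sigma>' (V NodeX) = x \<and> \<sigma>' (V Copy) = j
         \<and> \<sigma>' (V ValOld) = p x * m x \<and> \<sigma>' (V ValNew) = p y * m y)) (?\<sigma>1, S)"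
    unfolding compare_best_def
  proof (rule c_Cond, goal_cases)
    case 1 show ?case by (simp add: encx_client)
  next
    case 2 show ?case using f W(4) zw by (simp add: encx_ok encx_ev q lo_def[symmetric] del: One_nat_def)
  next
    case 3
    then have lt: "below S hi < R ^ 5 + lo" by (simp add: encx_ev q lo_def split: if_splits)
    have n: "k < lo" if "k \<in> S" "k < hi" for k
      using below_cases[OF finS lohi(1)] lt that unfolding top by (metis add_less_cancel_left not_le)
    have "\<not> (x, y, j) \<in> A" for x j
    proof
      assume a: "(x, y, j) \<in> A"
      let ?v = "p x * m x"
      have xj: "x < N" "j < K" using a q(2) by (auto simp: U_def)
      have v: "?v < R" using wf a by force
      have "k1 ?v (x, y, j) \<in> (\<lambda>t. k1 (p (fst t) * m (fst t)) t) ` A" using a by force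
      then have "k1 ?v (x, y, j) \<in> S" by (simp add: q(4) keys_def ks_def)
      moreover have "k1 ?v (x, y, j) < hi" "lo \<le> k1 ?v (x, y, j)"
        using enc_fields[OF xj(1) yN xj(2)] v f by (auto simp: k1_def hi_def lo_def enc_less enc_le)
      ultimately show False using n by fastforce
    qed
    then have none: "\<forall>(x, z, j)\<in>A. z = y \<longrightarrow> \<not> violates p x y" by auto
    have "fixed (?\<sigma>1(V Flag := 0))" using q(1) by (simp add: fixed_upd)
    then have "rep (?\<sigma>1(V Flag := 0)) S A p D" by (intro rep') simp_all
    then show ?case using zw none by (intro c_assign) (simp_all add: encx_cost)
  next
    case 4
    then have ge: "\<not> below S hi < R ^ 5 + lo" by (simp add: encx_ev q lo_def split: if_splits)
    from below_cases[OF finS lohi(1)] obtain k where k: "k \<in> S" "lo \<le> k" "k < hi" "below S hi = R ^ 5 + k"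
        "\<And>k'. k' \<in> S \<Longrightarrow> k' < hi \<Longrightarrow> k' \<le> k"
      using ge unfolding top by (metis (no_types, lifting))
    then obtain t where t: "t \<in> A" "fst (snd t) = y" "k = k1 (p (fst t) * m (fst t)) t"
      using ks_range1[of A "\<lambda>t. p (fst t) * m (fst t)" D "\<lambda>x. thr x (p x)" k y] wf yN
      by (auto simp: q(4) keys_def lo_def hi_def)
    obtain x j where tt: "t = (x, y, j)" using t(2) by (cases t) auto
    have xj: "x < N" "j < K" using t(1) tt q(2) by (auto simp: U_def)
    define v where "v = p x * m x"
    have v: "v < R" using wf t(1) tt by (force simp: v_def)
    have ke: "k = enc R 1 y v x j" using t(3) tt by (simp add: k1_def v_def)
    note xf = enc_fields[OF xj(1) yN xj(2)]
    have kd: "k div (R * R) mod R = v" "k div R mod R = x" "k mod R = j"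
      unfolding ke using xf v by (simp_all add: enc_decode)
    have kb: "k < R ^ 5" using k(3) lohi by simp
    have "p y + 1 \<le> R" "m y \<le> R" using qy(1) R_large(5,10) m_bounds(2)[of y] by linarith+
    then have pm: "(p y + 1) * m y \<le> R * R" by (rule mult_mono) auto
    have "p y * m y < R" using value_bound[OF qy(1)] .
    moreover have "(P + 4) * ((p y + 1) * m y) \<le> R * (R * R)" using mult_le_mono[OF _ pm, of "P + 4" R] R_large(4) by simp
    moreover have "P * v \<le> R * R" using v R_large(4) by (intro mult_mono) auto
    ultimately have W': "p y * m y < 2 ^ w" "(p y + 1) * m y < 2 ^ w" "(P + 4) * ((p y + 1) * m y) < 2 ^ w" "P * v < 2 ^ w"
        "P + 4 < 2 ^ w" "p y + 1 < 2 ^ w"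
      using pm W(1,2) R_less_word(1) R_large(4,10) qy(1) word R_pow(1) by (simp_all add: mult.assoc)
    have vio: "(P + 4) * ((p y + 1) * m y) < P * v \<longleftrightarrow> violates p x y" by (simp only: violates_def v_def mult.assoc)
    \<comment> \<open>The value precedes the owner in keys of kind 1, so the predecessor bounds the
      values of all other owners.\<close>
    have none: "\<not> violates p x' y" if "(x', y, j') \<in> A" "\<not> violates p x y" for x' j'
    proof -
      let ?v = "p x' * m x'"
      have xj': "x' < N" "j' < K" using that q(2) by (auto simp: U_def)
      have v': "?v < R" using wf that by force
      have "k1 ?v (x', y, j') \<in> (\<lambda>t. k1 (p (fst t) * m (fst t)) t) ` A" using that by force
      then have "k1 ?v (x', y, j') \<in> S" by (simp add: q(4) keys_def ks_def)
      moreover have "k1 ?v (x', y, j') < hi"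
        using enc_fields[OF xj'(1) yN xj'(2)] v' f by (auto simp: k1_def hi_def enc_less)
      ultimately have "enc R 1 y ?v x' j' \<le> enc R 1 y v x j" using k(5) ke by (auto simp: k1_def)
      then have "?v \<le> v" using enc_fields[OF xj'(1) yN xj'(2)] v' v xf by (auto simp: enc_le)
      then have "P * ?v \<le> P * v" by simp
      then show ?thesis using that(2) unfolding violates_def v_def not_less by (rule le_trans)
    qed
    let ?\<sigma>2 = "?\<sigma>1(V Cursor := k, V ValOld := v, V NodeX := x, V Copy := j, V ValNew := p y * m y,
      V Flag := of_bool (violates p x y))"
    have "rep ?\<sigma>2 S A p D" using q(1) by (intro rep') (simp_all add: fixed_upd)
    moreover have "if ?\<sigma>2 (V Flag) = 0 then \<forall>(x, z, j)\<in>A. z = y \<longrightarrow> \<not> violates p x y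
       else \<exists>x j. (x, y, j) \<in> A \<and> violates p x y \<and> ?\<sigma>2 (V NodeX) = x \<and> ?\<sigma>2 (V Copy) = j
         \<and> ?\<sigma>2 (V ValOld) = p x * m x \<and> ?\<sigma>2 (V ValNew) = p y * m y"
      using none t(1) tt by (auto simp: v_def)
    ultimately have fin: "rep ?\<sigma>2 S A p D \<and> S = S \<and> ?\<sigma>2 (V NodeY) = y \<and> (if ?\<sigma>2 (V Flag) = 0 then \<forall>(x, z, j)\<in>A. z = y \<longrightarrow> \<not> violates p x y
       else \<exists>x j. (x, y, j) \<in> A \<and> violates p x y \<and> ?\<sigma>2 (V NodeX) = x \<and> ?\<sigma>2 (V Copy) = j
         \<and> ?\<sigma>2 (V ValOld) = p x * m x \<and> ?\<sigma>2 (V ValNew) = p y * m y)" by simp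
    have W5: "R ^ 5 + k < 2 ^ w" using kb word by linarith
    have cost: "u \<le> u" for u :: real by simp
    show ?case
    proof (rule wp_conseq[where Q = "\<lambda>u (\<sigma>', S'). u \<le> 120 \<and> \<sigma>' = ?\<sigma>2 \<and> S' = S"], goal_cases)
      case 1
      show ?case
        using W W' W5 zw my qy(2) by (intro c_intros) (simp_all add: q(5-8) k(4) kd vio[simplified])
    next
      case (2 u z)
      then show ?case using fin t(1)[unfolded tt] none by (intro exI[of _ u]) (cases z, auto simp: encx_cost v_def)
    qed
  qed
  show ?thesis unfolding inspect_def
  proof (rule wp_SeqI[OF 1], clarify, rule wp_conseq[OF 2], goal_cases)
    case (1 u a b v z)
    then show ?case using lg1 by (intro exI[of _ v]) (cases z, auto)
  qed
qed

text \<open>The logarithm of \<open>l! * m x ^ l\<close>. The \<open>i\<close>-th summand is the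
  logarithm of the value that the node reaches with its \<open>i\<close>-th unit, so a move changes
  the sum by the logarithm of the receiver's new value divided by the giver's old one.\<close>

definition fe :: "nat \<Rightarrow> nat \<Rightarrow> real" where
  "fe x l = (\<Sum>i=1..l. ln (real i * real (m x)))"

definition Phi :: "edge_copy set \<Rightarrow> real" where
  "Phi A = (\<Sum>x<N. fe x (deg A x))"

text \<open>Makes the drop of \<open>1 / (2 P)\<close> in a flip worth \<open>2 * cL\<close>, for
  the drift of two loads by one, plus \<open>3000 * lg\<close> for the work.\<close>

definition cF :: real where "cF = (2 * cL + 3000 * lg) * (2 * real P)"

definition Pot :: "edge_copy set \<Rightarrow> (nat \<Rightarrow> nat) \<Rightarrow> nat set \<Rightarrow> real" where
  "Pot A p D = pot0 A p D + cF * Phi A"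

lemma fe_Suc: "fe x (Suc l) = fe x l + ln (real (Suc l) * real (m x))"
  by (simp add: fe_def)

lemma constants_pos: "0 \<le> cL" "0 \<le> cD" "0 \<le> cF"
  using lg1 by (auto simp: cL_def cD_def cF_def)

lemma fe_nonneg: "0 \<le> fe x l"
  unfolding fe_def
proof (intro sum_nonneg ln_ge_zero)
  fix i assume i: "i \<in> {1..l}"
  have "1 * 1 \<le> real i * real (m x)" using i m_bounds(1)[of x] by (intro mult_mono) auto
  then show "1 \<le> real i * real (m x)" by simp
qed

lemma Pot_nonneg: "0 \<le> Pot A p D"
proof -
  have "0 \<le> Phi A" unfolding Phi_def by (intro sum_nonneg fe_nonneg)
  then show ?thesis using constants_pos by (simp add: Pot_def pot0_def sum_nonneg)
qed

lemma pot0_change: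
  assumes "x < N" "\<And>z. \<bar>real (deg A' z) - real (deg A z)\<bar> \<le> (if z = x then 1 else 0)"
  shows "pot0 A' p D \<le> pot0 A p D + cL"
proof -
  have "(\<Sum>z<N. \<bar>real (deg A' z) - real (p z)\<bar>) \<le> (\<Sum>z<N. \<bar>real (deg A z) - real (p z)\<bar> + (if z = x then 1 else 0))"
  proof (rule sum_mono)
    fix z
    show "\<bar>real (deg A' z) - real (p z)\<bar> \<le> \<bar>real (deg A z) - real (p z)\<bar> + (if z = x then 1 else 0)"
      using assms(2)[of z] by linarith
  qed
  also have "\<dots> = (\<Sum>z<N. \<bar>real (deg A z) - real (p z)\<bar>) + 1" using assms(1) by (simp add: sum.distrib)
  finally have "cL * (\<Sum>z<N. \<bar>real (deg A' z) - real (p z)\<bar>) \<le> cL * ((\<Sum>z<N. \<bar>real (deg A z) - real (p z)\<bar>) + 1)"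
    using constants_pos by (intro mult_left_mono)
  then show ?thesis by (simp add: pot0_def algebra_simps)
qed

lemma pot0_insert:
  assumes "finite A" "(x, y, j) \<notin> A" "x < N"
  shows "pot0 (insert (x, y, j) A) p D \<le> pot0 A p D + cL"
  by (rule pot0_change[OF assms(3)]) (simp add: deg_insert[OF assms(1,2)])

lemma pot0_remove:
  assumes "finite A" "(x, y, j) \<in> A" "x < N"
  shows "pot0 (A - {(x, y, j)}) p D \<le> pot0 A p D + cL"
  by (rule pot0_change[OF assms(3)]) (simp add: deg_remove[OF assms(1,2)])

lemma Phi_insert:
  assumes "finite A" "(x, y, j) \<notin> A" "x < N"
  shows "Phi (insert (x, y, j) A) = Phi A + ln ((real (deg A x) + 1) * real (m x))"
proof -
  have "Phi (insert (x, y, j) A) = (\<Sum>z<N. fe z (deg A z) + (if z = x then ln ((real (deg A x) + 1) * real (m x)) else 0))"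
    unfolding Phi_def deg_insert[OF assms(1,2)]
    by (intro sum.cong) (auto simp: fe_Suc add.commute)
  then show ?thesis using assms(3) by (simp add: sum.distrib Phi_def)
qed

lemma Phi_remove:
  assumes "finite A" "(x, y, j) \<in> A" "x < N"
  shows "Phi (A - {(x, y, j)}) = Phi A - ln (real (deg A x) * real (m x))"
  using Phi_insert[of "A - {(x, y, j)}" x y j] deg_remove[OF assms(1,2), of x] assms
  by (simp add: insert_absorb add.commute)

lemma P_large: "128 \<le> P"
  by (simp add: P_def)

lemma nearD:
  assumes "near A p x"
  shows "real P * real (deg A x) \<le> (real P + 1) * real (p x)" "(real P - 1) * real (p x) \<le> real P * real (deg A x)"
proof -
  have "real P * (real (deg A x) - real (p x)) \<le> real P * \<bar>real (deg A x) - real (p x)\<bar>"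
    "real P * - (real (deg A x) - real (p x)) \<le> real P * \<bar>real (deg A x) - real (p x)\<bar>"
    by (intro mult_left_mono abs_ge_self abs_ge_minus_self; simp)+
  then show "real P * real (deg A x) \<le> (real P + 1) * real (p x)" "(real P - 1) * real (p x) \<le> real P * real (deg A x)"
    using assms by (simp_all add: near_def algebra_simps)
qed

text \<open>With \<open>q\<close> for \<open>P\<close>: the violation is a factor
  \<open>(q + 4) / q\<close> between published values, and the lag of the published loads costs
  factors \<open>(q - 1) / q\<close> and \<open>q / (q + 1)\<close>. Since
  \<open>(q + 1) ^ 2 \<le> (q - 1) * (q + 4)\<close>, a factor \<open>1 + 1 / q\<close> remains
  between the actual values; with 3 in place of 4 this inequality would fail.\<close>

lemma flip_gain:
  assumes "near A p x" "near A p y" "violates p x y"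
  shows "ln ((real (deg A y) + 1) * real (m y)) + 1 / (2 * real P) \<le> ln (real (deg A x) * real (m x))"
proof -
  define q where "q = real P"
  define c where "c = (real (p y) + 1) * real (m y)"
  define X where "X = real (p x) * real (m x)"
  define dx where "dx = real (deg A x) * real (m x)"
  define dy where "dy = (real (deg A y) + 1) * real (m y)"
  have q: "128 \<le> q" using P_large by (simp add: q_def)
  have mx: "1 \<le> real (m x)" "1 \<le> real (m y)" using m_bounds(1) by simp_all
  have c0: "0 < c" using mx by (simp add: c_def)
  have dy0: "0 < dy" using mx by (simp add: dy_def)
  have "(P + 4) * (p y + 1) * m y < P * (p x * m x)" using assms(3) by (simp add: violates_def)
  then have "real ((P + 4) * (p y + 1) * m y) < real (P * (p x * m x))" by (simp only: of_nat_less_iff)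
  then have v: "(q + 4) * c < q * X" by (simp add: q_def c_def X_def algebra_simps)
  have "(q - 1) * real (p x) \<le> q * real (deg A x)" using nearD(2)[OF assms(1)] by (simp add: q_def)
  then have "(q - 1) * real (p x) * real (m x) \<le> q * real (deg A x) * real (m x)" using mx by (intro mult_right_mono) auto
  then have 1: "(q - 1) * X \<le> q * dx" by (simp add: X_def dx_def mult.assoc)
  have "q * (real (deg A y) + 1) \<le> (q + 1) * (real (p y) + 1)" using nearD(1)[OF assms(2)] by (simp add: q_def algebra_simps)
  then have "q * (real (deg A y) + 1) * real (m y) \<le> (q + 1) * (real (p y) + 1) * real (m y)" using mx by (intro mult_right_mono) auto
  then have 2: "q * dy \<le> (q + 1) * c" by (simp add: c_def dy_def mult.assoc)
  have "q * ((q + 1) * dy) = (q + 1) * (q * dy)" by simp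
  also have "\<dots> \<le> (q + 1) * ((q + 1) * c)" using 2 q by (intro mult_left_mono) auto
  also have "\<dots> \<le> (q - 1) * ((q + 4) * c)"
  proof -
    have "(q + 1) * (q + 1) \<le> (q - 1) * (q + 4)" using q by (simp add: algebra_simps)
    then have "(q + 1) * (q + 1) * c \<le> (q - 1) * (q + 4) * c" using c0 by (intro mult_right_mono) auto
    then show ?thesis by (simp add: mult.assoc)
  qed
  also have "\<dots> \<le> (q - 1) * (q * X)" using v q by (intro mult_left_mono) auto
  also have "\<dots> = q * ((q - 1) * X)" by simp
  also have "\<dots> \<le> q * (q * dx)" using 1 q by (intro mult_left_mono) auto
  finally have "(q + 1) * dy \<le> q * dx" using q by simp
  then have "(1 + 1 / q) * dy \<le> dx" using q by (simp add: field_simps)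
  moreover have q1: "0 < 1 + 1 / q" using q by (intro add_pos_nonneg) auto
  moreover have "0 < (1 + 1 / q) * dy" using q1 dy0 by (rule mult_pos_pos)
  ultimately have "ln ((1 + 1 / q) * dy) \<le> ln dx" by (intro ln_mono) auto
  moreover have "ln ((1 + 1 / q) * dy) = ln (1 + 1 / q) + ln dy" using q1 dy0 by (rule ln_mult_pos)
  moreover have "1 / q - (1 / q)\<^sup>2 \<le> ln (1 + 1 / q)" using q by (intro ln_one_plus_pos_lower_bound) auto
  moreover have "1 / (2 * q) \<le> 1 / q - (1 / q)\<^sup>2" using q by (simp add: field_simps power2_eq_square)
  ultimately show ?thesis unfolding dx_def[symmetric] dy_def[symmetric] q_def[symmetric] by linarith
qed

text \<open>Forgets the ownership of the units.\<close>

definition und :: "edge_copy set \<Rightarrow> edge_copy set" where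
  "und A = A \<union> {(x, y, j). (y, x, j) \<in> A}"

definition Inv :: "(loc \<Rightarrow> nat) \<Rightarrow> nat set \<Rightarrow> edge_copy set \<Rightarrow> (nat \<Rightarrow> nat) \<Rightarrow> nat set \<Rightarrow> bool" where
  "Inv \<sigma> S A p D \<longleftrightarrow> rep \<sigma> S A p D \<and> good A p D \<and> (\<forall>x<N. near A p x)"

lemma near_cong: "deg A x = deg A' x \<Longrightarrow> p x = p' x \<Longrightarrow> near A p x = near A' p' x"
  by (simp add: near_def)

lemma wp_flip:
  assumes inv: "Inv \<sigma> S A p D" and t: "(x, y, j) \<in> A" "violates p x y"
    and r: "\<sigma> (V NodeX) = x" "\<sigma> (V NodeY) = y" "\<sigma> (V Copy) = j" "\<sigma> (V ValOld) = p x * m x" "\<sigma> (V ValNew) = p y * m y"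
  shows "wp w B cli flip (\<lambda>u (\<sigma>', S'). \<exists>A' p' D'. Inv \<sigma>' S' A' p' D' \<and> und A' = und A
    \<and> u + Pot A' p' D' + 1500 * lg \<le> Pot A p D) (\<sigma>, S)"
proof -
  define A1 where "A1 = A - {(x, y, j)}"
  define A2 where "A2 = insert (y, x, j) A1"
  have rep: "rep \<sigma> S A p D" and good: "good A p D" and near: "\<And>x. x < N \<Longrightarrow> near A p x"
    using inv by (auto simp: Inv_def)
  have q: "A \<subseteq> U" "card A \<le> ub" "(y, x, j) \<notin> A" using rep t(1) by (auto simp: rep_def)
  have b: "x < N" "y < N" "j < K" using q(1) t(1) by (auto simp: U_def)
  have xy: "x \<noteq> y" using q(3) t(1) by auto
  have fin: "finite A" "finite A1" using q(1) finite_U finite_subset by (auto simp: A1_def)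
  have n1: "(y, x, j) \<notin> A1" "(x, y, j) \<notin> A1" using q(3) by (auto simp: A1_def)
  have cA: "card A1 < ub" using q(2) fin t(1) card_Diff1_less[OF fin(1) t(1)] by (simp add: A1_def)
  have dA: "deg A z = deg A1 z + (if z = x then 1 else 0)" for z unfolding A1_def by (rule deg_remove[OF fin(1) t(1)])
  have dA2: "deg A2 z = deg A1 z + (if z = y then 1 else 0)" for z unfolding A2_def by (rule deg_insert[OF fin(2) n1(1)])
  \<comment> \<open>Nothing has been published yet, so the move itself raises the drift by at most
    one at each of the two nodes.\<close>
  have pot: "pot0 A2 p D + cF * Phi A2 + 3000 * lg \<le> Pot A p D"
  proof -
    have "pot0 A1 p D \<le> pot0 A p D + cL" unfolding A1_def by (rule pot0_remove[OF fin(1) t(1) b(1)])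
    moreover have "pot0 A2 p D \<le> pot0 A1 p D + cL" unfolding A2_def by (rule pot0_insert[OF fin(2) n1(1) b(2)])
    moreover have "Phi A2 + 1 / (2 * real P) \<le> Phi A"
    proof -
      have "Phi A2 = Phi A1 + ln ((real (deg A1 y) + 1) * real (m y))" unfolding A2_def by (rule Phi_insert[OF fin(2) n1(1) b(2)])
      moreover have "Phi A1 = Phi A - ln (real (deg A x) * real (m x))" unfolding A1_def by (rule Phi_remove[OF fin(1) t(1) b(1)])
      moreover have "deg A1 y = deg A y" using dA[of y] xy by simp
      ultimately show ?thesis using flip_gain[OF near[OF b(1)] near[OF b(2)] t(2)] by simp
    qed
    then have "cF * (Phi A2 + 1 / (2 * real P)) \<le> cF * Phi A" using constants_pos by (intro mult_left_mono)
    moreover have "cF * (1 / (2 * real P)) = 2 * cL + 3000 * lg" using P_large by (simp add: cF_def)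
    ultimately show ?thesis by (simp add: Pot_def distrib_left)
  qed
  \<comment> \<open>The violation puts the value of \<open>y\<close> below that of \<open>x\<close>,
    so the unit satisfies the condition in its new direction; for the other units nothing has
    changed.\<close>
  have good2: "good A2 p D"
  proof -
    have "P * (p y * m y) \<le> (P + 4) * (p x + 1) * m x"
    proof -
      have "P * (p y * m y) \<le> (P + 4) * (p y + 1) * m y" unfolding mult.assoc[symmetric] by (intro mult_right_mono mult_mono) auto
      also have "\<dots> \<le> P * (p x * m x)" using t(2) by (simp add: violates_def)
      also have "\<dots> \<le> (P + 4) * (p x + 1) * m x" unfolding mult.assoc[symmetric] by (intro mult_right_mono mult_mono) auto
      finally show ?thesis .
    qed
    then show ?thesis using good by (auto simp: good_def A2_def A1_def)
  qed
  have und: "und A2 = und A" using t(1) by (auto simp: und_def A2_def A1_def)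
  show ?thesis unfolding flip_def
  proof (rule wp_SeqI[OF wp_del_unit[OF rep r(1-4) t(1)]], simp_all, clarify, goal_cases)
    case (1 u1 \<sigma>1 S1)
    have k1: "\<sigma>1 (V NodeX) = x" "\<sigma>1 (V NodeY) = y" "\<sigma>1 (V Copy) = j" "\<sigma>1 (V ValNew) = p y * m y"
      using 1(2) r by (auto simp: but_key_def)
    note rep1 = 1(3)[folded A1_def] and u1 = 1(1)
    show ?case
    proof (rule wp_SeqI[OF wp_add_unit[OF rep1 k1(2,1,3,4) b(2,1,3) n1 xy[symmetric] cA]], simp_all, clarify, goal_cases)
      case (1 u2 \<sigma>2 S2)
      have k2: "\<sigma>2 (V NodeX) = x" "\<sigma>2 (V NodeY) = y"
        using 1(2) k1 by (auto simp: but_key_def)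
      note rep2 = 1(3)[folded A2_def] and u2 = 1(1)
      show ?case
      proof (rule wp_SeqI[OF wp_adjust[OF rep2 k2(1) b(1) good2]], clarify, goal_cases)
        case (1 u3 \<sigma>3 S3 p3 D3)
        have k3: "(\<sigma>3(V NodeX := y)) (V NodeX) = y" by simp
        have e3: "\<sigma>3 (V NodeY) = y" using 1(2) k2 by (simp add: same_regs_def)
        have rep3: "rep (\<sigma>3(V NodeX := y)) S3 A2 p3 D3" using 1(1) by (auto simp: rep_def fixed_upd)
        note g3 = 1(3) and n3 = 1(4) and p3 = 1(5) and u3 = 1(6)
        have "wp w B cli adjust (\<lambda>u4 (\<sigma>', S'). \<exists>A' p' D'. Inv \<sigma>' S' A' p' D' \<and> und A' = und A
            \<and> u1 + (u2 + (u3 + (4 + u4))) + Pot A' p' D' + 1500 * lg \<le> Pot A p D) (\<sigma>3(V NodeX := y), S3)"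
        proof (rule wp_conseq[OF wp_adjust[OF rep3 k3 b(2) g3]], goal_cases)
          case (1 u4 z)
          obtain \<sigma>4 S4 where z: "z = (\<sigma>4, S4)" by (cases z)
          from 1 obtain p4 D4 where 4: "rep \<sigma>4 S4 A2 p4 D4" "good A2 p4 D4" "near A2 p4 y" "\<forall>z. z \<noteq> y \<longrightarrow> p4 z = p3 z"
              "u4 + pot0 A2 p4 D4 \<le> pot0 A2 p3 D3 + 100 * lg"
            unfolding z prod.case by blast
          have "near A2 p4 z" if "z < N" for z
          proof (cases "z = y")
            case False
            have n: "near A2 p3 z"
            proof (cases "z = x")
              case False
              then have "deg A2 z = deg A z" "p3 z = p z" using dA dA2 \<open>z \<noteq> y\<close> p3 by auto
              then show ?thesis using near[OF that] near_cong[of A2 z A p3 p] by simp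
            qed (use n3 in simp)
            then show ?thesis using near_cong[of A2 z A2 p4 p3] 4(4) False by simp
          qed (use 4 in simp)
          then have "Inv \<sigma>4 S4 A2 p4 D4" using 4 by (simp add: Inv_def)
          moreover have "u1 + (u2 + (u3 + (4 + u4))) + Pot A2 p4 D4 + 1500 * lg \<le> Pot A p D"
            using 4(5) u3 u2 u1 pot lg1 by (simp add: Pot_def)
          ultimately show ?case using und unfolding z prod.case by (intro exI[of _ u4]) blast
        qed
        then show ?case
          using e3 by (intro wp_Seq c_assign) (simp_all add: add.assoc)
      qed
    qed
  qed
qed

text \<open>Every pass lowers \<open>Pot\<close> by more than its running time: a flip through
  \<open>Phi\<close>, an inspection without violation through the price of the node that leaves
  \<open>D\<close>. This bounds the time and yields termination, although flips can mark new
  nodes.\<close>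

lemma wp_settle:
  assumes inv: "Inv \<sigma> S A p D"
  shows "wp w B cli settle (\<lambda>u (\<sigma>', S'). \<exists>A' p'. Inv \<sigma>' S' A' p' {} \<and> und A' = und A
    \<and> u + Pot A' p' {} \<le> Pot A p D + 500 * lg) (\<sigma>, S)"
proof -
  define lo where "lo = enc R 2 0 0 0 0"
  define hi where "hi = enc R 3 0 0 0 0"
  have f: "0 < R" "2 < R" "3 < R" "1 < R" using R_large(7) by auto
  have lohi: "lo \<le> hi" "hi < R ^ 5" "lo < R ^ 5" using f by (simp_all add: lo_def hi_def enc_le enc_bounds)
  have zw: "0 < (2::nat) ^ w" "2 < (2::nat) ^ w" "3 < (2::nat) ^ w" using small by auto
  have W: "R ^ 5 + lo < 2 ^ w" using word lohi by linarith
  define I where "I = (\<lambda>(A', p', D') \<sigma>' S'. Inv \<sigma>' S' A' p' D' \<and> und A' = und A \<and> \<sigma>' (V Res) = below S' hi)"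
  have pred: "wp w B cli (do_pred (encx (Num 3) (Num 0) (Num 0) (Num 0) (Num 0)))
    (\<lambda>u (\<sigma>'', S''). u \<le> 350 * lg \<and> I (A', p', D') \<sigma>'' S'') (\<sigma>', S')"
    if "Inv \<sigma>' S' A' p' D'" "und A' = und A" for A' p' D' \<sigma>' S'
  proof -
    have "\<sigma>' (V Radix) = R" using that by (simp add: Inv_def rep_def fixed_def)
    moreover have "Inv (\<sigma>'(V Key := hi, V Res := below S' hi)) S' A' p' D'"
      using that(1) by (auto simp: Inv_def rep_def fixed_upd)
    ultimately show ?thesis using that(2) f zw lohi lg1
      by (intro c_do_pred[where k = hi])
        (simp_all add: encx_client encx_ev encx_cost encx_ok hi_def[symmetric] I_def)
  qed
  have loop: "wp w B cli (WHILE (Reg Res \<lhd> Reg KeyTop \<oplus> encx (Num 2) (Num 0) (Num 0) (Num 0) (Num 0)) \<doteq> Num 0 DO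
        (inspect ;;
         (IF Reg Flag THEN flip ELSE do_delete (encx (Num 2) (Reg NodeY) (Num 0) (Num 0) (Num 0))) ;;
         do_pred (encx (Num 3) (Num 0) (Num 0) (Num 0) (Num 0))))
     (\<lambda>u (\<sigma>', S'). \<exists>A' p'. Inv \<sigma>' S' A' p' {} \<and> und A' = und A \<and> u + Pot A' p' {} \<le> Pot A p D + 50) (\<tau>, T)"
    if I0: "I (A, p, D) \<tau> T" for \<tau> T
  proof (rule c_While[where I = I and pot = "\<lambda>(A, p, D). Pot A p D", OF _ I0], goal_cases)
    case 1 show ?case by (simp add: encx_client)
  next
    case (2 g \<tau> T)
    then have "\<tau> (V Radix) = R" "\<tau> (V KeyTop) = R ^ 5" by (auto simp: I_def Inv_def rep_def fixed_def split: prod.splits)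
    then show ?case using f zw W by (simp add: encx_ok encx_ev lo_def)
  next
    case (3 g \<tau> T) then show ?case using Pot_nonneg by (auto split: prod.splits)
  next
    case (4 g \<tau> T)
    obtain A1 p1 D1 where g: "g = (A1, p1, D1)" by (cases g)
    have i: "Inv \<tau> T A1 p1 D1" "und A1 = und A" "\<tau> (V Res) = below T hi" using 4(1) by (auto simp: I_def g)
    then have rep1: "rep \<tau> T A1 p1 D1" by (simp add: Inv_def)
    then have c: "\<tau> (V Radix) = R" "\<tau> (V KeyTop) = R ^ 5" by (auto simp: rep_def fixed_def)
    note wf = rep_wf[OF rep1, unfolded wf_def]
    have Tk: "T = keys A1 p1 D1" "D1 \<subseteq> {..<N}" using rep1 by (auto simp: rep_def)
    have finT: "finite T" unfolding Tk keys_def by (rule ks_card(1)[OF wf_finite[OF rep_wf[OF rep1]] Tk(2)])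
    have ge: "\<not> below T hi < R ^ 5 + lo" using 4(2) c i(3) by (simp add: encx_ev lo_def split: if_splits)
    from below_cases[OF finT lohi(1)] obtain k where k: "k \<in> T" "lo \<le> k" "k < hi" "below T hi = R ^ 5 + k"
      using ge unfolding top by (metis (no_types, lifting))
    then obtain y where y: "y \<in> D1" "k = k2 y"
      using ks_range2[of A1 "\<lambda>t. p1 (fst t) * m (fst t)" D1 "\<lambda>x. thr x (p1 x)" k] wf
      by (auto simp: Tk keys_def lo_def hi_def)
    have res: "\<tau> (V Res) = R ^ 5 + k2 y" using i(3) k(4) y(2) by simp
    \<comment> \<open>The reserve of \<open>1150 * lg\<close> covers the inspection with 600, the
      search for the next marked node with 350, and the loop test.\<close>
    have body: "wp w B cli (IF Reg Flag THEN flip ELSE do_delete (encx (Num 2) (Reg NodeY) (Num 0) (Num 0) (Num 0)))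
      (\<lambda>u (\<sigma>', S'). \<exists>A' p' D'. Inv \<sigma>' S' A' p' D' \<and> und A' = und A \<and> u + Pot A' p' D' + 1150 * lg \<le> Pot A1 p1 D1) (\<tau>', T)"
      if a: "rep \<tau>' T A1 p1 D1" "\<tau>' (V NodeY) = y"
        "if \<tau>' (V Flag) = 0 then \<forall>(x, z, j)\<in>A1. z = y \<longrightarrow> \<not> violates p1 x y
         else \<exists>x j. (x, y, j) \<in> A1 \<and> violates p1 x y \<and> \<tau>' (V NodeX) = x \<and> \<tau>' (V Copy) = j
         \<and> \<tau>' (V ValOld) = p1 x * m x \<and> \<tau>' (V ValNew) = p1 y * m y" for \<tau>'
    proof (rule c_Cond, goal_cases)
      case 3
      then obtain x j where x: "(x, y, j) \<in> A1" "violates p1 x y" "\<tau>' (V NodeX) = x" "\<tau>' (V Copy) = j"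
         "\<tau>' (V ValOld) = p1 x * m x" "\<tau>' (V ValNew) = p1 y * m y" using a(3) by auto
      have inv': "Inv \<tau>' T A1 p1 D1" using i(1) a(1) by (simp add: Inv_def)
      show ?case
      proof (rule wp_conseq[OF wp_flip[OF inv' x(1,2,3) a(2) x(4-6)]], goal_cases)
        case (1 u z)
        obtain \<sigma>' S' where z: "z = (\<sigma>', S')" by (cases z)
        from 1 obtain A' p' D' where "Inv \<sigma>' S' A' p' D'" "und A' = und A1" "u + Pot A' p' D' + 1500 * lg \<le> Pot A1 p1 D1"
          unfolding z prod.case by blast
        then show ?case using lg1 i(2) unfolding z prod.case
          by (intro exI[of _ u] conjI order_refl exI[of _ A'] exI[of _ p'] exI[of _ D']) auto
      qed
    next
      case 4
      then have no: "\<forall>(x, z, j)\<in>A1. z = y \<longrightarrow> \<not> violates p1 x y" using a(3) by simp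
      have "good A1 p1 D1" using i(1) by (simp add: Inv_def)
      then have good: "good A1 p1 (D1 - {y})" using no by (fastforce simp: good_def violates_def not_less)
      have T': "T - {k2 y} = keys A1 p1 (D1 - {y})"
        using ks_clean[of A1 "\<lambda>t. p1 (fst t) * m (fst t)" D1 "\<lambda>x. thr x (p1 x)" y] wf y(1) by (simp add: Tk keys_def)
      have "rep (\<tau>'(V Key := k2 y)) (T - {k2 y}) A1 p1 (D1 - {y})"
        using a(1) Tk(2) unfolding T' by (auto simp: rep_def fixed_upd)
      then have inv: "Inv (\<tau>'(V Key := k2 y)) (T - {k2 y}) A1 p1 (D1 - {y})" using i(1) good by (simp add: Inv_def)
      have "finite D1" using Tk(2) finite_subset by blast
      then have "card D1 = Suc (card (D1 - {y}))" by (rule card_Suc_Diff1[OF _ y(1), symmetric])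
      then have pot: "Pot A1 p1 (D1 - {y}) + 1500 * lg = Pot A1 p1 D1" by (simp add: Pot_def pot0_def cD_def algebra_simps)
      have yR: "y < R" using y(1) Tk(2) R_large(2) by auto
      have c': "\<tau>' (V Radix) = R" using a(1) by (auto simp: rep_def fixed_def)
      have mem: "k2 y \<in> T" using k(1) y(2) by simp
      show ?case
        using yR f zw c' a(2) mem inv pot lg1 i(2)
        by (intro c_do_delete[where k = "k2 y"])
          (auto simp: encx_client encx_ev encx_cost encx_ok k2_def[symmetric] intro!: exI[of _ A1] exI[of _ p1] exI[of _ "D1 - {y}"])
    qed auto
    show ?case
    proof (rule wp_SeqI[OF wp_inspect[OF rep1 y(1) res]], goal_cases)
      case (1 u s1)
      obtain \<tau>1 T1 where s1: "s1 = (\<tau>1, T1)" by (cases s1)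
      from 1 have u: "u \<le> 600 * lg" and a: "rep \<tau>1 T A1 p1 D1" "T1 = T" "\<tau>1 (V NodeY) = y"
        "if \<tau>1 (V Flag) = 0 then \<forall>(x, z, j)\<in>A1. z = y \<longrightarrow> \<not> violates p1 x y
         else \<exists>x j. (x, y, j) \<in> A1 \<and> violates p1 x y \<and> \<tau>1 (V NodeX) = x \<and> \<tau>1 (V Copy) = j
         \<and> \<tau>1 (V ValOld) = p1 x * m x \<and> \<tau>1 (V ValNew) = p1 y * m y"
        unfolding s1 prod.case by blast+
      show ?case unfolding s1 a(2)
      proof (rule wp_SeqI[OF body[OF a(1,3,4)]], goal_cases)
        case (1 u' s2)
        obtain \<tau>2 T2 where s2: "s2 = (\<tau>2, T2)" by (cases s2)
        from 1 obtain A2 p2 D2 where 2: "Inv \<tau>2 T2 A2 p2 D2" "und A2 = und A" "u' + Pot A2 p2 D2 + 1150 * lg \<le> Pot A1 p1 D1"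
          unfolding s2 prod.case by blast
        show ?case unfolding s2
        proof (rule wp_conseq[OF pred[OF 2(1,2)]], goal_cases)
          case (1 u'' z)
          obtain \<sigma>' S' where z: "z = (\<sigma>', S')" by (cases z)
          from 1 have "u'' \<le> 350 * lg" "I (A2, p2, D2) \<sigma>' S'" unfolding z prod.case by blast+
          then show ?case using u 2(3) lg1 unfolding z prod.case
            by (intro exI[of _ u''] conjI order_refl exI[of _ "(A2, p2, D2)"]) (auto simp: g encx_cost)
        qed
      qed
    qed
  next
    case (5 g \<tau> T)
    obtain A1 p1 D1 where g: "g = (A1, p1, D1)" by (cases g)
    have i: "Inv \<tau> T A1 p1 D1" "und A1 = und A" "\<tau> (V Res) = below T hi" using 5(1) by (auto simp: I_def g)
    then have rep1: "rep \<tau> T A1 p1 D1" by (simp add: Inv_def)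
    then have c: "\<tau> (V Radix) = R" "\<tau> (V KeyTop) = R ^ 5" by (auto simp: rep_def fixed_def)
    have Tk: "T = keys A1 p1 D1" "D1 \<subseteq> {..<N}" using rep1 by (auto simp: rep_def)
    have finT: "finite T" unfolding Tk keys_def by (rule ks_card(1)[OF wf_finite[OF rep_wf[OF rep1]] Tk(2)])
    have lt: "below T hi < R ^ 5 + lo" using 5(2) c i(3) by (simp add: encx_ev lo_def split: if_splits)
    have n: "k < lo" if "k \<in> T" "k < hi" for k
      using below_cases[OF finT lohi(1)] lt that unfolding top by (metis add_less_cancel_left not_le)
    have "D1 = {}"
    proof (rule ccontr)
      assume "D1 \<noteq> {}"
      then obtain y where y: "y \<in> D1" by blast
      then have "y < R" using Tk(2) R_large(2) by auto
      then have "lo \<le> k2 y" "k2 y < hi" using f by (auto simp: k2_def lo_def hi_def enc_le enc_less)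
      moreover have "k2 y \<in> T" using y by (simp add: Tk keys_def ks_def)
      ultimately show False using n[of "k2 y"] by simp
    qed
    then show ?case using i by (auto simp: g encx_cost intro!: exI[of _ A1] exI[of _ p1])
  qed
  show ?thesis unfolding settle_def
  proof (rule wp_SeqI[OF pred[OF inv refl]], clarify, rule wp_conseq[OF loop], assumption, goal_cases)
    case (1 u \<tau> T u' z)
    obtain \<sigma>' S' where z: "z = (\<sigma>', S')" by (cases z)
    from 1 obtain A' p' where "Inv \<sigma>' S' A' p' {}" "und A' = und A" "u' + Pot A' p' {} \<le> Pot A p D + 50"
      unfolding z prod.case by blast
    then show ?case using \<open>u \<le> 350 * lg\<close> lg1 unfolding z prod.case
      by (intro exI[of _ u'] conjI order_refl exI[of _ A'] exI[of _ p']) auto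
  qed
qed

end

section \<open>Updates and queries\<close>

definition locate :: com where
  "locate =
     (NodeX ::= Num 2 \<otimes> Reg Arg0 \<otimes> Reg Guesses \<oplus> Reg Index \<odot> Reg Guesses ;;
      NodeY ::= (Num 2 \<otimes> Reg Arg1 \<oplus> Num 1) \<otimes> Reg Guesses
        \<oplus> (Num 2 \<otimes> Reg SizeJ \<ominus> Reg Index \<odot> Reg Guesses) ;;
      Copy ::= Reg Index \<oslash> Reg Guesses)"

text \<open>Keys of kind 3 are ordered by value first, so the last one carries the largest value; if
  there is none, all values are below their cut-offs and the answer is 0.\<close>

definition answer :: com where
  "answer =
     (do_pred (encx (Num 4) (Num 0) (Num 0) (Num 0) (Num 0)) ;;
      (IF Reg Res \<lhd> Reg KeyTop \<oplus> encx (Num 3) (Num 0) (Num 0) (Num 0) (Num 0) THEN (AnsNum ::= Num 0)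
       ELSE (AnsNum ::= (Reg Res \<ominus> Reg KeyTop) \<oslash> (Reg Radix \<otimes> Reg Radix \<otimes> Reg Radix) \<odot> Reg Radix)))"

text \<open>The new unit starts at the left copy. Marking the right copy makes \<open>good\<close>
  hold for it without any comparison; \<open>settle\<close> decides later.\<close>

definition insert_step :: com where
  "insert_step =
     (locate ;; ValNew ::= Elem Pub (Reg NodeX) \<otimes> mult_at NodeX ;; add_unit NodeX NodeY ValNew ;;
      do_insert (encx (Num 2) (Reg NodeY) (Num 0) (Num 0) (Num 0)) ;; adjust ;;
      Index ::= Reg Index \<oplus> Num 1)"

text \<open>The present owner of a unit is recorded in the keys only. A key of kind 0 ends in the
  digit 0, so searching below the same digits ending in 1 returns it exactly if it is
  present.\<close>

definition choose_owner :: com where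
  "choose_owner =
     (do_pred (encx (Num 0) (Reg NodeX) (Reg NodeY) (Reg Copy) (Num 1)) ;;
      (IF Reg Res \<doteq> Reg KeyTop \<oplus> encx (Num 0) (Reg NodeX) (Reg NodeY) (Reg Copy) (Num 0) THEN Skip
       ELSE (Flag ::= Reg NodeX ;; NodeX ::= Reg NodeY ;; NodeY ::= Reg Flag)) ;;
      ValOld ::= Elem Pub (Reg NodeX) \<otimes> mult_at NodeX)"

definition delete_step :: com where
  "delete_step =
     (locate ;; choose_owner ;; del_unit NodeX NodeY ValOld ;; adjust ;;
      Index ::= Reg Index \<oplus> Num 1)"

definition update :: "com \<Rightarrow> com" where
  "update c = (Index ::= Num 0 ;; (WHILE Reg Index \<lhd> Reg Guesses \<otimes> Reg Copies DO c) ;; settle ;; answer)"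

definition query :: com where
  "query = (Arg0 ::= Reg AnsNum ;; Arg1 ::= Reg AnsDen)"

context graph_machine
begin

text \<open>Left copies have even and right copies odd quotients by \<open>G\<close>. The remainder
  is the exponent of the weight, so \<open>m\<close> needs no case distinction; this is why the
  right copy for guess \<open>e\<close> has remainder \<open>2 * J - e\<close>.\<close>

definition left :: "nat \<Rightarrow> nat \<Rightarrow> nat" where "left u e = 2 * u * G + e"
definition right :: "nat \<Rightarrow> nat \<Rightarrow> nat" where "right v e = (2 * v + 1) * G + (2 * J - e)"
definition cell :: "nat \<Rightarrow> nat \<Rightarrow> nat \<Rightarrow> edge_copy" where
  "cell u v i = (left u (i mod G), right v (i mod G), i div G)"
text \<open>The orientation in which left copies own everything. The actual orientation is compared
  with it through \<open>und\<close> only.\<close>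

definition units :: "nat edges \<Rightarrow> edge_copy set" where
  "units E = {cell u v i | u v i. (u, v) \<in> E \<and> i < G * K}"

lemma e_less: "i mod G < G" "i mod G \<le> 2 * J"
proof -
  show "i mod G < G" using G_pos by simp
  then show "i mod G \<le> 2 * J" by (simp add: G_def)
qed

lemma div_G: "e < G \<Longrightarrow> left u e div G = 2 * u" "e < G \<Longrightarrow> left u e mod G = e"
  "right v e div G = 2 * v + 1" "right v e mod G = 2 * J - e"
proof -
  have *: "(x * G + d) div G = x" "(x * G + d) mod G = d" if "d < G" for x d using that by simp_all
  have "2 * J - e < G" by (simp add: G_def)
  then show "right v e div G = 2 * v + 1" "right v e mod G = 2 * J - e" unfolding right_def by (rule *)+
qed (auto simp: left_def)

lemma node_less: "u < n \<Longrightarrow> e < G \<Longrightarrow> left u e < N" "v < n \<Longrightarrow> right v e < N"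
proof -
  have *: "x * G + e < 2 * n * G" if "x < 2 * n" "e < G" for x e
  proof -
    have "Suc x * G \<le> 2 * n * G" using that by (intro mult_right_mono) auto
    then show ?thesis using that by simp
  qed
  show "left u e < N" if "u < n" "e < G" using *[of "2 * u" e] that by (simp add: left_def N_def)
  show "right v e < N" if "v < n" using *[of "2 * v + 1" "2 * J - e"] that by (simp add: right_def N_def G_def)
qed

lemma cell_inj:
  assumes "cell u v i = cell u' v' i'"
  shows "u = u' \<and> v = v' \<and> i = i'"
proof -
  have l: "left u (i mod G) = left u' (i' mod G)" and r: "right v (i mod G) = right v' (i' mod G)" and d: "i div G = i' div G"
    using assms by (auto simp: cell_def)
  have "u = u'" "i mod G = i' mod G" using arg_cong[OF l, of "\<lambda>z. z div G"] arg_cong[OF l, of "\<lambda>z. z mod G"]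
    div_G e_less(1) by auto
  moreover have "v = v'" using arg_cong[OF r, of "\<lambda>z. z div G"] div_G by auto
  ultimately show ?thesis using d by (metis div_mult_mod_eq)
qed

lemma cell_swap: "cell u v i = (x, y, j) \<Longrightarrow> cell u' v' i' \<noteq> (y, x, j')"
proof
  assume "cell u v i = (x, y, j)" "cell u' v' i' = (y, x, j')"
  then have "x = left u (i mod G)" "x = right v' (i' mod G)" by (auto simp: cell_def)
  then have "left u (i mod G) div G = right v' (i' mod G) div G" by simp
  then have "2 * u = 2 * v' + 1" using div_G e_less(1) by simp
  then show False by presburger
qed

lemma cell_U:
  assumes "u < n" "v < n" "i < G * K"
  shows "cell u v i \<in> U" "i div G < K"
proof -
  show "i div G < K" using assms(3) by (simp add: less_mult_imp_div_less mult.commute)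
  then show "cell u v i \<in> U" using node_less assms e_less(1) by (auto simp: cell_def U_def)
qed

text \<open>As no unit has two owners, forgetting the owners doubles the cardinality. Hence
  \<open>und A\<close> determines the number of units, and flips cannot exhaust the capacity
  \<open>ub\<close>.\<close>

lemma card_und:
  assumes "finite A" "\<forall>(x, y, j)\<in>A. (y, x, j) \<notin> A"
  shows "card (und A) = 2 * card A"
proof -
  let ?s = "\<lambda>(x, y, j). (y, x, j)"
  have e: "{(x, y, j). (y, x, j) \<in> A} = ?s ` A" by force
  have "card (?s ` A) = card A" by (rule card_image) (auto simp: inj_on_def)
  moreover have "A \<inter> ?s ` A = {}" using assms(2) by auto
  ultimately show ?thesis unfolding und_def e using assms(1) by (simp add: card_Un_disjoint)
qed

lemma card_eq_und:
  assumes "finite A" "\<forall>(x, y, j)\<in>A. (y, x, j) \<notin> A" "finite A'" "\<forall>(x, y, j)\<in>A'. (y, x, j) \<notin> A'" "und A = und A'"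
  shows "card A = card A'"
  using card_und[OF assms(1,2)] card_und[OF assms(3,4)] assms(5) by simp

definition part :: "nat edges \<Rightarrow> nat \<Rightarrow> nat \<Rightarrow> nat \<Rightarrow> edge_copy set" where
  "part E u v i = units E \<union> cell u v ` {..<i}"

lemma units_asym: "T \<subseteq> {cell u v i | u v i. True} \<Longrightarrow> \<forall>(x, y, j)\<in>T. (y, x, j) \<notin> T"
proof clarify
  fix x y j assume T: "T \<subseteq> {cell u v i | u v i. True}" and a: "(x, y, j) \<in> T" "(y, x, j) \<in> T"
  obtain u v i u' v' i' where "(x, y, j) = cell u v i" "(y, x, j) = cell u' v' i'" using T a by blast
  then show False using cell_swap[of u v i x y j u' v' i' j] by simp
qed

lemma units_card:
  assumes "finite E"
  shows "finite (units E)" "card (units E) = card E * (G * K)"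
proof -
  have e: "units E = (\<lambda>((u, v), i). cell u v i) ` (E \<times> {..<G * K})" by (force simp: units_def)
  show "finite (units E)" unfolding e using assms by simp
  have "inj_on (\<lambda>((u, v), i). cell u v i) (E \<times> {..<G * K})" using cell_inj by (auto simp: inj_on_def)
  then show "card (units E) = card E * (G * K)" unfolding e using assms by (simp add: card_image card_cartesian_product)
qed

lemma cell_units: "cell u v i \<in> units E \<longleftrightarrow> (u, v) \<in> E \<and> i < G * K"
proof
  assume "cell u v i \<in> units E"
  then obtain u' v' i' where "cell u v i = cell u' v' i'" "(u', v') \<in> E" "i' < G * K" unfolding units_def by blast
  then show "(u, v) \<in> E \<and> i < G * K" using cell_inj by metis
qed (auto simp: units_def)

lemma cell_image: "cell u v i \<in> cell u v ` I \<longleftrightarrow> i \<in> I"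
  using cell_inj by blast

lemma part_full: "part E u v (G * K) = units (insert (u, v) E)"
  by (auto simp: part_def units_def)

lemma part_0: "part E u v 0 = units E"
  by (simp add: part_def)

text \<open>Values stay below \<open>R\<close>, so an additional unit raises \<open>Phi\<close> by
  at most \<open>lR\<close>. The price \<open>cI\<close> of a step adds the drift of one load, one
  marked node and the running time.\<close>

definition lR :: real where "lR = ln (real R)"
definition cI :: real where "cI = 1500 * lg + cL + cD + cF * lR"

lemma lR: "0 \<le> lR"
  using R_large(11) by (simp add: lR_def)

definition ans_ok :: "(loc \<Rightarrow> nat) \<Rightarrow> (nat \<Rightarrow> nat) \<Rightarrow> bool" where
  "ans_ok \<sigma> p \<longleftrightarrow> (\<forall>z<N. thr z (p z) \<le> \<sigma> (V AnsNum)) \<and> (\<sigma> (V AnsNum) = 0 \<or> (\<exists>x<N. \<sigma> (V AnsNum) = thr x (p x)))"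

section \<open>Correctness of the pieces of an update\<close>

lemma wp_locate:
  assumes fx: "fixed \<sigma>" and r: "\<sigma> (V Arg0) = u" "\<sigma> (V Arg1) = v" "\<sigma> (V Index) = i" and b: "u < n" "v < n" "i < G * K"
  shows "wp w B cli locate (\<lambda>t (\<sigma>', S'). t \<le> 100 \<and> S' = S
    \<and> \<sigma>' = \<sigma>(V NodeX := left u (i mod G), V NodeY := right v (i mod G), V Copy := i div G)) (\<sigma>, S)"
proof -
  have q: "\<sigma> (V Guesses) = G" "\<sigma> (V SizeJ) = J" using fx by (auto simp: fixed_def)
  have NW: "N < 2 ^ w" using R_large(2) R_less_word by simp
  have l: "left u (i mod G) < 2 ^ w" "right v (i mod G) < 2 ^ w" using node_less b e_less(1) NW by (meson less_trans)+
  have z: "2 * u \<le> 2 * u * G" "2 * v + 1 \<le> (2 * v + 1) * G" "2 * J < G" using G_pos by (auto simp: G_def)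
  have k: "2 * u * G + i mod G < 2 ^ w" "(2 * v + 1) * G + (2 * J - i mod G) < 2 ^ w"
    using l by (simp_all add: left_def right_def)
  have W: "2 * u < 2 ^ w" "2 * u * G < 2 ^ w" "2 * v < 2 ^ w" "2 * v + 1 < 2 ^ w" "(2 * v + 1) * G < 2 ^ w" "2 * J < 2 ^ w"
    using k z R_large(6) R_less_word(1)[of G] by linarith+
  show ?thesis unfolding locate_def
    using W k q r e_less(2)[of i] small[of 1] small[of 2]
    by (intro c_intros) (auto simp: left_def right_def simp del: One_nat_def add_Suc_right mult_Suc)
qed

lemma wp_answer:
  assumes inv: "Inv \<sigma> S A p D"
  shows "wp w B cli answer (\<lambda>t (\<sigma>', S'). t \<le> 450 * lg \<and> Inv \<sigma>' S' A p D \<and> ans_ok \<sigma>' p) (\<sigma>, S)"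
proof -
  define lo where "lo = enc R 3 0 0 0 0"
  define hi where "hi = enc R 4 0 0 0 0"
  have rep: "rep \<sigma> S A p D" using inv by (simp add: Inv_def)
  then have c: "\<sigma> (V Radix) = R" "\<sigma> (V KeyTop) = R ^ 5" by (auto simp: rep_def fixed_def)
  note wf = rep_wf[OF rep, unfolded wf_def]
  have Tk: "S = keys A p D" "D \<subseteq> {..<N}" using rep by (auto simp: rep_def)
  have finS: "finite S" unfolding Tk keys_def by (rule ks_card(1)[OF wf_finite[OF rep_wf[OF rep]] Tk(2)])
  have f: "0 < R" "3 < R" "4 < R" using R_large(7) by auto
  have lohi: "lo \<le> hi" "hi < R ^ 5" "lo < R ^ 5" using f by (simp_all add: lo_def hi_def enc_le enc_bounds)
  have zw: "0 < (2::nat) ^ w" "4 < (2::nat) ^ w" "3 < (2::nat) ^ w" using small by auto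
  have W: "R ^ 5 + lo < 2 ^ w" "R * R < 2 ^ w" "R * R * R < 2 ^ w" using word lohi R_pow by linarith+
  have val: "k3 (thr x (p x)) x < hi \<and> lo \<le> k3 (thr x (p x)) x \<and> thr x (p x) < R" if "x < N" for x
    using that wf f R_large(2) by (auto simp: k3_def hi_def lo_def enc_less enc_le)
  have mem: "k3 (thr x (p x)) x \<in> S" if "x < N" "thr x (p x) \<noteq> 0" for x
    using that by (auto simp: Tk keys_def ks_def)
  let ?\<sigma> = "\<sigma>(V Key := hi, V Res := below S hi)"
  have inv': "Inv (?\<sigma>(V AnsNum := v)) S A p D" for v
    using inv by (auto simp: Inv_def rep_def fixed_upd)
  have 1: "wp w B cli (do_pred (encx (Num 4) (Num 0) (Num 0) (Num 0) (Num 0))) (\<lambda>t (\<sigma>', S'). t \<le> 350 * lg \<and> \<sigma>' = ?\<sigma> \<and> S' = S) (\<sigma>, S)"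
    using f zw lohi lg1 c by (intro c_do_pred[where k = hi]) (simp_all add: encx_client encx_ev encx_cost encx_ok hi_def[symmetric])
  have 2: "wp w B cli (IF Reg Res \<lhd> Reg KeyTop \<oplus> encx (Num 3) (Num 0) (Num 0) (Num 0) (Num 0) THEN (AnsNum ::= Num 0)
       ELSE (AnsNum ::= (Reg Res \<ominus> Reg KeyTop) \<oslash> (Reg Radix \<otimes> Reg Radix \<otimes> Reg Radix) \<odot> Reg Radix))
    (\<lambda>t (\<sigma>', S'). t \<le> 100 \<and> Inv \<sigma>' S' A p D \<and> ans_ok \<sigma>' p) (?\<sigma>, S)"
  proof (rule c_Cond, goal_cases)
    case 1 show ?case by (simp add: encx_client)
  next
    case 2 show ?case using f W(1) zw c by (simp add: encx_ok encx_ev lo_def)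
  next
    case 3
    then have lt: "below S hi < R ^ 5 + lo" using c by (simp add: encx_ev lo_def split: if_splits)
    have n: "k < lo" if "k \<in> S" "k < hi" for k
      using below_cases[OF finS lohi(1)] lt that unfolding top by (metis add_less_cancel_left not_le)
    have "thr x (p x) = 0" if "x < N" for x using n[OF mem[OF that]] val[OF that] by (meson not_le)
    then have "ans_ok (?\<sigma>(V AnsNum := 0)) p" by (simp add: ans_ok_def)
    then show ?case using inv' zw by (intro c_assign) (simp_all add: encx_cost)
  next
    case 4
    then have ge: "\<not> below S hi < R ^ 5 + lo" using c by (simp add: encx_ev lo_def split: if_splits)
    from below_cases[OF finS lohi(1)] obtain k where k: "k \<in> S" "lo \<le> k" "k < hi" "below S hi = R ^ 5 + k"
        "\<And>k'. k' \<in> S \<Longrightarrow> k' < hi \<Longrightarrow> k' \<le> k"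
      using ge unfolding top by (metis (no_types, lifting))
    then obtain x where x: "x < N" "thr x (p x) \<noteq> 0" "k = k3 (thr x (p x)) x"
      using ks_range3[of A "\<lambda>t. p (fst t) * m (fst t)" D "\<lambda>x. thr x (p x)" k] wf by (auto simp: Tk keys_def lo_def)
    have xR: "x < R" "thr x (p x) < R" using x(1) R_large(2) val[OF x(1)] by auto
    have dec: "k div (R * R * R) mod R = thr x (p x)" unfolding x(3) k3_def using xR f by (simp add: enc_decode)
    have "thr z (p z) \<le> thr x (p x)" if "z < N" for z
    proof (cases "thr z (p z) = 0")
      case False
      then have "k3 (thr z (p z)) z \<le> k3 (thr x (p x)) x" using k(5)[OF mem[OF that]] val[OF that] x(3) by simp
      then show ?thesis using xR val[OF that] that R_large(2) f by (auto simp: k3_def enc_le)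
    qed simp
    then have "ans_ok (?\<sigma>(V AnsNum := thr x (p x))) p" using x(1) by (auto simp: ans_ok_def)
    moreover have "R ^ 5 + k < 2 ^ w" using k(3) lohi word by linarith
    ultimately show ?case using inv' zw W c dec k(4) by (intro c_assign) (simp_all add: encx_cost)
  qed
  show ?thesis unfolding answer_def
  proof (rule wp_SeqI[OF 1], clarify, rule wp_conseq[OF 2], goal_cases)
    case (1 t a c t' z)
    then show ?case using lg1 by (intro exI[of _ t']) (cases z, auto)
  qed
qed

lemma wp_insert_step:
  assumes rep: "rep \<sigma> S A p D" and good: "good A p D" and near: "\<And>x. x < N \<Longrightarrow> near A p x"
    and r: "\<sigma> (V Arg0) = u" "\<sigma> (V Arg1) = v" "\<sigma> (V Index) = i" and b: "u < n" "v < n" "i < G * K"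
    and und: "cell u v i \<notin> und A" and card: "card A < ub"
  shows "wp w B cli insert_step (\<lambda>t (\<sigma>', S'). \<exists>p' D'. Inv \<sigma>' S' (insert (cell u v i) A) p' D'
    \<and> \<sigma>' (V Arg0) = u \<and> \<sigma>' (V Arg1) = v \<and> \<sigma>' (V Index) = i + 1
    \<and> t + 50 + Pot (insert (cell u v i) A) p' D' \<le> Pot A p D + cI) (\<sigma>, S)"
proof -
  define x where "x = left u (i mod G)"
  define y where "y = right v (i mod G)"
  define j where "j = i div G"
  have ce: "cell u v i = (x, y, j)" by (simp add: cell_def x_def y_def j_def)
  have xy: "x < N" "y < N" "j < K" using node_less b e_less(1) cell_U(2) by (auto simp: x_def y_def j_def)
  have ne: "x \<noteq> y" using cell_swap[of u v i x y j u v i j] ce by auto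
  have nA: "(x, y, j) \<notin> A" "(y, x, j) \<notin> A" using und by (auto simp: und_def ce)
  define A' where "A' = insert (x, y, j) A"
  have AU: "A \<subseteq> U" "D \<subseteq> {..<N}" using rep by (auto simp: rep_def)
  have fin: "finite A" "finite D" using AU finite_U finite_subset by auto
  have fx: "fixed \<sigma>" using rep by (simp add: rep_def)
  let ?\<sigma>1 = "\<sigma>(V NodeX := x, V NodeY := y, V Copy := j)"
  let ?\<sigma>2 = "?\<sigma>1(V ValNew := p x * m x)"
  have fx1: "fixed ?\<sigma>1" using fx by (simp add: fixed_upd)
  have px: "\<sigma> (H Pub x) = p x" "p x \<le> N * K" using rep xy(1) by (auto simp: rep_def)
  have 2: "wp w B cli (ValNew ::= Elem Pub (Reg NodeX) \<otimes> mult_at NodeX) (\<lambda>t (\<sigma>', S'). t \<le> 50 \<and> \<sigma>' = ?\<sigma>2 \<and> S' = S) (?\<sigma>1, S)"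
  proof -
    have "(?\<sigma>1) (H Pow (x mod G)) = m x" "x mod G < B" using fx1 index(2)[of "x mod G"] G_pos by (auto simp: fixed_def m_def)
    moreover have "\<sigma> (V Guesses) = G" using fx by (simp add: fixed_def)
    ultimately show ?thesis using R_less_word(1)[OF value_bound[OF px(2), of x]] index(1)[OF xy(1)] px(1)
      by (intro c_intros) simp_all
  qed
  have rep2: "rep ?\<sigma>2 S A p D" using rep by (auto simp: rep_def fixed_upd)
  have A'p: "pot0 A' p D \<le> pot0 A p D + cL" "Phi A' \<le> Phi A + lR"
  proof -
    show "pot0 A' p D \<le> pot0 A p D + cL" unfolding A'_def by (rule pot0_insert[OF fin(1) nA(1) xy(1)])
    have d: "deg A' x = deg A x + 1" unfolding A'_def using deg_insert[OF fin(1) nA(1)] by simp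
    have "A' \<subseteq> U" using AU xy by (auto simp: A'_def U_def)
    then have "deg A' x * m x < R" using value_bound[OF deg_le] by blast
    then have "real (deg A' x * m x) \<le> real R" by (simp only: of_nat_le_iff)
    moreover have "real (deg A' x * m x) = (real (deg A x) + 1) * real (m x)" by (simp add: d algebra_simps)
    moreover have "0 < (real (deg A x) + 1) * real (m x)" using m_bounds(1)[of x] by (intro mult_pos_pos) auto
    ultimately have "ln ((real (deg A x) + 1) * real (m x)) \<le> lR" unfolding lR_def by (intro ln_mono) auto
    then show "Phi A' \<le> Phi A + lR" unfolding A'_def Phi_insert[OF fin(1) nA(1) xy(1)] by simp
  qed
  have dirty: "wp w B cli (do_insert (encx (Num 2) (Reg NodeY) (Num 0) (Num 0) (Num 0)))
    (\<lambda>t (\<sigma>', S'). t \<le> 250 * lg \<and> but_key \<tau> \<sigma>' \<and> rep \<sigma>' S' A' p (insert y D)) (\<tau>, T)"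
    if "rep \<tau> T A' p D" "\<tau> (V NodeY) = y" for \<tau> T
  proof -
    have c: "\<tau> (V Radix) = R" "T = keys A' p D" using that by (auto simp: rep_def fixed_def)
    have T': "insert (k2 y) T = keys A' p (insert y D)" unfolding c(2) by (auto simp: keys_def ks_def)
    have rep': "rep (\<tau>(V Key := k2 y)) (insert (k2 y) T) A' p (insert y D)"
      unfolding T' using that(1) xy(2) by (auto simp: rep_def fixed_upd)
    have f: "y < R" "0 < R" "2 < R" using xy(2) R_large(2,7) by auto
    have "k2 y < R ^ 5" using f by (simp add: k2_def enc_bounds)
    moreover have "1 + (40 * J + 80) * card (insert (k2 y) T) \<le> NB"
      unfolding T' keys_def by (rule wf_cap[OF rep_wf[OF rep']]) simp
    ultimately show ?thesis using f rep' c(1) that(2) lg1 small[of 0] small[of 2]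
      by (intro c_do_insert[where k = "k2 y"])
        (auto simp: encx_client encx_ev encx_cost encx_ok k2_def[symmetric] but_key_def)
  qed
  have good': "good A' p (insert y D)" using good by (auto simp: good_def A'_def)
  have cardD: "pot0 A' p (insert y D) \<le> pot0 A' p D + cD"
  proof -
    have "real (card (insert y D)) \<le> real (card D) + 1" using fin(2) by (simp add: card_insert_if)
    then have "cD * real (card (insert y D)) \<le> cD * (real (card D) + 1)" using constants_pos by (intro mult_left_mono)
    then show ?thesis by (simp add: pot0_def algebra_simps)
  qed
  have PotA: "pot0 A' p (insert y D) + cF * Phi A' \<le> Pot A p D + cL + cD + cF * lR"
  proof -
    have "cF * Phi A' \<le> cF * (Phi A + lR)" using A'p(2) constants_pos by (intro mult_left_mono)
    then show ?thesis using A'p(1) cardD by (simp add: Pot_def algebra_simps)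
  qed
  have x2: "?\<sigma>2 (V NodeX) = x" "?\<sigma>2 (V NodeY) = y" "?\<sigma>2 (V Copy) = j" "?\<sigma>2 (V ValNew) = p x * m x" by simp_all
  show ?thesis unfolding insert_step_def ce
  proof (rule wp_SeqI[OF wp_locate[OF fx r b]], fold x_def y_def j_def, clarify, rule wp_SeqI[OF 2], clarify, goal_cases)
    case (1 t1 a c t2 d e)
    show ?case
    proof (rule wp_SeqI[OF wp_add_unit[OF rep2 x2 xy nA ne card]], goal_cases)
      case (7 t3 s3)
      obtain \<sigma>3 S3 where s3: "s3 = (\<sigma>3, S3)" by (cases s3)
      from 7 have 3: "t3 \<le> 550 * lg" "but_key ?\<sigma>2 \<sigma>3" "rep \<sigma>3 S3 A' p D" unfolding s3 prod.case A'_def by blast+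
      have y3: "\<sigma>3 (V NodeY) = y" using 3(2) by (simp add: but_key_def)
      show ?case unfolding s3
      proof (rule wp_SeqI[OF dirty[OF 3(3) y3]], goal_cases)
        case (1 t4 s4)
        obtain \<sigma>4 S4 where s4: "s4 = (\<sigma>4, S4)" by (cases s4)
        from 1 have 4: "t4 \<le> 250 * lg" "but_key \<sigma>3 \<sigma>4" "rep \<sigma>4 S4 A' p (insert y D)" unfolding s4 prod.case by blast+
        have r4: "\<sigma>4 (V NodeX) = x" "\<sigma>4 (V Arg0) = u" "\<sigma>4 (V Arg1) = v" "\<sigma>4 (V Index) = i"
          using 3(2) 4(2) r by (simp_all add: but_key_def)
        show ?case unfolding s4
        proof (rule wp_SeqI[OF wp_adjust[OF 4(3) r4(1) xy(1) good']], goal_cases)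
          case (1 t5 s5)
          obtain \<sigma>5 S5 where s5: "s5 = (\<sigma>5, S5)" by (cases s5)
          from 1 obtain p5 D5 where 5: "rep \<sigma>5 S5 A' p5 D5" "same_regs \<sigma>4 \<sigma>5" "good A' p5 D5" "near A' p5 x"
              "\<forall>z. z \<noteq> x \<longrightarrow> p5 z = p z" "t5 + pot0 A' p5 D5 \<le> pot0 A' p (insert y D) + 100 * lg"
            unfolding s5 prod.case by blast
          have r5: "\<sigma>5 (V Arg0) = u" "\<sigma>5 (V Arg1) = v" "\<sigma>5 (V Index) = i" using 5(2) r4 by (simp_all add: same_regs_def)
          have "near A' p5 z" if "z < N" for z
          proof (cases "z = x")
            case False
            then have "deg A' z = deg A z" unfolding A'_def using deg_insert[OF fin(1) nA(1)] by simp
            then show ?thesis using near[OF that] 5(5) False near_cong[of A' z A p5 p] by simp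
          qed (use 5 in simp)
          moreover have "rep (\<sigma>5(V Index := i + 1)) S5 A' p5 D5" using 5(1) by (auto simp: rep_def fixed_upd)
          ultimately have inv: "Inv (\<sigma>5(V Index := i + 1)) S5 A' p5 D5" using 5(3) by (simp add: Inv_def)
          have iw: "i + 1 < 2 ^ w"
          proof -
            have "G * K \<le> N * K" using n(1) by (auto simp: N_def)
            then show ?thesis using b(3) R_large(10) R_less_word(1) word R_pow(1) by linarith
          qed
          have "t1 + (t2 + (t3 + (t4 + (t5 + 6)))) + 50 + Pot A' p5 D5 \<le> Pot A p D + cI"
            using \<open>t1 \<le> 100\<close> \<open>t2 \<le> 50\<close> 3(1) 4(1) 5(6) PotA lg1 by (simp add: Pot_def cI_def)
          then have fin5: "\<exists>p' D'. Inv (\<sigma>5(V Index := i + 1)) S5 A' p' D' \<and>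
              t1 + (t2 + (t3 + (t4 + (t5 + 6)))) + 50 + Pot A' p' D' \<le> Pot A p D + cI" using inv by blast
          show ?case unfolding s5
            using fin5 r5 iw small[of 1] by (intro c_assign) (simp_all add: A'_def[symmetric] add.assoc)
        qed
      qed
    qed simp_all
  qed
qed

lemma und_Un: "und (X \<union> Y) = und X \<union> und Y"
  by (auto simp: und_def)

lemma und_remove:
  assumes "\<forall>(x, y, j)\<in>A. (y, x, j) \<notin> A" "(x, y, j) \<in> A"
  shows "und (A - {(x, y, j)}) = und A - {(x, y, j), (y, x, j)}"
  using assms by (auto simp: und_def)

lemma ks_mem0:
  assumes wf: "wf A g D f" and t: "t \<in> U"
  shows "k0 t \<in> ks A g D f \<longleftrightarrow> t \<in> A"
proof
  note w = wf[unfolded wf_def]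
  assume "k0 t \<in> ks A g D f"
  then consider s where "s \<in> A" "k0 t = k0 s" | s where "s \<in> A" "k0 t = k1 (g s) s" | y where "y \<in> D" "k0 t = k2 y"
    | y where "y < N" "k0 t = k3 (f y) y"
    by (auto simp: ks_def)
  then show "t \<in> A"
  proof cases
    case (1 s)
    then have "s \<in> U" using w by blast
    then have "t = s" using k_eq(1)[OF t \<open>s \<in> U\<close>] 1(2) by simp
    then show ?thesis using 1(1) by simp
  next
    case (2 s)
    then have "s \<in> U" "g s < R" using w by blast+
    then show ?thesis using k_eq(5)[OF t \<open>s \<in> U\<close> \<open>g s < R\<close>] 2(2) by blast
  next
    case (3 y)
    then have "y < N" using w by auto
    then show ?thesis using k_eq(7)[OF t \<open>y < N\<close>] 3(2) by blast
  next
    case (4 y)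
    then have "f y < R" using w by blast
    then show ?thesis using k_eq(9)[OF t 4(1) \<open>f y < R\<close>] 4(2) by blast
  qed
qed (simp add: ks_def)

text \<open>A membership test by means of a predecessor search.\<close>

lemma below_Suc:
  assumes "finite S"
  shows "below S (k + 1) = R ^ 5 + k \<longleftrightarrow> k \<in> S"
proof (rule below_cases[OF assms le_add1[of k 1]])
  assume "below S (k + 1) < 2 ^ (40 * J + 80) + k" "\<And>k'. k' \<in> S \<Longrightarrow> k' < k + 1 \<Longrightarrow> k' < k"
  then show ?thesis unfolding top by auto
next
  fix k' assume "k' \<in> S" "k \<le> k'" "k' < k + 1" "below S (k + 1) = 2 ^ (40 * J + 80) + k'"
  then show ?thesis unfolding top by (auto simp: less_Suc_eq_le)
qed

lemma wp_value:
  assumes rep: "rep \<sigma> S A p D" and x: "\<sigma> (V NodeX) = x" "x < N" and v: "client (V rv)" "\<not> kept (V rv)"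
  shows "wp w B cli (rv ::= Elem Pub (Reg NodeX) \<otimes> mult_at NodeX)
    (\<lambda>t (\<sigma>', S'). t \<le> 50 \<and> \<sigma>' = \<sigma>(V rv := p x * m x) \<and> S' = S) (\<sigma>, S)"
proof -
  have q: "\<sigma> (H Pub x) = p x" "p x \<le> N * K" "fixed \<sigma>" using rep x(2) by (auto simp: rep_def)
  then have "\<sigma> (H Pow (x mod G)) = m x" "x mod G < B" "\<sigma> (V Guesses) = G"
    using index(2)[of "x mod G"] G_pos by (auto simp: fixed_def m_def)
  moreover have "rv \<noteq> KeyTop" "rv \<noteq> KeyHalf" using v by auto
  ultimately show ?thesis using R_less_word(1)[OF value_bound[OF q(2), of x]] index(1)[OF x(2)] q(1) x(1) v(1)
    by (intro c_assign) simp_all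
qed

lemma wp_choose_owner:
  assumes rep: "rep \<sigma> S A p D" and r: "\<sigma> (V NodeX) = x" "\<sigma> (V NodeY) = y" "\<sigma> (V Copy) = j"
    and U: "(x, y, j) \<in> U" and A: "(x, y, j) \<in> A \<or> (y, x, j) \<in> A"
  shows "wp w B cli choose_owner (\<lambda>t (\<sigma>', S'). t \<le> 500 * lg \<and> S' = S \<and> rep \<sigma>' S A p D
    \<and> \<sigma>' (V Arg0) = \<sigma> (V Arg0) \<and> \<sigma>' (V Arg1) = \<sigma> (V Arg1) \<and> \<sigma>' (V Index) = \<sigma> (V Index) \<and> \<sigma>' (V Copy) = j
    \<and> (\<exists>x' y'. \<sigma>' (V NodeX) = x' \<and> \<sigma>' (V NodeY) = y' \<and> (x', y', j) \<in> A \<and> {x', y'} = {x, y}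
        \<and> \<sigma>' (V ValOld) = p x' * m x')) (\<sigma>, S)"
proof -
  have c: "\<sigma> (V Radix) = R" "\<sigma> (V KeyTop) = R ^ 5" "S = keys A p D" "D \<subseteq> {..<N}" "A \<subseteq> U"
    using rep by (auto simp: rep_def fixed_def)
  have b: "x < N" "y < N" "j < K" using U by (auto simp: U_def)
  note f = enc_fields[OF b]
  have R1: "1 < R" using R_large(7) by simp
  define k where "k = k0 (x, y, j)"
  have e: "enc R 0 x y j 0 = k" "enc R 0 x y j 1 = k + 1" by (auto simp: k_def k0_def enc_def)
  have "enc R 0 x y j 1 < R ^ 5" using f R1 by (intro enc_bounds) auto
  then have kb: "k + 1 < R ^ 5" "k < R ^ 5" unfolding e by auto
  have W: "R ^ 5 + k < 2 ^ w" using kb word by linarith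
  have finS: "finite S" unfolding c(3) keys_def by (rule ks_card(1)[OF wf_finite[OF rep_wf[OF rep]] c(4)])
  have mem: "below S (k + 1) = R ^ 5 + k \<longleftrightarrow> (x, y, j) \<in> A"
    using below_Suc[OF finS, of k] ks_mem0[OF rep_wf[OF rep] U] by (simp add: k_def c(3) keys_def)
  have zw: "0 < (2::nat) ^ w" "1 < (2::nat) ^ w" using small by auto
  let ?\<sigma>1 = "\<sigma>(V Key := k + 1, V Res := below S (k + 1))"
  let ?ow = "(x, y, j) \<in> A"
  let ?\<sigma>2 = "if ?ow then ?\<sigma>1 else ?\<sigma>1(V Flag := x, V NodeX := y, V NodeY := x)"
  have 1: "wp w B cli (do_pred (encx (Num 0) (Reg NodeX) (Reg NodeY) (Reg Copy) (Num 1)))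
     (\<lambda>t (\<sigma>', S'). t \<le> 350 * lg \<and> \<sigma>' = ?\<sigma>1 \<and> S' = S) (\<sigma>, S)"
    using f R1 zw kb lg1 c(1) r e
    by (intro c_do_pred[where k = "k + 1"]) (simp_all add: encx_client encx_ev encx_cost encx_ok del: One_nat_def)
  have 2: "wp w B cli (IF Reg Res \<doteq> Reg KeyTop \<oplus> encx (Num 0) (Reg NodeX) (Reg NodeY) (Reg Copy) (Num 0) THEN Skip
       ELSE (Flag ::= Reg NodeX ;; NodeX ::= Reg NodeY ;; NodeY ::= Reg Flag))
     (\<lambda>t (\<sigma>', S'). t \<le> 90 \<and> \<sigma>' = ?\<sigma>2 \<and> S' = S) (?\<sigma>1, S)"
  proof (rule c_Cond, goal_cases)
    case 1 show ?case by (simp add: encx_client)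
  next
    case 2 show ?case using f W zw c r e by (simp add: encx_ok encx_ev)
  next
    case 3
    then have ?ow using mem c r e by (simp add: encx_ev split: if_splits)
    then show ?case by (intro wp_Skip) (simp add: encx_cost)
  next
    case 4
    then have "\<not> ?ow" using mem c r e by (simp add: encx_ev split: if_splits)
    then show ?case using r by (intro c_intros) (simp_all add: encx_cost)
  qed
  have rep2: "rep ?\<sigma>2 S A p D" using rep by (auto simp: rep_def fixed_upd)
  define x' where "x' = (if ?ow then x else y)"
  have x': "?\<sigma>2 (V NodeX) = x'" "x' < N" using r b by (auto simp: x'_def)
  have v: "client (V ValOld)" "\<not> kept (V ValOld)" by auto
  show ?thesis unfolding choose_owner_def
  proof (rule wp_SeqI[OF 1], clarify, rule wp_SeqI[OF 2], clarify, rule wp_conseq[OF wp_value[OF rep2 x' v]], goal_cases)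
    case (1 t1 a1 b1 t2 a2 b2 t3 z)
    let ?\<sigma>3 = "?\<sigma>2(V ValOld := p x' * m x')"
    have z: "z = (?\<sigma>3, S)" using 1(3) by (cases z) auto
    have t: "t3 \<le> 50" using 1(3) by (cases z) auto
    have "rep ?\<sigma>3 S A p D" using rep2 by (auto simp: rep_def fixed_upd)
    moreover have "?\<sigma>3 (V NodeX) = x'" "?\<sigma>3 (V NodeY) = (if ?ow then y else x)" "?\<sigma>3 (V ValOld) = p x' * m x'"
      "?\<sigma>3 (V Arg0) = \<sigma> (V Arg0)" "?\<sigma>3 (V Arg1) = \<sigma> (V Arg1)" "?\<sigma>3 (V Index) = \<sigma> (V Index)" "?\<sigma>3 (V Copy) = j"
      using r x'(1) by auto
    moreover have "(x', if ?ow then y else x, j) \<in> A" "{x', if ?ow then y else x} = {x, y}" using A by (auto simp: x'_def)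
    moreover have "t1 + (t2 + t3) \<le> 500 * lg" using 1(1,2) t lg1 by simp
    ultimately show ?case unfolding z prod.case by (intro exI[of _ t3]) blast
  qed
qed

lemma wp_delete_step:
  assumes inv: "Inv \<sigma> S A p D"
    and r: "\<sigma> (V Arg0) = u" "\<sigma> (V Arg1) = v" "\<sigma> (V Index) = i" and b: "u < n" "v < n" "i < G * K"
    and c: "cell u v i = (x, y, j)" and und: "(x, y, j) \<in> und A"
  shows "wp w B cli delete_step (\<lambda>t (\<sigma>', S'). \<exists>A' p' D'. Inv \<sigma>' S' A' p' D' \<and> und A' = und A - {(x, y, j), (y, x, j)}
    \<and> \<sigma>' (V Arg0) = u \<and> \<sigma>' (V Arg1) = v \<and> \<sigma>' (V Index) = i + 1
    \<and> t + 50 + Pot A' p' D' \<le> Pot A p D + cI) (\<sigma>, S)"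
proof -
  have rep: "rep \<sigma> S A p D" and good: "good A p D" and near: "\<And>x. x < N \<Longrightarrow> near A p x"
    using inv by (auto simp: Inv_def)
  have ce: "left u (i mod G) = x" "right v (i mod G) = y" "i div G = j" using c by (auto simp: cell_def)
  have U: "(x, y, j) \<in> U" using cell_U(1)[OF b] c by simp
  have A: "(x, y, j) \<in> A \<or> (y, x, j) \<in> A" using und by (auto simp: und_def)
  have AU: "A \<subseteq> U" "\<forall>(x, y, j)\<in>A. (y, x, j) \<notin> A" using rep by (auto simp: rep_def)
  have fin: "finite A" using AU finite_U finite_subset by auto
  have fx: "fixed \<sigma>" using rep by (simp add: rep_def)
  let ?\<sigma>1 = "\<sigma>(V NodeX := x, V NodeY := y, V Copy := j)"
  have rep1: "rep ?\<sigma>1 S A p D" using rep by (auto simp: rep_def fixed_upd)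
  have r1: "?\<sigma>1 (V NodeX) = x" "?\<sigma>1 (V NodeY) = y" "?\<sigma>1 (V Copy) = j" by simp_all
  show ?thesis unfolding delete_step_def
  proof (rule wp_SeqI[OF wp_locate[OF fx r b]], unfold ce, clarify, rule wp_SeqI[OF wp_choose_owner[OF rep1 r1 U A]], goal_cases)
    case (1 t1 a c t2 s2)
    obtain \<sigma>2 S2 where s2: "s2 = (\<sigma>2, S2)" by (cases s2)
    from 1(2) obtain x' y' where 2: "t2 \<le> 500 * lg" "S2 = S" "rep \<sigma>2 S A p D" "\<sigma>2 (V Arg0) = u" "\<sigma>2 (V Arg1) = v"
        "\<sigma>2 (V Index) = i" "\<sigma>2 (V Copy) = j" "\<sigma>2 (V NodeX) = x'" "\<sigma>2 (V NodeY) = y'" "(x', y', j) \<in> A" "{x', y'} = {x, y}"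
        "\<sigma>2 (V ValOld) = p x' * m x'"
      using r unfolding s2 prod.case by auto
    define A' where "A' = A - {(x', y', j)}"
    have x'N: "x' < N" using 2(10) AU by (auto simp: U_def)
    have "und A' = und A - {(x', y', j), (y', x', j)}" unfolding A'_def by (rule und_remove[OF AU(2) 2(10)])
    moreover have "{(x', y', j), (y', x', j)} = {(x, y, j), (y, x, j)}" using 2(11) by (auto simp: doubleton_eq_iff)
    ultimately have undA': "und A' = und A - {(x, y, j), (y, x, j)}" by simp
    have goodA': "good A' p D" using good by (auto simp: good_def A'_def)
    have d: "deg A z = deg A' z + (if z = x' then 1 else 0)" for z unfolding A'_def by (rule deg_remove[OF fin 2(10)])
    have pot: "pot0 A' p D + cF * Phi A' \<le> Pot A p D + cL"
    proof -
      have "pot0 A' p D \<le> pot0 A p D + cL" unfolding A'_def by (rule pot0_remove[OF fin 2(10) x'N])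
      \<comment> \<open>A node that owns a unit has value at least 1, so the removed summand is a
        nonnegative logarithm.\<close>
      moreover have "Phi A' \<le> Phi A"
      proof -
        have "1 * 1 \<le> real (deg A x') * real (m x')" using d[of x'] m_bounds(1)[of x'] by (intro mult_mono) auto
        then have "0 \<le> ln (real (deg A x') * real (m x'))" by (intro ln_ge_zero) simp
        then show ?thesis unfolding A'_def Phi_remove[OF fin 2(10) x'N] by simp
      qed
      then have "cF * Phi A' \<le> cF * Phi A" using constants_pos by (intro mult_left_mono)
      ultimately show ?thesis by (simp add: Pot_def)
    qed
    show ?case unfolding s2 2(2)
    proof (rule wp_SeqI[OF wp_del_unit[OF 2(3,8,9,7,12,10)]], goal_cases)
      case (7 t3 s3)
      obtain \<sigma>3 S3 where s3: "s3 = (\<sigma>3, S3)" by (cases s3)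
      from 7 have 3: "t3 \<le> 650 * lg" "but_key \<sigma>2 \<sigma>3" "rep \<sigma>3 S3 A' p D" unfolding s3 prod.case A'_def by blast+
      have r3: "\<sigma>3 (V NodeX) = x'" "\<sigma>3 (V Arg0) = u" "\<sigma>3 (V Arg1) = v" "\<sigma>3 (V Index) = i"
        using 3(2) 2 by (simp_all add: but_key_def)
      show ?case unfolding s3
      proof (rule wp_SeqI[OF wp_adjust[OF 3(3) r3(1) x'N goodA']], goal_cases)
        case (1 t5 s5)
        obtain \<sigma>5 S5 where s5: "s5 = (\<sigma>5, S5)" by (cases s5)
        from 1 obtain p5 D5 where 5: "rep \<sigma>5 S5 A' p5 D5" "same_regs \<sigma>3 \<sigma>5" "good A' p5 D5" "near A' p5 x'"
            "\<forall>z. z \<noteq> x' \<longrightarrow> p5 z = p z" "t5 + pot0 A' p5 D5 \<le> pot0 A' p D + 100 * lg"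
          unfolding s5 prod.case by blast
        have r5: "\<sigma>5 (V Arg0) = u" "\<sigma>5 (V Arg1) = v" "\<sigma>5 (V Index) = i" using 5(2) r3 by (simp_all add: same_regs_def)
        have "near A' p5 z" if "z < N" for z
        proof (cases "z = x'")
          case False
          then have "deg A' z = deg A z" using d by simp
          then show ?thesis using near[OF that] 5(5) False near_cong[of A' z A p5 p] by simp
        qed (use 5 in simp)
        moreover have "rep (\<sigma>5(V Index := i + 1)) S5 A' p5 D5" using 5(1) by (auto simp: rep_def fixed_upd)
        ultimately have inv: "Inv (\<sigma>5(V Index := i + 1)) S5 A' p5 D5" using 5(3) by (simp add: Inv_def)
        have iw: "i + 1 < 2 ^ w"
        proof -
          have "G * K \<le> N * K" using n(1) by (auto simp: N_def)
          then show ?thesis using b(3) R_large(10) R_less_word(1) word R_pow(1) by linarith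
        qed
        have c0: "0 \<le> cD" "0 \<le> cF * lR" using constants_pos lR by auto
        have "t1 + (t2 + (t3 + (t5 + 6))) + 50 + Pot A' p5 D5 \<le> Pot A p D + cI"
          using \<open>t1 \<le> 100\<close> 2(1) 3(1) 5(6) pot lg1 c0 by (simp add: Pot_def cI_def)
        then have fin5: "\<exists>A' p' D'. Inv (\<sigma>5(V Index := i + 1)) S5 A' p' D' \<and> und A' = und A - {(x, y, j), (y, x, j)} \<and>
            t1 + (t2 + (t3 + (t5 + 6))) + 50 + Pot A' p' D' \<le> Pot A p D + cI" using inv undA' by blast
        show ?case unfolding s5
          using fin5 r5 iw small[of 1] by (intro c_assign) (simp_all add: add.assoc)
      qed
    qed simp_all
  qed
qed

text \<open>\<open>Z i\<close> is the target unit set, up to ownership, after \<open>i\<close>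
  steps; insertion and deletion differ only in \<open>Z\<close> and in the step. During the loop the
  local condition may fail at nodes in \<open>D\<close>; \<open>settle\<close> restores it once, at
  the end.\<close>

lemma wp_update:
  fixes Z :: "nat \<Rightarrow> edge_copy set"
  assumes inv: "Inv \<sigma> S A p {}" and r: "\<sigma> (V Arg0) = u" "\<sigma> (V Arg1) = v" and undA: "und A = und (Z 0)"
    and step: "\<And>\<sigma> S A p D i. Inv \<sigma> S A p D \<Longrightarrow> \<sigma> (V Arg0) = u \<Longrightarrow> \<sigma> (V Arg1) = v \<Longrightarrow> \<sigma> (V Index) = i \<Longrightarrow>
      i < G * K \<Longrightarrow> und A = und (Z i) \<Longrightarrow>
      wp w B cli c (\<lambda>t (\<sigma>', S'). \<exists>A' p' D'. Inv \<sigma>' S' A' p' D' \<and> und A' = und (Z (i + 1))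
        \<and> \<sigma>' (V Arg0) = u \<and> \<sigma>' (V Arg1) = v \<and> \<sigma>' (V Index) = i + 1
        \<and> t + 50 + Pot A' p' D' \<le> Pot A p D + cI) (\<sigma>, S)"
  shows "wp w B cli (update c) (\<lambda>t (\<sigma>', S'). \<exists>A' p'. Inv \<sigma>' S' A' p' {} \<and> und A' = und (Z (G * K)) \<and> ans_ok \<sigma>' p'
    \<and> t + Pot A' p' {} \<le> Pot A p {} + real (G * K) * cI + 1200 * lg) (\<sigma>, S)"
proof -
  define I where "I = (\<lambda>(i, A, p, D) \<sigma> S. Inv \<sigma> S A p D \<and> i \<le> G * K \<and> und A = und (Z i)
    \<and> \<sigma> (V Arg0) = u \<and> \<sigma> (V Arg1) = v \<and> \<sigma> (V Index) = i)"
  have cI: "0 \<le> cI" using constants_pos lR lg1 by (simp add: cI_def)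
  have GK: "G * K < 2 ^ w"
  proof -
    have "G * K \<le> N * K" using n(1) by (auto simp: N_def)
    then have "G * K < R" using R_large(10) by linarith
    then show ?thesis by (rule R_less_word)
  qed
  have gd: "\<sigma> (V Guesses) = G" "\<sigma> (V Copies) = K" if "I g \<sigma> S" for g \<sigma> S
    using that by (auto simp: I_def Inv_def rep_def fixed_def split: prod.splits)
  have I0: "I (0, A, p, {}) (\<sigma>(V Index := 0)) S"
    using inv r undA by (auto simp: I_def Inv_def rep_def fixed_upd)
  have loop: "wp w B cli (WHILE Reg Index \<lhd> Reg Guesses \<otimes> Reg Copies DO c)
    (\<lambda>t (\<sigma>', S'). \<exists>A' p' D'. Inv \<sigma>' S' A' p' D' \<and> und A' = und (Z (G * K))
      \<and> t + Pot A' p' D' \<le> Pot A p {} + real (G * K) * cI + 50) (\<sigma>(V Index := 0), S)"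
  proof (rule c_While[where I = I and pot = "\<lambda>(i, A, p, D). Pot A p D + real (G * K - i) * cI", OF _ I0], goal_cases)
    case 1 show ?case by simp
  next
    case (2 g \<sigma> S) then show ?case using gd[OF 2] GK by simp
  next
    case (3 g \<sigma> S) then show ?case using Pot_nonneg cI by (auto split: prod.splits)
  next
    case (4 g \<sigma> S)
    obtain i A1 p1 D1 where g: "g = (i, A1, p1, D1)" by (cases g) auto
    have iv: "Inv \<sigma> S A1 p1 D1" "\<sigma> (V Arg0) = u" "\<sigma> (V Arg1) = v" "\<sigma> (V Index) = i" "und A1 = und (Z i)"
      using 4(1) by (auto simp: I_def g)
    have i: "i < G * K" using 4(2) gd[OF 4(1)] iv(4) by (simp split: if_splits)
    show ?case
    proof (rule wp_conseq[OF step[OF iv(1-4) i iv(5)]], goal_cases)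
      case (1 t z)
      obtain \<sigma>' S' where z: "z = (\<sigma>', S')" by (cases z)
      from 1 obtain A' p' D' where 2: "Inv \<sigma>' S' A' p' D'" "und A' = und (Z (i + 1))" "\<sigma>' (V Arg0) = u" "\<sigma>' (V Arg1) = v"
          "\<sigma>' (V Index) = i + 1" "t + 50 + Pot A' p' D' \<le> Pot A1 p1 D1 + cI"
        unfolding z prod.case by blast
      have "I (i + 1, A', p', D') \<sigma>' S'" using 2 i by (simp add: I_def)
      moreover have "real (G * K - i) = real (G * K - (i + 1)) + 1" using i by simp
      then have "real (G * K - i) * cI = real (G * K - (i + 1)) * cI + cI" by (simp only: distrib_right mult_1_left)
      ultimately show ?case using 2(6) unfolding z prod.case
        by (intro exI[of _ t] conjI order_refl exI[of _ "(i + 1, A', p', D')"]) (simp_all add: g)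
    qed
  next
    case (5 h \<sigma>' S')
    obtain i A1 p1 D1 where h: "h = (i, A1, p1, D1)" by (cases h) auto
    have iv: "Inv \<sigma>' S' A1 p1 D1" "\<sigma>' (V Index) = i" "und A1 = und (Z i)" "i \<le> G * K"
      using 5(1) by (auto simp: I_def h)
    have i: "i = G * K" using 5(2) gd[OF 5(1)] iv(2,4) by (simp split: if_splits)
    then show ?case using iv by (auto simp: h intro!: exI[of _ A1] exI[of _ p1] exI[of _ D1])
  qed
  have start: "wp w B cli (Index ::= Num 0) (\<lambda>t (\<sigma>', S'). t \<le> 5 \<and> \<sigma>' = \<sigma>(V Index := 0) \<and> S' = S) (\<sigma>, S)"
    using small[of 0] by (intro c_assign) simp_all
  show ?thesis unfolding update_def
  proof (rule wp_SeqI[OF start], clarify, rule wp_SeqI[OF loop], goal_cases)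
    case (1 t0 a0 b0 t s)
    obtain \<sigma>1 S1 where s: "s = (\<sigma>1, S1)" by (cases s)
    from 1 obtain A1 p1 D1 where inv1: "Inv \<sigma>1 S1 A1 p1 D1" and und1: "und A1 = und (Z (G * K))"
        and t: "t + Pot A1 p1 D1 \<le> Pot A p {} + real (G * K) * cI + 50" unfolding s prod.case by blast
    show ?case unfolding s
    proof (rule wp_SeqI[OF wp_settle[OF inv1]], goal_cases)
      case (1 t2 s2)
      obtain \<sigma>2 S2 where s2: "s2 = (\<sigma>2, S2)" by (cases s2)
      from 1 obtain A2 p2 where 2: "Inv \<sigma>2 S2 A2 p2 {}" "und A2 = und A1" "t2 + Pot A2 p2 {} \<le> Pot A1 p1 D1 + 500 * lg"
        unfolding s2 prod.case by blast
      show ?case unfolding s2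
      proof (rule wp_conseq[OF wp_answer[OF 2(1)]], goal_cases)
        case (1 t3 s3)
        obtain \<sigma>3 S3 where s3: "s3 = (\<sigma>3, S3)" by (cases s3)
        from 1 have 3: "t3 \<le> 450 * lg" "Inv \<sigma>3 S3 A2 p2 {}" "ans_ok \<sigma>3 p2" unfolding s3 prod.case by blast+
        have "und A2 = und (Z (G * K))" using 2(2) und1 by simp
        moreover have "t0 + (t + (t2 + t3)) + Pot A2 p2 {} \<le> Pot A p {} + real (G * K) * cI + 1200 * lg"
          using 2(3) 3(1) t lg1 \<open>t0 \<le> 5\<close> by linarith
        ultimately show ?case using 3 unfolding s3 prod.case by (intro exI[of _ t3] conjI order_refl) blast
      qed
    qed
  qed
qed

lemma wp_insert_op:
  assumes inv: "Inv \<sigma> S A p {}" and r: "\<sigma> (V Arg0) = u" "\<sigma> (V Arg1) = v" and undA: "und A = und (units E)"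
    and E: "finite E" "(u, v) \<notin> E" "u < n" "v < n" "(card E + 1) * (G * K) \<le> ub"
  shows "wp w B cli (update insert_step) (\<lambda>t (\<sigma>', S'). \<exists>A' p'. Inv \<sigma>' S' A' p' {} \<and> und A' = und (units (insert (u, v) E))
    \<and> ans_ok \<sigma>' p' \<and> t + Pot A' p' {} \<le> Pot A p {} + real (G * K) * cI + 1200 * lg) (\<sigma>, S)"
  unfolding part_full[symmetric]
proof (rule wp_update[OF inv r], goal_cases)
  case 1 show ?case using undA by (simp add: part_0)
next
  case (2 \<sigma> S A p D i)
  have rep: "rep \<sigma> S A p D" "good A p D" "\<And>x. x < N \<Longrightarrow> near A p x" using 2(1) by (auto simp: Inv_def)
  have asymA: "\<forall>(x, y, j)\<in>A. (y, x, j) \<notin> A" "finite A" using rep(1) finite_U finite_subset by (auto simp: rep_def)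
  have asymP: "\<forall>(x, y, j)\<in>part E u v i. (y, x, j) \<notin> part E u v i" by (rule units_asym) (auto simp: part_def units_def)
  have finP: "finite (part E u v i)" using units_card(1)[OF E(1)] by (simp add: part_def)
  have new: "cell u v i \<notin> part E u v i" using E(2) by (simp add: part_def cell_units cell_image)
  have "cell u v i \<notin> und A"
  proof
    assume a: "cell u v i \<in> und A"
    obtain x y j where c: "cell u v i = (x, y, j)" by (cases "cell u v i")
    have "(x, y, j) \<in> und (part E u v i)" using a c 2(6) by simp
    then have "(y, x, j) \<in> part E u v i" using new c by (auto simp: und_def)
    moreover have "\<exists>u' v' i'. t = cell u' v' i'" if "t \<in> part E u v i" for t
      using that unfolding part_def units_def by blast
    ultimately obtain u' v' i' where "cell u' v' i' = (y, x, j)" by metis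
    then show False using cell_swap[OF c] by blast
  qed
  moreover have "card A < ub"
  proof -
    have e: "card A = card (part E u v i)" by (rule card_eq_und[OF asymA(2,1) finP asymP 2(6)])
    have "insert (cell u v i) (part E u v i) \<subseteq> units (insert (u, v) E)"
      unfolding part_full[symmetric] using 2(5) by (auto simp: part_def)
    then have "card (insert (cell u v i) (part E u v i)) \<le> card (units (insert (u, v) E))"
      by (intro card_mono) (use units_card(1)[of "insert (u, v) E"] E(1) in auto)
    also have "\<dots> = (card E + 1) * (G * K)" using units_card(2)[of "insert (u, v) E"] E(1,2) by simp
    finally show ?thesis using new finP e E(5) by simp
  qed
  moreover have "und (insert (cell u v i) A) = und (part E u v (i + 1))"
  proof -
    have "insert (cell u v i) A = A \<union> {cell u v i}" "part E u v (i + 1) = part E u v i \<union> {cell u v i}"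
      by (auto simp: part_def less_Suc_eq)
    then show ?thesis using 2(6) by (simp only: und_Un)
  qed
  ultimately have c: "cell u v i \<notin> und A" "card A < ub" "und (insert (cell u v i) A) = und (part E u v (i + 1))" .
  show ?case
  proof (rule wp_conseq[OF wp_insert_step[OF rep 2(2-4) E(3,4) 2(5) c(1,2)]], assumption, goal_cases)
    case (1 t z)
    obtain \<sigma>' S' where z: "z = (\<sigma>', S')" by (cases z)
    from 1 show ?case using c(3) unfolding z prod.case by (intro exI[of _ t] conjI order_refl) blast
  qed
qed

lemma wp_delete_op:
  assumes inv: "Inv \<sigma> S A p {}" and r: "\<sigma> (V Arg0) = u" "\<sigma> (V Arg1) = v" and undA: "und A = und (units E)"
    and E: "(u, v) \<in> E" "u < n" "v < n"
  shows "wp w B cli (update delete_step) (\<lambda>t (\<sigma>', S'). \<exists>A' p'. Inv \<sigma>' S' A' p' {} \<and> und A' = und (units (E - {(u, v)}))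
    \<and> ans_ok \<sigma>' p' \<and> t + Pot A' p' {} \<le> Pot A p {} + real (G * K) * cI + 1200 * lg) (\<sigma>, S)"
proof -
  define Z where "Z = (\<lambda>i. units (E - {(u, v)}) \<union> cell u v ` {i..<G * K})"
  have "Z 0 = part (E - {(u, v)}) u v (G * K)" by (simp add: Z_def part_def lessThan_atLeast0)
  then have Z0: "Z 0 = units E" using E(1) by (simp add: part_full insert_absorb)
  have Z1: "Z (G * K) = units (E - {(u, v)})" by (simp add: Z_def)
  have asym: "\<forall>(x, y, j)\<in>Z i. (y, x, j) \<notin> Z i" for i by (rule units_asym) (auto simp: Z_def units_def)
  have new: "cell u v i \<notin> units (E - {(u, v)})" for i by (simp add: cell_units)
  show ?thesis unfolding Z1[symmetric]
  proof (rule wp_update[OF inv r], goal_cases)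
    case 1 show ?case using undA by (simp add: Z0)
  next
    case (2 \<sigma> S A p D i)
    obtain x y j where c: "cell u v i = (x, y, j)" by (cases "cell u v i")
    have mem: "(x, y, j) \<in> Z i" using 2(5) unfolding c[symmetric] by (simp add: Z_def cell_image)
    then have "(x, y, j) \<in> und (Z i)" by (simp add: und_def)
    then have und: "(x, y, j) \<in> und A" using 2(6) by simp
    have "{i..<G * K} = insert i {i + 1..<G * K}" using 2(5) by auto
    then have "Z i = insert (cell u v i) (Z (i + 1))" by (simp add: Z_def)
    moreover have "cell u v i \<notin> Z (i + 1)" using new[of i] by (simp add: Z_def cell_image)
    ultimately have "Z (i + 1) = Z i - {(x, y, j)}" using c by simp
    then have e: "und (Z (i + 1)) = und A - {(x, y, j), (y, x, j)}"
      using und_remove[OF asym mem] 2(6) by simp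
    show ?case unfolding e
      by (rule wp_delete_step[OF 2(1-4) E(2,3) 2(5) c und])
  qed
qed

end

section \<open>Approximation\<close>

lemma density_set_finite:
  fixes n :: nat
  assumes "1 \<le> n"
  shows "finite {density E X Y | X Y. X \<subseteq> {..<n} \<and> X \<noteq> {} \<and> Y \<subseteq> {..<n} \<and> Y \<noteq> {}}"
    "{density E X Y | X Y. X \<subseteq> {..<n} \<and> X \<noteq> {} \<and> Y \<subseteq> {..<n} \<and> Y \<noteq> {}} \<noteq> {}"
proof -
  let ?D = "{density E X Y | X Y. X \<subseteq> {..<n} \<and> X \<noteq> {} \<and> Y \<subseteq> {..<n} \<and> Y \<noteq> {}}"
  have "?D \<subseteq> (\<lambda>(X, Y). density E X Y) ` (Set.Pow {..<n} \<times> Set.Pow {..<n})" by auto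
  then show "finite ?D" by (rule finite_subset) simp
  have "density E {0} {0} \<in> ?D" using assms by (intro CollectI exI[of _ "{0}"]) auto
  then show "?D \<noteq> {}" by blast
qed

lemma density_le_max:
  fixes n :: nat
  assumes "X \<subseteq> {..<n}" "X \<noteq> {}" "Y \<subseteq> {..<n}" "Y \<noteq> {}"
  shows "density E X Y \<le> max_density {..<n} E"
proof -
  have "1 \<le> n" using assms(1,2) by (cases n) auto
  then show ?thesis unfolding max_density_def
    using assms density_set_finite[of n E] by (intro Max_ge) blast+
qed

lemma max_density_attained:
  fixes n :: nat
  assumes "1 \<le> n"
  obtains X Y where "X \<subseteq> {..<n}" "X \<noteq> {}" "Y \<subseteq> {..<n}" "Y \<noteq> {}" "max_density {..<n} E = density E X Y"
  using Max_in[OF density_set_finite(1)[OF assms] density_set_finite(2)[OF assms], of E]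
  unfolding max_density_def by blast

lemma max_density_nonneg: "1 \<le> (n::nat) \<Longrightarrow> 0 \<le> max_density {..<n} E"
  by (rule max_density_attained[of n E]) (auto simp: density_def)

lemma card_edges_le:
  fixes n :: nat
  assumes "X \<subseteq> {..<n}" "Y \<subseteq> {..<n}" "1 \<le> n"
  shows "real (card (edges_between E X Y)) \<le> max_density {..<n} E * sqrt (real (card X) * real (card Y))"
proof (cases "X = {} \<or> Y = {}")
  case True
  then have "edges_between E X Y = {}" by (auto simp: edges_between_def)
  then show ?thesis using max_density_nonneg[OF assms(3)] by simp
next
  case False
  then have "card X \<noteq> 0" "card Y \<noteq> 0" using assms finite_subset by (auto simp: card_eq_0_iff)
  then have "0 < sqrt (real (card X) * real (card Y))" by simp
  moreover have "density E X Y \<le> max_density {..<n} E" using density_le_max assms False by blast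
  ultimately show ?thesis by (simp add: density_def field_simps)
qed

text \<open>A star with \<open>d\<close> edges has density \<open>sqrt d\<close>, so degrees are at
  most the square of the maximal density. In an optimal pair this bounds the ratio of the two sides,
  which \<open>approx_lower\<close> needs in order to pass the cut-off.\<close>

lemma card_edges_star:
  fixes n :: nat
  assumes "X \<subseteq> {..<n}" "Y \<subseteq> {..<n}" "1 \<le> n"
  shows "real (card (edges_between E X Y)) \<le> real (card Y) * (max_density {..<n} E)\<^sup>2"
    "real (card (edges_between E X Y)) \<le> real (card X) * (max_density {..<n} E)\<^sup>2"
proof -
  define M where "M = max_density {..<n} E"
  have fin: "finite X" "finite Y" using assms finite_subset by auto
  have star: "real c \<le> M\<^sup>2" if "c \<noteq> 0" "real c \<le> M * sqrt (real c)" for c :: nat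
  proof -
    have "sqrt (real c) * sqrt (real c) \<le> M * sqrt (real c)" using that by simp
    then have "sqrt (real c) \<le> M" by (rule mult_right_le_imp_le) (use that(1) in simp)
    then have "(sqrt (real c))\<^sup>2 \<le> M\<^sup>2" by (intro power_mono) auto
    then show ?thesis by simp
  qed
  have "real (card {x \<in> X. (x, y) \<in> E}) \<le> M\<^sup>2" if "y \<in> Y" for y
  proof (cases "card {x \<in> X. (x, y) \<in> E} = 0")
    case False
    let ?Z = "{x \<in> X. (x, y) \<in> E}"
    have "edges_between E ?Z {y} = (\<lambda>x. (x, y)) ` ?Z" by (auto simp: edges_between_def)
    then have "card (edges_between E ?Z {y}) = card ?Z" by (simp add: card_image inj_on_def)
    then have "real (card ?Z) \<le> M * sqrt (real (card ?Z))"
      using card_edges_le[of ?Z n "{y}" E] assms that by (auto simp: M_def)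
    then show ?thesis using star False by blast
  qed simp
  then have "(\<Sum>y\<in>Y. real (card {x \<in> X. (x, y) \<in> E})) \<le> (\<Sum>y\<in>Y. M\<^sup>2)" by (intro sum_mono)
  moreover have "card (edges_between E X Y) = (\<Sum>y\<in>Y. card {x \<in> X. (x, y) \<in> E})"
  proof -
    have "edges_between E X Y = (\<Union>y\<in>Y. (\<lambda>x. (x, y)) ` {x \<in> X. (x, y) \<in> E})" by (auto simp: edges_between_def)
    then have "card (edges_between E X Y) = (\<Sum>y\<in>Y. card ((\<lambda>x. (x, y)) ` {x \<in> X. (x, y) \<in> E}))"
      using fin by (simp only:) (subst card_UN_disjoint, auto)
    then show ?thesis by (simp add: card_image inj_on_def)
  qed
  ultimately show "real (card (edges_between E X Y)) \<le> real (card Y) * (max_density {..<n} E)\<^sup>2"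
    by (simp add: M_def)
  have "real (card {y \<in> Y. (x, y) \<in> E}) \<le> M\<^sup>2" if "x \<in> X" for x
  proof (cases "card {y \<in> Y. (x, y) \<in> E} = 0")
    case False
    let ?Z = "{y \<in> Y. (x, y) \<in> E}"
    have "edges_between E {x} ?Z = Pair x ` ?Z" by (auto simp: edges_between_def)
    then have "card (edges_between E {x} ?Z) = card ?Z" by (simp add: card_image inj_on_def)
    then have "real (card ?Z) \<le> M * sqrt (real (card ?Z))"
      using card_edges_le[of "{x}" n ?Z E] assms that by (auto simp: M_def)
    then show ?thesis using star False by blast
  qed simp
  then have "(\<Sum>x\<in>X. real (card {y \<in> Y. (x, y) \<in> E})) \<le> (\<Sum>x\<in>X. M\<^sup>2)" by (intro sum_mono)
  moreover have "card (edges_between E X Y) = (\<Sum>x\<in>X. card {y \<in> Y. (x, y) \<in> E})"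
  proof -
    have "edges_between E X Y = (\<Union>x\<in>X. Pair x ` {y \<in> Y. (x, y) \<in> E})" by (auto simp: edges_between_def)
    then have "card (edges_between E X Y) = (\<Sum>x\<in>X. card (Pair x ` {y \<in> Y. (x, y) \<in> E}))"
      using fin by (simp only:) (subst card_UN_disjoint, auto)
    then show ?thesis by (simp add: card_image inj_on_def)
  qed
  ultimately show "real (card (edges_between E X Y)) \<le> real (card X) * (max_density {..<n} E)\<^sup>2"
    by (simp add: M_def)
qed

lemma sum_deg:
  assumes "finite A" "finite Z"
  shows "(\<Sum>x\<in>Z. deg A x) = card {t \<in> A. fst t \<in> Z}"
proof -
  have "{t \<in> A. fst t \<in> Z} = (\<Union>x\<in>Z. {t \<in> A. fst t = x})" by auto
  then show ?thesis unfolding deg_def using assms by (simp only:) (subst card_UN_disjoint, auto)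
qed

context graph_machine
begin

section \<open>Counting the units of one guess\<close>

definition cls :: "nat edges \<Rightarrow> nat \<Rightarrow> nat set \<Rightarrow> nat set \<Rightarrow> edge_copy set" where
  "cls E e X Y = (\<lambda>((u, v), j). (left u e, right v e, j)) ` (edges_between E X Y \<times> {..<K})"

lemma left_inj: "e < G \<Longrightarrow> left u e = left u' e \<longleftrightarrow> u = u'"
  using G_pos by (simp add: left_def)

lemma right_inj: "right u e = right u' e \<longleftrightarrow> u = u'"
  using G_pos by (simp add: right_def)

lemma left_not_right: "e < G \<Longrightarrow> left u e \<noteq> right v e'"
proof
  assume "e < G" "left u e = right v e'"
  then have "2 * u = 2 * v + 1" using div_G by metis
  then show False by presburger
qed

lemma cls_card:
  assumes "finite E" "e < G"
  shows "finite (cls E e X Y)" "card (cls E e X Y) = card (edges_between E X Y) * K"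
proof -
  have f: "finite (edges_between E X Y)" using assms(1) by (rule finite_subset[rotated]) (auto simp: edges_between_def)
  then show "finite (cls E e X Y)" by (simp add: cls_def)
  have "inj_on (\<lambda>((u, v), j). (left u e, right v e, j)) (edges_between E X Y \<times> {..<K})"
    using left_inj[OF assms(2)] right_inj by (auto simp: inj_on_def)
  then show "card (cls E e X Y) = card (edges_between E X Y) * K"
    unfolding cls_def by (simp add: card_image card_cartesian_product)
qed

lemma cls_units:
  assumes "e < G" "(u, v) \<in> E" "j < K"
  shows "(left u e, right v e, j) \<in> units E"
proof -
  have "Suc j * G \<le> K * G" using assms(3) by (intro mult_right_mono) auto
  then have "j * G + e < G * K" using assms(1) by (simp add: mult.commute)
  moreover have "cell u v (j * G + e) = (left u e, right v e, j)" using assms(1) by (simp add: cell_def)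
  ultimately show ?thesis using assms(2) unfolding units_def by force
qed

lemma units_cases:
  assumes "(x, y, j) \<in> units E"
  obtains u v e where "(u, v) \<in> E" "e < G" "j < K" "x = left u e" "y = right v e"
proof -
  obtain u v i where i: "(x, y, j) = cell u v i" "(u, v) \<in> E" "i < G * K" using assms unfolding units_def by blast
  have "i div G < K" using i(3) by (simp add: less_mult_imp_div_less mult.commute)
  then show ?thesis using that[of u v "i mod G"] i e_less(1) by (auto simp: cell_def)
qed

lemma m_left: "e < G \<Longrightarrow> m (left u e) = 2 ^ e" and m_right: "m (right v e) = 2 ^ (2 * J - e)"
  using div_G by (simp_all add: m_def)

lemma mult_pair: "e < G \<Longrightarrow> (2::nat) ^ e * 2 ^ (2 * J - e) = 4 ^ J"
  by (simp add: G_def power_mult flip: power_add)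

text \<open>Each unit of an edge between \<open>X\<close> and \<open>Y\<close> is owned by one of
  its endpoints, and the copies of both sets are counted. The map \<open>h\<close> sends a canonical
  unit to its actual orientation.\<close>

lemma units_of_count:
  assumes A: "finite A" "und A = und (units E)" and E: "finite E" and e: "e < G" and XY: "finite X" "finite Y"
  shows "card (edges_between E X Y) * K \<le> (\<Sum>u\<in>X. deg A (left u e)) + (\<Sum>v\<in>Y. deg A (right v e))"
proof -
  define Z where "Z = (\<lambda>u. left u e) ` X \<union> (\<lambda>v. right v e) ` Y"
  define T where "T = {t \<in> A. fst t \<in> Z}"
  define h where "h = (\<lambda>(x, y, j). if (x, y, j) \<in> A then (x, y, j) else (y, x, j :: nat))"
  have "h ` cls E e X Y \<subseteq> T"
  proof
    fix t assume "t \<in> h ` cls E e X Y"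
    then obtain u v j where t: "t = h (left u e, right v e, j)" "(u, v) \<in> E" "u \<in> X" "v \<in> Y" "j < K"
      by (auto simp: cls_def edges_between_def)
    have "(left u e, right v e, j) \<in> und (units E)" using cls_units[OF e t(2,5)] by (simp add: und_def)
    then have "(left u e, right v e, j) \<in> und A" using A(2) by simp
    then show "t \<in> T" using t(3,4) by (auto simp: t(1) h_def T_def Z_def und_def)
  qed
  moreover have "inj_on h (cls E e X Y)"
  proof (rule inj_onI)
    fix s t assume st: "s \<in> cls E e X Y" "t \<in> cls E e X Y" "h s = h t"
    obtain u v j u' v' j' where "s = (left u e, right v e, j)" "t = (left u' e, right v' e, j')"
      using st(1,2) by (auto simp: cls_def)
    then show "s = t" using st(3) left_not_right[OF e] by (auto simp: h_def split: if_splits)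
  qed
  moreover have "finite T" using A(1) by (simp add: T_def)
  ultimately have "card (cls E e X Y) \<le> card T" using card_inj_on_le by blast
  also have "card T = (\<Sum>x\<in>Z. deg A x)" unfolding T_def using sum_deg[OF A(1), of Z] XY by (simp add: Z_def)
  also have "\<dots> = (\<Sum>x\<in>(\<lambda>u. left u e) ` X. deg A x) + (\<Sum>x\<in>(\<lambda>v. right v e) ` Y. deg A x)"
    unfolding Z_def using XY left_not_right[OF e] by (intro sum.union_disjoint) auto
  also have "\<dots> = (\<Sum>u\<in>X. deg A (left u e)) + (\<Sum>v\<in>Y. deg A (right v e))"
    using left_inj[OF e] right_inj by (simp add: sum.reindex inj_on_def)
  finally show ?thesis by (simp add: cls_card[OF E e])
qed

text \<open>The opposite estimate: the loads count only units whose endpoints lie in the larger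
  pair, and \<open>h\<close> maps them injectively to canonical units. The hypothesis
  \<open>closed\<close> is what the local condition supplies for two successive level sets.\<close>

lemma owned_count:
  assumes A: "finite A" "\<forall>(x, y, j)\<in>A. (y, x, j) \<notin> A" "und A = und (units E)" and E: "finite E" and e: "e < G"
    and XY: "finite X" "finite Y"
    and closed: "\<And>u v j. (u, v) \<in> E \<Longrightarrow> (left u e, right v e, j) \<in> A \<Longrightarrow> u \<in> X \<Longrightarrow> u \<in> X' \<and> v \<in> Y'"
      "\<And>u v j. (u, v) \<in> E \<Longrightarrow> (right v e, left u e, j) \<in> A \<Longrightarrow> v \<in> Y \<Longrightarrow> u \<in> X' \<and> v \<in> Y'"
  shows "(\<Sum>u\<in>X. deg A (left u e)) + (\<Sum>v\<in>Y. deg A (right v e)) \<le> card (edges_between E X' Y') * K"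
proof -
  define Z where "Z = (\<lambda>u. left u e) ` X \<union> (\<lambda>v. right v e) ` Y"
  define T where "T = {t \<in> A. fst t \<in> Z}"
  define h where "h = (\<lambda>(x, y, j). if (x, y, j) \<in> units E then (x, y, j) else (y, x, j :: nat))"
  \<comment> \<open>A copy belongs to one guess only, so whatever it owns is a unit of guess
    \<open>e\<close>.\<close>
  have G': "e' = e" if "left u e = left u' e'" "e' < G" for u u' e'
    using that div_G(2)[OF e, of u] div_G(2)[of e' u'] by simp
  have H': "e' = e" if "right v e = right v' e'" "e' < G" for v v' e'
  proof -
    have "2 * J - e = 2 * J - e'" using that div_G(4)[of v e] div_G(4)[of v' e'] by simp
    then show ?thesis using that(2) e by (simp add: G_def)
  qed
  have "h ` T \<subseteq> cls E e X' Y'"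
  proof
    fix t assume "t \<in> h ` T"
    then obtain x y j where t: "t = h (x, y, j)" "(x, y, j) \<in> A" "x \<in> Z" by (auto simp: T_def)
    have "(x, y, j) \<in> und (units E)" using t(2) A(3) by (auto simp: und_def)
    then consider "(x, y, j) \<in> units E" | "(x, y, j) \<notin> units E" "(y, x, j) \<in> units E" by (auto simp: und_def)
    then show "t \<in> cls E e X' Y'"
    proof cases
      case 1
      then obtain u v e' where u: "(u, v) \<in> E" "e' < G" "j < K" "x = left u e'" "y = right v e'" by (rule units_cases)
      obtain u0 where u0: "u0 \<in> X" "x = left u0 e" using t(3) u(2,4) left_not_right[OF u(2)] by (auto simp: Z_def)
      have "e' = e" using G' u(2,4) u0(2) by simp
      then have "u = u0" using left_inj[OF e] u(4) u0(2) by simp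
      then have "u \<in> X' \<and> v \<in> Y'" using closed(1)[OF u(1)] t(2) u u0(1) \<open>e' = e\<close> by simp
      then show ?thesis using 1 t(1) u \<open>e' = e\<close> by (force simp: h_def cls_def edges_between_def)
    next
      case 2
      obtain u v e' where u: "(u, v) \<in> E" "e' < G" "j < K" "y = left u e'" "x = right v e'" by (rule units_cases[OF 2(2)])
      obtain v0 where v0: "v0 \<in> Y" "x = right v0 e" using t(3) u(5) left_not_right[OF e, of _ v e'] unfolding Z_def by blast
      have "e' = e" using H' u(2,5) v0(2) by simp
      then have "v = v0" using right_inj u(5) v0(2) by simp
      then have "u \<in> X' \<and> v \<in> Y'" using closed(2)[OF u(1)] t(2) u v0(1) \<open>e' = e\<close> by simp
      then show ?thesis using 2 t(1) u \<open>e' = e\<close> by (force simp: h_def cls_def edges_between_def)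
    qed
  qed
  moreover have "inj_on h T"
    using A(2) by (auto simp: inj_on_def h_def T_def split: if_splits)
  moreover have "finite (cls E e X' Y')" using cls_card(1)[OF E e] .
  ultimately have "card T \<le> card (cls E e X' Y')" using card_inj_on_le by blast
  moreover have "card T = (\<Sum>x\<in>Z. deg A x)" unfolding T_def using sum_deg[OF A(1), of Z] XY by (simp add: Z_def)
  moreover have "\<dots> = (\<Sum>x\<in>(\<lambda>u. left u e) ` X. deg A x) + (\<Sum>x\<in>(\<lambda>v. right v e) ` Y. deg A x)"
    unfolding Z_def using XY left_not_right[OF e] by (intro sum.union_disjoint) auto
  moreover have "\<dots> = (\<Sum>u\<in>X. deg A (left u e)) + (\<Sum>v\<in>Y. deg A (right v e))"
    using left_inj[OF e] right_inj by (simp add: sum.reindex inj_on_def)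
  ultimately show ?thesis by (simp add: cls_card[OF E e])
qed

text \<open>The easy direction of duality, by averaging: the units inside an optimal pair must be
  owned by its copies. If all their values were below \<open>\<Lambda>\<close>, the total load would
  be at most about \<open>\<Lambda> * (\<alpha> + \<beta>)\<close>, which is too little. It remains
  to see that \<open>\<Lambda>\<close> exceeds the cut-off, so that \<open>thr\<close> does not hide
  the node.\<close>

lemma approx_lower:
  assumes A: "finite A" "und A = und (units E)" and E: "E \<subseteq> {..<n} \<times> {..<n}" and near: "\<And>x. x < N \<Longrightarrow> near A p x"
    and M: "M = max_density {..<n} E" "0 < M"
  shows "\<exists>x<N. 2 ^ J * real K * M / 4 \<le> real (thr x (p x))"
proof -
  have fE: "finite E" using E finite_subset by blast
  obtain X Y where XY: "X \<subseteq> {..<n}" "X \<noteq> {}" "Y \<subseteq> {..<n}" "Y \<noteq> {}" "M = density E X Y"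
    using max_density_attained[OF n(1)] M(1) by metis
  have fin: "finite X" "finite Y" using XY finite_subset by auto
  define a where "a = real (card X)"
  define b where "b = real (card Y)"
  define c where "c = real (card (edges_between E X Y))"
  have ab: "1 \<le> a" "1 \<le> b" "a \<le> 4 ^ J" "b \<le> 4 ^ J"
  proof -
    have "card X \<noteq> 0" "card Y \<noteq> 0" using XY fin by auto
    then show "1 \<le> a" "1 \<le> b" by (auto simp: a_def b_def)
    have "card X \<le> 4 ^ J" "card Y \<le> 4 ^ J"
      using card_mono[OF _ XY(1)] card_mono[OF _ XY(3)] n(2) by auto
    then have "real (card X) \<le> real (4 ^ J)" "real (card Y) \<le> real (4 ^ J)" by (simp_all only: of_nat_le_iff)
    then show "a \<le> 4 ^ J" "b \<le> 4 ^ J" by (simp_all add: a_def b_def)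
  qed
  have cM: "c = M * sqrt (a * b)" using XY(5) ab by (simp add: density_def c_def a_def b_def)
  have sp: "0 < sqrt (a * b)" using ab by simp
  have c0: "0 < c" using cM M(2) sp by simp
  have c2: "c * c = M\<^sup>2 * (a * b)" using ab by (simp add: cM power2_eq_square)
  have st: "c \<le> b * M\<^sup>2" "c \<le> a * M\<^sup>2"
    using card_edges_star[OF XY(1,3) n(1), of E] by (simp_all add: a_def b_def c_def M(1))
  have M2: "a \<le> b * M\<^sup>2" "b \<le> a * M\<^sup>2"
  proof -
    have "c * c \<le> b * M\<^sup>2 * (b * M\<^sup>2)" using st(1) c0 by (intro mult_mono) auto
    then have "a * (b * M\<^sup>2) \<le> (b * M\<^sup>2) * (b * M\<^sup>2)" unfolding c2 by (simp add: mult_ac)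
    then show "a \<le> b * M\<^sup>2" using ab M(2) by (simp add: mult_le_cancel_right)
    have "c * c \<le> a * M\<^sup>2 * (a * M\<^sup>2)" using st(2) c0 by (intro mult_mono) auto
    then have "b * (a * M\<^sup>2) \<le> (a * M\<^sup>2) * (a * M\<^sup>2)" unfolding c2 by (simp add: mult_ac)
    then show "b \<le> a * M\<^sup>2" using ab M(2) by (simp add: mult_le_cancel_right)
  qed
  \<comment> \<open>The largest guess that does not exceed the ratio, so that
    \<open>\<alpha> / \<beta>\<close> below lies between 1 and 4.\<close>
  define e where "e = Max {e. e \<le> 2 * J \<and> 4 ^ e * b \<le> 4 ^ J * a}"
  have fe: "finite {e. e \<le> 2 * J \<and> 4 ^ e * b \<le> 4 ^ J * a}" by simp
  have "4 ^ 0 * b \<le> 4 ^ J * a"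
  proof -
    have "b * 1 \<le> 4 ^ J * a" using ab by (intro mult_mono) auto
    then show ?thesis by simp
  qed
  then have "0 \<in> {e. e \<le> 2 * J \<and> 4 ^ e * b \<le> 4 ^ J * a}" by simp
  then have "{e. e \<le> 2 * J \<and> 4 ^ e * b \<le> 4 ^ J * a} \<noteq> {}" by blast
  from Max_in[OF fe this] have e: "e \<le> 2 * J" "4 ^ e * b \<le> 4 ^ J * a" by (auto simp: e_def)
  have e': "4 ^ J * a \<le> 4 * (4 ^ e * b)"
  proof (cases "e = 2 * J")
    case True
    have "4 ^ J * a \<le> 4 ^ J * (4 ^ J * b)" using ab mult_mono[of a "4 ^ J" 1 b] by (intro mult_left_mono) auto
    also have "\<dots> = 4 ^ e * b" using True by (simp add: power_mult power2_eq_square mult_2 power_add)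
    finally have "4 ^ J * a \<le> 4 ^ e * b" .
    moreover have "0 \<le> 4 ^ e * b" using ab by simp
    ultimately show ?thesis by linarith
  next
    case False
    have "\<not> 4 ^ Suc e * b \<le> 4 ^ J * a"
    proof
      assume "4 ^ Suc e * b \<le> 4 ^ J * a"
      then have "Suc e \<le> e" unfolding e_def using False e(1) fe by (intro Max_ge) (auto simp: e_def)
      then show False by simp
    qed
    then show ?thesis by simp
  qed
  have eG: "e < G" using e(1) by (simp add: G_def)
  define ma where "ma = (2::real) ^ e"
  define mb where "mb = (2::real) ^ (2 * J - e)"
  have mab: "ma * mb = 4 ^ J" "0 < ma" "0 < mb" "ma * ma = 4 ^ e"
  proof -
    have "real (2 ^ e * 2 ^ (2 * J - e)) = real (4 ^ J)" using mult_pair[OF eG] by (simp only:)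
    then show "ma * mb = 4 ^ J" by (simp add: ma_def mb_def)
    show "ma * ma = 4 ^ e" by (simp add: ma_def flip: power_mult_distrib)
  qed (auto simp: ma_def mb_def)
  define \<alpha> where "\<alpha> = a / ma"
  define \<beta> where "\<beta> = b / mb"
  have pos: "0 < \<alpha>" "0 < \<beta>" using ab mab by (auto simp: \<alpha>_def \<beta>_def)
  have prod: "\<alpha> * \<beta> = a * b / 4 ^ J" using mab by (simp add: \<alpha>_def \<beta>_def)
  have \<beta>\<alpha>: "\<beta> \<le> \<alpha>"
  proof -
    have "ma * (b * ma) \<le> ma * (a * mb)" using e(2) mab(1,4) by (simp add: mult_ac flip: mult.assoc)
    then have "b * ma \<le> a * mb" using mab(2) by simp
    then show ?thesis using mab(2,3) by (simp add: \<alpha>_def \<beta>_def field_simps)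
  qed
  have \<alpha>\<beta>: "\<alpha> \<le> 4 * \<beta>"
  proof -
    have "ma * (a * mb) \<le> ma * (4 * b * ma)" using e' mab(1,4) by (metis mult.assoc mult.commute)
    then have "a * mb \<le> 4 * b * ma" using mab(2) by simp
    then show ?thesis using mab(2,3) by (simp add: \<alpha>_def \<beta>_def field_simps)
  qed
  have ms: "(\<alpha> + \<beta>) \<le> 5 / 2 * sqrt (a * b) / 2 ^ J"
  proof -
    \<comment> \<open>Expanded, this says that
      \<open>\<alpha> ^ 2 + \<beta> ^ 2 \<le> 17 / 4 * \<alpha> * \<beta>\<close>; adding
      \<open>2 * \<alpha> * \<beta>\<close> gives the square of \<open>5 / 2\<close>.\<close>
    have "(\<alpha> - 4 * \<beta>) * (\<alpha> - \<beta> / 4) \<le> 0" using \<alpha>\<beta> \<beta>\<alpha> pos by (intro mult_nonpos_nonneg) auto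
    then have "(\<alpha> + \<beta>)\<^sup>2 \<le> 25 / 4 * (\<alpha> * \<beta>)" by (simp add: power2_eq_square algebra_simps)
    also have "\<dots> = (5 / 2 * sqrt (a * b) / 2 ^ J)\<^sup>2"
    proof -
      have "((2::real) ^ J)\<^sup>2 = 4 ^ J" by (simp flip: power_mult add: mult.commute[of J] power_mult)
      then show ?thesis using ab by (simp add: prod power_mult_distrib power_divide)
    qed
    finally show ?thesis by (rule power2_le_imp_le) (use ab in auto)
  qed
  \<comment> \<open>Slightly below \<open>2 / 5\<close>, the inverse of \<open>5 / 2\<close>, to
    absorb the factor \<open>129 / 128\<close> between actual and published loads:
    \<open>129 / 128 * (25 / 26) < 1\<close>.\<close>
  define \<Lambda> where "\<Lambda> = 2 ^ J * real K * M * (5 / 13)"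
  \<comment> \<open>The squared weights follow the ratio of the two sides up to a factor 4, and the
    stars confine this ratio between \<open>1 / M ^ 2\<close> and \<open>M ^ 2\<close>.\<close>
  have MJ: "ma \<le> 2 * M * 2 ^ J" "mb \<le> 2 * M * 2 ^ J"
  proof -
    have "4 ^ e * b \<le> 4 ^ J * (b * M\<^sup>2)" using e(2) M2(1) by (rule order_trans[OF _ mult_left_mono]) auto
    then have "4 ^ e * b \<le> (M * M * 4 ^ J) * b" by (simp add: power2_eq_square mult_ac)
    then have "4 ^ e \<le> M * M * 4 ^ J" using ab(2) by simp
    moreover have "(4::real) ^ J = 2 ^ J * 2 ^ J" by (simp flip: power_mult_distrib)
    ultimately have "ma * ma \<le> M * M * (2 ^ J * 2 ^ J)" using mab(4) by simp
    then have "ma\<^sup>2 \<le> (M * 2 ^ J)\<^sup>2" by (simp add: power2_eq_square mult_ac)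
    then have "ma \<le> M * 2 ^ J" by (rule power2_le_imp_le) (use M(2) in simp)
    moreover have "0 < M * 2 ^ J" using M(2) by simp
    ultimately show "ma \<le> 2 * M * 2 ^ J" by linarith
    have "4 ^ J * a \<le> 4 * (4 ^ e * (a * M\<^sup>2))" using e' M2(2) by (rule order_trans[OF _ mult_left_mono[OF mult_left_mono]]) auto
    then have "4 ^ J * a \<le> 4 * (ma * ma * M\<^sup>2) * a" unfolding mab(4) by (simp add: mult_ac)
    then have "4 ^ J \<le> 4 * (ma * ma * M\<^sup>2)" using ab(1) by simp
    then have "4 ^ J \<le> (2 * M * ma)\<^sup>2" by (simp add: power2_eq_square mult_ac)
    then have "(2 ^ J)\<^sup>2 \<le> (2 * M * ma)\<^sup>2" by (simp flip: power_mult add: mult.commute[of J] power_mult)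
    then have "2 ^ J \<le> 2 * M * ma" by (rule power2_le_imp_le) (use M(2) mab in simp)
    then have "2 ^ J * mb \<le> 2 * M * (ma * mb)" using mab(3) by (simp add: mult.assoc[symmetric])
    also have "\<dots> = 2 ^ J * (2 * M * 2 ^ J)" unfolding mab(1) by (simp flip: power_mult_distrib)
    finally show "mb \<le> 2 * M * 2 ^ J" by simp
  qed
  have ex: "(\<exists>u\<in>X. \<Lambda> \<le> real (p (left u e)) * ma) \<or> (\<exists>v\<in>Y. \<Lambda> \<le> real (p (right v e)) * mb)"
  proof (rule ccontr)
    assume "\<not> ?thesis"
    then have lt: "real (p (left u e)) \<le> \<Lambda> / ma" "real (p (right v e)) \<le> \<Lambda> / mb" if "u \<in> X" "v \<in> Y" for u v
      using that mab(2,3) by (auto simp: field_simps not_le intro: less_imp_le)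
    have P: "128 \<le> real P" using P_large by simp
    have dg: "real (deg A x) \<le> 129 / 128 * real (p x)" if "x < N" for x
    proof -
      have "real P * real (deg A x) \<le> (real P + 1) * real (p x)" using nearD(1)[OF near[OF that]] .
      also have "\<dots> \<le> real P * (129 / 128 * real (p x))"
      proof -
        have "(real P + 1) * real (p x) \<le> (real P * (129 / 128)) * real (p x)" using P by (intro mult_right_mono) auto
        then show ?thesis by simp
      qed
      finally show ?thesis using P by simp
    qed
    obtain u0 v0 where uv0: "u0 \<in> X" "v0 \<in> Y" using XY by blast
    have "c * real K \<le> (\<Sum>u\<in>X. real (deg A (left u e))) + (\<Sum>v\<in>Y. real (deg A (right v e)))"
    proof -
      have "real (card (edges_between E X Y) * K) \<le> real ((\<Sum>u\<in>X. deg A (left u e)) + (\<Sum>v\<in>Y. deg A (right v e)))"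
        using units_of_count[OF A fE eG fin] by (simp only: of_nat_le_iff)
      then show ?thesis by (simp add: c_def)
    qed
    also have "\<dots> \<le> (\<Sum>u\<in>X. 129 / 128 * (\<Lambda> / ma)) + (\<Sum>v\<in>Y. 129 / 128 * (\<Lambda> / mb))"
    proof (intro add_mono sum_mono)
      fix u assume u: "u \<in> X"
      then have "left u e < N" using XY(1) node_less(1)[OF _ eG] by auto
      then show "real (deg A (left u e)) \<le> 129 / 128 * (\<Lambda> / ma)" using dg[of "left u e"] lt(1)[OF u uv0(2)] by simp
    next
      fix v assume v: "v \<in> Y"
      then have "right v e < N" using XY(3) node_less(2) by auto
      then show "real (deg A (right v e)) \<le> 129 / 128 * (\<Lambda> / mb)" using dg[of "right v e"] lt(2)[OF uv0(1) v] by simp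
    qed
    also have "\<dots> = 129 / 128 * \<Lambda> * (\<alpha> + \<beta>)" by (simp add: \<alpha>_def \<beta>_def a_def b_def algebra_simps)
    also have "\<dots> \<le> 129 / 128 * \<Lambda> * (5 / 2 * sqrt (a * b) / 2 ^ J)"
      using ms M(2) by (intro mult_left_mono) (auto simp: \<Lambda>_def)
    also have "\<dots> = 129 / 128 * (25 / 26) * (c * real K)" by (simp add: \<Lambda>_def cM)
    finally show False using c0 R_large(9) by simp
  qed
  have "\<exists>x<N. \<Lambda> \<le> real (p x * m x) \<and> max (m x) (4 ^ J div m x) = max (2 ^ e) (2 ^ (2 * J - e))"
  proof -
    have q: "(4::nat) ^ J div 2 ^ e = 2 ^ (2 * J - e)" "(4::nat) ^ J div 2 ^ (2 * J - e) = 2 ^ e"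
      using mult_pair[OF eG] by (metis nonzero_mult_div_cancel_left power_not_zero zero_neq_numeral,
        metis nonzero_mult_div_cancel_right power_not_zero zero_neq_numeral)
    from ex show ?thesis
    proof
      assume "\<exists>u\<in>X. \<Lambda> \<le> real (p (left u e)) * ma"
      then obtain u where u: "u \<in> X" "\<Lambda> \<le> real (p (left u e)) * ma" by blast
      then have "left u e < N" using XY(1) node_less(1)[OF _ eG] by auto
      then show ?thesis using u(2) q by (intro exI[of _ "left u e"]) (simp add: m_left[OF eG] ma_def)
    next
      assume "\<exists>v\<in>Y. \<Lambda> \<le> real (p (right v e)) * mb"
      then obtain v where v: "v \<in> Y" "\<Lambda> \<le> real (p (right v e)) * mb" by blast
      then have "right v e < N" using XY(3) node_less(2) by auto
      then show ?thesis using v(2) q by (intro exI[of _ "right v e"]) (simp add: m_right mb_def max.commute)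
    qed
  qed
  then obtain x where x: "x < N" "\<Lambda> \<le> real (p x * m x)" "max (m x) (4 ^ J div m x) = max (2 ^ e) (2 ^ (2 * J - e))"
    by blast
  have "real (F x) = 32 * (real J + 1) * max ma mb"
    unfolding F_def x(3) by (simp add: ma_def mb_def of_nat_max)
  also have "\<dots> \<le> 32 * (real J + 1) * (2 * M * 2 ^ J)" using MJ by (intro mult_left_mono) auto
  also have "\<dots> \<le> \<Lambda>"
  proof -
    have "64 * ((real J + 1) * M * 2 ^ J) \<le> 256 * (5 / 13) * ((real J + 1) * M * 2 ^ J)" using M(2) by (intro mult_right_mono) auto
    then show ?thesis by (simp add: \<Lambda>_def K_def algebra_simps)
  qed
  finally have "real (F x) \<le> real (p x * m x)" using x(2) by linarith
  then have "thr x (p x) = p x * m x" unfolding thr_def of_nat_le_iff by simp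
  moreover have "2 ^ J * real K * M / 4 \<le> \<Lambda>" using M(2) by (simp add: \<Lambda>_def)
  ultimately show ?thesis using x(1,2) by (intro exI[of _ x]) auto
qed

lemma node_cases:
  assumes "x < N"
  obtains u e where "u < n" "e < G" "x = left u e" | v e where "v < n" "e < G" "x = right v e"
proof -
  define q where "q = x div G"
  define r where "r = x mod G"
  have x: "x = q * G + r" by (simp add: q_def r_def)
  have r: "r < G" using G_pos by (simp add: r_def)
  have q: "q < 2 * n" using assms unfolding q_def N_def by (simp add: less_mult_imp_div_less)
  show ?thesis
  proof (cases "even q")
    case True
    then obtain u where "q = 2 * u" by blast
    then show ?thesis using that(1)[of u r] q r x by (simp add: left_def)
  next
    case False
    then obtain v where v: "q = 2 * v + 1" using oddE by blast
    have "2 * J - (2 * J - r) = r" "2 * J - r < G" using r by (auto simp: G_def)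
    then show ?thesis using that(2)[of v "2 * J - r"] q x v by (simp add: right_def)
  qed
qed

text \<open>Suppose a value \<open>l0\<close> exceeds \<open>2 * 2 ^ J * K * M\<close>. With
  \<open>W\<close> the weighted size of a level set, the loads give
  \<open>127 / 128 * l i * W i \<le> K * M * sqrt (|X| |Y|)\<close> for the next level sets, and the
  right side is at most \<open>l0 / 4 * W (Suc i)\<close>. As \<open>l i\<close> stays above
  \<open>3 / 4 * l0\<close>, the size grows by nearly 3 per level, more than the doubling that is
  used.\<close>

lemma approx_upper:
  assumes A: "A \<subseteq> U" "\<forall>(x, y, j)\<in>A. (y, x, j) \<notin> A" "und A = und (units E)" and E: "E \<subseteq> {..<n} \<times> {..<n}"
    and near: "\<And>x. x < N \<Longrightarrow> near A p x" and good: "good A p {}"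
    and x: "x < N" and M: "M = max_density {..<n} E"
  shows "real (thr x (p x)) \<le> 2 * 2 ^ J * real K * M"
proof (rule ccontr)
  assume neg: "\<not> ?thesis"
  have fA: "finite A" using A(1) finite_U finite_subset by blast
  have fE: "finite E" using E finite_subset by blast
  have M0: "0 \<le> M" using max_density_nonneg[OF n(1)] by (simp add: M)
  have "0 \<le> 2 * 2 ^ J * real K * M" using M0 by simp
  then have "thr x (p x) \<noteq> 0" using neg by (metis of_nat_0)
  then have t: "thr x (p x) = p x * m x" "F x \<le> p x * m x" by (auto simp: thr_def split: if_splits)
  define l0 where "l0 = real (p x * m x)"
  have big: "2 * 2 ^ J * real K * M < l0" using neg t(1) by (simp add: l0_def)
  obtain e where e: "e < G" "(\<exists>u<n. x = left u e) \<or> (\<exists>v<n. x = right v e)" by (rule node_cases[OF x]) blast+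
  define ma where "ma = (2::real) ^ e"
  define mb where "mb = (2::real) ^ (2 * J - e)"
  define mx where "mx = max ma mb"
  have mab: "ma * mb = 4 ^ J" "0 < ma" "0 < mb" "1 \<le> ma" "1 \<le> mb"
  proof -
    have "real (2 ^ e * 2 ^ (2 * J - e)) = real (4 ^ J)" using mult_pair[OF e(1)] by (simp only:)
    then show "ma * mb = 4 ^ J" by (simp add: ma_def mb_def)
  qed (auto simp: ma_def mb_def)
  have mx: "ma \<le> mx" "mb \<le> mx" "0 < mx" "mx \<le> 4 ^ J"
  proof -
    have "ma * 1 \<le> ma * mb" "1 * mb \<le> ma * mb" using mab by (intro mult_left_mono mult_right_mono; simp)+
    then show "mx \<le> 4 ^ J" using mab(1) by (simp add: mx_def)
  qed (use mab in \<open>auto simp: mx_def\<close>)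
  have Fx: "32 * (real J + 1) * mx \<le> l0"
  proof -
    have q: "(4::nat) ^ J div 2 ^ e = 2 ^ (2 * J - e)" "(4::nat) ^ J div 2 ^ (2 * J - e) = 2 ^ e"
      using mult_pair[OF e(1)] by (metis nonzero_mult_div_cancel_left power_not_zero zero_neq_numeral,
        metis nonzero_mult_div_cancel_right power_not_zero zero_neq_numeral)
    have "max (m x) (4 ^ J div m x) = max (2 ^ e) (2 ^ (2 * J - e))"
      using e q by (auto simp: m_left m_right max.commute)
    then have "real (F x) = 32 * (real J + 1) * mx" by (simp add: F_def mx_def ma_def mb_def of_nat_max)
    moreover have "real (F x) \<le> l0" using t(2) unfolding l0_def of_nat_le_iff .
    ultimately show ?thesis by simp
  qed
  have l0: "0 < l0"
  proof -
    have "0 < 32 * (real J + 1) * mx" using mx by simp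
    then show ?thesis using Fx by linarith
  qed
  define q where "q = real P"
  have q: "q = 128 * (real J + 1)" by (simp add: q_def P_def)
  have q128: "128 \<le> q" by (simp add: q)
  \<comment> \<open>Each level gives up the relative slack \<open>4 / q\<close> of the local
    condition and one weight, for the unit that the other endpoint would gain.\<close>
  define l where "l = (\<lambda>i. l0 - real i * (4 * l0 / q + mx))"
  \<comment> \<open>\<open>W\<close> starts at \<open>1 / mx\<close> or more and never exceeds
    \<open>2 * mx\<close>, where \<open>mx \<le> 4 ^ J\<close>; so at most \<open>4 * J + 1\<close>
    doublings are possible.\<close>
  define I where "I = 4 * (J + 1)"
  have l_low: "3 / 4 * l0 \<le> l i" if "i \<le> I" for i
  proof -
    have i: "real i \<le> 4 * (real J + 1)"
    proof -
      have "real i \<le> real I" using that by simp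
      then show ?thesis by (simp add: I_def)
    qed
    then have "real i * (4 * l0 / q + mx) \<le> 4 * (real J + 1) * (4 * l0 / q + mx)"
      using l0 q128 mx by (intro mult_right_mono) auto
    also have "\<dots> = l0 / 8 + 4 * (real J + 1) * mx"
    proof -
      have "4 * (real J + 1) * (4 * l0 / q) = l0 / 8" using q128 by (simp add: q field_simps)
      then show ?thesis by (simp add: distrib_left)
    qed
    finally have "real i * (4 * l0 / q + mx) \<le> l0 / 8 + 4 * (real J + 1) * mx" .
    moreover have "4 * (real J + 1) * mx \<le> l0 / 8" using Fx by linarith
    ultimately have "real i * (4 * l0 / q + mx) \<le> l0 / 4" by linarith
    then show ?thesis by (simp add: l_def)
  qed
  have l_dec: "l (Suc i) = l i - 4 * l0 / q - mx" for i by (simp add: l_def distrib_right del: times_divide_eq_left times_divide_eq_right)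
  have l_le: "l i \<le> l0" for i
  proof -
    have "0 \<le> real i * (4 * l0 / q + mx)" using l0 q128 mx by simp
    then show ?thesis by (simp add: l_def)
  qed
  define X where "X = (\<lambda>i. {u \<in> {..<n}. l i \<le> real (p (left u e)) * ma})"
  define Y where "Y = (\<lambda>i. {v \<in> {..<n}. l i \<le> real (p (right v e)) * mb})"
  define W where "W = (\<lambda>i. real (card (X i)) / ma + real (card (Y i)) / mb)"
  have W0: "0 \<le> W i" for i using mab by (simp add: W_def)
  have fin: "finite (X i)" "finite (Y i)" for i by (auto simp: X_def Y_def)
  have anti: "l (Suc i) \<le> l i" for i
  proof -
    have "0 \<le> 4 * l0 / q" using l0 q128 by simp
    then show ?thesis unfolding l_dec using mx by linarith
  qed
  \<comment> \<open>The local condition bounds \<open>p y + 1\<close> from below; dropping the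
    summand 1 costs \<open>my\<close>, which is at most \<open>mx\<close>.\<close>
  have hop: "l (Suc i) \<le> real (p y) * my"
    if "i \<le> I" "l i \<le> real (p z) * mz" "real P * (real (p z) * mz) \<le> (real P + 4) * (real (p y) + 1) * my" "my \<le> mx" for i y z my mz
  proof -
    have li: "0 \<le> l i" using l_low[OF that(1)] l0 by linarith
    have "q * l i \<le> q * (real (p z) * mz)" using that(2) q128 by (intro mult_left_mono) auto
    also have "\<dots> \<le> (q + 4) * (real (p y) * my + my)" using that(3) by (simp add: q_def algebra_simps)
    finally have "q * l i \<le> (q + 4) * (real (p y) * my + my)" .
    moreover have "(q + 4) * (l i - 4 * l0 / q) \<le> q * l i"
    proof -
      have "4 * l i \<le> (q + 4) * (4 * l0 / q)"
      proof -
        have "q * (4 * l0 / q) \<le> (q + 4) * (4 * l0 / q)" using l0 q128 by (intro mult_right_mono) auto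
        then show ?thesis using l_le[of i] q128 by simp
      qed
      then show ?thesis by (simp add: algebra_simps)
    qed
    ultimately have "(q + 4) * (l i - 4 * l0 / q) \<le> (q + 4) * (real (p y) * my + my)" by linarith
    then have "l i - 4 * l0 / q \<le> real (p y) * my + my" using q128 by simp
    then show ?thesis unfolding l_dec using that(4) by linarith
  qed
  have gd: "real P * (real (p z) * real (m z)) \<le> (real P + 4) * (real (p y) + 1) * real (m y)" if "(z, y, j) \<in> A" for z y j
  proof -
    have "P * (p z * m z) \<le> (P + 4) * (p y + 1) * m y" using good that by (auto simp: good_def)
    then have "real (P * (p z * m z)) \<le> real ((P + 4) * (p y + 1) * m y)" by (simp only: of_nat_le_iff)
    then show ?thesis by (simp add: algebra_simps)
  qed
  have grow: "2 * W i \<le> W (Suc i)" if i: "i \<le> I" for i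
  proof -
    have c: "(\<Sum>u\<in>X i. deg A (left u e)) + (\<Sum>v\<in>Y i. deg A (right v e))
        \<le> card (edges_between E (X (Suc i)) (Y (Suc i))) * K"
    proof (rule owned_count[OF fA A(2,3) fE e(1) fin])
      fix u v j assume a: "(u, v) \<in> E" "(left u e, right v e, j) \<in> A" "u \<in> X i"
      have uv: "u < n" "v < n" using a(1) E by auto
      have g: "real P * (real (p (left u e)) * ma) \<le> (real P + 4) * (real (p (right v e)) + 1) * mb"
        using gd[OF a(2)] by (simp add: m_left[OF e(1)] m_right ma_def mb_def)
      have "l i \<le> real (p (left u e)) * ma" using a(3) by (simp add: X_def)
      then have "l (Suc i) \<le> real (p (right v e)) * mb" "l (Suc i) \<le> real (p (left u e)) * ma"
        using hop[OF i _ g mx(2)] anti[of i] by auto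
      then show "u \<in> X (Suc i) \<and> v \<in> Y (Suc i)" using uv by (simp add: X_def Y_def)
    next
      fix u v j assume a: "(u, v) \<in> E" "(right v e, left u e, j) \<in> A" "v \<in> Y i"
      have uv: "u < n" "v < n" using a(1) E by auto
      have g: "real P * (real (p (right v e)) * mb) \<le> (real P + 4) * (real (p (left u e)) + 1) * ma"
        using gd[OF a(2)] by (simp add: m_left[OF e(1)] m_right ma_def mb_def)
      have "l i \<le> real (p (right v e)) * mb" using a(3) by (simp add: Y_def)
      then have "l (Suc i) \<le> real (p (left u e)) * ma" "l (Suc i) \<le> real (p (right v e)) * mb"
        using hop[OF i _ g mx(1)] anti[of i] by auto
      then show "u \<in> X (Suc i) \<and> v \<in> Y (Suc i)" using uv by (simp add: X_def Y_def)
    qed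
    have dg: "127 / 128 * real (p z) \<le> real (deg A z)" if "z < N" for z
    proof -
      have "q * (127 / 128 * real (p z)) \<le> (q - 1) * real (p z)"
      proof -
        have "(q * (127 / 128)) * real (p z) \<le> (q - 1) * real (p z)" using q128 by (intro mult_right_mono) auto
        then show ?thesis by simp
      qed
      also have "\<dots> \<le> q * real (deg A z)" using nearD(2)[OF near[OF that]] by (simp add: q_def)
      finally show ?thesis using q128 by simp
    qed
    have li: "0 \<le> l i" using l_low[OF i] l0 by linarith
    have "127 / 128 * l i * W i = (\<Sum>u\<in>X i. 127 / 128 * (l i / ma)) + (\<Sum>v\<in>Y i. 127 / 128 * (l i / mb))"
      by (simp add: W_def algebra_simps)
    also have "\<dots> \<le> (\<Sum>u\<in>X i. real (deg A (left u e))) + (\<Sum>v\<in>Y i. real (deg A (right v e)))"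
    proof (intro add_mono sum_mono)
      fix u assume u: "u \<in> X i"
      then have N: "left u e < N" using node_less(1)[OF _ e(1)] by (simp add: X_def)
      have "l i / ma \<le> real (p (left u e))" using u mab(2) by (simp add: X_def field_simps)
      then show "127 / 128 * (l i / ma) \<le> real (deg A (left u e))" using dg[OF N] by linarith
    next
      fix v assume v: "v \<in> Y i"
      then have N: "right v e < N" using node_less(2) by (simp add: Y_def)
      have "l i / mb \<le> real (p (right v e))" using v mab(3) by (simp add: Y_def field_simps)
      then show "127 / 128 * (l i / mb) \<le> real (deg A (right v e))" using dg[OF N] by linarith
    qed
    also have "\<dots> = real ((\<Sum>u\<in>X i. deg A (left u e)) + (\<Sum>v\<in>Y i. deg A (right v e)))" by simp
    also have "\<dots> \<le> real (card (edges_between E (X (Suc i)) (Y (Suc i))) * K)" using c by (simp only: of_nat_le_iff)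
    also have "\<dots> \<le> M * sqrt (real (card (X (Suc i))) * real (card (Y (Suc i)))) * real K"
    proof -
      have "X (Suc i) \<subseteq> {..<n}" "Y (Suc i) \<subseteq> {..<n}" by (auto simp: X_def Y_def)
      from card_edges_le[OF this n(1), of E] show ?thesis by (simp add: M mult_right_mono)
    qed
    \<comment> \<open>The geometric mean of the two weighted sizes is at most their arithmetic mean,
      and the product of the weights contributes \<open>sqrt (4 ^ J)\<close>.\<close>
    also have "\<dots> \<le> M * (2 ^ J / 2 * W (Suc i)) * real K"
    proof -
      define \<alpha> where "\<alpha> = real (card (X (Suc i))) / ma"
      define \<beta> where "\<beta> = real (card (Y (Suc i))) / mb"
      have nn: "0 \<le> \<alpha>" "0 \<le> \<beta>" using mab by (auto simp: \<alpha>_def \<beta>_def)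
      have "real (card (X (Suc i))) * real (card (Y (Suc i))) = \<alpha> * \<beta> * (ma * mb)" using mab by (simp add: \<alpha>_def \<beta>_def)
      also have "\<dots> = \<alpha> * \<beta> * (2 ^ J)\<^sup>2" unfolding mab(1) by (simp flip: power_mult add: mult.commute[of J] power_mult)
      finally have "sqrt (real (card (X (Suc i))) * real (card (Y (Suc i)))) = sqrt (\<alpha> * \<beta>) * 2 ^ J"
        by (simp add: real_sqrt_mult)
      also have "\<dots> \<le> (\<alpha> + \<beta>) / 2 * 2 ^ J" using arith_geo_mean_sqrt[OF nn] by (intro mult_right_mono) auto
      finally have "sqrt (real (card (X (Suc i))) * real (card (Y (Suc i)))) \<le> 2 ^ J / 2 * W (Suc i)"
        by (simp add: W_def \<alpha>_def \<beta>_def mult.commute)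
      then show ?thesis using M0 by (intro mult_right_mono mult_left_mono) auto
    qed
    also have "\<dots> = (2 * 2 ^ J * real K * M) / 4 * W (Suc i)" by simp
    also have "\<dots> \<le> l0 / 4 * W (Suc i)"
      using W0 by (intro mult_right_mono divide_right_mono less_imp_le[OF big]) auto
    finally have "127 / 128 * l i * W i \<le> l0 / 4 * W (Suc i)" .
    moreover have "127 / 128 * (3 / 4 * l0) * W i \<le> 127 / 128 * l i * W i"
      using l_low[OF i] W0 by (intro mult_right_mono) auto
    ultimately have "l0 * (127 / 128 * (3 / 4) * W i) \<le> l0 * (1 / 4 * W (Suc i))" by simp
    then have "127 / 128 * (3 / 4) * W i \<le> 1 / 4 * W (Suc i)" using l0 by (simp only: mult_le_cancel_left_pos)
    then show ?thesis using W0[of i] by linarith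
  qed
  have geo: "2 ^ i * W 0 \<le> W i" if "i \<le> I" for i
    using that
  proof (induction i)
    case (Suc i)
    then have "2 ^ Suc i * W 0 \<le> 2 * W i" by simp
    also have "\<dots> \<le> W (Suc i)" using grow Suc by simp
    finally show ?case .
  qed simp
  have start: "1 / mx \<le> W 0"
  proof -
    have l00: "l 0 = real (p x) * real (m x)" by (simp add: l_def l0_def)
    from e(2) show ?thesis
    proof
      assume "\<exists>u<n. x = left u e"
      then obtain u where "u < n" "x = left u e" by blast
      then have "u \<in> X 0" by (simp add: X_def l00 m_left[OF e(1)] ma_def)
      then have "card (X 0) \<noteq> 0" using fin by auto
      then have "1 / ma \<le> real (card (X 0)) / ma" using mab by (intro divide_right_mono) auto
      moreover have "1 / mx \<le> 1 / ma" using mx mab by (simp add: frac_le)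
      moreover have "0 \<le> real (card (Y 0)) / mb" using mab by simp
      ultimately show ?thesis by (simp add: W_def)
    next
      assume "\<exists>v<n. x = right v e"
      then obtain v where "v < n" "x = right v e" by blast
      then have "v \<in> Y 0" by (simp add: Y_def l00 m_right mb_def)
      then have "card (Y 0) \<noteq> 0" using fin by auto
      then have "1 / mb \<le> real (card (Y 0)) / mb" using mab by (intro divide_right_mono) auto
      moreover have "1 / mx \<le> 1 / mb" using mx mab by (simp add: frac_le)
      moreover have "0 \<le> real (card (X 0)) / ma" using mab by simp
      ultimately show ?thesis by (simp add: W_def)
    qed
  qed
  have stop: "W I \<le> 2 * mx"
  proof -
    have cX: "real (card (X I)) \<le> 4 ^ J" "real (card (Y I)) \<le> 4 ^ J"
    proof -
      have "X I \<subseteq> {..<n}" "Y I \<subseteq> {..<n}" by (auto simp: X_def Y_def)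
      then have "card (X I) \<le> n" "card (Y I) \<le> n"
        using card_mono[of "{..<n}" "X I"] card_mono[of "{..<n}" "Y I"] by simp_all
      then have "card (X I) \<le> 4 ^ J" "card (Y I) \<le> 4 ^ J" using n(2) by simp_all
      then have "real (card (X I)) \<le> real (4 ^ J)" "real (card (Y I)) \<le> real (4 ^ J)" by (simp_all only: of_nat_le_iff)
      then show "real (card (X I)) \<le> 4 ^ J" "real (card (Y I)) \<le> 4 ^ J" by simp_all
    qed
    have "real (card (X I)) / ma \<le> mb" "real (card (Y I)) / mb \<le> ma"
      using cX mab(1-3) by (simp_all add: field_simps)
    then show ?thesis using mx by (simp add: W_def)
  qed
  have "2 ^ I * (1 / mx) \<le> 2 * mx"
  proof -
    have "2 ^ I * (1 / mx) \<le> 2 ^ I * W 0" using start by (intro mult_left_mono) auto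
    then show ?thesis using geo[of I] stop by simp
  qed
  then have "2 ^ I \<le> 2 * (mx * mx)" using mx(3) by (simp add: field_simps)
  also have "\<dots> \<le> 2 * (4 ^ J * 4 ^ J)" using mx by (intro mult_left_mono mult_mono) auto
  also have "\<dots> = 2 * 2 ^ (4 * J)" by (simp add: power_mult flip: power_mult_distrib)
  finally have "(2::real) ^ I \<le> 2 * 2 ^ (4 * J)" .
  moreover have "(2::real) ^ I = 16 * 2 ^ (4 * J)" by (simp add: I_def power_add)
  moreover have "(0::real) < 2 ^ (4 * J)" by simp
  ultimately show False by linarith
qed

text \<open>The denominator \<open>2 * 2 ^ J * K\<close> normalises the upper bound to the density;
  the lower bound is an eighth of the upper one. A graph without edges is covered by the answer
  0.\<close>

lemma approx:
  assumes inv: "Inv \<sigma> S A p {}" and und: "und A = und (units E)" and E: "E \<subseteq> {..<n} \<times> {..<n}" and ans: "ans_ok \<sigma> p"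
  shows "is_approx 8 (max_density {..<n} E) (real (\<sigma> (V AnsNum)) / real (2 * 2 ^ J * K))"
proof -
  define M where "M = max_density {..<n} E"
  define v where "v = real (\<sigma> (V AnsNum))"
  have A: "A \<subseteq> U" "\<forall>(x, y, j)\<in>A. (y, x, j) \<notin> A" and near: "\<And>x. x < N \<Longrightarrow> near A p x" and good: "good A p {}"
    using inv by (auto simp: Inv_def rep_def)
  have fA: "finite A" using A(1) finite_U finite_subset by blast
  have M0: "0 \<le> M" using max_density_nonneg[OF n(1)] by (simp add: M_def)
  have K: "0 < real K" using R_large(9) by simp
  have up: "v \<le> 2 * 2 ^ J * real K * M"
  proof (cases "\<sigma> (V AnsNum) = 0")
    case False
    then obtain x where "x < N" "\<sigma> (V AnsNum) = thr x (p x)" using ans by (auto simp: ans_ok_def)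
    then show ?thesis using approx_upper[OF A und E near good _ M_def] by (simp add: v_def)
  qed (use M0 in \<open>simp add: v_def\<close>)
  have lo: "2 ^ J * real K * M / 4 \<le> v"
  proof (cases "M = 0")
    case False
    then have "0 < M" using M0 by simp
    from approx_lower[OF fA und E near M_def this] obtain x where x: "x < N" "2 ^ J * real K * M / 4 \<le> real (thr x (p x))" by blast
    have "real (thr x (p x)) \<le> v" using ans x(1) by (simp add: ans_ok_def v_def)
    then show ?thesis using x(2) by linarith
  qed (simp add: v_def)
  have "M / 8 \<le> v / (2 * 2 ^ J * real K)" "v / (2 * 2 ^ J * real K) \<le> M"
    using up lo K by (simp_all add: field_simps)
  then show ?thesis by (simp add: is_approx_def M_def v_def)
qed

end

section \<open>Initialisation and runs\<close>

text \<open>Finds the least \<open>J\<close> with \<open>n \<le> 4 ^ J\<close> by repeated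
  multiplication and tabulates the powers of two up to \<open>2 ^ (2 J)\<close> on the way; the
  factor 256 adds the 8 bits of \<open>Radix\<close> per level. \<open>SizeJ\<close> starts from the
  zeroed memory.\<close>

definition grow :: com where
  "grow =
     (put Pow (Num 2 \<otimes> Reg SizeJ \<oplus> Num 1) (Num 2 \<otimes> Reg Pow4) ;;
      put Pow (Num 2 \<otimes> Reg SizeJ \<oplus> Num 2) (Num 4 \<otimes> Reg Pow4) ;;
      SizeJ ::= Reg SizeJ \<oplus> Num 1 ;;
      Pow4 ::= Num 4 \<otimes> Reg Pow4 ;;
      Radix ::= Num 256 \<otimes> Reg Radix)"

text \<open>Setting \<open>TrieFresh\<close> to 1 reserves slot 0 for the root, whose child cells
  are 0 from the start.\<close>

definition constants :: com where
  "constants =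
     (Guesses ::= Num 2 \<otimes> Reg SizeJ \<oplus> Num 1 ;;
      Copies ::= Num 256 \<otimes> (Reg SizeJ \<oplus> Num 1) ;;
      Prec ::= Num 128 \<otimes> (Reg SizeJ \<oplus> Num 1) ;;
      KeyTop ::= Reg Radix \<otimes> Reg Radix \<otimes> Reg Radix \<otimes> Reg Radix \<otimes> Reg Radix ;;
      KeyHalf ::= Reg KeyTop \<oslash> Num 2 ;;
      AnsDen ::= Num 2 \<otimes> Elem Pow (Reg SizeJ) \<otimes> Reg Copies ;;
      TrieFresh ::= Num 1)"

definition init :: com where
  "init =
     (Pow4 ::= Num 1 ;; Radix ::= Num 65536 ;; put Pow (Num 0) (Num 1) ;;
      (WHILE Reg Pow4 \<lhd> Reg Arg0 DO grow) ;; constants)"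

definition alg :: dyn_alg where
  "alg = \<lparr>init_com = init, insert_com = update insert_step, delete_com = update delete_step, query_com = query\<rparr>"

section \<open>Sums over the updates of a sequence\<close>

lemma updates_Cons: "updates (q # ops) = (if q = Query then {} else {0}) \<union> Suc ` updates ops"
  by (auto simp: updates_def less_Suc_eq_0_disj)

lemma queries_Cons: "queries (q # ops) = (if q = Query then {0} else {}) \<union> Suc ` queries ops"
  by (auto simp: queries_def less_Suc_eq_0_disj)

lemma finite_updates: "finite (updates ops)"
  by (simp add: updates_def)

lemma sum_updates_Cons:
  "(\<Sum>i\<in>updates (q # ops). f i) = (if q = Query then 0 else f 0) + (\<Sum>i\<in>updates ops. f (Suc i))" for f :: "nat \<Rightarrow> 'a::comm_monoid_add"
proof -
  have "(\<Sum>i\<in>Suc ` updates ops. f i) = (\<Sum>i\<in>updates ops. f (Suc i))" by (simp add: sum.reindex)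
  then show ?thesis using finite_updates[of ops] by (simp add: updates_Cons)
qed

lemma card_updates_Cons: "card (updates (q # ops)) = (if q = Query then 0 else 1) + card (updates ops)"
  using finite_updates[of ops] by (simp add: updates_Cons card_image)

context graph_machine
begin

definition boot :: "(loc \<Rightarrow> nat) \<Rightarrow> bool" where
  "boot s \<longleftrightarrow> fixed s \<and> s (V KeyHalf) = 2 ^ (40 * J + 79) \<and> s (V TrieFresh) = 1 \<and> s (V TrieFree) = 0
     \<and> s (V AnsNum) = 0 \<and> (\<forall>i. s (H Kid i) = 0 \<and> s (H Load i) = 0 \<and> s (H Pub i) = 0)"

lemma B_large: "2 * J + 2 < B"
proof -
  define T where "T = 2 * ub + 4 * n * (2 * J + 1)"
  have "4 * 1 * (2 * J + 1) \<le> 4 * n * (2 * J + 1)" using n(1) by (intro mult_right_mono) auto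
  then have "4 * 1 * (2 * J + 1) \<le> T" unfolding T_def by (rule trans_le_add2)
  moreover have "1 * T \<le> (40 * J + 80) * T" by (intro mult_right_mono) auto
  moreover define X where "X = (40 * J + 80) * T"
  ultimately have "4 * (2 * J + 1) \<le> X" by linarith
  moreover have "1 + X \<le> NB" using NB_cap by (simp only: T_def X_def)
  ultimately have "8 * J + 5 \<le> NB" "2 * NB \<le> B" using NB by simp_all
  then show ?thesis by simp
qed

lemma AnsDen_less: "2 * 2 ^ J * K < 2 ^ w" "0 < 2 * 2 ^ J * K"
proof -
  have "2 * 2 ^ J * K \<le> N * 4 ^ J * K"
  proof -
    have "2 * 1 * 1 \<le> N" unfolding N_def G_def using n(1) by (intro mult_mono) auto
    then have "2 \<le> N" by simp
    then show ?thesis by (intro mult_mono power_mono) auto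
  qed
  also have "\<dots> < R" using R_large(1) by (simp add: mult_ac)
  finally show "2 * 2 ^ J * K < 2 ^ w" by (rule R_less_word(1))
  show "0 < 2 * 2 ^ J * K" using R_large(9) by simp
qed

definition growing :: "nat \<Rightarrow> (loc \<Rightarrow> nat) \<Rightarrow> bool" where
  "growing j s \<longleftrightarrow> j \<le> J \<and> s (V Arg0) = n \<and> s (V SizeJ) = j \<and> s (V Pow4) = 4 ^ j \<and> s (V Radix) = 2 ^ (8 * j + 16)
     \<and> (\<forall>e\<le>2 * j. s (H Pow e) = 2 ^ e) \<and> s (V TrieFree) = 0 \<and> s (V AnsNum) = 0
     \<and> (\<forall>i. s (H Kid i) = 0 \<and> s (H Load i) = 0 \<and> s (H Pub i) = 0)"

lemma wp_grow:
  assumes s: "growing j s" and j: "j < J"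
  shows "wp w B raw grow (\<lambda>u s'. u \<le> 80 \<and> growing (j + 1) s') s"
proof -
  have R4: "4 * 4 ^ j < (2::nat) ^ w" "4 ^ j < (2::nat) ^ w" "2 * 4 ^ j < (2::nat) ^ w"
  proof -
    have "4 ^ Suc j \<le> (4::nat) ^ J" using j by (intro power_increasing) auto
    then have "4 * 4 ^ j < R" using R_large(5) by simp
    then show "4 * 4 ^ j < (2::nat) ^ w" by (rule R_less_word(1))
    then show "4 ^ j < (2::nat) ^ w" "2 * 4 ^ j < (2::nat) ^ w" by linarith+
  qed
  have R8: "256 * 2 ^ (8 * j + 16) < (2::nat) ^ w"
  proof -
    have "256 * (2::nat) ^ (8 * j + 16) = 2 ^ (8 * (j + 1) + 16)" by (simp add: power_add)
    also have "\<dots> \<le> R" unfolding R_def using j by (intro power_increasing) auto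
    also have "\<dots> < 2 ^ w" using word R_pow(1) R_large(11) by linarith
    finally show ?thesis .
  qed
  have c: "256 < (2::nat) ^ w" "2 < (2::nat) ^ w" "1 < (2::nat) ^ w" "4 < (2::nat) ^ w"
  proof -
    have "256 * 1 \<le> 256 * (2::nat) ^ (8 * j + 16)" by (intro mult_left_mono) auto
    then show "256 < (2::nat) ^ w" using R8 by linarith
  qed (use small[of 2] small[of 1] small[of 4] in auto)
  have i: "2 * j + 2 < B" "2 * j + 1 < B" "2 * j + 2 < 2 ^ w" "2 * j + 1 < 2 ^ w" "2 * j < 2 ^ w" "j + 1 < 2 ^ w"
    using B_large j space by linarith+
  have g: "s (V SizeJ) = j" "s (V Pow4) = 4 ^ j" "s (V Radix) = 2 ^ (8 * j + 16)" using s by (auto simp: growing_def)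
  define s' where "s' = s(H Pow (2 * j + 1) := 2 * 4 ^ j, H Pow (Suc (Suc (2 * j))) := 4 * 4 ^ j, V SizeJ := j + 1,
    V Pow4 := 4 * 4 ^ j, V Radix := 256 * 2 ^ (8 * j + 16))"
  have "growing (j + 1) s'"
  proof -
    have "s' (H Pow e) = 2 ^ e" if "e \<le> 2 * (j + 1)" for e
    proof -
      have "(2::nat) ^ (2 * j) = 4 ^ j" by (simp add: power_mult)
      moreover have "e \<le> 2 * j \<or> e = 2 * j + 1 \<or> e = 2 * j + 2" using that by (simp add: distrib_left) linarith
      ultimately show ?thesis using s by (auto simp: s'_def growing_def)
    qed
    then show ?thesis using s j unfolding growing_def by (simp add: s'_def power_add)
  qed
  then show ?thesis unfolding grow_def
    using i R4 R8 c by (intro raw_intros) (simp_all add: g flip: s'_def del: One_nat_def)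
qed

lemma wp_constants:
  assumes s: "growing J s"
  shows "wp w B raw constants (\<lambda>u s'. u \<le> 80 \<and> boot s') s"
proof -
  have g: "s (V SizeJ) = J" "s (V Pow4) = 4 ^ J" "s (V Radix) = R" "s (H Pow J) = 2 ^ J"
    using s by (auto simp: growing_def R_def)
  have s2: "\<forall>e\<le>2 * J. s (H Pow e) = 2 ^ e" "s (V TrieFree) = 0" "s (V AnsNum) = 0"
    "\<forall>i. s (H Kid i) = 0 \<and> s (H Load i) = 0 \<and> s (H Pub i) = 0"
    using s by (auto simp: growing_def)
  have R5: "R * R * R * R * R = R ^ 5" by (simp add: eval_nat_numeral mult_ac)
  have w: "R * R * R * R * R < 2 ^ w" "R * R * R * R < 2 ^ w" "R * R * R < 2 ^ w" "R * R < 2 ^ w"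
  proof -
    have *: "x < 2 ^ w" if "x \<le> R ^ 5" for x using that word R_large(11) R_pow(1) by linarith
    have "R * R * R * R * 1 \<le> R * R * R * R * R" using R_large(11) by (intro mult_left_mono) auto
    then show "R * R * R * R * R < 2 ^ w" "R * R * R * R < 2 ^ w" "R * R * R < 2 ^ w" "R * R < 2 ^ w"
      using * R_pow unfolding R5 by auto
  qed
  have KP: "256 * (J + 1) < 2 ^ w" "128 * (J + 1) < 2 ^ w" "2 * J + 1 < 2 ^ w" "2 * J < 2 ^ w" "J + 1 < 2 ^ w"
    "256 < (2::nat) ^ w" "128 < (2::nat) ^ w" "J < B"
    using R_less_word(1)[OF R_large(3)] space B_large by (auto simp: K_def)
  have d: "2 * 2 ^ J * (256 * (J + 1)) < 2 ^ w" using AnsDen_less(1) by (simp add: K_def)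
  have d': "2 * 2 ^ J < (2::nat) ^ w"
  proof -
    have "2 * 2 ^ J * 1 \<le> 2 * 2 ^ J * (256 * (J + 1))" by (intro mult_left_mono) auto
    then show ?thesis using d by linarith
  qed
  have half: "R ^ 5 div 2 = 2 ^ (40 * J + 79)"
  proof -
    have "R ^ 5 = 2 ^ (40 * J + 79) * 2" unfolding top[symmetric] by (simp add: power_add)
    then show ?thesis by simp
  qed
  define s' where "s' = s(V Guesses := 2 * J + 1, V Copies := 256 * J + 256, V Prec := 128 * J + 128,
    V KeyTop := R * R * R * R * R, V KeyHalf := R * R * R * R * R div 2, V AnsDen := 2 * 2 ^ J * (256 * J + 256), V TrieFresh := 1)"
  have "boot s'"
    using g half s2 unfolding boot_def fixed_def
    by (simp add: s'_def R5 G_def K_def P_def less_Suc_eq_le)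
  then show ?thesis unfolding constants_def
    using w KP d d' small[of 2] small[of 1] by (intro raw_intros) (simp_all add: g flip: s'_def del: One_nat_def)
qed

lemma wp_init:
  assumes J: "\<And>j. j < J \<Longrightarrow> 4 ^ j < n"
  shows "wp w B raw init (\<lambda>u s. u \<le> 300 * (real J + 1) \<and> boot s) (start_mem n \<circ> addr)"
proof -
  define s0 where "s0 = start_mem n \<circ> addr"
  have z: "s0 (V Arg0) = n" "\<And>r. r \<noteq> Arg0 \<Longrightarrow> s0 (V r) = 0" "\<And>a i. s0 (H a i) = 0"
  proof -
    show "s0 (V Arg0) = n" by (simp add: s0_def start_mem_def)
    fix r assume "r \<noteq> Arg0"
    then have "reg_index r \<noteq> 0" by (cases r) auto
    then show "s0 (V r) = 0" by (simp add: s0_def start_mem_def)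
  next
    fix a i show "s0 (H a i) = 0" by (simp add: s0_def start_mem_def)
  qed
  define s1 where "s1 = s0(V Pow4 := 1, V Radix := 65536, H Pow 0 := 1)"
  have start: "growing 0 s1" by (simp add: growing_def s1_def z)
  have loop: "wp w B raw (WHILE Reg Pow4 \<lhd> Reg Arg0 DO grow) (\<lambda>u s. u \<le> 10 + 100 * real J \<and> growing J s) s1"
  proof (rule raw_While[where g = 0 and I = growing and pot = "\<lambda>j _. 100 * (real J - real j)", OF space start], goal_cases)
    case (3 j s)
    then have j: "j < J"
    proof -
      have "j \<le> J" "4 ^ j < n" using 3 by (auto simp: growing_def split: if_splits)
      then show ?thesis using n(2) by (cases "j = J") auto
    qed
    show ?case
      by (rule wp_conseq[OF wp_grow[OF 3(1) j]]) (auto intro!: exI[of _ "j + 1"])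
  next
    case (4 j s)
    have "\<not> j < J" using 4 J[of j] by (auto simp: growing_def)
    then have "j = J" using 4(1) by (simp add: growing_def)
    then show ?case using 4(1) by simp
  qed (auto simp: growing_def)
  have c: "65536 < (2::nat) ^ w" "0 < B"
  proof -
    have "(2::nat) ^ 16 \<le> R" unfolding R_def by (intro power_increasing) auto
    then show "65536 < (2::nat) ^ w" using word R_pow(1) by simp
  qed (use B_large in simp)
  define rest where "rest = ((WHILE Reg Pow4 \<lhd> Reg Arg0 DO grow) ;; constants)"
  have rest: "wp w B raw rest (\<lambda>u s. u \<le> 90 + 100 * real J \<and> boot s) s1"
    unfolding rest_def
  proof (rule wp_SeqI[OF loop], goal_cases)
    case (1 u s)
    then show ?case
      by (intro wp_conseq[OF wp_constants]) auto
  qed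
  show ?thesis unfolding init_def s0_def[symmetric] rest_def[symmetric]
  proof (intro raw_intros, goal_cases)
    case 6
    show ?case
      using rest by (simp flip: s1_def del: One_nat_def) (erule wp_conseq, auto)
  qed (use c small[of 0] small[of 1] in simp_all)
qed

lemma booted:
  assumes "boot (M \<circ> addr)"
  shows "cli M (M \<circ> addr, {})" "Inv (M \<circ> addr) {} {} (\<lambda>_. 0) {}" "ans_ok (M \<circ> addr) (\<lambda>_. 0)" "Pot {} (\<lambda>_. 0) {} = 0"
proof -
  define s where "s = M \<circ> addr"
  have s: "fixed s" "s (V KeyHalf) = 2 ^ (40 * J + 79)" "s (V TrieFresh) = 1" "s (V TrieFree) = 0" "s (V AnsNum) = 0"
    "\<And>i. s (H Kid i) = 0" "\<And>i. s (H Load i) = 0" "\<And>i. s (H Pub i) = 0"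
    using assms by (auto simp: boot_def s_def)
  have p: "pref {} = {1}" by (simp add: pref_def)
  have "1 < (2::nat) ^ (81 + 40 * J)" by (intro one_less_power) auto
  then have "links s {1} (\<lambda>_. 0)" using s by (simp add: links_def)
  moreover have "pool s ((\<lambda>_. 0) ` {1})" using s NB by (simp add: pool_def lessThan_Suc bij_betw_def)
  ultimately have "tset s {}" unfolding tset_def p by blast
  moreover have "params s" using s by (simp add: params_def fixed_def top)
  ultimately show "cli M (M \<circ> addr, {})" by (simp add: cli_def same_refl s_def)
  have F: "thr x 0 = 0" for x by (simp add: thr_def)
  have d: "deg {} x = 0" for x by (simp add: deg_def)
  have "keys {} (\<lambda>_. 0) {} = {}" by (simp add: keys_def ks_def F)
  then have "rep s {} {} (\<lambda>_. 0) {}" using s by (simp add: rep_def d)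
  then show "Inv (M \<circ> addr) {} {} (\<lambda>_. 0) {}" unfolding s_def by (simp add: Inv_def good_def near_def d)
  show "ans_ok (M \<circ> addr) (\<lambda>_. 0)" using s(5) unfolding s_def[symmetric] by (simp add: ans_ok_def F)
  show "Pot {} (\<lambda>_. 0) {} = 0" by (simp add: Pot_def pot0_def Phi_def fe_def d)
qed

text \<open>Between operations only the graph and a cap \<open>h\<close> on the stored potential
  matter; orientation, published loads and keys are hidden. No node awaits inspection, hence the
  empty set.\<close>

definition state :: "mem \<Rightarrow> nat edges \<Rightarrow> real \<Rightarrow> bool" where
  "state M E h \<longleftrightarrow> (\<exists>\<sigma> S A p. cli M (\<sigma>, S) \<and> Inv \<sigma> S A p {} \<and> und A = und (units E) \<and> ans_ok \<sigma> p \<and> Pot A p {} \<le> h)"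

definition cost :: real where "cost = real (G * K) * cI + 1200 * lg"

lemma state_start: "boot (M \<circ> addr) \<Longrightarrow> state M {} 0"
  unfolding state_def using booted[of M] by (intro exI[of _ "M \<circ> addr"] exI[of _ "{}"] exI[of _ "\<lambda>_. 0"]) (simp add: units_def)

lemma Inv_args: "Inv \<sigma> S A p D \<Longrightarrow> Inv (\<sigma>(V Arg0 := a, V Arg1 := c)) S A p D"
  by (simp add: Inv_def rep_def fixed_upd)

lemma cli_args: "cli M (\<sigma>, S) \<Longrightarrow> cli (M(0 := a, 1 := c)) (\<sigma>(V Arg0 := a, V Arg1 := c), S)"
proof -
  have "(M(0 := a, 1 := c)) \<circ> addr = (M \<circ> addr)(V Arg0 := a, V Arg1 := c)"
    using upd_addr[of M "V Arg0" a] upd_addr[of "M(0 := a)" "V Arg1" c] by simp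
  then show "cli M (\<sigma>, S) \<Longrightarrow> ?thesis"
    by (simp add: cli_def tset_upd params_def same_upd2)
qed

lemma exec_update:
  assumes st: "state M E h" and E: "E \<subseteq> {..<n} \<times> {..<n}" and q: "legal_opn n E q" "q \<noteq> Query"
    and card: "card (apply_opn q E) * (G * K) \<le> ub"
  shows "\<exists>t A M' h'. exec w (com_of alg q) (pass_args q M) t A M' \<and> A \<subseteq> {..<64 + 8 * B}
    \<and> state M' (apply_opn q E) h' \<and> real t + h' \<le> h + cost"
proof -
  obtain \<sigma> S A p where s: "cli M (\<sigma>, S)" "Inv \<sigma> S A p {}" "und A = und (units E)" "Pot A p {} \<le> h"
    using st by (auto simp: state_def)
  have fE: "finite E" using E finite_subset by blast
  define Q where "Q = (\<lambda>t ((\<sigma>' :: loc \<Rightarrow> nat), S'). \<exists>A' p'. Inv \<sigma>' S' A' p' {} \<and> und A' = und (units (apply_opn q E))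
    \<and> ans_ok \<sigma>' p' \<and> t + Pot A' p' {} \<le> Pot A p {} + real (G * K) * cI + 1200 * lg)"
  have "\<exists>a c. pass_args q M = M(0 := a, 1 := c) \<and> wp w B cli (com_of alg q) Q (\<sigma>(V Arg0 := a, V Arg1 := c), S)"
  proof (cases q)
    case (Insert u v)
    then have uv: "(u, v) \<notin> E" "u < n" "v < n" using q by auto
    then have "(card E + 1) * (G * K) \<le> ub" using card fE by (simp add: Insert)
    from wp_insert_op[OF Inv_args[OF s(2)] _ _ s(3) fE uv this, of u v]
    show ?thesis unfolding Q_def Insert by (intro exI[of _ u] exI[of _ v]) (simp add: alg_def)
  next
    case (Delete u v)
    then have uv: "(u, v) \<in> E" "u < n" "v < n" using q E by auto
    from wp_delete_op[OF Inv_args[OF s(2)] _ _ s(3) uv, of u v]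
    show ?thesis unfolding Q_def Delete by (intro exI[of _ u] exI[of _ v]) (simp add: alg_def)
  qed (use q in simp)
  then obtain a c where ac: "pass_args q M = M(0 := a, 1 := c)"
    "wp w B cli (com_of alg q) Q (\<sigma>(V Arg0 := a, V Arg1 := c), S)" by blast
  from ac(2) cli_args[OF s(1), of a c] obtain t A' M' u x where r: "exec w (com_of alg q) (pass_args q M) t A' M'"
    "A' \<subseteq> {..<64 + 8 * B}" "real t \<le> u" "cli M' x" "Q u x"
    unfolding wp_def ac(1) by blast
  obtain \<sigma>' S' where x: "x = (\<sigma>', S')" by (cases x)
  from r(5) obtain A'' p' where f: "Inv \<sigma>' S' A'' p' {}" "und A'' = und (units (apply_opn q E))" "ans_ok \<sigma>' p'"
    "u + Pot A'' p' {} \<le> Pot A p {} + real (G * K) * cI + 1200 * lg" unfolding Q_def x by blast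
  have "state M' (apply_opn q E) (Pot A'' p' {})"
    unfolding state_def using r(4) f(1-3) unfolding x by blast
  moreover have "real t + Pot A'' p' {} \<le> h + cost" using r(3) f(4) s(4) by (simp add: cost_def)
  ultimately show ?thesis using r(1,2) by blast
qed

lemma exec_query:
  assumes st: "state M E h" and E: "E \<subseteq> {..<n} \<times> {..<n}"
  shows "\<exists>t A M' \<eta>. exec w query M t A M' \<and> A \<subseteq> {..<64 + 8 * B} \<and> state M' E h \<and> t \<le> 10
    \<and> answers M' \<eta> \<and> is_approx 8 (max_density {..<n} E) \<eta>"
proof -
  obtain \<sigma> S A p where s: "cli M (\<sigma>, S)" "Inv \<sigma> S A p {}" "und A = und (units E)" "ans_ok \<sigma> p" "Pot A p {} \<le> h"
    using st by (auto simp: state_def)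
  define a where "a = \<sigma> (V AnsNum)"
  define c where "c = 2 * 2 ^ J * K"
  have c: "\<sigma> (V AnsDen) = c" using s(2) by (simp add: Inv_def rep_def fixed_def c_def)
  have "wp w B cli query (\<lambda>u y. u \<le> 10 \<and> y = (\<sigma>(V Arg0 := a, V Arg1 := c), S)) (\<sigma>, S)"
    unfolding query_def by (intro wp_Seq c_assign) (simp_all add: a_def c)
  with s(1) obtain t A' M' u where r: "exec w query M t A' M'" "A' \<subseteq> {..<64 + 8 * B}" "real t \<le> u" "u \<le> 10"
    "cli M' (\<sigma>(V Arg0 := a, V Arg1 := c), S)" unfolding wp_def by blast
  have "same (\<sigma>(V Arg0 := a, V Arg1 := c)) (M' \<circ> addr)" using r(5) by (simp add: cli_def)
  note e = this[unfolded same_def, rule_format]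
  have M': "M' 0 = a" "M' 1 = c" using e[of "V Arg0"] e[of "V Arg1"] by simp_all
  have "ans_ok (\<sigma>(V Arg0 := a, V Arg1 := c)) p" using s(4) by (simp add: ans_ok_def)
  then have "state M' E h" unfolding state_def using r(5) Inv_args[OF s(2)] s(3,5) by blast
  moreover have "answers M' (real a / real c)" using M' AnsDen_less(2) by (simp add: answers_def c_def)
  moreover have "is_approx 8 (max_density {..<n} E) (real a / real c)"
    using approx[OF s(2,3) E s(4)] by (simp add: a_def c_def)
  moreover have "t \<le> 10" using r(3,4) by simp
  ultimately show ?thesis using r(1,2) by blast
qed

lemma run_ops:
  assumes "state M E h" "E \<subseteq> {..<n} \<times> {..<n}"
    and "\<forall>i<length ops. legal_opn n (fold apply_opn (take i ops) E) (ops ! i)"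
    and "\<forall>i\<le>length ops. card (fold apply_opn (take i ops) E) * (G * K) \<le> ub"
  shows "\<exists>tr. run w alg M ops tr
    \<and> (\<forall>i\<in>queries ops. \<exists>\<eta>. answers (memory (tr ! i)) \<eta> \<and> is_approx 8 (max_density {..<n} (fold apply_opn (take i ops) E)) \<eta>)
    \<and> (\<forall>i\<in>queries ops. time (tr ! i) \<le> 10)
    \<and> real (\<Sum>i\<in>updates ops. time (tr ! i)) \<le> h + cost * real (card (updates ops))
    \<and> (\<forall>s\<in>set tr. touched s \<subseteq> {..<64 + 8 * B})"
  using assms
proof (induction ops arbitrary: M E h)
  case Nil
  obtain \<sigma> S A p where "Pot A p {} \<le> h" using Nil(1) by (auto simp: state_def)
  then have "0 \<le> h" using Pot_nonneg[of A p "{}"] by linarith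
  then show ?case by (intro exI[of _ "[]"]) (simp add: run.Nil queries_def updates_def)
next
  case (Cons q ops)
  define E' where "E' = apply_opn q E"
  have q: "legal_opn n E q" using Cons.prems(3)[rule_format, of 0] by simp
  have E': "E' \<subseteq> {..<n} \<times> {..<n}" using Cons.prems(2) q by (cases q) (auto simp: E'_def)
  have legal: "\<forall>i<length ops. legal_opn n (fold apply_opn (take i ops) E') (ops ! i)"
  proof (intro allI impI)
    fix i assume "i < length ops"
    then show "legal_opn n (fold apply_opn (take i ops) E') (ops ! i)"
      using Cons.prems(3)[rule_format, of "Suc i"] by (simp add: E'_def)
  qed
  have small: "\<forall>i\<le>length ops. card (fold apply_opn (take i ops) E') * (G * K) \<le> ub"
  proof (intro allI impI)
    fix i assume "i \<le> length ops"
    then show "card (fold apply_opn (take i ops) E') * (G * K) \<le> ub"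
      using Cons.prems(4)[rule_format, of "Suc i"] by (simp add: E'_def)
  qed
  have cE': "card (apply_opn q E) * (G * K) \<le> ub" using small[rule_format, of 0] by (simp add: E'_def)
  show ?case
  proof (cases "q = Query")
    case True
    have EE: "E' = E" by (simp add: E'_def True)
    obtain t A M' \<eta> where r: "exec w query M t A M'" "A \<subseteq> {..<64 + 8 * B}" "state M' E h" "t \<le> 10"
      "answers M' \<eta>" "is_approx 8 (max_density {..<n} E) \<eta>" using exec_query[OF Cons.prems(1,2)] by blast
    from Cons.IH[OF r(3) Cons.prems(2) legal[unfolded EE] small[unfolded EE]] obtain tr where tr: "run w alg M' ops tr"
      "\<forall>i\<in>queries ops. \<exists>\<eta>. answers (memory (tr ! i)) \<eta> \<and> is_approx 8 (max_density {..<n} (fold apply_opn (take i ops) E)) \<eta>"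
      "\<forall>i\<in>queries ops. time (tr ! i) \<le> 10"
      "real (\<Sum>i\<in>updates ops. time (tr ! i)) \<le> h + cost * real (card (updates ops))"
      "\<forall>s\<in>set tr. touched s \<subseteq> {..<64 + 8 * B}" by blast
    have "run w alg M (q # ops) (\<lparr>time = t, touched = A, memory = M'\<rparr> # tr)"
      using r(1) tr(1) True by (intro run.Cons) (simp_all add: alg_def)
    then show ?thesis using r tr True
      by (intro exI[of _ "\<lparr>time = t, touched = A, memory = M'\<rparr> # tr"])
        (auto simp: queries_Cons sum_updates_Cons card_updates_Cons)
  next
    case False
    obtain t A M' h' where r: "exec w (com_of alg q) (pass_args q M) t A M'" "A \<subseteq> {..<64 + 8 * B}" "state M' E' h'"
      "real t + h' \<le> h + cost" using exec_update[OF Cons.prems(1,2) q False cE'] unfolding E'_def by blast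
    from Cons.IH[OF r(3) E' legal small] obtain tr where tr: "run w alg M' ops tr"
      "\<forall>i\<in>queries ops. \<exists>\<eta>. answers (memory (tr ! i)) \<eta> \<and> is_approx 8 (max_density {..<n} (fold apply_opn (take i ops) E')) \<eta>"
      "\<forall>i\<in>queries ops. time (tr ! i) \<le> 10"
      "real (\<Sum>i\<in>updates ops. time (tr ! i)) \<le> h' + cost * real (card (updates ops))"
      "\<forall>s\<in>set tr. touched s \<subseteq> {..<64 + 8 * B}" by blast
    have "run w alg M (q # ops) (\<lparr>time = t, touched = A, memory = M'\<rparr> # tr)"
      using r(1) tr(1) by (intro run.Cons)
    then show ?thesis using r tr False
      by (intro exI[of _ "\<lparr>time = t, touched = A, memory = M'\<rparr> # tr"])
        (auto simp: queries_Cons sum_updates_Cons card_updates_Cons E'_def algebra_simps)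
  qed
qed

end

section \<open>Resource bounds\<close>

lemma is_approx_mono: "is_approx \<gamma> r \<eta> \<Longrightarrow> 0 \<le> r \<Longrightarrow> 0 < \<gamma> \<Longrightarrow> \<gamma> \<le> \<gamma>' \<Longrightarrow> is_approx \<gamma>' r \<eta>"
  by (auto simp: is_approx_def intro: order_trans[OF divide_left_mono])

lemma graph_after_nodes: "legal_seq n ops \<Longrightarrow> i \<le> length ops \<Longrightarrow> graph_after ops i \<subseteq> {..<n} \<times> {..<n}"
proof (induction i)
  case (Suc i)
  then have "legal_opn n (graph_after ops i) (ops ! i)" by (simp add: legal_seq_def)
  moreover have "graph_after ops (Suc i) = apply_opn (ops ! i) (graph_after ops i)"
    using Suc.prems(2) by (simp add: graph_after_def take_Suc_conv_app_nth)
  ultimately show ?case using Suc by (cases "ops ! i") auto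
qed (simp add: graph_after_def)

lemma card_graph_after: "i \<le> length ops \<Longrightarrow> card (graph_after ops i) \<le> peak_edges ops"
  unfolding peak_edges_def by (intro Max_ge) auto

lemma peak_edges_le: "legal_seq n ops \<Longrightarrow> peak_edges ops \<le> n * n"
proof -
  assume l: "legal_seq n ops"
  have "card (graph_after ops i) \<le> n * n" if "i \<le> length ops" for i
    using card_mono[OF _ graph_after_nodes[OF l that]] by simp
  then show ?thesis unfolding peak_edges_def by simp
qed

section \<open>From the number of nodes to the parameters\<close>

definition scale :: "nat \<Rightarrow> nat" where
  "scale n = (LEAST j. n \<le> 4 ^ j)"

lemma scale: "n \<le> 4 ^ scale n" "j < scale n \<Longrightarrow> 4 ^ j < n"
proof -
  have "(2::nat) ^ n \<le> 4 ^ n" by (rule power_mono) auto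
  then have "n \<le> 4 ^ n" using less_exp[of n] by linarith
  then show "n \<le> 4 ^ scale n" unfolding scale_def by (rule LeastI)
  show "4 ^ j < n" if "j < scale n" using not_less_Least[OF that[unfolded scale_def]] by simp
qed

lemma log_node: "1 \<le> n \<Longrightarrow> 1 \<le> log 2 (real n + 1)"
  using log_le_cancel_iff[of 2 2 "real n + 1"] by simp

text \<open>Minimality gives \<open>4 ^ (scale n - 1) < n\<close> for positive
  \<open>scale n\<close>, so \<open>scale n\<close> is at most \<open>1 + l / 2\<close>, with
  \<open>l\<close> the logarithm of \<open>n + 1\<close>. Since \<open>l\<close> is at least 1, this
  is within \<open>3 * l\<close>.\<close>

lemma scale_le:
  assumes "1 \<le> n"
  shows "real (scale n) + 1 \<le> 3 * log 2 (real n + 1)"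
proof (cases "scale n")
  case (Suc j)
  have "real (4 ^ j) < real n" using scale(2)[of j n] Suc by (simp only: of_nat_less_iff)
  then have "real (4 ^ j) \<le> real n + 1" by linarith
  then have "(4::real) ^ j \<le> real n + 1" by simp
  moreover have "(4::real) ^ j = 2 ^ (2 * j)" by (simp add: power_mult)
  ultimately have "(2::real) ^ (2 * j) \<le> real n + 1" by linarith
  then have "log 2 (2 ^ (2 * j)) \<le> log 2 (real n + 1)" by (subst log_le_cancel_iff) auto
  moreover have "log 2 ((2::real) ^ (2 * j)) = real (2 * j)" by (subst log_nat_power) auto
  ultimately have "2 * real j \<le> log 2 (real n + 1)" by linarith
  moreover have "real (scale n) = real j + 1" using Suc by simp
  ultimately show ?thesis using log_node[OF assms] by linarith
next
  case 0
  then have "real (scale n) = 0" by simp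
  then show ?thesis using log_node[OF assms] by linarith
qed

text \<open>The least \<open>NB\<close> that \<open>NB_cap\<close> admits if \<open>ub\<close>
  provides \<open>G * K\<close> units for each of \<open>k\<close> edges.\<close>

definition nodes_for :: "nat \<Rightarrow> nat \<Rightarrow> nat" where
  "nodes_for n k = 1 + (40 * scale n + 80) * (2 * ((2 * scale n + 1) * (256 * (scale n + 1)) * k) + 4 * n * (2 * scale n + 1))"

lemma nodes_for_le:
  assumes "1 \<le> n"
  shows "real (64 + 8 * (2 * nodes_for n k)) \<le> 2 ^ 21 * (real (scale n) + 1) ^ 3 * real (k + n)"
proof -
  define z where "z = real (scale n) + 1"
  have z: "1 \<le> z" by (simp add: z_def)
  have zz: "z ^ 2 \<le> z ^ 3" "1 \<le> z ^ 3" using z by (auto intro: power_increasing one_le_power)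
  have "real (nodes_for n k) = 1 + (40 * z + 40) * (2 * ((2 * z - 1) * (256 * z) * real k) + 4 * real n * (2 * z - 1))"
    by (simp add: nodes_for_def z_def algebra_simps)
  also have "\<dots> \<le> 1 + (80 * z) * (2 * ((2 * z) * (256 * z) * real k) + 4 * real n * (2 * z))"
    using z by (intro add_mono mult_mono order_refl add_nonneg_nonneg mult_nonneg_nonneg) auto
  also have "\<dots> = 1 + 81920 * z ^ 3 * real k + 640 * z ^ 2 * real n"
    by (simp add: power2_eq_square power3_eq_cube algebra_simps)
  finally have "real (64 + 8 * (2 * nodes_for n k)) \<le> 80 + 1310720 * z ^ 3 * real k + 10240 * z ^ 2 * real n" by simp
  moreover have "z ^ 2 * real n \<le> z ^ 3 * real n" using zz by (intro mult_right_mono) auto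
  moreover have "1 * 1 \<le> z ^ 3 * real n" using z zz assms by (intro mult_mono) auto
  moreover have "0 \<le> z ^ 3 * real k" using z by simp
  ultimately have "real (64 + 8 * (2 * nodes_for n k)) \<le> 2 ^ 21 * (z ^ 3 * real k) + 2 ^ 21 * (z ^ 3 * real n)" by simp
  then show ?thesis by (simp add: z_def algebra_simps)
qed

text \<open>\<open>249\<close> is \<open>3 * 83\<close>: keys with their spare bits need
  \<open>40 * scale n + 83\<close> bits, at most \<open>83 * (scale n + 1)\<close>, and
  \<open>scale_le\<close> brings in the 3. The memory is bounded by a multiple of
  \<open>(n + 1) ^ 5\<close>, whose addresses need only \<open>26 + 5 * l\<close> bits.\<close>

lemma word_bounds:
  assumes n: "1 \<le> n" and w: "249 * log 2 (real n + 1) \<le> real w" and k: "k \<le> n * n"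
  shows "64 + 8 * (2 * nodes_for n k) \<le> 2 ^ w" "40 * scale n + 80 + 3 \<le> w"
proof -
  define l where "l = log 2 (real n + 1)"
  define z where "z = real (scale n) + 1"
  have l: "1 \<le> l" "z \<le> 3 * l" using log_node[OF n] scale_le[OF n] by (auto simp: l_def z_def)
  have p: "2 powr l = real n + 1" by (simp add: l_def)
  have ln: "l \<le> real n + 1"
  proof -
    have "real n + 1 \<le> 2 ^ (n + 1)" using of_nat_mono[OF less_imp_le[OF less_exp[of "n + 1"]], where 'a = real] by simp
    then have "l \<le> log 2 (2 ^ (n + 1))" unfolding l_def by (subst log_le_cancel_iff) auto
    also have "\<dots> = real (n + 1)" by (subst log_nat_power) auto
    finally show ?thesis by simp
  qed
  have "real (40 * scale n + 80 + 3) \<le> 83 * z" by (simp add: z_def)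
  also have "\<dots> \<le> real w" using l w by (simp add: l_def)
  finally show "40 * scale n + 80 + 3 \<le> w" by (simp only: of_nat_le_iff)
  have "real (64 + 8 * (2 * nodes_for n k)) \<le> 2 ^ 21 * z ^ 3 * real (k + n)"
    using nodes_for_le[OF n] by (simp add: z_def)
  also have "\<dots> \<le> 2 ^ 21 * (3 * (real n + 1)) ^ 3 * (real n + 1) ^ 2"
  proof -
    have "real (k + n) \<le> real (n * n + n)" using k by (simp only: of_nat_le_iff)
    then have "real (k + n) \<le> (real n + 1) ^ 2" by (simp add: power2_eq_square algebra_simps)
    moreover have "z ^ 3 \<le> (3 * (real n + 1)) ^ 3" using l(2) ln by (intro power_mono) (auto simp: z_def)
    ultimately show ?thesis by (intro mult_mono mult_left_mono) (auto simp: z_def)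
  qed
  also have "\<dots> = 2 ^ 21 * 27 * (real n + 1) ^ 5"
  proof -
    have "2 ^ 21 * (3 * x) ^ 3 * x ^ 2 = 2 ^ 21 * 27 * x ^ 5" for x :: real
      by (simp add: power_mult_distrib eval_nat_numeral)
    then show ?thesis .
  qed
  also have "\<dots> \<le> 2 ^ 26 * (2 powr l) ^ 5" unfolding p by simp
  also have "\<dots> = 2 powr (26 + 5 * l)" by (simp add: powr_add powr_realpow[symmetric] powr_powr mult.commute)
  also have "\<dots> \<le> 2 powr real w" using l(1) w unfolding l_def[symmetric] by (intro powr_mono) auto
  also have "\<dots> = real (2 ^ w)" by (simp add: powr_realpow)
  finally show "64 + 8 * (2 * nodes_for n k) \<le> 2 ^ w" by (simp only: of_nat_le_iff)
qed

lemma graph_machine_scale: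
  assumes "1 \<le> n" "249 * log 2 (real n + 1) \<le> real w" "k \<le> n * n"
  shows "graph_machine w (2 * nodes_for n k) (scale n) (nodes_for n k) n ((2 * scale n + 1) * (256 * (scale n + 1)) * k)"
proof unfold_locales
  show "1 + (40 * scale n + 80) * (2 * ((2 * scale n + 1) * (256 * (scale n + 1)) * k) + 4 * n * (2 * scale n + 1))
      \<le> nodes_for n k"
    by (simp only: nodes_for_def)
qed (use word_bounds[OF assms] assms(1) scale(1)[of n] in \<open>auto simp: nodes_for_def\<close>)

text \<open>\<open>lg\<close>, \<open>P\<close> and \<open>lR\<close> are linear in
  \<open>J + 1\<close>, so \<open>cL\<close> is quadratic, \<open>cF\<close> cubic and
  \<open>cI\<close> of degree 4. The \<open>G * K\<close> units of an edge supply the other two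
  factors.\<close>

lemma (in graph_machine) cost_le: "cost \<le> 10 ^ 15 * (real J + 1) ^ 6"
proof -
  define z where "z = real J + 1"
  have z: "1 \<le> z" by (simp add: z_def)
  have up: "z ^ i \<le> z ^ j" if "i \<le> j" for i j using z that by (intro power_increasing)
  have lg: "lg \<le> 81 * z" by (simp add: lg_def z_def)
  have Pz: "real P = 128 * z" "real P + 2 \<le> 130 * z" using z by (simp_all add: P_def z_def)
  have "cL \<le> 4600 * (81 * z) * (130 * z)" unfolding cL_def using lg Pz lg1 z by (intro mult_mono) auto
  then have cL: "cL \<le> 48438000 * z ^ 2" by (simp add: power2_eq_square)
  have cF: "cF \<le> 24863400000 * z ^ 3"
  proof -
    have "3000 * lg \<le> 243000 * z ^ 2" using lg up[of 1 2] by simp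
    then have "2 * cL + 3000 * lg \<le> 97119000 * z ^ 2" using cL by simp
    then have "cF \<le> 97119000 * z ^ 2 * (2 * (128 * z))" unfolding cF_def Pz(1) using z by (intro mult_right_mono) auto
    also have "\<dots> \<le> 24863400000 * z ^ 3" using z by (simp add: power2_eq_square power3_eq_cube)
    finally show ?thesis .
  qed
  have lR16: "lR \<le> 16 * z"
  proof -
    have "lR = real (8 * J + 16) * ln 2" by (simp add: lR_def R_def ln_realpow)
    also have "\<dots> \<le> real (8 * J + 16) * 1" using ln_2_less_1 by (intro mult_left_mono) auto
    finally show ?thesis by (simp add: z_def)
  qed
  have "cF * lR \<le> (24863400000 * z ^ 3) * (16 * z)" using cF lR16 lR z by (intro mult_mono) auto
  then have "cF * lR \<le> 397814400000 * z ^ 4" by (simp add: eval_nat_numeral mult_ac)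
  moreover have "1500 * lg \<le> 121500 * z ^ 4" "cD \<le> 121500 * z ^ 4" using lg up[of 1 4] by (simp_all add: cD_def)
  moreover have "cL \<le> 48438000 * z ^ 4" using cL up[of 2 4] by simp
  moreover have "0 \<le> z ^ 4" using z by simp
  ultimately have cI: "cI \<le> 400000000000 * z ^ 4" unfolding cI_def by linarith
  have "real (G * K) \<le> (2 * z) * (256 * z)"
    unfolding of_nat_mult by (intro mult_mono) (auto simp: G_def K_def z_def)
  then have "real (G * K) * cI \<le> (2 * z) * (256 * z) * (400000000000 * z ^ 4)"
    using cI constants_pos lR lg1 z by (intro mult_mono) (auto simp: cI_def)
  also have "\<dots> = 204800000000000 * z ^ 6" by (simp add: eval_nat_numeral mult_ac)
  finally have "real (G * K) * cI \<le> 204800000000000 * z ^ 6" .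
  moreover have "1200 * lg \<le> 97200 * z ^ 6" using lg up[of 1 6] by simp
  moreover have "0 \<le> z ^ 6" using z by simp
  ultimately have "real (G * K) * cI + 1200 * lg \<le> 1000000000000000 * z ^ 6" by linarith
  then show ?thesis by (simp add: cost_def flip: z_def)
qed

text \<open>The factor 3 of \<open>scale_le\<close> becomes \<open>3 ^ 6 = 729\<close>, rounded up
  to \<open>10 ^ 3\<close>; hence \<open>10 ^ 18\<close>.\<close>

lemma polyfactor_ge:
  assumes "1 \<le> n" "0 < \<epsilon>" "\<epsilon> < 1"
  shows "10 ^ 15 * (real (scale n) + 1) ^ 6 \<le> polyfactor (10 ^ 18) 6 n \<epsilon>"
proof -
  define l where "l = log 2 (real n + 1)"
  have l: "1 \<le> l" using log_node[OF assms(1)] by (simp add: l_def)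
  have "l * \<epsilon> \<le> l * 1" using l assms by (intro mult_left_mono) auto
  then have "l \<le> l / \<epsilon>" using assms by (simp add: field_simps)
  then have "real (scale n) + 1 \<le> 3 * (l / \<epsilon>)" using scale_le[OF assms(1)] by (simp add: l_def)
  then have "(real (scale n) + 1) ^ 6 \<le> (3 * (l / \<epsilon>)) ^ 6" by (intro power_mono) auto
  also have "\<dots> = 729 * (l / \<epsilon>) ^ 6" by (simp only: power_mult_distrib) simp
  also have "\<dots> \<le> 1000 * (l / \<epsilon>) ^ 6" by (intro mult_right_mono) auto
  finally show ?thesis by (simp add: polyfactor_def l_def)
qed

text \<open>The capacities depend on the peak \<open>k\<close> of a particular sequence, whereas the
  initial run must be exhibited before the sequence is known. So initialisation is analysed for
  every \<open>k\<close>, and the locale is interpreted anew for each sequence.\<close>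

lemma alg_correct:
  assumes \<epsilon>: "0 < \<epsilon>" "\<epsilon> < 1" and n: "1 \<le> n" and w: "249 * log 2 ((real n + 1) / \<epsilon>) \<le> real w"
  shows "\<exists>t0 A0 M0. exec w (init_com alg) (start_mem n) t0 A0 M0 \<and> real t0 \<le> polyfactor (10 ^ 18) 6 n \<epsilon> * real n \<and>
    (\<forall>ops. legal_seq n ops \<longrightarrow> (\<exists>tr. run w alg M0 ops tr \<and>
      (\<forall>i\<in>queries ops. \<exists>\<eta>. answers (memory (tr ! i)) \<eta> \<and> is_approx (8 + \<epsilon>) (max_density {..<n} (graph_after ops i)) \<eta>) \<and>
      (\<forall>i\<in>queries ops. real (time (tr ! i)) \<le> 10 ^ 18) \<and>
      real (\<Sum>i\<in>updates ops. time (tr ! i)) \<le> polyfactor (10 ^ 18) 6 n \<epsilon> * real (card (updates ops)) \<and>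
      space_within (A0 \<union> (\<Union>s\<in>set tr. touched s)) (polyfactor (10 ^ 18) 6 n \<epsilon> * real (peak_edges ops + n))))"
proof -
  define pf where "pf = polyfactor (10 ^ 18) 6 n \<epsilon>"
  define z where "z = real (scale n) + 1"
  have z: "1 \<le> z" by (simp add: z_def)
  have pf: "10 ^ 15 * z ^ 6 \<le> pf" using polyfactor_ge[OF n \<epsilon>] by (simp add: pf_def z_def)
  have up: "z ^ i \<le> z ^ 6" if "i \<le> 6" for i using z that by (intro power_increasing)
  have w': "249 * log 2 (real n + 1) \<le> real w"
  proof -
    have "real n + 1 \<le> (real n + 1) / \<epsilon>" using \<epsilon> by (simp add: le_divide_eq)
    then have "log 2 (real n + 1) \<le> log 2 ((real n + 1) / \<epsilon>)" using \<epsilon> by (subst log_le_cancel_iff) auto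
    then show ?thesis using w by simp
  qed
  have boot: "\<exists>t A M. exec w init (start_mem n) t A M \<and> A \<subseteq> {..<64 + 8 * (2 * nodes_for n k)} \<and> real t \<le> 300 * z
      \<and> graph_machine.boot (scale n) (M \<circ> addr)" if k: "k \<le> n * n" for k
  proof -
    interpret graph_machine w "2 * nodes_for n k" "scale n" "nodes_for n k" n "(2 * scale n + 1) * (256 * (scale n + 1)) * k"
      by (rule graph_machine_scale[OF n w' k])
    from wp_init[OF scale(2)] show ?thesis unfolding wp_def z_def by fastforce
  qed
  obtain t0 A0 M0 where i: "exec w init (start_mem n) t0 A0 M0" "real t0 \<le> 300 * z"
    using boot[of 0] by auto
  \<comment> \<open>Determinism identifies the runs obtained for the different \<open>k\<close> with
    the single run fixed above.\<close>
  have same: "A0 \<subseteq> {..<64 + 8 * (2 * nodes_for n k)}" "graph_machine.boot (scale n) (M0 \<circ> addr)" if "k \<le> n * n" for k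
    using boot[OF that] exec_deterministic[OF i(1)] by blast+
  have "real t0 \<le> pf * real n"
  proof -
    have "real t0 \<le> 10 ^ 15 * z ^ 6" using i(2) up[of 1] z by simp
    also have "\<dots> \<le> pf" by (rule pf)
    also have "\<dots> \<le> pf * real n"
    proof -
      have "0 \<le> pf" using pf z by (intro order_trans[OF _ pf]) simp
      then have "pf * 1 \<le> pf * real n" using n by (intro mult_left_mono) auto
      then show ?thesis by simp
    qed
    finally show ?thesis .
  qed
  moreover have "\<exists>tr. run w alg M0 ops tr \<and>
      (\<forall>i\<in>queries ops. \<exists>\<eta>. answers (memory (tr ! i)) \<eta> \<and> is_approx (8 + \<epsilon>) (max_density {..<n} (graph_after ops i)) \<eta>) \<and>
      (\<forall>i\<in>queries ops. real (time (tr ! i)) \<le> 10 ^ 18) \<and>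
      real (\<Sum>i\<in>updates ops. time (tr ! i)) \<le> pf * real (card (updates ops)) \<and>
      space_within (A0 \<union> (\<Union>s\<in>set tr. touched s)) (pf * real (peak_edges ops + n))" if l: "legal_seq n ops" for ops
  proof -
    define k where "k = peak_edges ops"
    have k: "k \<le> n * n" using peak_edges_le[OF l] by (simp add: k_def)
    interpret graph_machine w "2 * nodes_for n k" "scale n" "nodes_for n k" n "(2 * scale n + 1) * (256 * (scale n + 1)) * k"
      by (rule graph_machine_scale[OF n w' k])
    have legal: "\<forall>i<length ops. legal_opn n (fold apply_opn (take i ops) {}) (ops ! i)"
      using l by (simp add: legal_seq_def graph_after_def)
    have "card (graph_after ops i) * (G * K) \<le> (2 * scale n + 1) * (256 * (scale n + 1)) * k" if "i \<le> length ops" for i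
      using mult_right_mono[OF card_graph_after[OF that], of "G * K"]
      by (simp only: k_def G_def K_def mult.commute[of "peak_edges ops"])
    then have small: "\<forall>i\<le>length ops. card (fold apply_opn (take i ops) {}) * (G * K) \<le> (2 * scale n + 1) * (256 * (scale n + 1)) * k"
      unfolding graph_after_def by blast
    from run_ops[OF state_start[OF same(2)[OF k]] _ legal small] obtain tr where tr: "run w alg M0 ops tr"
      "\<forall>i\<in>queries ops. \<exists>\<eta>. answers (memory (tr ! i)) \<eta> \<and> is_approx 8 (max_density {..<n} (graph_after ops i)) \<eta>"
      "\<forall>i\<in>queries ops. time (tr ! i) \<le> 10"
      "real (\<Sum>i\<in>updates ops. time (tr ! i)) \<le> 0 + cost * real (card (updates ops))"
      "\<forall>s\<in>set tr. touched s \<subseteq> {..<64 + 8 * (2 * nodes_for n k)}"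
      unfolding graph_after_def by blast
    have "\<forall>i\<in>queries ops. \<exists>\<eta>. answers (memory (tr ! i)) \<eta> \<and> is_approx (8 + \<epsilon>) (max_density {..<n} (graph_after ops i)) \<eta>"
      using tr(2) is_approx_mono[OF _ max_density_nonneg[OF assms(3)], of 8 _ _ "8 + \<epsilon>"] \<epsilon>(1) by fastforce
    moreover have "\<forall>i\<in>queries ops. real (time (tr ! i)) \<le> 10 ^ 18"
    proof
      fix i assume "i \<in> queries ops"
      then have "time (tr ! i) \<le> 10" using tr(3) by blast
      then have "real (time (tr ! i)) \<le> 10" by simp
      then show "real (time (tr ! i)) \<le> 10 ^ 18" by simp
    qed
    moreover have "real (\<Sum>i\<in>updates ops. time (tr ! i)) \<le> pf * real (card (updates ops))"
    proof -
      have "cost \<le> pf" using cost_le pf by (simp add: z_def)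
      then have "cost * real (card (updates ops)) \<le> pf * real (card (updates ops))" by (intro mult_right_mono) auto
      then show ?thesis using tr(4) by simp
    qed
    moreover have "space_within (A0 \<union> (\<Union>s\<in>set tr. touched s)) (pf * real (peak_edges ops + n))"
      unfolding space_within_def
    proof
      fix a assume "a \<in> A0 \<union> (\<Union>s\<in>set tr. touched s)"
      then have "a < 64 + 8 * (2 * nodes_for n k)" using same(1)[OF k] tr(5) by fastforce
      then have "real (Suc a) \<le> real (64 + 8 * (2 * nodes_for n k))" by (simp only: of_nat_le_iff)
      also have "\<dots> \<le> 2 ^ 21 * z ^ 3 * real (k + n)" using nodes_for_le[OF assms(3)] by (simp add: z_def)
      also have "\<dots> \<le> pf * real (k + n)"
      proof -
        have "2 ^ 21 * z ^ 3 \<le> 10 ^ 15 * z ^ 6" by (rule mult_mono) (use up[of 3] z in auto)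
        then have "2 ^ 21 * z ^ 3 \<le> pf" using pf by linarith
        then show ?thesis by (rule mult_right_mono) simp
      qed
      finally show "real (Suc a) \<le> pf * real (peak_edges ops + n)" by (simp add: k_def)
    qed
    ultimately show ?thesis using tr(1) by blast
  qed
  ultimately show ?thesis using i(1) unfolding pf_def[symmetric] by (intro exI[of _ t0] exI[of _ A0] exI[of _ M0]) (simp add: alg_def)
qed

theorem theorem6p2:
  "\<exists>(\<epsilon>0::real) (C::real) (k::nat) (K::real).
     0 < \<epsilon>0 \<and> \<epsilon>0 < 1 \<and>
     (\<forall>\<epsilon>. 0 < \<epsilon> \<and> \<epsilon> < \<epsilon>0 \<longrightarrow>
       (\<exists>D :: dyn_alg. \<forall>n w :: nat.
          1 \<le> n \<and> K * log 2 ((real n + 1) / \<epsilon>) \<le> real w \<longrightarrow>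
          (\<exists>t0 A0 M0.
             exec w (init_com D) (start_mem n) t0 A0 M0 \<and>
             real t0 \<le> polyfactor C k n \<epsilon> * real n \<and>
             (\<forall>ops. legal_seq n ops \<longrightarrow>
               (\<exists>tr. run w D M0 ops tr \<and>
                  (\<forall>i \<in> queries ops. \<exists>\<eta>.
                     answers (memory (tr ! i)) \<eta> \<and>
                     is_approx (8 + \<epsilon>) (max_density {..<n} (graph_after ops i)) \<eta>) \<and>
                  (\<forall>i \<in> queries ops. real (time (tr ! i)) \<le> C) \<and>
                  real (\<Sum>i \<in> updates ops. time (tr ! i))
                    \<le> polyfactor C k n \<epsilon> * real (card (updates ops)) \<and>
                  space_within (A0 \<union> (\<Union>s \<in> set tr. touched s))
                    (polyfactor C k n \<epsilon> * real (peak_edges ops + n)))))))"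
proof (rule exI[of _ "1 / 2"], rule exI[of _ "10 ^ 18"], rule exI[of _ 6], rule exI[of _ 249], intro conjI allI impI, goal_cases)
  case (3 \<epsilon>)
  then have "\<epsilon> < 1" by simp
  with 3 alg_correct show ?case by (intro exI[of _ alg]) blast
qed simp_all

end
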